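(* Every discrete opfibration $P\colon\mathbb X\to\mathbb Y$ between (large) virtual double categories is powerful in $\mathbf{VDBL}$; that is, the pullback 2-functor $P^\ast\colon\mathbf{VDBL}/\mathbb Y\to\mathbf{VDBL}/\mathbb X$ has a right 2-adjoint $\prod_P\colon\mathbf{VDBL}/\mathbb X\to\mathbf{VDBL}/\mathbb Y$.
   Context: Virtual double categories. A virtual double category $\mathbb A$ consists of: a category $\mathbb A_{\mathrm{vert}}$, whose objects and morphisms are the objects and vertical morphisms of $\mathbb A$; for each pair of objects a set of horizontal morphisms $\Gamma\colon A\nrightarrow A'$; for each $n\ge0$, each path of horizontal morphisms $\Gamma_i\colon A_{i-1}\nrightarrow A_i$ ($1\le i\le n$), each $\Delta\colon B\nrightarrow B'$ and vertical $u\colon A_0\to B$, $u'\colon A_n\to B'$, a set of multicells, written $\theta\colon(\Gamma_1,\dots,\Gamma_n)\Rightarrow\Delta$ over $(u,u')$ (for $n=0$ the top is a single object $A_0$; a cell is a multicell with $n=1$); identity cells $\mathrm{id}_\Gamma\colon(\Gamma)\Rightarrow\Gamma$ over identities; composites: for $\theta_i\colon(\Gamma_{i,1},\dots,\Gamma_{i,n_i})\Rightarrow\Delta_i$ over $(u_{i-1},u_i)$ ($1\le i\le m$) and $\kappa\colon(\Delta_1,\dots,\Delta_m)\Rightarrow\Lambda$ over $(v,v')$, a multicell $\kappa\circ(\theta_1,\dots,\theta_m)\colon(\Gamma_{1,1},\dots,\Gamma_{m,n_m})\Rightarrow\Lambda$ over $(vu_0,v'u_m)$; for $m=0$, given $\kappa\colon()\Rightarrow\Lambda$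 over $(v,v')$ with top $B$ and vertical $u\colon A\to B$, a composite $\kappa\circ(u)$ over $(vu,v'u)$. Evident unit and associativity axioms hold. A virtual double functor $F\colon\mathbb A\to\mathbb B$ sends objects, vertical and horizontal morphisms and multicells to those of $\mathbb B$, compatibly with boundaries, functorially on vertical morphisms, and preserving identity cells and composites. A vertical transformation $\alpha\colon F\to G$ consists of a natural transformation $F_{\mathrm{vert}}\to G_{\mathrm{vert}}$ with components $\alpha_A\colon FA\to GA$, and cells $\alpha_\Gamma\colon(F\Gamma)\Rightarrow G\Gamma$ over $(\alpha_A,\alpha_{A'})$ for $\Gamma\colon A\nrightarrow A'$, with $\alpha_\Gamma\circ(F\theta)=G\theta\circ(\alpha_{\Gamma_1},\dots,\alpha_{\Gamma_n})$ for each multicell $\theta\colon(\Gamma_1,\dots,\Gamma_n)\Rightarrow\Gamma$ (for $n=0$ the right side is $G\theta\circ(\alpha_{A_0})$). Large (i.e. belonging to a fixed Grothendieck universe) virtual double categories, virtual double functors and vertical transformations form the 2-category $\mathbf{VDBL}$. Slices are strict slice 2-categories, and $P^\ast$ is given by (strict 2-)pullback along $P$. Discrete opfibrations. A virtual double functor $P\colon\mathbb X\to\mathbb Y$ is a discrete opfibration if: (i) for each object $X\in\mathbb X$ and each vertical $v\colon PX\to Y$ in $\mathbb Y$ there is a unique vertical $\overline v_X\colon X\to v_\ast X$ in $\mathbb X$ with $P\overline v_X=v$; (ii) for each $n\ge 0$, each path of horizontal morphisms $\Phi_i\colon X_{i-1}\nrightarrow X_i$ ($1\le i\le n$) in $\mathbb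 X$ and each multicell $\nu\colon(P\Phi_1,\dots,P\Phi_n)\Rightarrow\Psi$ over $(v,v')$ in $\mathbb Y$, there is a unique multicell $\overline\nu\colon(\Phi_1,\dots,\Phi_n)\Rightarrow\nu_\ast(\Phi_1,\dots,\Phi_n)$ over $(\overline v_{X_0},\overline{v'}_{X_n})$ in $\mathbb X$ (i.e. a unique pair of a horizontal morphism and such a multicell) with $P\overline\nu=\nu$. *)

theory Defs
  imports Main "HOL-Library.FuncSet"
begin

section \<open>Strict 2-categories\<close>

text \<open>Objects, 1-cells and 2-cells are sets of elements of three types. Composites are written in
  the order of function composition, and \<open>hcmp\<close> is the horizontal composite of 2-cells.\<close>

record ('o, 'm, 'c) two_cat =
  Obj  :: "'o set"
  Mor  :: "'m set"
  Two  :: "'c set"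
  src  :: "'m \<Rightarrow> 'o"
  tgt  :: "'m \<Rightarrow> 'o"
  src2 :: "'c \<Rightarrow> 'm"
  tgt2 :: "'c \<Rightarrow> 'm"
  idm  :: "'o \<Rightarrow> 'm"
  cmp  :: "'m \<Rightarrow> 'm \<Rightarrow> 'm"
  id2  :: "'m \<Rightarrow> 'c"
  vcmp :: "'c \<Rightarrow> 'c \<Rightarrow> 'c"
  hcmp :: "'c \<Rightarrow> 'c \<Rightarrow> 'c"

locale two_category =
  fixes K :: "('o, 'm, 'c) two_cat"
  assumes src_Obj: "f \<in> Mor K \<Longrightarrow> src K f \<in> Obj K"
    and tgt_Obj: "f \<in> Mor K \<Longrightarrow> tgt K f \<in> Obj K"
    and idm_Mor: "a \<in> Obj K \<Longrightarrow> idm K a \<in> Mor K"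
    and src_idm: "a \<in> Obj K \<Longrightarrow> src K (idm K a) = a"
    and tgt_idm: "a \<in> Obj K \<Longrightarrow> tgt K (idm K a) = a"
    and cmp_Mor: "\<lbrakk>f \<in> Mor K; g \<in> Mor K; tgt K f = src K g\<rbrakk> \<Longrightarrow> cmp K g f \<in> Mor K"
    and src_cmp: "\<lbrakk>f \<in> Mor K; g \<in> Mor K; tgt K f = src K g\<rbrakk> \<Longrightarrow> src K (cmp K g f) = src K f"
    and tgt_cmp: "\<lbrakk>f \<in> Mor K; g \<in> Mor K; tgt K f = src K g\<rbrakk> \<Longrightarrow> tgt K (cmp K g f) = tgt K g"
    and cmp_idm_right: "f \<in> Mor K \<Longrightarrow> cmp K f (idm K (src K f)) = f"
    and cmp_idm_left: "f \<in> Mor K \<Longrightarrow> cmp K (idm K (tgt K f)) f = f"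
    and cmp_assoc: "\<lbrakk>f \<in> Mor K; g \<in> Mor K; h \<in> Mor K; tgt K f = src K g; tgt K g = src K h\<rbrakk>
          \<Longrightarrow> cmp K (cmp K h g) f = cmp K h (cmp K g f)"
    and src2_Mor: "\<alpha> \<in> Two K \<Longrightarrow> src2 K \<alpha> \<in> Mor K"
    and tgt2_Mor: "\<alpha> \<in> Two K \<Longrightarrow> tgt2 K \<alpha> \<in> Mor K"
    and src_parallel: "\<alpha> \<in> Two K \<Longrightarrow> src K (src2 K \<alpha>) = src K (tgt2 K \<alpha>)"
    and tgt_parallel: "\<alpha> \<in> Two K \<Longrightarrow> tgt K (src2 K \<alpha>) = tgt K (tgt2 K \<alpha>)"
    and id2_Two: "f \<in> Mor K \<Longrightarrow> id2 K f \<in> Two K"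
    and src2_id2: "f \<in> Mor K \<Longrightarrow> src2 K (id2 K f) = f"
    and tgt2_id2: "f \<in> Mor K \<Longrightarrow> tgt2 K (id2 K f) = f"
    and vcmp_Two: "\<lbrakk>\<alpha> \<in> Two K; \<beta> \<in> Two K; tgt2 K \<alpha> = src2 K \<beta>\<rbrakk> \<Longrightarrow> vcmp K \<beta> \<alpha> \<in> Two K"
    and src2_vcmp: "\<lbrakk>\<alpha> \<in> Two K; \<beta> \<in> Two K; tgt2 K \<alpha> = src2 K \<beta>\<rbrakk>
          \<Longrightarrow> src2 K (vcmp K \<beta> \<alpha>) = src2 K \<alpha>"
    and tgt2_vcmp: "\<lbrakk>\<alpha> \<in> Two K; \<beta> \<in> Two K; tgt2 K \<alpha> = src2 K \<beta>\<rbrakk>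
          \<Longrightarrow> tgt2 K (vcmp K \<beta> \<alpha>) = tgt2 K \<beta>"
    and vcmp_id2_right: "\<alpha> \<in> Two K \<Longrightarrow> vcmp K \<alpha> (id2 K (src2 K \<alpha>)) = \<alpha>"
    and vcmp_id2_left: "\<alpha> \<in> Two K \<Longrightarrow> vcmp K (id2 K (tgt2 K \<alpha>)) \<alpha> = \<alpha>"
    and vcmp_assoc: "\<lbrakk>\<alpha> \<in> Two K; \<beta> \<in> Two K; \<gamma> \<in> Two K; tgt2 K \<alpha> = src2 K \<beta>; tgt2 K \<beta> = src2 K \<gamma>\<rbrakk>
          \<Longrightarrow> vcmp K (vcmp K \<gamma> \<beta>) \<alpha> = vcmp K \<gamma> (vcmp K \<beta> \<alpha>)"
    and hcmp_Two: "\<lbrakk>\<alpha> \<in> Two K; \<beta> \<in> Two K; tgt K (src2 K \<alpha>) = src K (src2 K \<beta>)\<rbrakk>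
          \<Longrightarrow> hcmp K \<beta> \<alpha> \<in> Two K"
    and src2_hcmp: "\<lbrakk>\<alpha> \<in> Two K; \<beta> \<in> Two K; tgt K (src2 K \<alpha>) = src K (src2 K \<beta>)\<rbrakk>
          \<Longrightarrow> src2 K (hcmp K \<beta> \<alpha>) = cmp K (src2 K \<beta>) (src2 K \<alpha>)"
    and tgt2_hcmp: "\<lbrakk>\<alpha> \<in> Two K; \<beta> \<in> Two K; tgt K (src2 K \<alpha>) = src K (src2 K \<beta>)\<rbrakk>
          \<Longrightarrow> tgt2 K (hcmp K \<beta> \<alpha>) = cmp K (tgt2 K \<beta>) (tgt2 K \<alpha>)"
    and hcmp_unit_right: "\<alpha> \<in> Two K \<Longrightarrow> hcmp K \<alpha> (id2 K (idm K (src K (src2 K \<alpha>)))) = \<alpha>"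
    and hcmp_unit_left: "\<alpha> \<in> Two K \<Longrightarrow> hcmp K (id2 K (idm K (tgt K (src2 K \<alpha>)))) \<alpha> = \<alpha>"
    and hcmp_assoc: "\<lbrakk>\<alpha> \<in> Two K; \<beta> \<in> Two K; \<gamma> \<in> Two K;
            tgt K (src2 K \<alpha>) = src K (src2 K \<beta>); tgt K (src2 K \<beta>) = src K (src2 K \<gamma>)\<rbrakk>
          \<Longrightarrow> hcmp K (hcmp K \<gamma> \<beta>) \<alpha> = hcmp K \<gamma> (hcmp K \<beta> \<alpha>)"
    and hcmp_id2: "\<lbrakk>f \<in> Mor K; g \<in> Mor K; tgt K f = src K g\<rbrakk>
          \<Longrightarrow> hcmp K (id2 K g) (id2 K f) = id2 K (cmp K g f)"
    and interchange: "\<lbrakk>\<alpha> \<in> Two K; \<alpha>' \<in> Two K; \<beta> \<in> Two K; \<beta>' \<in> Two K;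
            tgt2 K \<alpha> = src2 K \<alpha>'; tgt2 K \<beta> = src2 K \<beta>'; tgt K (src2 K \<alpha>) = src K (src2 K \<beta>)\<rbrakk>
          \<Longrightarrow> hcmp K (vcmp K \<beta>' \<beta>) (vcmp K \<alpha>' \<alpha>) = vcmp K (hcmp K \<beta>' \<alpha>') (hcmp K \<beta> \<alpha>)"

record ('o, 'm, 'c, 'p, 'n, 'd) two_fun =
  map0 :: "'o \<Rightarrow> 'p"
  map1 :: "'m \<Rightarrow> 'n"
  map2c :: "'c \<Rightarrow> 'd"

locale two_functor = C: two_category C + D: two_category D
  for C :: "('o, 'm, 'c) two_cat" and D :: "('p, 'n, 'd) two_cat" +
  fixes F :: "('o, 'm, 'c, 'p, 'n, 'd) two_fun"
  assumes map0_Obj: "a \<in> Obj C \<Longrightarrow> map0 F a \<in> Obj D"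
    and map1_Mor: "f \<in> Mor C \<Longrightarrow> map1 F f \<in> Mor D"
    and map2_Two: "\<alpha> \<in> Two C \<Longrightarrow> map2c F \<alpha> \<in> Two D"
    and map1_src: "f \<in> Mor C \<Longrightarrow> src D (map1 F f) = map0 F (src C f)"
    and map1_tgt: "f \<in> Mor C \<Longrightarrow> tgt D (map1 F f) = map0 F (tgt C f)"
    and map2_src2: "\<alpha> \<in> Two C \<Longrightarrow> src2 D (map2c F \<alpha>) = map1 F (src2 C \<alpha>)"
    and map2_tgt2: "\<alpha> \<in> Two C \<Longrightarrow> tgt2 D (map2c F \<alpha>) = map1 F (tgt2 C \<alpha>)"
    and map1_idm: "a \<in> Obj C \<Longrightarrow> map1 F (idm C a) = idm D (map0 F a)"
    and map1_cmp: "\<lbrakk>f \<in> Mor C; g \<in> Mor C; tgt C f = src C g\<rbrakk>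
          \<Longrightarrow> map1 F (cmp C g f) = cmp D (map1 F g) (map1 F f)"
    and map2_id2: "f \<in> Mor C \<Longrightarrow> map2c F (id2 C f) = id2 D (map1 F f)"
    and map2_vcmp: "\<lbrakk>\<alpha> \<in> Two C; \<beta> \<in> Two C; tgt2 C \<alpha> = src2 C \<beta>\<rbrakk>
          \<Longrightarrow> map2c F (vcmp C \<beta> \<alpha>) = vcmp D (map2c F \<beta>) (map2c F \<alpha>)"
    and map2_hcmp: "\<lbrakk>\<alpha> \<in> Two C; \<beta> \<in> Two C; tgt C (src2 C \<alpha>) = src C (src2 C \<beta>)\<rbrakk>
          \<Longrightarrow> map2c F (hcmp C \<beta> \<alpha>) = hcmp D (map2c F \<beta>) (map2c F \<alpha>)"

definition id_two_fun :: "('o, 'm, 'c, 'o, 'm, 'c) two_fun" where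
  "id_two_fun = \<lparr>map0 = (\<lambda>a. a), map1 = (\<lambda>f. f), map2c = (\<lambda>\<alpha>. \<alpha>)\<rparr>"

definition comp_two_fun ::
  "('p, 'n, 'd, 'q, 'r, 'e) two_fun \<Rightarrow> ('o, 'm, 'c, 'p, 'n, 'd) two_fun
    \<Rightarrow> ('o, 'm, 'c, 'q, 'r, 'e) two_fun" where
  "comp_two_fun G F =
    \<lparr>map0 = map0 G \<circ> map0 F, map1 = map1 G \<circ> map1 F, map2c = map2c G \<circ> map2c F\<rparr>"

locale two_natural = F: two_functor C D F + G: two_functor C D G
  for C :: "('o, 'm, 'c) two_cat" and D :: "('p, 'n, 'd) two_cat"
    and F :: "('o, 'm, 'c, 'p, 'n, 'd) two_fun" and G :: "('o, 'm, 'c, 'p, 'n, 'd) two_fun" +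
  fixes \<eta> :: "'o \<Rightarrow> 'n"
  assumes component_Mor: "a \<in> Obj C \<Longrightarrow> \<eta> a \<in> Mor D"
    and component_src: "a \<in> Obj C \<Longrightarrow> src D (\<eta> a) = map0 F a"
    and component_tgt: "a \<in> Obj C \<Longrightarrow> tgt D (\<eta> a) = map0 G a"
    and natural1: "f \<in> Mor C
          \<Longrightarrow> cmp D (map1 G f) (\<eta> (src C f)) = cmp D (\<eta> (tgt C f)) (map1 F f)"
    and natural2: "\<alpha> \<in> Two C
          \<Longrightarrow> hcmp D (map2c G \<alpha>) (id2 D (\<eta> (src C (src2 C \<alpha>))))
            = hcmp D (id2 D (\<eta> (tgt C (src2 C \<alpha>)))) (map2c F \<alpha>)"

text \<open>\<open>G\<close> is a right 2-adjoint of \<open>F\<close> with unit \<open>\<eta>\<close> and counit \<open>\<epsilon>\<close>.\<close>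

locale two_adjunction = F: two_functor C D F + G: two_functor D C G +
    unit: two_natural C C id_two_fun "comp_two_fun G F" \<eta> +
    counit: two_natural D D "comp_two_fun F G" id_two_fun \<epsilon>
  for C :: "('o, 'm, 'c) two_cat" and D :: "('p, 'n, 'd) two_cat"
    and F :: "('o, 'm, 'c, 'p, 'n, 'd) two_fun" and G :: "('p, 'n, 'd, 'o, 'm, 'c) two_fun"
    and \<eta> :: "'o \<Rightarrow> 'm" and \<epsilon> :: "'p \<Rightarrow> 'n" +
  assumes triangle_left: "a \<in> Obj C
          \<Longrightarrow> cmp D (\<epsilon> (map0 F a)) (map1 F (\<eta> a)) = idm D (map0 F a)"
    and triangle_right: "b \<in> Obj D
          \<Longrightarrow> cmp C (map1 G (\<epsilon> b)) (\<eta> (map0 G b)) = idm C (map0 G b)"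

definition right_2adjoint ::
  "('o, 'm, 'c) two_cat \<Rightarrow> ('p, 'n, 'd) two_cat \<Rightarrow> ('o, 'm, 'c, 'p, 'n, 'd) two_fun
    \<Rightarrow> ('p, 'n, 'd, 'o, 'm, 'c) two_fun \<Rightarrow> bool" where
  "right_2adjoint C D F G \<longleftrightarrow> (\<exists>\<eta> \<epsilon>. two_adjunction C D F G \<eta> \<epsilon>)"

text \<open>The strict slice: objects are the 1-cells \<open>p\<close> into \<open>Y\<close>, a 1-cell \<open>(p, f, q)\<close> is a strictly
  commuting triangle from \<open>p\<close> to \<open>q\<close>, and a 2-cell \<open>(p, \<alpha>, q)\<close> is a 2-cell whose whiskering with
  \<open>q\<close> is the identity of \<open>p\<close>.\<close>

definition slice :: "('o, 'm, 'c) two_cat \<Rightarrow> 'o \<Rightarrow> ('m, 'm \<times> 'm \<times> 'm, 'm \<times> 'c \<times> 'm) two_cat" where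
  "slice K Y =
    \<lparr>Obj = {p \<in> Mor K. tgt K p = Y},
     Mor = {(p, f, q). p \<in> Mor K \<and> q \<in> Mor K \<and> tgt K p = Y \<and> tgt K q = Y \<and>
              f \<in> Mor K \<and> src K f = src K p \<and> tgt K f = src K q \<and> cmp K q f = p},
     Two = {(p, \<alpha>, q). p \<in> Mor K \<and> q \<in> Mor K \<and> tgt K p = Y \<and> tgt K q = Y \<and>
              \<alpha> \<in> Two K \<and> src K (src2 K \<alpha>) = src K p \<and> tgt K (src2 K \<alpha>) = src K q \<and>
              hcmp K (id2 K q) \<alpha> = id2 K p},
     src = (\<lambda>(p, f, q). p),
     tgt = (\<lambda>(p, f, q). q),
     src2 = (\<lambda>(p, \<alpha>, q). (p, src2 K \<alpha>, q)),
     tgt2 = (\<lambda>(p, \<alpha>, q). (p, tgt2 K \<alpha>, q)),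
     idm = (\<lambda>p. (p, idm K (src K p), p)),
     cmp = (\<lambda>(q, g, r) (p, f, q'). (p, cmp K g f, r)),
     id2 = (\<lambda>(p, f, q). (p, id2 K f, q)),
     vcmp = (\<lambda>(p, \<beta>, q) (p', \<alpha>, q'). (p', vcmp K \<beta> \<alpha>, q)),
     hcmp = (\<lambda>(q, \<beta>, r) (p, \<alpha>, q'). (p, hcmp K \<beta> \<alpha>, r))\<rparr>"

text \<open>The square \<open>e \<circ> a = p \<circ> b\<close> exhibits the common source of \<open>a\<close> and \<open>b\<close> as a strict 2-pullback
  of \<open>e\<close> along \<open>p\<close>: a universal property for 1-cells and one for 2-cells.\<close>

definition two_pullback :: "('o, 'm, 'c) two_cat \<Rightarrow> 'm \<Rightarrow> 'm \<Rightarrow> 'm \<Rightarrow> 'm \<Rightarrow> bool" where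
  "two_pullback K e p a b \<longleftrightarrow>
    e \<in> Mor K \<and> p \<in> Mor K \<and> a \<in> Mor K \<and> b \<in> Mor K \<and> tgt K e = tgt K p \<and>
    src K a = src K b \<and> tgt K a = src K e \<and> tgt K b = src K p \<and> cmp K e a = cmp K p b \<and>
    (\<forall>f\<in>Mor K. \<forall>g\<in>Mor K. src K f = src K g \<and> tgt K f = src K e \<and> tgt K g = src K p \<and>
        cmp K e f = cmp K p g \<longrightarrow>
      (\<exists>!h. h \<in> Mor K \<and> src K h = src K f \<and> tgt K h = src K a \<and>
        cmp K a h = f \<and> cmp K b h = g)) \<and>
    (\<forall>h\<in>Mor K. \<forall>k\<in>Mor K. \<forall>\<alpha>\<in>Two K. \<forall>\<beta>\<in>Two K.
        src K h = src K k \<and> tgt K h = src K a \<and> tgt K k = src K a \<and>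
        src2 K \<alpha> = cmp K a h \<and> tgt2 K \<alpha> = cmp K a k \<and>
        src2 K \<beta> = cmp K b h \<and> tgt2 K \<beta> = cmp K b k \<and>
        hcmp K (id2 K e) \<alpha> = hcmp K (id2 K p) \<beta> \<longrightarrow>
      (\<exists>!\<gamma>. \<gamma> \<in> Two K \<and> src2 K \<gamma> = h \<and> tgt2 K \<gamma> = k \<and>
        hcmp K (id2 K a) \<gamma> = \<alpha> \<and> hcmp K (id2 K b) \<gamma> = \<beta>))"

text \<open>A 2-functor \<open>K/Y \<rightarrow> K/X\<close> given by strict 2-pullback along \<open>p : X \<rightarrow> Y\<close>, where \<open>pr e\<close> is the
  projection of the pullback of \<open>e\<close> to the source of \<open>e\<close>. The last two conditions, together with
  the universal property, determine the action on 1-cells and 2-cells; hence such a 2-functor is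
  unique up to 2-natural isomorphism.\<close>

definition pullback_2functor ::
  "('o, 'm, 'c) two_cat \<Rightarrow> 'm
    \<Rightarrow> ('m, 'm \<times> 'm \<times> 'm, 'm \<times> 'c \<times> 'm, 'm, 'm \<times> 'm \<times> 'm, 'm \<times> 'c \<times> 'm) two_fun \<Rightarrow> bool" where
  "pullback_2functor K p F \<longleftrightarrow>
    two_functor (slice K (tgt K p)) (slice K (src K p)) F \<and>
    (\<exists>pr. (\<forall>e \<in> Obj (slice K (tgt K p)). two_pullback K e p (pr e) (map0 F e)) \<and>
      (\<forall>e f e'. (e, f, e') \<in> Mor (slice K (tgt K p)) \<longrightarrow>
        cmp K (pr e') (fst (snd (map1 F (e, f, e')))) = cmp K f (pr e)) \<and>
      (\<forall>e \<alpha> e'. (e, \<alpha>, e') \<in> Two (slice K (tgt K p)) \<longrightarrow>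
        hcmp K (id2 K (pr e')) (fst (snd (map2c F (e, \<alpha>, e')))) = hcmp K \<alpha> (id2 K (pr e))))"

definition powerful :: "('o, 'm, 'c) two_cat \<Rightarrow> 'm \<Rightarrow> bool" where
  "powerful K p \<longleftrightarrow> p \<in> Mor K \<and>
    (\<exists>F. pullback_2functor K p F \<and>
      (\<exists>G. right_2adjoint (slice K (tgt K p)) (slice K (src K p)) F G))"


section \<open>Virtual double categories\<close>

text \<open>Arrows and multicells carry their boundaries. The top of a multicell \<open>\<theta>\<close> is the list
  \<open>ctop \<theta>\<close>; if it is empty, the top object is the common domain of \<open>cleft \<theta>\<close> and \<open>cright \<theta>\<close>.\<close>

record 'u vdc =
  Ob     :: "'u set"
  Ver    :: "'u set"
  vdom   :: "'u \<Rightarrow> 'u"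
  vcod   :: "'u \<Rightarrow> 'u"
  vid    :: "'u \<Rightarrow> 'u"
  vcomp  :: "'u \<Rightarrow> 'u \<Rightarrow> 'u"
  Hor    :: "'u set"
  hsrc   :: "'u \<Rightarrow> 'u"
  htgt   :: "'u \<Rightarrow> 'u"
  Cel    :: "'u set"
  ctop   :: "'u \<Rightarrow> 'u list"
  ctgt   :: "'u \<Rightarrow> 'u"
  cleft  :: "'u \<Rightarrow> 'u"
  cright :: "'u \<Rightarrow> 'u"
  cid    :: "'u \<Rightarrow> 'u"
  mcomp  :: "'u \<Rightarrow> 'u \<Rightarrow> 'u list \<Rightarrow> 'u"

text \<open>\<open>mcomp \<kappa> u \<theta>s\<close> is the composite of \<open>\<kappa>\<close> with the path \<open>\<theta>s\<close> of multicells whose leftmost vertical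
  boundary is \<open>u\<close>. For nonempty \<open>\<theta>s\<close> the morphism \<open>u\<close> is redundant and this is
  \<open>\<kappa> \<circ> (\<theta>\<^sub>1, \<dots>, \<theta>\<^sub>m)\<close>; for empty \<open>\<theta>s\<close> it is the nullary composite \<open>\<kappa> \<circ> (u)\<close>.\<close>

fun hpath :: "'u vdc \<Rightarrow> 'u \<Rightarrow> 'u list \<Rightarrow> 'u \<Rightarrow> bool" where
  "hpath A a [] b \<longleftrightarrow> a \<in> Ob A \<and> a = b"
| "hpath A a (\<Gamma> # \<Gamma>s) b \<longleftrightarrow> \<Gamma> \<in> Hor A \<and> hsrc A \<Gamma> = a \<and> hpath A (htgt A \<Gamma>) \<Gamma>s b"

fun cpath :: "'u vdc \<Rightarrow> 'u \<Rightarrow> 'u list \<Rightarrow> bool" where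
  "cpath A u [] \<longleftrightarrow> u \<in> Ver A"
| "cpath A u (\<theta> # \<theta>s) \<longleftrightarrow> \<theta> \<in> Cel A \<and> cleft A \<theta> = u \<and> cpath A (cright A \<theta>) \<theta>s"

fun cpath_end :: "'u vdc \<Rightarrow> 'u \<Rightarrow> 'u list \<Rightarrow> 'u" where
  "cpath_end A u [] = u"
| "cpath_end A u (\<theta> # \<theta>s) = cpath_end A (cright A \<theta>) \<theta>s"

definition composable :: "'u vdc \<Rightarrow> 'u \<Rightarrow> 'u \<Rightarrow> 'u list \<Rightarrow> bool" where
  "composable A \<kappa> u \<theta>s \<longleftrightarrow>
    \<kappa> \<in> Cel A \<and> cpath A u \<theta>s \<and> map (ctgt A) \<theta>s = ctop A \<kappa> \<and> vcod A u = vdom A (cleft A \<kappa>)"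

text \<open>\<open>block_comps A u [\<theta>\<^sub>1, \<dots>, \<theta>\<^sub>m] [\<chi>s\<^sub>1, \<dots>, \<chi>s\<^sub>m]\<close> is the list of the composites of \<open>\<theta>\<^sub>i\<close> with
  \<open>\<chi>s\<^sub>i\<close>, where \<open>concat [\<chi>s\<^sub>1, \<dots>, \<chi>s\<^sub>m]\<close> is a path of multicells with leftmost boundary \<open>u\<close>; an
  empty \<open>\<chi>s\<^sub>i\<close> stands for the vertical morphism which this path has at that position.\<close>

fun block_comps :: "'u vdc \<Rightarrow> 'u \<Rightarrow> 'u list \<Rightarrow> 'u list list \<Rightarrow> 'u list" where
  "block_comps A u (\<theta> # \<theta>s) (\<chi>s # \<chi>ss) =
    mcomp A \<theta> u \<chi>s # block_comps A (cpath_end A u \<chi>s) \<theta>s \<chi>ss"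
| "block_comps A u _ _ = []"

locale virtual_double_category =
  fixes A :: "'u vdc"
  assumes vdom_Ob: "u \<in> Ver A \<Longrightarrow> vdom A u \<in> Ob A"
    and vcod_Ob: "u \<in> Ver A \<Longrightarrow> vcod A u \<in> Ob A"
    and vid_Ver: "a \<in> Ob A \<Longrightarrow> vid A a \<in> Ver A"
    and vdom_vid: "a \<in> Ob A \<Longrightarrow> vdom A (vid A a) = a"
    and vcod_vid: "a \<in> Ob A \<Longrightarrow> vcod A (vid A a) = a"
    and vcomp_Ver: "\<lbrakk>u \<in> Ver A; v \<in> Ver A; vcod A u = vdom A v\<rbrakk> \<Longrightarrow> vcomp A v u \<in> Ver A"
    and vdom_vcomp: "\<lbrakk>u \<in> Ver A; v \<in> Ver A; vcod A u = vdom A v\<rbrakk>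
          \<Longrightarrow> vdom A (vcomp A v u) = vdom A u"
    and vcod_vcomp: "\<lbrakk>u \<in> Ver A; v \<in> Ver A; vcod A u = vdom A v\<rbrakk>
          \<Longrightarrow> vcod A (vcomp A v u) = vcod A v"
    and vcomp_vid_right: "u \<in> Ver A \<Longrightarrow> vcomp A u (vid A (vdom A u)) = u"
    and vcomp_vid_left: "u \<in> Ver A \<Longrightarrow> vcomp A (vid A (vcod A u)) u = u"
    and vcomp_assoc: "\<lbrakk>u \<in> Ver A; v \<in> Ver A; w \<in> Ver A; vcod A u = vdom A v; vcod A v = vdom A w\<rbrakk>
          \<Longrightarrow> vcomp A (vcomp A w v) u = vcomp A w (vcomp A v u)"
    and hsrc_Ob: "\<Gamma> \<in> Hor A \<Longrightarrow> hsrc A \<Gamma> \<in> Ob A"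
    and htgt_Ob: "\<Gamma> \<in> Hor A \<Longrightarrow> htgt A \<Gamma> \<in> Ob A"
    and ctgt_Hor: "\<theta> \<in> Cel A \<Longrightarrow> ctgt A \<theta> \<in> Hor A"
    and cleft_Ver: "\<theta> \<in> Cel A \<Longrightarrow> cleft A \<theta> \<in> Ver A"
    and cright_Ver: "\<theta> \<in> Cel A \<Longrightarrow> cright A \<theta> \<in> Ver A"
    and ctop_hpath: "\<theta> \<in> Cel A \<Longrightarrow> hpath A (vdom A (cleft A \<theta>)) (ctop A \<theta>) (vdom A (cright A \<theta>))"
    and vcod_cleft: "\<theta> \<in> Cel A \<Longrightarrow> vcod A (cleft A \<theta>) = hsrc A (ctgt A \<theta>)"
    and vcod_cright: "\<theta> \<in> Cel A \<Longrightarrow> vcod A (cright A \<theta>) = htgt A (ctgt A \<theta>)"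
    and cid_Cel: "\<Gamma> \<in> Hor A \<Longrightarrow> cid A \<Gamma> \<in> Cel A"
    and ctop_cid: "\<Gamma> \<in> Hor A \<Longrightarrow> ctop A (cid A \<Gamma>) = [\<Gamma>]"
    and ctgt_cid: "\<Gamma> \<in> Hor A \<Longrightarrow> ctgt A (cid A \<Gamma>) = \<Gamma>"
    and cleft_cid: "\<Gamma> \<in> Hor A \<Longrightarrow> cleft A (cid A \<Gamma>) = vid A (hsrc A \<Gamma>)"
    and cright_cid: "\<Gamma> \<in> Hor A \<Longrightarrow> cright A (cid A \<Gamma>) = vid A (htgt A \<Gamma>)"
    and mcomp_Cel: "composable A \<kappa> u \<theta>s \<Longrightarrow> mcomp A \<kappa> u \<theta>s \<in> Cel A"
    and ctop_mcomp: "composable A \<kappa> u \<theta>s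
          \<Longrightarrow> ctop A (mcomp A \<kappa> u \<theta>s) = concat (map (ctop A) \<theta>s)"
    and ctgt_mcomp: "composable A \<kappa> u \<theta>s \<Longrightarrow> ctgt A (mcomp A \<kappa> u \<theta>s) = ctgt A \<kappa>"
    and cleft_mcomp: "composable A \<kappa> u \<theta>s
          \<Longrightarrow> cleft A (mcomp A \<kappa> u \<theta>s) = vcomp A (cleft A \<kappa>) u"
    and cright_mcomp: "composable A \<kappa> u \<theta>s
          \<Longrightarrow> cright A (mcomp A \<kappa> u \<theta>s) = vcomp A (cright A \<kappa>) (cpath_end A u \<theta>s)"
    and mcomp_cid_right: "\<kappa> \<in> Cel A
          \<Longrightarrow> mcomp A \<kappa> (vid A (vdom A (cleft A \<kappa>))) (map (cid A) (ctop A \<kappa>)) = \<kappa>"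
    and mcomp_cid_left: "\<theta> \<in> Cel A \<Longrightarrow> mcomp A (cid A (ctgt A \<theta>)) (cleft A \<theta>) [\<theta>] = \<theta>"
    and mcomp_assoc: "\<lbrakk>composable A \<kappa> v \<theta>s; cpath A u (concat \<chi>ss); vcod A u = vdom A v;
            map (map (ctgt A)) \<chi>ss = map (ctop A) \<theta>s\<rbrakk>
          \<Longrightarrow> mcomp A (mcomp A \<kappa> v \<theta>s) u (concat \<chi>ss)
            = mcomp A \<kappa> (vcomp A v u) (block_comps A u \<theta>s \<chi>ss)"

text \<open>The maps of a virtual double functor are required to be \<^const>\<open>undefined\<close> outside the carrier
  sets, so that equality of these records is equality of virtual double functors; likewise for
  vertical transformations.\<close>

record 'u vdf =
  fdom :: "'u vdc"
  fcod :: "'u vdc"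
  fOb  :: "'u \<Rightarrow> 'u"
  fVer :: "'u \<Rightarrow> 'u"
  fHor :: "'u \<Rightarrow> 'u"
  fCel :: "'u \<Rightarrow> 'u"

locale virtual_double_functor =
  A: virtual_double_category "fdom F" + B: virtual_double_category "fcod F"
  for F :: "'u vdf" +
  assumes fOb_maps: "fOb F \<in> Ob (fdom F) \<rightarrow>\<^sub>E Ob (fcod F)"
    and fVer_maps: "fVer F \<in> Ver (fdom F) \<rightarrow>\<^sub>E Ver (fcod F)"
    and fHor_maps: "fHor F \<in> Hor (fdom F) \<rightarrow>\<^sub>E Hor (fcod F)"
    and fCel_maps: "fCel F \<in> Cel (fdom F) \<rightarrow>\<^sub>E Cel (fcod F)"
    and fVer_vdom: "u \<in> Ver (fdom F) \<Longrightarrow> vdom (fcod F) (fVer F u) = fOb F (vdom (fdom F) u)"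
    and fVer_vcod: "u \<in> Ver (fdom F) \<Longrightarrow> vcod (fcod F) (fVer F u) = fOb F (vcod (fdom F) u)"
    and fVer_vid: "a \<in> Ob (fdom F) \<Longrightarrow> fVer F (vid (fdom F) a) = vid (fcod F) (fOb F a)"
    and fVer_vcomp: "\<lbrakk>u \<in> Ver (fdom F); v \<in> Ver (fdom F); vcod (fdom F) u = vdom (fdom F) v\<rbrakk>
          \<Longrightarrow> fVer F (vcomp (fdom F) v u) = vcomp (fcod F) (fVer F v) (fVer F u)"
    and fHor_hsrc: "\<Gamma> \<in> Hor (fdom F) \<Longrightarrow> hsrc (fcod F) (fHor F \<Gamma>) = fOb F (hsrc (fdom F) \<Gamma>)"
    and fHor_htgt: "\<Gamma> \<in> Hor (fdom F) \<Longrightarrow> htgt (fcod F) (fHor F \<Gamma>) = fOb F (htgt (fdom F) \<Gamma>)"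
    and fCel_ctop: "\<theta> \<in> Cel (fdom F)
          \<Longrightarrow> ctop (fcod F) (fCel F \<theta>) = map (fHor F) (ctop (fdom F) \<theta>)"
    and fCel_ctgt: "\<theta> \<in> Cel (fdom F) \<Longrightarrow> ctgt (fcod F) (fCel F \<theta>) = fHor F (ctgt (fdom F) \<theta>)"
    and fCel_cleft: "\<theta> \<in> Cel (fdom F) \<Longrightarrow> cleft (fcod F) (fCel F \<theta>) = fVer F (cleft (fdom F) \<theta>)"
    and fCel_cright: "\<theta> \<in> Cel (fdom F)
          \<Longrightarrow> cright (fcod F) (fCel F \<theta>) = fVer F (cright (fdom F) \<theta>)"
    and fCel_cid: "\<Gamma> \<in> Hor (fdom F) \<Longrightarrow> fCel F (cid (fdom F) \<Gamma>) = cid (fcod F) (fHor F \<Gamma>)"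
    and fCel_mcomp: "composable (fdom F) \<kappa> u \<theta>s
          \<Longrightarrow> fCel F (mcomp (fdom F) \<kappa> u \<theta>s)
            = mcomp (fcod F) (fCel F \<kappa>) (fVer F u) (map (fCel F) \<theta>s)"

record 'u vtr =
  tdom :: "'u vdf"
  tcod :: "'u vdf"
  tOb  :: "'u \<Rightarrow> 'u"
  tHor :: "'u \<Rightarrow> 'u"

locale vertical_transformation =
  F: virtual_double_functor "tdom \<alpha>" + G: virtual_double_functor "tcod \<alpha>"
  for \<alpha> :: "'u vtr" +
  fixes A B F G
  defines "A \<equiv> fdom (tdom \<alpha>)" and "B \<equiv> fcod (tdom \<alpha>)" and "F \<equiv> tdom \<alpha>" and "G \<equiv> tcod \<alpha>"
  assumes same_dom: "fdom G = A"
    and same_cod: "fcod G = B"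
    and tOb_maps: "tOb \<alpha> \<in> Ob A \<rightarrow>\<^sub>E Ver B"
    and vdom_tOb: "a \<in> Ob A \<Longrightarrow> vdom B (tOb \<alpha> a) = fOb F a"
    and vcod_tOb: "a \<in> Ob A \<Longrightarrow> vcod B (tOb \<alpha> a) = fOb G a"
    and tOb_natural: "u \<in> Ver A
          \<Longrightarrow> vcomp B (tOb \<alpha> (vcod A u)) (fVer F u) = vcomp B (fVer G u) (tOb \<alpha> (vdom A u))"
    and tHor_maps: "tHor \<alpha> \<in> Hor A \<rightarrow>\<^sub>E Cel B"
    and ctop_tHor: "\<Gamma> \<in> Hor A \<Longrightarrow> ctop B (tHor \<alpha> \<Gamma>) = [fHor F \<Gamma>]"
    and ctgt_tHor: "\<Gamma> \<in> Hor A \<Longrightarrow> ctgt B (tHor \<alpha> \<Gamma>) = fHor G \<Gamma>"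
    and cleft_tHor: "\<Gamma> \<in> Hor A \<Longrightarrow> cleft B (tHor \<alpha> \<Gamma>) = tOb \<alpha> (hsrc A \<Gamma>)"
    and cright_tHor: "\<Gamma> \<in> Hor A \<Longrightarrow> cright B (tHor \<alpha> \<Gamma>) = tOb \<alpha> (htgt A \<Gamma>)"
    and tHor_natural: "\<theta> \<in> Cel A
          \<Longrightarrow> mcomp B (tHor \<alpha> (ctgt A \<theta>)) (cleft B (fCel F \<theta>)) [fCel F \<theta>]
            = mcomp B (fCel G \<theta>) (tOb \<alpha> (vdom A (cleft A \<theta>))) (map (tHor \<alpha>) (ctop A \<theta>))"


section \<open>The 2-category of large virtual double categories\<close>

text \<open>The type \<open>'u\<close> with the membership relation \<open>E\<close> plays the role of the Grothendieck universe: the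
  conditions are extensionality, foundation, and closure under subsets, pairs, power sets and unions
  of families indexed by an element. Subsets and families range over all HOL sets and functions, so
  such a structure is, up to isomorphism, a nonempty Grothendieck universe in the usual sense; it
  need not have an infinite element. A set of type \<open>'u set\<close> belongs to the universe if it is the
  extension of an element. Functions between such sets then belong to it as well, and hence so do
  virtual double categories all of whose carrier sets do.\<close>

locale grothendieck_universe =
  fixes E :: "'u \<Rightarrow> 'u \<Rightarrow> bool"
  assumes extensionality: "(\<And>z. E z x \<longleftrightarrow> E z y) \<Longrightarrow> x = y"
    and foundation: "wfP E"
    and subset: "S \<subseteq> {z. E z x} \<Longrightarrow> \<exists>y. {z. E z y} = S"
    and pair: "\<exists>p. {z. E z p} = {x, y}"
    and power: "\<exists>p. {z. E z p} = {y. \<forall>z. E z y \<longrightarrow> E z x}"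
    and union: "\<exists>y. {z. E z y} = (\<Union>i\<in>{i. E i x}. {z. E z (f i)})"

definition in_universe :: "('u \<Rightarrow> 'u \<Rightarrow> bool) \<Rightarrow> 'u set \<Rightarrow> bool" where
  "in_universe E S \<longleftrightarrow> (\<exists>x. S = {z. E z x})"

definition large_vdc :: "('u \<Rightarrow> 'u \<Rightarrow> bool) \<Rightarrow> 'u vdc \<Rightarrow> bool" where
  "large_vdc E A \<longleftrightarrow> virtual_double_category A \<and>
    in_universe E (Ob A) \<and> in_universe E (Ver A) \<and> in_universe E (Hor A) \<and> in_universe E (Cel A)"

definition id_vdf :: "'u vdc \<Rightarrow> 'u vdf" where
  "id_vdf A = \<lparr>fdom = A, fcod = A,
    fOb = restrict (\<lambda>a. a) (Ob A), fVer = restrict (\<lambda>u. u) (Ver A),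
    fHor = restrict (\<lambda>\<Gamma>. \<Gamma>) (Hor A), fCel = restrict (\<lambda>\<theta>. \<theta>) (Cel A)\<rparr>"

definition comp_vdf :: "'u vdf \<Rightarrow> 'u vdf \<Rightarrow> 'u vdf" where
  "comp_vdf G F = \<lparr>fdom = fdom F, fcod = fcod G,
    fOb = compose (Ob (fdom F)) (fOb G) (fOb F),
    fVer = compose (Ver (fdom F)) (fVer G) (fVer F),
    fHor = compose (Hor (fdom F)) (fHor G) (fHor F),
    fCel = compose (Cel (fdom F)) (fCel G) (fCel F)\<rparr>"

definition id_vtr :: "'u vdf \<Rightarrow> 'u vtr" where
  "id_vtr F = \<lparr>tdom = F, tcod = F,
    tOb = restrict (\<lambda>a. vid (fcod F) (fOb F a)) (Ob (fdom F)),
    tHor = restrict (\<lambda>\<Gamma>. cid (fcod F) (fHor F \<Gamma>)) (Hor (fdom F))\<rparr>"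

definition vcomp_vtr :: "'u vtr \<Rightarrow> 'u vtr \<Rightarrow> 'u vtr" where
  "vcomp_vtr \<beta> \<alpha> = (let A = fdom (tdom \<alpha>); B = fcod (tdom \<alpha>) in
    \<lparr>tdom = tdom \<alpha>, tcod = tcod \<beta>,
     tOb = restrict (\<lambda>a. vcomp B (tOb \<beta> a) (tOb \<alpha> a)) (Ob A),
     tHor = restrict (\<lambda>\<Gamma>. mcomp B (tHor \<beta> \<Gamma>) (tOb \<alpha> (hsrc A \<Gamma>)) [tHor \<alpha> \<Gamma>]) (Hor A)\<rparr>)"

text \<open>For \<open>\<alpha> : F \<rightarrow> G\<close> and \<open>\<beta> : H \<rightarrow> K\<close>, the horizontal composite \<open>HF \<rightarrow> KG\<close> is \<open>\<beta>G\<close> after \<open>H\<alpha>\<close>.\<close>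

definition hcomp_vtr :: "'u vtr \<Rightarrow> 'u vtr \<Rightarrow> 'u vtr" where
  "hcomp_vtr \<beta> \<alpha> =
    (let A = fdom (tdom \<alpha>); C = fcod (tdom \<beta>); G = tcod \<alpha>; H = tdom \<beta> in
    \<lparr>tdom = comp_vdf (tdom \<beta>) (tdom \<alpha>), tcod = comp_vdf (tcod \<beta>) (tcod \<alpha>),
     tOb = restrict (\<lambda>a. vcomp C (tOb \<beta> (fOb G a)) (fVer H (tOb \<alpha> a))) (Ob A),
     tHor = restrict (\<lambda>\<Gamma>. mcomp C (tHor \<beta> (fHor G \<Gamma>)) (fVer H (tOb \<alpha> (hsrc A \<Gamma>)))
                             [fCel H (tHor \<alpha> \<Gamma>)]) (Hor A)\<rparr>)"

definition VDBL :: "('u \<Rightarrow> 'u \<Rightarrow> bool) \<Rightarrow> ('u vdc, 'u vdf, 'u vtr) two_cat" where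
  "VDBL E =
    \<lparr>Obj = {A. large_vdc E A},
     Mor = {F. virtual_double_functor F \<and> large_vdc E (fdom F) \<and> large_vdc E (fcod F)},
     Two = {\<alpha>. vertical_transformation \<alpha> \<and>
              large_vdc E (fdom (tdom \<alpha>)) \<and> large_vdc E (fcod (tdom \<alpha>))},
     src = fdom, tgt = fcod, src2 = tdom, tgt2 = tcod,
     idm = id_vdf, cmp = comp_vdf, id2 = id_vtr, vcmp = vcomp_vtr, hcmp = hcomp_vtr\<rparr>"


section \<open>Discrete opfibrations\<close>

text \<open>The vertical morphism out of \<open>x\<close> that lies over \<open>v\<close>; it is used only where it is unique.\<close>

definition vlift :: "'u vdf \<Rightarrow> 'u \<Rightarrow> 'u \<Rightarrow> 'u" where
  "vlift P x v = (THE w. w \<in> Ver (fdom P) \<and> vdom (fdom P) w = x \<and> fVer P w = v)"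

text \<open>In \<open>multicell_lift\<close>, the condition on the domain of \<open>cleft \<nu>\<close> matters only if \<open>\<Phi>s\<close> is
  empty.\<close>

locale discrete_opfibration = virtual_double_functor P for P :: "'u vdf" +
  assumes vertical_lift:
      "\<lbrakk>x \<in> Ob (fdom P); v \<in> Ver (fcod P); vdom (fcod P) v = fOb P x\<rbrakk>
        \<Longrightarrow> \<exists>!w. w \<in> Ver (fdom P) \<and> vdom (fdom P) w = x \<and> fVer P w = v"
    and multicell_lift:
      "\<lbrakk>hpath (fdom P) x \<Phi>s x'; \<nu> \<in> Cel (fcod P); ctop (fcod P) \<nu> = map (fHor P) \<Phi>s;
        vdom (fcod P) (cleft (fcod P) \<nu>) = fOb P x\<rbrakk>
        \<Longrightarrow> \<exists>!\<theta>. \<theta> \<in> Cel (fdom P) \<and> ctop (fdom P) \<theta> = \<Phi>s \<and>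
              cleft (fdom P) \<theta> = vlift P x (cleft (fcod P) \<nu>) \<and>
              cright (fdom P) \<theta> = vlift P x' (cright (fcod P) \<nu>) \<and> fCel P \<theta> = \<nu>"

end

theory Submission
  imports Defs
begin

text \<open>Why discrete opfibrations are powerful. Let \<open>P : X \<rightarrow> Y\<close> be a discrete opfibration. If the image
  under \<open>P\<close> of a vertical morphism or of a multicell is a composite in \<open>Y\<close>, then lifting the factors one
  after the other exhibits it as a composite in \<open>X\<close> of lifts of these factors, in exactly one way; and
  every lift of an identity is an identity. This unique lifting of factorizations
  (\<open>discrete_conduche\<close>, proved in \<open>opfibration.discrete_conduche\<close>) is the property of \<open>P\<close> on
  which the whole construction rests.

  The right 2-adjoint is found by testing what it must be on generic objects and cells. For
  \<open>Q : Z \<rightarrow> X\<close>, an object of the dependent product over \<open>y\<close> has to be a section of \<open>Q\<close> over the fibre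
  of \<open>P\<close> at \<open>y\<close>; a vertical or horizontal morphism over \<open>v\<close> has to consist of two such sections and of a
  choice, for each lift \<open>w\<close> of \<open>v\<close>, of a morphism of \<open>Z\<close> over \<open>w\<close> between their values; and a multicell
  over \<open>\<nu>\<close> has to consist of such boundary data and of a choice, for each lift \<open>\<theta>\<close> of \<open>\<nu>\<close>, of a
  multicell of \<open>Z\<close> over \<open>\<theta>\<close> with the resulting boundary. The value of a composite at a lift \<open>\<theta>\<close> of the
  composite is obtained by factoring \<open>\<theta>\<close> and composing the values at the factors. Existence and
  uniqueness of factorizations make this a definition; uniqueness also transports associativity and
  the unit laws from \<open>X\<close> and \<open>Z\<close> (\<open>mcomp_R\<close>, \<open>mcomp_R_assoc\<close>, \<open>virtual_double_category_R\<close>).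

  Evaluating a family at a lift is then a virtual double functor \<open>ev\<close> from the pullback of the
  dependent product along \<open>P\<close> to \<open>Z\<close>. A virtual double functor \<open>g\<close> over \<open>X\<close> from the pullback of
  \<open>e : A \<rightarrow> Y\<close> to \<open>Z\<close> is the same as one over \<open>Y\<close> from \<open>A\<close> to the dependent product, namely the one
  that sends \<open>a\<close> to the family \<open>x \<mapsto> g (a, x)\<close>; the same holds for vertical transformations
  (\<open>curry_exists\<close>, \<open>curry_unique\<close>, \<open>curry2_exists\<close>, \<open>curry2_unique\<close>).

  This universal property, in dimensions one and two, suffices in any 2-category with chosen
  pullbacks along a 1-cell: the unique fillers are the values of the right 2-adjoint, and all its
  laws follow from uniqueness (\<open>couniversal_arrows\<close>, \<open>dependent_products.powerful\<close>). It remains to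
  know that virtual double categories form a 2-category (\<open>two_category_VDBL\<close>), that their pullbacks
  are computed componentwise on pairs (\<open>two_pullback_VDBL\<close>), and that pairs and families can be coded
  by elements of the universe. For the last point, the universe contains products, function sets
  and sets of lists of a fixed length; since the top of a multicell over \<open>\<nu>\<close> is as long as that of
  \<open>\<nu>\<close>, this covers multicells even if the universe has no infinite element.\<close>

section \<open>Right 2-adjoints from couniversal arrows\<close>

context two_category
begin

lemmas mor_rules = src_Obj tgt_Obj idm_Mor src_idm tgt_idm cmp_Mor src_cmp tgt_cmp
  src2_Mor tgt2_Mor id2_Two src2_id2 tgt2_id2 vcmp_Two src2_vcmp tgt2_vcmp
  hcmp_Two src2_hcmp tgt2_hcmp

lemma src_tgt2: "\<alpha> \<in> Two K \<Longrightarrow> src K (tgt2 K \<alpha>) = src K (src2 K \<alpha>)"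
  and tgt_tgt2: "\<alpha> \<in> Two K \<Longrightarrow> tgt K (tgt2 K \<alpha>) = tgt K (src2 K \<alpha>)"
  by (simp_all add: src_parallel tgt_parallel)

lemma cmp_idm_right': "f \<in> Mor K \<Longrightarrow> src K f = a \<Longrightarrow> cmp K f (idm K a) = f"
  and cmp_idm_left': "f \<in> Mor K \<Longrightarrow> tgt K f = a \<Longrightarrow> cmp K (idm K a) f = f"
  using cmp_idm_right cmp_idm_left by auto

lemma hcmp_unit_right': "\<alpha> \<in> Two K \<Longrightarrow> src K (src2 K \<alpha>) = a \<Longrightarrow> hcmp K \<alpha> (id2 K (idm K a)) = \<alpha>"
  and hcmp_unit_left': "\<alpha> \<in> Two K \<Longrightarrow> tgt K (src2 K \<alpha>) = a \<Longrightarrow> hcmp K (id2 K (idm K a)) \<alpha> = \<alpha>"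
  using hcmp_unit_right hcmp_unit_left by auto

text \<open>Interchange, applied to the identity 2-cell of \<open>f\<close> written as its own vertical composite; likewise
  on the other side.\<close>

lemma whisker_left_vcmp:
  assumes "f \<in> Mor K" "\<alpha> \<in> Two K" "\<beta> \<in> Two K" "tgt2 K \<alpha> = src2 K \<beta>" "tgt K (src2 K \<alpha>) = src K f"
  shows "hcmp K (id2 K f) (vcmp K \<beta> \<alpha>) = vcmp K (hcmp K (id2 K f) \<beta>) (hcmp K (id2 K f) \<alpha>)"
proof -
  have "vcmp K (id2 K f) (id2 K f) = id2 K f"
    using vcmp_id2_right[of "id2 K f"] assms by (simp add: mor_rules)
  then show ?thesis
    using interchange[of \<alpha> \<beta> "id2 K f" "id2 K f"] assms by (simp add: mor_rules)
qed

lemma whisker_right_vcmp: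
  assumes "f \<in> Mor K" "\<alpha> \<in> Two K" "\<beta> \<in> Two K" "tgt2 K \<alpha> = src2 K \<beta>" "src K (src2 K \<alpha>) = tgt K f"
  shows "hcmp K (vcmp K \<beta> \<alpha>) (id2 K f) = vcmp K (hcmp K \<beta> (id2 K f)) (hcmp K \<alpha> (id2 K f))"
proof -
  have "vcmp K (id2 K f) (id2 K f) = id2 K f"
    using vcmp_id2_right[of "id2 K f"] assms by (simp add: mor_rules)
  then show ?thesis
    using interchange[of "id2 K f" "id2 K f" \<alpha> \<beta>] assms by (simp add: mor_rules)
qed

end

text \<open>As for ordinary adjunctions, a couniversal 1-cell \<open>\<epsilon> b : F (R b) \<rightarrow> b\<close> for every \<open>b\<close> determines a right
  adjoint, provided that it is couniversal for 2-cells as well. The right adjoint sends a 1-cell \<open>f\<close>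
  to the unique filler of \<open>f \<circ> \<epsilon>\<close>, and similarly a 2-cell; an equation between parallel 1-cells or
  2-cells into \<open>R b\<close> holds as soon as it holds after applying \<open>F\<close> and composing with \<open>\<epsilon> b\<close>.\<close>

locale couniversal_arrows = two_functor C D F
  for C :: "('o, 'm, 'c) two_cat" and D :: "('p, 'n, 'd) two_cat"
    and F :: "('o, 'm, 'c, 'p, 'n, 'd) two_fun" +
  fixes R :: "'p \<Rightarrow> 'o" and \<epsilon> :: "'p \<Rightarrow> 'n"
  assumes R_Obj: "b \<in> Obj D \<Longrightarrow> R b \<in> Obj C"
    and eps_Mor: "b \<in> Obj D \<Longrightarrow> \<epsilon> b \<in> Mor D"
    and src_eps: "b \<in> Obj D \<Longrightarrow> src D (\<epsilon> b) = map0 F (R b)"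
    and tgt_eps: "b \<in> Obj D \<Longrightarrow> tgt D (\<epsilon> b) = b"
    and mor_exists: "\<lbrakk>a \<in> Obj C; b \<in> Obj D; g \<in> Mor D; src D g = map0 F a; tgt D g = b\<rbrakk>
          \<Longrightarrow> \<exists>h. h \<in> Mor C \<and> src C h = a \<and> tgt C h = R b \<and> cmp D (\<epsilon> b) (map1 F h) = g"
    and mor_unique: "\<lbrakk>b \<in> Obj D; h \<in> Mor C; k \<in> Mor C; src C h = src C k; tgt C h = R b; tgt C k = R b;
            cmp D (\<epsilon> b) (map1 F h) = cmp D (\<epsilon> b) (map1 F k)\<rbrakk> \<Longrightarrow> h = k"
    and two_exists: "\<lbrakk>b \<in> Obj D; h \<in> Mor C; k \<in> Mor C; src C h = src C k; tgt C h = R b; tgt C k = R b;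
            \<gamma> \<in> Two D; src2 D \<gamma> = cmp D (\<epsilon> b) (map1 F h); tgt2 D \<gamma> = cmp D (\<epsilon> b) (map1 F k)\<rbrakk>
          \<Longrightarrow> \<exists>\<alpha>. \<alpha> \<in> Two C \<and> src2 C \<alpha> = h \<and> tgt2 C \<alpha> = k \<and> hcmp D (id2 D (\<epsilon> b)) (map2c F \<alpha>) = \<gamma>"
    and two_unique: "\<lbrakk>b \<in> Obj D; \<alpha> \<in> Two C; \<beta> \<in> Two C; src2 C \<alpha> = src2 C \<beta>; tgt2 C \<alpha> = tgt2 C \<beta>;
            tgt C (src2 C \<alpha>) = R b;
            hcmp D (id2 D (\<epsilon> b)) (map2c F \<alpha>) = hcmp D (id2 D (\<epsilon> b)) (map2c F \<beta>)\<rbrakk> \<Longrightarrow> \<alpha> = \<beta>"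
begin

definition adjunct :: "'o \<Rightarrow> 'n \<Rightarrow> 'm" where
  "adjunct a g = (SOME h. h \<in> Mor C \<and> src C h = a \<and> tgt C h = R (tgt D g) \<and>
     cmp D (\<epsilon> (tgt D g)) (map1 F h) = g)"

definition adjunct2 :: "'m \<Rightarrow> 'm \<Rightarrow> 'd \<Rightarrow> 'c" where
  "adjunct2 h k \<gamma> = (SOME \<alpha>. \<alpha> \<in> Two C \<and> src2 C \<alpha> = h \<and> tgt2 C \<alpha> = k \<and>
     hcmp D (id2 D (\<epsilon> (tgt D (src2 D \<gamma>)))) (map2c F \<alpha>) = \<gamma>)"

definition R1 :: "'n \<Rightarrow> 'm" where
  "R1 f = adjunct (R (src D f)) (cmp D f (\<epsilon> (src D f)))"

definition R2 :: "'d \<Rightarrow> 'c" where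
  "R2 \<gamma> = adjunct2 (R1 (src2 D \<gamma>)) (R1 (tgt2 D \<gamma>)) (hcmp D \<gamma> (id2 D (\<epsilon> (src D (src2 D \<gamma>)))))"

definition G :: "('p, 'n, 'd, 'o, 'm, 'c) two_fun" where
  "G = \<lparr>map0 = R, map1 = R1, map2c = R2\<rparr>"

definition \<eta> :: "'o \<Rightarrow> 'm" where
  "\<eta> a = adjunct a (idm D (map0 F a))"

lemma adjunct:
  assumes "a \<in> Obj C" "g \<in> Mor D" "src D g = map0 F a"
  shows "adjunct a g \<in> Mor C" "src C (adjunct a g) = a" "tgt C (adjunct a g) = R (tgt D g)"
    "cmp D (\<epsilon> (tgt D g)) (map1 F (adjunct a g)) = g"
  using someI_ex[OF mor_exists[OF assms(1) D.tgt_Obj[OF assms(2)] assms(2,3) refl]]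
  unfolding adjunct_def by auto

lemmas eps_rules = R_Obj eps_Mor src_eps tgt_eps map0_Obj map1_Mor map2_Two map1_src map1_tgt
  map2_src2 map2_tgt2

lemma R1:
  assumes "f \<in> Mor D"
  shows "R1 f \<in> Mor C" "src C (R1 f) = R (src D f)" "tgt C (R1 f) = R (tgt D f)"
    "cmp D (\<epsilon> (tgt D f)) (map1 F (R1 f)) = cmp D f (\<epsilon> (src D f))"
  using adjunct[of "R (src D f)" "cmp D f (\<epsilon> (src D f))"] assms
  unfolding R1_def by (simp_all add: eps_rules D.mor_rules)

lemma eta:
  assumes "a \<in> Obj C"
  shows "\<eta> a \<in> Mor C" "src C (\<eta> a) = a" "tgt C (\<eta> a) = R (map0 F a)"
    "cmp D (\<epsilon> (map0 F a)) (map1 F (\<eta> a)) = idm D (map0 F a)"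
  using adjunct[of a "idm D (map0 F a)"] assms
  unfolding \<eta>_def by (simp_all add: eps_rules D.mor_rules)

lemma R2:
  assumes "\<gamma> \<in> Two D"
  shows "R2 \<gamma> \<in> Two C" "src2 C (R2 \<gamma>) = R1 (src2 D \<gamma>)" "tgt2 C (R2 \<gamma>) = R1 (tgt2 D \<gamma>)"
    "hcmp D (id2 D (\<epsilon> (tgt D (src2 D \<gamma>)))) (map2c F (R2 \<gamma>)) = hcmp D \<gamma> (id2 D (\<epsilon> (src D (src2 D \<gamma>))))"
proof -
  let ?b = "tgt D (src2 D \<gamma>)"
  let ?g = "hcmp D \<gamma> (id2 D (\<epsilon> (src D (src2 D \<gamma>))))"
  have *: "src2 D \<gamma> \<in> Mor D" "tgt2 D \<gamma> \<in> Mor D" "src D (tgt2 D \<gamma>) = src D (src2 D \<gamma>)"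
    "tgt D (tgt2 D \<gamma>) = ?b"
    using assms by (simp_all add: D.mor_rules D.src_tgt2 D.tgt_tgt2)
  have b: "?b \<in> Obj D" using * D.tgt_Obj by blast
  have g: "?g \<in> Two D" "tgt D (src2 D ?g) = ?b"
    using assms * by (simp_all add: eps_rules D.mor_rules)
  have "\<exists>\<alpha>. \<alpha> \<in> Two C \<and> src2 C \<alpha> = R1 (src2 D \<gamma>) \<and> tgt2 C \<alpha> = R1 (tgt2 D \<gamma>) \<and>
     hcmp D (id2 D (\<epsilon> ?b)) (map2c F \<alpha>) = ?g"
    by (rule two_exists)
      (use assms * b g R1[of "src2 D \<gamma>"] R1[of "tgt2 D \<gamma>"] in \<open>simp_all add: eps_rules D.mor_rules\<close>)
  from someI_ex[OF this]
  show "R2 \<gamma> \<in> Two C" "src2 C (R2 \<gamma>) = R1 (src2 D \<gamma>)" "tgt2 C (R2 \<gamma>) = R1 (tgt2 D \<gamma>)"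
    "hcmp D (id2 D (\<epsilon> ?b)) (map2c F (R2 \<gamma>)) = ?g"
    unfolding R2_def adjunct2_def g(2) by auto
qed

lemma eps_cmp:
  assumes "b \<in> Obj D" "h \<in> Mor C" "k \<in> Mor C" "tgt C h = src C k" "tgt C k = R b"
  shows "cmp D (\<epsilon> b) (map1 F (cmp C k h)) = cmp D (cmp D (\<epsilon> b) (map1 F k)) (map1 F h)"
  using assms by (simp add: map1_cmp D.cmp_assoc eps_rules)

lemma eps_hcmp:
  assumes "b \<in> Obj D" "\<alpha> \<in> Two C" "\<beta> \<in> Two C" "tgt C (src2 C \<alpha>) = src C (src2 C \<beta>)"
    "tgt C (src2 C \<beta>) = R b"
  shows "hcmp D (id2 D (\<epsilon> b)) (map2c F (hcmp C \<beta> \<alpha>))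
    = hcmp D (hcmp D (id2 D (\<epsilon> b)) (map2c F \<beta>)) (map2c F \<alpha>)"
  using assms by (simp add: map2_hcmp D.hcmp_assoc eps_rules C.mor_rules D.mor_rules)

lemma R1_cmp:
  assumes f: "f \<in> Mor D" and g: "g \<in> Mor D" and fg: "tgt D f = src D g"
  shows "R1 (cmp D g f) = cmp C (R1 g) (R1 f)"
  proof -
    have b: "tgt D g \<in> Obj D" using g by (simp add: D.mor_rules)
    have "cmp D (\<epsilon> (tgt D g)) (map1 F (cmp C (R1 g) (R1 f))) = cmp D g (cmp D f (\<epsilon> (src D f)))"
      using f g fg R1(4)[OF f] R1(4)[OF g]
      by (simp add: eps_cmp b R1 D.cmp_assoc D.mor_rules eps_rules)
    moreover have "cmp D (\<epsilon> (tgt D g)) (map1 F (R1 (cmp D g f))) = cmp D g (cmp D f (\<epsilon> (src D f)))"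
      using f g fg R1(4)[of "cmp D g f"] by (simp add: D.cmp_assoc D.mor_rules eps_rules)
    ultimately show ?thesis
      by (intro mor_unique[OF b]) (use f g fg in \<open>simp_all add: R1 C.mor_rules D.mor_rules\<close>)
  qed

lemma two_functor_G: "two_functor D C G"
proof
  fix a f g \<alpha> \<beta>
  show "map0 G a \<in> Obj C" if "a \<in> Obj D" using that by (simp add: G_def R_Obj)
  show "map1 G f \<in> Mor C" if "f \<in> Mor D" using that by (simp add: G_def R1)
  show "map2c G \<alpha> \<in> Two C" if "\<alpha> \<in> Two D" using that by (simp add: G_def R2)
  show "src C (map1 G f) = map0 G (src D f)" if "f \<in> Mor D" using that by (simp add: G_def R1)
  show "tgt C (map1 G f) = map0 G (tgt D f)" if "f \<in> Mor D" using that by (simp add: G_def R1)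
  show "src2 C (map2c G \<alpha>) = map1 G (src2 D \<alpha>)" if "\<alpha> \<in> Two D" using that by (simp add: G_def R2)
  show "tgt2 C (map2c G \<alpha>) = map1 G (tgt2 D \<alpha>)" if "\<alpha> \<in> Two D" using that by (simp add: G_def R2)
  show "map1 G (idm D a) = idm C (map0 G a)" if a: "a \<in> Obj D"
    unfolding G_def two_fun.simps
    by (rule mor_unique[OF a])
      (use a R1(4)[of "idm D a"] in \<open>simp_all add: R1 eps_rules C.mor_rules D.mor_rules
        map1_idm D.cmp_idm_right' D.cmp_idm_left'\<close>)
  show "map1 G (cmp D g f) = cmp C (map1 G g) (map1 G f)"
    if "f \<in> Mor D" and "g \<in> Mor D" and "tgt D f = src D g"
    using that by (simp add: G_def R1_cmp)
  show "map2c G (id2 D f) = id2 C (map1 G f)" if f: "f \<in> Mor D"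
  proof -
    have b: "tgt D f \<in> Obj D" using f by (simp add: D.mor_rules)
    show ?thesis
      unfolding G_def two_fun.simps
      by (rule two_unique[OF b])
        (use f R2(4)[of "id2 D f"] in \<open>simp_all add: R1 R2 C.mor_rules D.mor_rules map2_id2 D.hcmp_id2
          eps_rules\<close>)
  qed
  show "map2c G (vcmp D \<beta> \<alpha>) = vcmp C (map2c G \<beta>) (map2c G \<alpha>)"
    if f: "\<alpha> \<in> Two D" and g: "\<beta> \<in> Two D" and fg: "tgt2 D \<alpha> = src2 D \<beta>"
  proof -
    let ?b = "tgt D (src2 D \<alpha>)"
    have b: "?b \<in> Obj D" using f by (simp add: D.mor_rules)
    have [simp]: "src D (src2 D \<beta>) = src D (src2 D \<alpha>)" "tgt D (src2 D \<beta>) = tgt D (src2 D \<alpha>)"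
      using f g fg by (metis D.src_parallel, metis D.tgt_parallel)
    have "hcmp D (id2 D (\<epsilon> ?b)) (map2c F (vcmp C (R2 \<beta>) (R2 \<alpha>)))
        = hcmp D (vcmp D \<beta> \<alpha>) (id2 D (\<epsilon> (src D (src2 D \<alpha>))))"
      using f g fg R2(4)[OF f] R2(4)[OF g]
      by (simp add: map2_vcmp D.whisker_left_vcmp D.whisker_right_vcmp b R1 R2 C.mor_rules D.mor_rules eps_rules)
    moreover have "hcmp D (id2 D (\<epsilon> ?b)) (map2c F (R2 (vcmp D \<beta> \<alpha>)))
        = hcmp D (vcmp D \<beta> \<alpha>) (id2 D (\<epsilon> (src D (src2 D \<alpha>))))"
      using f g fg R2(4)[of "vcmp D \<beta> \<alpha>"] by (simp add: D.mor_rules)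
    ultimately show ?thesis
      unfolding G_def two_fun.simps
      by (intro two_unique[OF b]) (use f g fg in \<open>simp_all add: R1 R2 C.mor_rules D.mor_rules\<close>)
  qed
  show "map2c G (hcmp D \<beta> \<alpha>) = hcmp C (map2c G \<beta>) (map2c G \<alpha>)"
    if f: "\<alpha> \<in> Two D" and g: "\<beta> \<in> Two D" and fg: "tgt D (src2 D \<alpha>) = src D (src2 D \<beta>)"
  proof -
    let ?b = "tgt D (src2 D \<beta>)"
    have b: "?b \<in> Obj D" using g by (simp add: D.mor_rules)
    have t: "src2 D \<alpha> \<in> Mor D" "src2 D \<beta> \<in> Mor D" "tgt2 D \<alpha> \<in> Mor D" "tgt2 D \<beta> \<in> Mor D"
       "tgt D (tgt2 D \<alpha>) = src D (tgt2 D \<beta>)"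
      using f g fg by (simp_all add: D.mor_rules D.src_tgt2 D.tgt_tgt2)
    have "hcmp D (id2 D (\<epsilon> ?b)) (map2c F (hcmp C (R2 \<beta>) (R2 \<alpha>)))
        = hcmp D \<beta> (hcmp D \<alpha> (id2 D (\<epsilon> (src D (src2 D \<alpha>)))))"
      using f g fg R2(4)[OF f] R2(4)[OF g]
      by (simp add: eps_hcmp D.hcmp_assoc b R1 R2 C.mor_rules D.mor_rules eps_rules)
    moreover have "hcmp D (id2 D (\<epsilon> ?b)) (map2c F (R2 (hcmp D \<beta> \<alpha>)))
        = hcmp D \<beta> (hcmp D \<alpha> (id2 D (\<epsilon> (src D (src2 D \<alpha>)))))"
      using f g fg R2(4)[of "hcmp D \<beta> \<alpha>"] by (simp add: D.mor_rules D.hcmp_assoc eps_rules)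
    moreover have "R1 (cmp D (src2 D \<beta>) (src2 D \<alpha>)) = cmp C (R1 (src2 D \<beta>)) (R1 (src2 D \<alpha>))"
      "R1 (cmp D (tgt2 D \<beta>) (tgt2 D \<alpha>)) = cmp C (R1 (tgt2 D \<beta>)) (R1 (tgt2 D \<alpha>))"
      using R1_cmp fg t by blast+
    ultimately show ?thesis
      unfolding G_def two_fun.simps
      by (intro two_unique[OF b]) (use f g fg t in \<open>simp_all add: R1 R2 C.mor_rules D.mor_rules\<close>)
  qed
qed

lemma eta_natural:
  assumes f: "f \<in> Mor C"
  shows "cmp C (R1 (map1 F f)) (\<eta> (src C f)) = cmp C (\<eta> (tgt C f)) f"
    proof -
      have o: "src C f \<in> Obj C" "tgt C f \<in> Obj C" using f by (simp_all add: C.mor_rules)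
      have b: "map0 F (tgt C f) \<in> Obj D" using o by (simp add: eps_rules)
      have "cmp D (\<epsilon> (map0 F (tgt C f))) (map1 F (cmp C (R1 (map1 F f)) (\<eta> (src C f)))) = map1 F f"
        using f o b R1(4)[of "map1 F f"] eta(4)[OF o(1)]
        by (simp add: eps_cmp R1 eta eps_rules D.cmp_assoc D.cmp_idm_right')
      moreover have "cmp D (\<epsilon> (map0 F (tgt C f))) (map1 F (cmp C (\<eta> (tgt C f)) f)) = map1 F f"
        using f o b eta(4)[OF o(2)]
        by (simp add: eps_cmp eta eps_rules D.cmp_idm_left')
      ultimately show ?thesis
        by (intro mor_unique[OF b]) (use f o b in \<open>simp_all add: R1 eta C.mor_rules eps_rules\<close>)
    qed

lemma two_adjunction_G: "two_adjunction C D F G \<eta> \<epsilon>"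
proof -
  interpret G: two_functor D C G by (rule two_functor_G)
  have idC: "two_functor C C id_two_fun" and idD: "two_functor D D id_two_fun"
    by (unfold_locales; simp add: id_two_fun_def)+
  have GF: "two_functor C C (comp_two_fun G F)"
    by unfold_locales (simp_all add: comp_two_fun_def G.map0_Obj G.map1_Mor G.map2_Two G.map1_src
        G.map1_tgt G.map2_src2 G.map2_tgt2 G.map1_idm G.map1_cmp G.map2_id2 G.map2_vcmp G.map2_hcmp
        eps_rules map1_idm map1_cmp map2_id2 map2_vcmp map2_hcmp C.mor_rules D.mor_rules)
  have FG: "two_functor D D (comp_two_fun F G)"
    by unfold_locales (simp_all add: comp_two_fun_def G.map0_Obj G.map1_Mor G.map2_Two G.map1_src
        G.map1_tgt G.map2_src2 G.map2_tgt2 G.map1_idm G.map1_cmp G.map2_id2 G.map2_vcmp G.map2_hcmp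
        eps_rules map1_idm map1_cmp map2_id2 map2_vcmp map2_hcmp C.mor_rules D.mor_rules)
  have unit: "two_natural C C id_two_fun (comp_two_fun G F) \<eta>"
  proof (intro two_natural.intro idC GF two_natural_axioms.intro)
    fix a f \<alpha>
    show "\<eta> a \<in> Mor C" "src C (\<eta> a) = map0 id_two_fun a" "tgt C (\<eta> a) = map0 (comp_two_fun G F) a"
      if "a \<in> Obj C" using that by (simp_all add: eta id_two_fun_def comp_two_fun_def G_def)
    show "cmp C (map1 (comp_two_fun G F) f) (\<eta> (src C f)) = cmp C (\<eta> (tgt C f)) (map1 id_two_fun f)"
      if "f \<in> Mor C"
      using eta_natural[OF that] by (simp add: G_def comp_two_fun_def id_two_fun_def)
    show "hcmp C (map2c (comp_two_fun G F) \<alpha>) (id2 C (\<eta> (src C (src2 C \<alpha>))))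
        = hcmp C (id2 C (\<eta> (tgt C (src2 C \<alpha>)))) (map2c id_two_fun \<alpha>)" if f: "\<alpha> \<in> Two C"
    proof -
      let ?f = "src2 C \<alpha>" and ?g = "tgt2 C \<alpha>"
      have o: "?f \<in> Mor C" "?g \<in> Mor C" "src C ?f \<in> Obj C" "tgt C ?f \<in> Obj C"
        "src C ?g = src C ?f" "tgt C ?g = tgt C ?f"
        using f by (simp_all add: C.mor_rules C.src_tgt2 C.tgt_tgt2)
      have b: "map0 F (tgt C ?f) \<in> Obj D" using o by (simp add: eps_rules)
      have "hcmp D (id2 D (\<epsilon> (map0 F (tgt C ?f))))
          (map2c F (hcmp C (R2 (map2c F \<alpha>)) (id2 C (\<eta> (src C ?f))))) = map2c F \<alpha>"
        using f o b R2(4)[of "map2c F \<alpha>"] eta(4)[of "src C ?f"]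
        by (simp add: eps_hcmp R1 R2 eta eps_rules D.hcmp_assoc D.mor_rules C.mor_rules map2_id2
            D.hcmp_id2 D.hcmp_unit_right')
      moreover have "hcmp D (id2 D (\<epsilon> (map0 F (tgt C ?f))))
          (map2c F (hcmp C (id2 C (\<eta> (tgt C ?f))) \<alpha>)) = map2c F \<alpha>"
        using f o b eta(4)[of "tgt C ?f"]
        by (simp add: eps_hcmp R1 R2 eta eps_rules D.mor_rules C.mor_rules map2_id2
            D.hcmp_id2 D.hcmp_unit_left')
      moreover
      have "cmp C (R1 (map1 F ?f)) (\<eta> (src C ?f)) = cmp C (\<eta> (tgt C ?f)) ?f"
        "cmp C (R1 (map1 F ?g)) (\<eta> (src C ?f)) = cmp C (\<eta> (tgt C ?f)) ?g"
        using eta_natural[OF o(1)] eta_natural[OF o(2)] by (simp_all add: o)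
      ultimately show ?thesis
        unfolding G_def comp_two_fun_def id_two_fun_def two_fun.simps o_apply
        by (intro two_unique[OF b]) (use f o b in \<open>simp_all add: R1 R2 eta C.mor_rules eps_rules\<close>)
    qed
  qed
  have counit: "two_natural D D (comp_two_fun F G) id_two_fun \<epsilon>"
    by (intro two_natural.intro idD FG two_natural_axioms.intro)
      (simp_all add: id_two_fun_def comp_two_fun_def G_def eps_rules R1 R2)
  show ?thesis
  proof (intro two_adjunction.intro unit counit two_adjunction_axioms.intro two_functor_axioms two_functor_G)
    fix a b
    show "cmp D (\<epsilon> (map0 F a)) (map1 F (\<eta> a)) = idm D (map0 F a)" if "a \<in> Obj C"
      using that by (rule eta(4))
    show "cmp C (map1 G (\<epsilon> b)) (\<eta> (map0 G b)) = idm C (map0 G b)" if b: "b \<in> Obj D"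
      unfolding G_def two_fun.simps
      by (rule mor_unique[OF b])
        (use b R1(4)[of "\<epsilon> b"] eta(4)[of "R b"] in \<open>simp_all add: eps_cmp eps_rules R1 eta C.mor_rules
          D.cmp_assoc map1_idm\<close>)
  qed
qed

end


section \<open>Slices and pullback 2-functors\<close>

context two_category
begin

lemma two_category_slice: "two_category (slice K Y)"
proof
  let ?S = "slice K Y"
  fix \<alpha> \<beta> \<alpha>' \<beta>' \<gamma>
  show "src ?S (src2 ?S \<alpha>) = src ?S (tgt2 ?S \<alpha>)" for \<alpha>
    by (cases \<alpha>) (simp add: slice_def)
  show "tgt ?S (src2 ?S \<alpha>) = tgt ?S (tgt2 ?S \<alpha>)" for \<alpha>
    by (cases \<alpha>) (simp add: slice_def)
  show "src2 ?S \<alpha> \<in> Mor ?S" "tgt2 ?S \<alpha> \<in> Mor ?S"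
    if "\<alpha> \<in> Two ?S" for \<alpha>
  proof -
    from that obtain p a q where \<alpha>: "\<alpha> = (p, a, q)" and h: "p \<in> Mor K" "q \<in> Mor K" "tgt K p = Y"
      "tgt K q = Y" "a \<in> Two K" "src K (src2 K a) = src K p" "tgt K (src2 K a) = src K q"
      "hcmp K (id2 K q) a = id2 K p" by (auto simp: slice_def)
    have "cmp K q (src2 K a) = p" "cmp K q (tgt2 K a) = p"
      using src2_hcmp[of a "id2 K q"] tgt2_hcmp[of a "id2 K q"] h by (simp_all add: mor_rules)
    then show "src2 ?S \<alpha> \<in> Mor ?S" "tgt2 ?S \<alpha> \<in> Mor ?S"
      using h by (auto simp: \<alpha> slice_def mor_rules src_tgt2 tgt_tgt2)
  qed
  show "hcmp ?S (vcmp ?S \<beta>' \<beta>) (vcmp ?S \<alpha>' \<alpha>)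
      = vcmp ?S (hcmp ?S \<beta>' \<alpha>') (hcmp ?S \<beta> \<alpha>)"
    if "\<alpha> \<in> Two ?S" "\<alpha>' \<in> Two ?S" "\<beta> \<in> Two ?S" "\<beta>' \<in> Two ?S"
      "tgt2 ?S \<alpha> = src2 ?S \<alpha>'" "tgt2 ?S \<beta> = src2 ?S \<beta>'"
      "tgt ?S (src2 ?S \<alpha>) = src ?S (src2 ?S \<beta>)"
    using that by (auto simp: slice_def interchange)
  show "vcmp ?S \<beta> \<alpha> \<in> Two ?S"
    if "\<alpha> \<in> Two ?S" "\<beta> \<in> Two ?S" "tgt2 ?S \<alpha> = src2 ?S \<beta>"
    using that vcmp_id2_right[of "id2 K (fst \<alpha>)"]
    by (auto simp: slice_def mor_rules whisker_left_vcmp)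
  show "hcmp ?S \<beta> \<alpha> \<in> Two ?S"
    if "\<alpha> \<in> Two ?S" "\<beta> \<in> Two ?S"
      "tgt ?S (src2 ?S \<alpha>) = src ?S (src2 ?S \<beta>)"
    using that by (auto simp: slice_def mor_rules hcmp_assoc[symmetric])
  show "cmp ?S g f \<in> Mor ?S"
    if "f \<in> Mor ?S" "g \<in> Mor ?S" "tgt ?S f = src ?S g" for f g
  proof -
    from that obtain p u q v r where "f = (p, u, q)" "g = (q, v, r)"
      and h: "p \<in> Mor K" "q \<in> Mor K" "r \<in> Mor K" "tgt K p = Y" "tgt K q = Y" "tgt K r = Y"
      "u \<in> Mor K" "v \<in> Mor K" "src K u = src K p" "tgt K u = src K q" "cmp K q u = p"
      "src K v = src K q" "tgt K v = src K r" "cmp K r v = q"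
      by (cases f; cases g) (simp add: slice_def)
    moreover have "cmp K r (cmp K v u) = p"
      using h cmp_assoc[of u v r] by simp
    ultimately show ?thesis by (simp add: slice_def mor_rules)
  qed
qed (simp_all add: slice_def split_beta prod_eq_iff mor_rules cmp_idm_right cmp_idm_left cmp_assoc vcmp_id2_right vcmp_id2_left
    vcmp_assoc hcmp_unit_right' hcmp_unit_left' hcmp_assoc hcmp_id2 cmp_idm_right' cmp_idm_left')

end


text \<open>The projection \<open>pb e\<close> to the source of \<open>p\<close> will be the value of the pullback 2-functor at \<open>e\<close>.\<close>

locale chosen_pullbacks = two_category K for K :: "('o, 'm, 'c) two_cat" +
  fixes p :: 'm and pa pb :: "'m \<Rightarrow> 'm"
  assumes p_Mor: "p \<in> Mor K"
    and pullback: "\<lbrakk>e \<in> Mor K; tgt K e = tgt K p\<rbrakk> \<Longrightarrow> two_pullback K e p (pa e) (pb e)"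
begin

lemma pullback_square:
  assumes "e \<in> Mor K" "tgt K e = tgt K p"
  shows "pa e \<in> Mor K" "pb e \<in> Mor K" "src K (pa e) = src K (pb e)" "tgt K (pa e) = src K e"
    "tgt K (pb e) = src K p" "cmp K e (pa e) = cmp K p (pb e)"
  using pullback[OF assms] by (simp_all add: two_pullback_def)

lemma pullback_mor_exists:
  assumes "e \<in> Mor K" "tgt K e = tgt K p" "f \<in> Mor K" "g \<in> Mor K" "src K f = src K g"
    "tgt K f = src K e" "tgt K g = src K p" "cmp K e f = cmp K p g"
  shows "\<exists>h. h \<in> Mor K \<and> src K h = src K f \<and> tgt K h = src K (pb e) \<and> cmp K (pa e) h = f \<and> cmp K (pb e) h = g"
proof -
  have "\<exists>!h. h \<in> Mor K \<and> src K h = src K f \<and> tgt K h = src K (pa e) \<and> cmp K (pa e) h = f \<and> cmp K (pb e) h = g"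
    using pullback[OF assms(1,2)] assms(3-) unfolding two_pullback_def by blast
  then show ?thesis unfolding pullback_square(3)[OF assms(1,2)] by (rule ex1_implies_ex)
qed

text \<open>Both 1-cells are mediating for the cone formed by the composites of \<open>h\<close> with the projections.\<close>

lemma pullback_mor_eqI:
  assumes "e \<in> Mor K" "tgt K e = tgt K p" "h \<in> Mor K" "k \<in> Mor K" "src K h = src K k"
    "tgt K h = src K (pb e)" "tgt K k = src K (pb e)"
    "cmp K (pa e) h = cmp K (pa e) k" "cmp K (pb e) h = cmp K (pb e) k"
  shows "h = k"
proof -
  note sq = pullback_square[OF assms(1,2)]
  let ?f = "cmp K (pa e) h" and ?g = "cmp K (pb e) h"
  have "\<exists>!h. h \<in> Mor K \<and> src K h = src K ?f \<and> tgt K h = src K (pa e) \<and> cmp K (pa e) h = ?f \<and> cmp K (pb e) h = ?g"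
  proof -
    have "?f \<in> Mor K" "?g \<in> Mor K" "src K ?f = src K ?g" "tgt K ?f = src K e" "tgt K ?g = src K p"
      using assms sq by (simp_all add: mor_rules)
    moreover have "cmp K e ?f = cmp K p ?g"
      using assms sq p_Mor by (simp add: cmp_assoc[symmetric])
    ultimately show ?thesis
      using pullback[OF assms(1,2)] unfolding two_pullback_def by blast
  qed
  moreover have "src K h = src K ?f" "src K k = src K ?f" using assms sq by (simp_all add: mor_rules)
  ultimately show ?thesis using assms sq by metis
qed

lemma pullback_two_exists:
  assumes "e \<in> Mor K" "tgt K e = tgt K p" "h \<in> Mor K" "k \<in> Mor K" "\<alpha> \<in> Two K" "\<beta> \<in> Two K"
    "src K h = src K k" "tgt K h = src K (pb e)" "tgt K k = src K (pb e)"
    "src2 K \<alpha> = cmp K (pa e) h" "tgt2 K \<alpha> = cmp K (pa e) k"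
    "src2 K \<beta> = cmp K (pb e) h" "tgt2 K \<beta> = cmp K (pb e) k"
    "hcmp K (id2 K e) \<alpha> = hcmp K (id2 K p) \<beta>"
  shows "\<exists>\<gamma>. \<gamma> \<in> Two K \<and> src2 K \<gamma> = h \<and> tgt2 K \<gamma> = k \<and>
        hcmp K (id2 K (pa e)) \<gamma> = \<alpha> \<and> hcmp K (id2 K (pb e)) \<gamma> = \<beta>"
proof -
  note sq = pullback_square[OF assms(1,2)]
  have "\<exists>!\<gamma>. \<gamma> \<in> Two K \<and> src2 K \<gamma> = h \<and> tgt2 K \<gamma> = k \<and>
        hcmp K (id2 K (pa e)) \<gamma> = \<alpha> \<and> hcmp K (id2 K (pb e)) \<gamma> = \<beta>"
    using pullback[OF assms(1,2)] assms(3-) unfolding two_pullback_def sq(3)[symmetric] by blast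
  then show ?thesis by (rule ex1_implies_ex)
qed

lemma pullback_two_eqI:
  assumes e: "e \<in> Mor K" "tgt K e = tgt K p" and "\<gamma> \<in> Two K" "\<delta> \<in> Two K"
    "src2 K \<gamma> = src2 K \<delta>" "tgt2 K \<gamma> = tgt2 K \<delta>" "tgt K (src2 K \<gamma>) = src K (pb e)"
    "hcmp K (id2 K (pa e)) \<gamma> = hcmp K (id2 K (pa e)) \<delta>"
    "hcmp K (id2 K (pb e)) \<gamma> = hcmp K (id2 K (pb e)) \<delta>"
  shows "\<gamma> = \<delta>"
proof -
  note sq = pullback_square[OF e]
  let ?\<alpha> = "hcmp K (id2 K (pa e)) \<gamma>" and ?\<beta> = "hcmp K (id2 K (pb e)) \<gamma>"
  let ?h = "src2 K \<gamma>" and ?k = "tgt2 K \<gamma>"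
  have hk: "?h \<in> Mor K" "?k \<in> Mor K" "src K ?h = src K ?k" "tgt K ?h = src K (pa e)" "tgt K ?k = src K (pa e)"
    using assms(3-) sq by (simp_all add: mor_rules src_tgt2 tgt_tgt2)
  have "?\<alpha> \<in> Two K" "?\<beta> \<in> Two K" "src2 K ?\<alpha> = cmp K (pa e) ?h" "tgt2 K ?\<alpha> = cmp K (pa e) ?k"
    "src2 K ?\<beta> = cmp K (pb e) ?h" "tgt2 K ?\<beta> = cmp K (pb e) ?k"
    using assms(3-7) sq by (simp_all add: mor_rules)
  moreover have "hcmp K (id2 K e) ?\<alpha> = hcmp K (id2 K p) ?\<beta>"
    using e assms(3-7) sq p_Mor by (simp add: hcmp_assoc[symmetric] mor_rules hcmp_id2)
  ultimately have "\<exists>!\<gamma>. \<gamma> \<in> Two K \<and> src2 K \<gamma> = ?h \<and> tgt2 K \<gamma> = ?k \<and>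
        hcmp K (id2 K (pa e)) \<gamma> = ?\<alpha> \<and> hcmp K (id2 K (pb e)) \<gamma> = ?\<beta>"
    using pullback[OF e] hk unfolding two_pullback_def by blast
  then show ?thesis using assms(3-) by metis
qed

text \<open>The 1-cell \<open>h'\<close> is the base change of \<open>h : e \<rightarrow> r\<close> along \<open>p\<close>.\<close>

definition base_change1 :: "'m \<Rightarrow> 'm \<Rightarrow> 'm \<Rightarrow> 'm \<Rightarrow> bool" where
  "base_change1 e h r h' \<longleftrightarrow> h' \<in> Mor K \<and> src K h' = src K (pb e) \<and> tgt K h' = src K (pb r) \<and>
    cmp K (pa r) h' = cmp K h (pa e) \<and> cmp K (pb r) h' = pb e"

text \<open>The corresponding relation for a 2-cell \<open>\<alpha>\<close> of the slice; on the \<open>p\<close> side it lies over an identity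
  because base change leaves the component in the source of \<open>p\<close> fixed.\<close>

definition base_change2 :: "'m \<Rightarrow> 'c \<Rightarrow> 'm \<Rightarrow> 'c \<Rightarrow> bool" where
  "base_change2 e \<alpha> r \<alpha>' \<longleftrightarrow> \<alpha>' \<in> Two K \<and>
    base_change1 e (src2 K \<alpha>) r (src2 K \<alpha>') \<and> base_change1 e (tgt2 K \<alpha>) r (tgt2 K \<alpha>') \<and>
    hcmp K (id2 K (pa r)) \<alpha>' = hcmp K \<alpha> (id2 K (pa e)) \<and> hcmp K (id2 K (pb r)) \<alpha>' = id2 K (pb e)"

definition pullback_fun ::
  "('m, 'm \<times> 'm \<times> 'm, 'm \<times> 'c \<times> 'm, 'm, 'm \<times> 'm \<times> 'm, 'm \<times> 'c \<times> 'm) two_fun" where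
  "pullback_fun =
    \<lparr>map0 = pb,
     map1 = (\<lambda>(e, h, r). (pb e, THE h'. base_change1 e h r h', pb r)),
     map2c = (\<lambda>(e, \<alpha>, r). (pb e, THE \<alpha>'. base_change2 e \<alpha> r \<alpha>', pb r))\<rparr>"

abbreviation "SY \<equiv> slice K (tgt K p)"
abbreviation "SX \<equiv> slice K (src K p)"

lemma slice_MorD:
  assumes "(e, h, r) \<in> Mor (slice K Y)"
  shows "e \<in> Mor K" "r \<in> Mor K" "tgt K e = Y" "tgt K r = Y" "h \<in> Mor K"
    "src K h = src K e" "tgt K h = src K r" "cmp K r h = e"
  using assms by (simp_all add: slice_def)

lemma slice_TwoD:
  assumes "(e, \<alpha>, r) \<in> Two (slice K Y)"
  shows "e \<in> Mor K" "r \<in> Mor K" "tgt K e = Y" "tgt K r = Y" "\<alpha> \<in> Two K"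
    "src K (src2 K \<alpha>) = src K e" "tgt K (src2 K \<alpha>) = src K r" "hcmp K (id2 K r) \<alpha> = id2 K e"
    "(e, src2 K \<alpha>, r) \<in> Mor (slice K Y)" "(e, tgt2 K \<alpha>, r) \<in> Mor (slice K Y)"
  using assms two_category.src2_Mor[OF two_category_slice assms]
    two_category.tgt2_Mor[OF two_category_slice assms] by (simp_all add: slice_def)

lemma base_change1_unique:
  assumes "r \<in> Mor K" "tgt K r = tgt K p" "base_change1 e h r h'" "base_change1 e h r h''"
  shows "h' = h''"
  by (rule pullback_mor_eqI[OF assms(1,2)])
    (use assms in \<open>auto simp: base_change1_def\<close>)

lemma base_change1_exists:
  assumes "(e, h, r) \<in> Mor SY"
  shows "\<exists>h'. base_change1 e h r h'"
proof -
  note * = slice_MorD[OF assms]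
  note sq = pullback_square[OF *(1,3)]
  have "cmp K r (cmp K h (pa e)) = cmp K p (pb e)"
    using * sq by (simp add: cmp_assoc[symmetric])
  from pullback_mor_exists[OF *(2,4) _ sq(2) _ _ _ this]
  show ?thesis using * sq by (auto simp: base_change1_def mor_rules)
qed

lemma base_change1_the:
  assumes "(e, h, r) \<in> Mor SY"
  shows "base_change1 e h r (THE h'. base_change1 e h r h')"
  using base_change1_exists[OF assms] base_change1_unique[OF slice_MorD(2,4)[OF assms]]
  by (metis theI)

lemma base_change2_unique:
  assumes "r \<in> Mor K" "tgt K r = tgt K p" "base_change2 e \<alpha> r \<alpha>'" "base_change2 e \<alpha> r \<alpha>''"
  shows "\<alpha>' = \<alpha>''"
proof -
  have eq: "src2 K \<alpha>' = src2 K \<alpha>''" "tgt2 K \<alpha>' = tgt2 K \<alpha>''"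
    using assms base_change1_unique[OF assms(1,2)] by (auto simp: base_change2_def)
  show ?thesis
    by (rule pullback_two_eqI[OF assms(1,2)])
      (use assms eq in \<open>auto simp: base_change2_def base_change1_def\<close>)
qed

text \<open>Since \<open>\<alpha>\<close> lies over the identity 2-cell of \<open>e\<close>, its whiskering with \<open>pa e\<close> and the identity 2-cell of
  \<open>pb e\<close> agree after passing to the target of \<open>p\<close>, which is the condition for a mediating 2-cell.\<close>

lemma base_change2_exists:
  assumes "(e, \<alpha>, r) \<in> Two SY"
  shows "\<exists>\<alpha>'. base_change2 e \<alpha> r \<alpha>'"
proof -
  note * = slice_TwoD[OF assms]
  note sq = pullback_square[OF *(1,3)]
  obtain h k where h: "base_change1 e (src2 K \<alpha>) r h" and k: "base_change1 e (tgt2 K \<alpha>) r k"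
    using base_change1_exists *(9,10) by blast
  have "hcmp K (id2 K r) (hcmp K \<alpha> (id2 K (pa e))) = hcmp K (id2 K p) (id2 K (pb e))"
    using * sq p_Mor by (simp add: hcmp_assoc[symmetric] mor_rules hcmp_id2)
  then have "\<exists>\<gamma>. \<gamma> \<in> Two K \<and> src2 K \<gamma> = h \<and> tgt2 K \<gamma> = k \<and>
        hcmp K (id2 K (pa r)) \<gamma> = hcmp K \<alpha> (id2 K (pa e)) \<and> hcmp K (id2 K (pb r)) \<gamma> = id2 K (pb e)"
    using * sq h k
    by (intro pullback_two_exists[OF *(2,4)]) (auto simp: base_change1_def mor_rules)
  then show ?thesis using h k by (auto simp: base_change2_def)
qed

lemma base_change2_the:
  assumes "(e, \<alpha>, r) \<in> Two SY"
  shows "base_change2 e \<alpha> r (THE \<alpha>'. base_change2 e \<alpha> r \<alpha>')"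
  using base_change2_exists[OF assms] base_change2_unique[OF slice_TwoD(2,4)[OF assms]]
  by (metis theI)

lemma base_change1_the_eq:
  "(e, h, r) \<in> Mor SY \<Longrightarrow> base_change1 e h r h' \<Longrightarrow> (THE h'. base_change1 e h r h') = h'"
  using base_change1_the base_change1_unique slice_MorD by metis

lemma base_change2_the_eq:
  "(e, h, r) \<in> Two SY \<Longrightarrow> base_change2 e h r h' \<Longrightarrow> (THE h'. base_change2 e h r h') = h'"
  using base_change2_the base_change2_unique slice_TwoD by metis

lemma base_change1_idm:
  assumes "e \<in> Mor K" "tgt K e = tgt K p"
  shows "base_change1 e (idm K (src K e)) e (idm K (src K (pb e)))"
  using assms pullback_square[OF assms]
  by (simp add: base_change1_def mor_rules cmp_idm_left' cmp_idm_right')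

lemma base_change1_cmp:
  assumes "(e, h, r) \<in> Mor SY" "(r, k, s) \<in> Mor SY" "base_change1 e h r h'" "base_change1 r k s k'"
  shows "base_change1 e (cmp K k h) s (cmp K k' h')"
proof -
  note 1 = slice_MorD[OF assms(1)] and 2 = slice_MorD[OF assms(2)]
  note sq = pullback_square[OF 1(1,3)] pullback_square[OF 2(1,3)] pullback_square[OF 2(2,4)]
  have h': "h' \<in> Mor K" "src K h' = src K (pb e)" "tgt K h' = src K (pb r)"
    "cmp K (pa r) h' = cmp K h (pa e)" "cmp K (pb r) h' = pb e"
    and k': "k' \<in> Mor K" "src K k' = src K (pb r)" "tgt K k' = src K (pb s)"
    "cmp K (pa s) k' = cmp K k (pa r)" "cmp K (pb s) k' = pb r"
    using assms(3,4) by (simp_all add: base_change1_def)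
  have "cmp K (pa s) (cmp K k' h') = cmp K (cmp K k h) (pa e)"
    using 1 2 sq h' k' by (simp add: cmp_assoc[symmetric]) (simp add: cmp_assoc)
  moreover have "cmp K (pb s) (cmp K k' h') = pb e"
    using 1 2 sq h' k' by (simp add: cmp_assoc[symmetric])
  ultimately show ?thesis
    using 1 2 sq h' k' by (simp add: base_change1_def mor_rules)
qed

lemma base_change2_id2:
  assumes "(e, h, r) \<in> Mor SY" "base_change1 e h r h'"
  shows "base_change2 e (id2 K h) r (id2 K h')"
proof -
  note 1 = slice_MorD[OF assms(1)]
  note sq = pullback_square[OF 1(1,3)] pullback_square[OF 1(2,4)]
  show ?thesis
    using 1 sq assms(2) by (auto simp: base_change2_def base_change1_def mor_rules hcmp_id2)
qed

lemma base_change2_vcmp: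
  assumes "(e, \<alpha>, r) \<in> Two SY" "(e, \<beta>, r) \<in> Two SY" "tgt2 K \<alpha> = src2 K \<beta>"
    "base_change2 e \<alpha> r \<alpha>'" "base_change2 e \<beta> r \<beta>'"
  shows "base_change2 e (vcmp K \<beta> \<alpha>) r (vcmp K \<beta>' \<alpha>')"
proof -
  note 1 = slice_TwoD[OF assms(1)] and 2 = slice_TwoD[OF assms(2)]
  note sq = pullback_square[OF 1(1,3)] pullback_square[OF 1(2,4)]
  have a: "\<alpha>' \<in> Two K" "\<beta>' \<in> Two K" using assms by (simp_all add: base_change2_def)
  have eq: "tgt2 K \<alpha>' = src2 K \<beta>'"
    using assms base_change1_unique[OF 1(2,4)] by (auto simp: base_change2_def)
  have t: "tgt K (src2 K \<alpha>') = src K (pb r)" using assms by (simp add: base_change2_def base_change1_def)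
  have "vcmp K (id2 K (pb e)) (id2 K (pb e)) = id2 K (pb e)"
    using vcmp_id2_right[of "id2 K (pb e)"] sq by (simp add: mor_rules)
  then show ?thesis
    using 1 2 sq a eq t assms
    by (simp add: base_change2_def mor_rules whisker_left_vcmp whisker_right_vcmp)
qed

lemma base_change2_hcmp:
  assumes "(e, \<alpha>, r) \<in> Two SY" "(r, \<beta>, s) \<in> Two SY"
    "base_change2 e \<alpha> r \<alpha>'" "base_change2 r \<beta> s \<beta>'"
  shows "base_change2 e (hcmp K \<beta> \<alpha>) s (hcmp K \<beta>' \<alpha>')"
proof -
  note 1 = slice_TwoD[OF assms(1)] and 2 = slice_TwoD[OF assms(2)]
  note sq = pullback_square[OF 1(1,3)] pullback_square[OF 1(2,4)] pullback_square[OF 2(2,4)]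
  have a: "\<alpha>' \<in> Two K" "hcmp K (id2 K (pa r)) \<alpha>' = hcmp K \<alpha> (id2 K (pa e))"
    "hcmp K (id2 K (pb r)) \<alpha>' = id2 K (pb e)"
    "base_change1 e (src2 K \<alpha>) r (src2 K \<alpha>')" "base_change1 e (tgt2 K \<alpha>) r (tgt2 K \<alpha>')"
    using assms(3) by (simp_all add: base_change2_def)
  have b: "\<beta>' \<in> Two K" "hcmp K (id2 K (pa s)) \<beta>' = hcmp K \<beta> (id2 K (pa r))"
    "hcmp K (id2 K (pb s)) \<beta>' = id2 K (pb r)"
    "base_change1 r (src2 K \<beta>) s (src2 K \<beta>')" "base_change1 r (tgt2 K \<beta>) s (tgt2 K \<beta>')"
    using assms(4) by (simp_all add: base_change2_def)
  have t: "tgt K (src2 K \<alpha>') = src K (pb r)" "src K (src2 K \<alpha>') = src K (pb e)"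
    "src K (src2 K \<beta>') = src K (pb r)" "tgt K (src2 K \<beta>') = src K (pb s)"
    using a b by (simp_all add: base_change1_def)
  note c1 = base_change1_cmp[OF 1(9) 2(9) a(4) b(4)] base_change1_cmp[OF 1(10) 2(10) a(5) b(5)]
  have "hcmp K (id2 K (pa s)) (hcmp K \<beta>' \<alpha>') = hcmp K (hcmp K \<beta> \<alpha>) (id2 K (pa e))"
    using 1 2 sq a(1,2) b(1,2) t
    by (simp add: hcmp_assoc[symmetric] mor_rules) (simp add: hcmp_assoc mor_rules)
  moreover have "hcmp K (id2 K (pb s)) (hcmp K \<beta>' \<alpha>') = id2 K (pb e)"
    using 1 2 sq a(1,3) b(1,3) t by (simp add: hcmp_assoc[symmetric] mor_rules)
  ultimately show ?thesis
    using 1 2 sq a b t c1 by (simp add: base_change2_def mor_rules)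
qed

lemma map1_pullback_fun:
  "(e, h, r) \<in> Mor SY \<Longrightarrow> base_change1 e h r h' \<Longrightarrow> map1 pullback_fun (e, h, r) = (pb e, h', pb r)"
  by (simp add: pullback_fun_def base_change1_the_eq)

lemma map2_pullback_fun:
  "(e, h, r) \<in> Two SY \<Longrightarrow> base_change2 e h r h' \<Longrightarrow> map2c pullback_fun (e, h, r) = (pb e, h', pb r)"
  by (simp add: pullback_fun_def base_change2_the_eq)

lemma map1_pullback_fun_Mor:
  assumes "(e, h, r) \<in> Mor SY" "base_change1 e h r h'"
  shows "(pb e, h', pb r) \<in> Mor SX"
  using slice_MorD[OF assms(1)] pullback_square[OF slice_MorD(1,3)[OF assms(1)]]
    pullback_square[OF slice_MorD(2,4)[OF assms(1)]] assms(2)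
  by (simp add: slice_def base_change1_def)

lemma map2_pullback_fun_Two:
  assumes "(e, h, r) \<in> Two SY" "base_change2 e h r h'"
  shows "(pb e, h', pb r) \<in> Two SX"
  using slice_TwoD[OF assms(1)] pullback_square[OF slice_TwoD(1,3)[OF assms(1)]]
    pullback_square[OF slice_TwoD(2,4)[OF assms(1)]] assms(2)
  by (simp add: slice_def base_change2_def base_change1_def)

lemma two_functor_pullback_fun: "two_functor SY SX pullback_fun"
proof (intro two_functor.intro two_category_slice two_functor_axioms.intro)
  show "map0 pullback_fun a \<in> Obj SX" if "a \<in> Obj SY" for a
    using that pullback_square[of a] by (simp add: slice_def pullback_fun_def)
  show "map1 pullback_fun (idm SY a) = idm SX (map0 pullback_fun a)" if "a \<in> Obj SY" for a
  proof -
    have a: "a \<in> Mor K" "tgt K a = tgt K p" using that by (simp_all add: slice_def)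
    have "(a, idm K (src K a), a) \<in> Mor SY"
      using a by (simp add: slice_def mor_rules cmp_idm_right')
    from map1_pullback_fun[OF this base_change1_idm[OF a]]
    show ?thesis by (simp add: slice_def pullback_fun_def)
  qed
next
  fix f assume "f \<in> Mor SY"
  moreover obtain e h r where f: "f = (e, h, r)" by (cases f)
  ultimately have m: "(e, h, r) \<in> Mor SY" by simp
  obtain h' where h': "base_change1 e h r h'" using base_change1_exists[OF m] by blast
  note * = map1_pullback_fun[OF m h'] map1_pullback_fun_Mor[OF m h'] slice_MorD[OF m]
  show "map1 pullback_fun f \<in> Mor SX" "src SX (map1 pullback_fun f) = map0 pullback_fun (src SY f)"
    "tgt SX (map1 pullback_fun f) = map0 pullback_fun (tgt SY f)"
    using * unfolding f by (simp_all add: slice_def) (simp_all add: pullback_fun_def)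
  have "(e, id2 K h, r) \<in> Two SY"
    using * by (simp add: slice_def mor_rules hcmp_id2)
  from map2_pullback_fun[OF this base_change2_id2[OF m h']]
  show "map2c pullback_fun (id2 SY f) = id2 SX (map1 pullback_fun f)"
    using * unfolding f by (simp add: slice_def)
  fix g assume "g \<in> Mor SY" "tgt SY f = src SY g"
  moreover obtain r' k s where "g = (r', k, s)" by (cases g)
  ultimately have g: "g = (r, k, s)" and m2: "(r, k, s) \<in> Mor SY" by (simp_all add: f slice_def)
  obtain k' where k': "base_change1 r k s k'" using base_change1_exists[OF m2] by blast
  have m3: "(e, cmp K k h, s) \<in> Mor SY"
    using slice_MorD[OF m] slice_MorD[OF m2] by (simp add: slice_def mor_rules cmp_assoc[symmetric])
  show "map1 pullback_fun (cmp SY g f) = cmp SX (map1 pullback_fun g) (map1 pullback_fun f)"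
    using map1_pullback_fun[OF m3 base_change1_cmp[OF m m2 h' k']] map1_pullback_fun[OF m h']
      map1_pullback_fun[OF m2 k'] by (simp add: f g slice_def)
next
  fix f assume "f \<in> Two SY"
  moreover obtain e h r where f: "f = (e, h, r)" by (cases f)
  ultimately have m: "(e, h, r) \<in> Two SY" by simp
  obtain h' where h': "base_change2 e h r h'" using base_change2_exists[OF m] by blast
  note * = map2_pullback_fun[OF m h'] map2_pullback_fun_Two[OF m h'] slice_TwoD[OF m]
  have b1: "base_change1 e (src2 K h) r (src2 K h')" "base_change1 e (tgt2 K h) r (tgt2 K h')"
    using h' by (simp_all add: base_change2_def)
  show "map2c pullback_fun f \<in> Two SX"
    "src2 SX (map2c pullback_fun f) = map1 pullback_fun (src2 SY f)"
    "tgt2 SX (map2c pullback_fun f) = map1 pullback_fun (tgt2 SY f)"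
    using * map1_pullback_fun[OF *(11) b1(1)] map1_pullback_fun[OF *(12) b1(2)]
    unfolding f by (simp_all add: slice_def)
  show "map2c pullback_fun (vcmp SY g f) = vcmp SX (map2c pullback_fun g) (map2c pullback_fun f)"
    if "g \<in> Two SY" "tgt2 SY f = src2 SY g" for g
  proof -
    obtain a k b where g': "g = (a, k, b)" by (cases g)
    have "a = e" "b = r" and eq: "tgt2 K h = src2 K k" using that by (simp_all add: f g' slice_def)
    with g' that(1) have g: "g = (e, k, r)" and m2: "(e, k, r) \<in> Two SY" by simp_all
    obtain k' where k': "base_change2 e k r k'" using base_change2_exists[OF m2] by blast
    have m3: "(e, vcmp K k h, r) \<in> Two SY"
      using two_category.vcmp_Two[OF two_category_slice m m2] eq by (simp add: slice_def)
    show ?thesis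
      using map2_pullback_fun[OF m3 base_change2_vcmp[OF m m2 eq h' k']] map2_pullback_fun[OF m h']
        map2_pullback_fun[OF m2 k'] by (simp add: f g slice_def)
  qed
  show "map2c pullback_fun (hcmp SY g f) = hcmp SX (map2c pullback_fun g) (map2c pullback_fun f)"
    if "g \<in> Two SY" "tgt SY (src2 SY f) = src SY (src2 SY g)" for g
  proof -
    obtain a k s where g': "g = (a, k, s)" by (cases g)
    have "a = r" using that by (simp add: f g' slice_def)
    with g' that(1) have g: "g = (r, k, s)" and m2: "(r, k, s) \<in> Two SY" by simp_all
    obtain k' where k': "base_change2 r k s k'" using base_change2_exists[OF m2] by blast
    have m3: "(e, hcmp K k h, s) \<in> Two SY"
      using two_category.hcmp_Two[OF two_category_slice m m2] by (simp add: slice_def)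
    show ?thesis
      using map2_pullback_fun[OF m3 base_change2_hcmp[OF m m2 h' k']] map2_pullback_fun[OF m h']
        map2_pullback_fun[OF m2 k'] by (simp add: f g slice_def)
  qed
qed

lemma pullback_2functor_pullback_fun: "pullback_2functor K p pullback_fun"
  unfolding pullback_2functor_def
proof (intro conjI exI[of _ pa] ballI allI impI two_functor_pullback_fun)
  show "two_pullback K e p (pa e) (map0 pullback_fun e)" if "e \<in> Obj SY" for e
    using that pullback[of e] by (simp add: slice_def pullback_fun_def)
  show "cmp K (pa r) (fst (snd (map1 pullback_fun (e, h, r)))) = cmp K h (pa e)"
    if m: "(e, h, r) \<in> Mor SY" for e h r
    using base_change1_the[OF m] by (simp add: pullback_fun_def base_change1_def)
  show "hcmp K (id2 K (pa r)) (fst (snd (map2c pullback_fun (e, h, r)))) = hcmp K h (id2 K (pa e))"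
    if m: "(e, h, r) \<in> Two SY" for e h r
    using base_change2_the[OF m] by (simp add: pullback_fun_def base_change2_def)
qed

end


section \<open>Dependent products in a 2-category\<close>

text \<open>The universal property of dependent products along \<open>p\<close>: 1-cells and 2-cells \<open>e \<rightarrow> R q\<close> over
  the target of \<open>p\<close> correspond to 1-cells and 2-cells \<open>pb e \<rightarrow> q\<close> over its source, by base change
  followed by the evaluation \<open>ev q\<close>.\<close>

locale dependent_products = chosen_pullbacks K p pa pb
  for K :: "('o, 'm, 'c) two_cat" and p :: 'm and pa pb :: "'m \<Rightarrow> 'm" +
  fixes R ev :: "'m \<Rightarrow> 'm"
  assumes ev: "q \<in> Obj (slice K (src K p)) \<Longrightarrow> R q \<in> Obj (slice K (tgt K p)) \<and>
          (pb (R q), ev q, q) \<in> Mor (slice K (src K p))"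
    and curry_exists: "\<lbrakk>q \<in> Obj (slice K (src K p)); e \<in> Obj (slice K (tgt K p));
            (pb e, g, q) \<in> Mor (slice K (src K p))\<rbrakk>
          \<Longrightarrow> \<exists>h h'. (e, h, R q) \<in> Mor (slice K (tgt K p)) \<and> base_change1 e h (R q) h' \<and> cmp K (ev q) h' = g"
    and curry_unique: "\<lbrakk>q \<in> Obj (slice K (src K p)); (e, h, R q) \<in> Mor (slice K (tgt K p));
            (e, k, R q) \<in> Mor (slice K (tgt K p)); base_change1 e h (R q) h'; base_change1 e k (R q) k';
            cmp K (ev q) h' = cmp K (ev q) k'\<rbrakk> \<Longrightarrow> h = k"
    and curry2_exists: "\<lbrakk>q \<in> Obj (slice K (src K p)); (e, h, R q) \<in> Mor (slice K (tgt K p));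
            (e, k, R q) \<in> Mor (slice K (tgt K p)); base_change1 e h (R q) h'; base_change1 e k (R q) k';
            (pb e, \<gamma>, q) \<in> Two (slice K (src K p)); src2 K \<gamma> = cmp K (ev q) h'; tgt2 K \<gamma> = cmp K (ev q) k'\<rbrakk>
          \<Longrightarrow> \<exists>\<alpha> \<alpha>'. (e, \<alpha>, R q) \<in> Two (slice K (tgt K p)) \<and> src2 K \<alpha> = h \<and> tgt2 K \<alpha> = k \<and>
            base_change2 e \<alpha> (R q) \<alpha>' \<and> hcmp K (id2 K (ev q)) \<alpha>' = \<gamma>"
    and curry2_unique: "\<lbrakk>q \<in> Obj (slice K (src K p)); (e, \<alpha>, R q) \<in> Two (slice K (tgt K p));
            (e, \<beta>, R q) \<in> Two (slice K (tgt K p)); src2 K \<alpha> = src2 K \<beta>; tgt2 K \<alpha> = tgt2 K \<beta>;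
            base_change2 e \<alpha> (R q) \<alpha>'; base_change2 e \<beta> (R q) \<beta>';
            hcmp K (id2 K (ev q)) \<alpha>' = hcmp K (id2 K (ev q)) \<beta>'\<rbrakk> \<Longrightarrow> \<alpha> = \<beta>"
begin

lemma couniversal_arrows_ev:
  "couniversal_arrows SY SX pullback_fun R (\<lambda>q. (pb (R q), ev q, q))"
proof (intro couniversal_arrows.intro two_functor_pullback_fun couniversal_arrows_axioms.intro)
  fix b assume b: "b \<in> Obj SX"
  show "R b \<in> Obj SY" "(pb (R b), ev b, b) \<in> Mor SX" using ev[OF b] by auto
  show "src SX (pb (R b), ev b, b) = map0 pullback_fun (R b)" "tgt SX (pb (R b), ev b, b) = b"
    by (simp_all add: slice_def pullback_fun_def)
next
  fix a b g
  assume a: "a \<in> Obj SY" and b: "b \<in> Obj SX" and g: "g \<in> Mor SX" "src SX g = map0 pullback_fun a" "tgt SX g = b"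
  obtain g' where g': "g = (pb a, g', b)" using g(2,3)
    by (cases g) (simp add: slice_def pullback_fun_def)
  obtain h h' where h: "(a, h, R b) \<in> Mor SY" "base_change1 a h (R b) h'" "cmp K (ev b) h' = g'"
    using curry_exists[OF b a] g(1) g' by blast
  then show "\<exists>h. h \<in> Mor SY \<and> src SY h = a \<and> tgt SY h = R b \<and>
      cmp SX (pb (R b), ev b, b) (map1 pullback_fun h) = g"
    using map1_pullback_fun[OF h(1,2)]
    by (intro exI[of _ "(a, h, R b)"]) (simp add: g' slice_def)
next
  fix b h k
  assume b: "b \<in> Obj SX" and h: "h \<in> Mor SY" and k: "k \<in> Mor SY" and st: "src SY h = src SY k"
    "tgt SY h = R b" "tgt SY k = R b"
    and eq: "cmp SX (pb (R b), ev b, b) (map1 pullback_fun h) = cmp SX (pb (R b), ev b, b) (map1 pullback_fun k)"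
  obtain e u v where hk: "h = (e, u, R b)" "k = (e, v, R b)"
    using st by (cases h; cases k) (simp add: slice_def)
  obtain u' v' where uv: "base_change1 e u (R b) u'" "base_change1 e v (R b) v'"
    using base_change1_exists h k hk by blast
  have "cmp K (ev b) u' = cmp K (ev b) v'"
    using eq map1_pullback_fun[of e u "R b", OF _ uv(1)] map1_pullback_fun[of e v "R b", OF _ uv(2)] h k
    by (simp add: hk slice_def)
  from curry_unique[OF b _ _ uv this] show "h = k" using h k hk by blast
next
  fix b h k \<gamma>
  assume b: "b \<in> Obj SX" and h: "h \<in> Mor SY" and k: "k \<in> Mor SY" and st: "src SY h = src SY k"
    "tgt SY h = R b" "tgt SY k = R b" and \<gamma>: "\<gamma> \<in> Two SX"
    and s: "src2 SX \<gamma> = cmp SX (pb (R b), ev b, b) (map1 pullback_fun h)"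
    and t: "tgt2 SX \<gamma> = cmp SX (pb (R b), ev b, b) (map1 pullback_fun k)"
  obtain e u v where hk: "h = (e, u, R b)" "k = (e, v, R b)"
    using st by (cases h; cases k) (simp add: slice_def)
  obtain u' v' where uv: "base_change1 e u (R b) u'" "base_change1 e v (R b) v'"
    using base_change1_exists h k hk by blast
  obtain g where g: "\<gamma> = (pb e, g, b)" "src2 K g = cmp K (ev b) u'" "tgt2 K g = cmp K (ev b) v'"
    using s t map1_pullback_fun[of e u "R b", OF _ uv(1)] map1_pullback_fun[of e v "R b", OF _ uv(2)] h k
    by (cases \<gamma>) (simp add: hk slice_def)
  obtain \<alpha> \<alpha>' where \<alpha>: "(e, \<alpha>, R b) \<in> Two SY" "src2 K \<alpha> = u" "tgt2 K \<alpha> = v"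
    "base_change2 e \<alpha> (R b) \<alpha>'" "hcmp K (id2 K (ev b)) \<alpha>' = g"
    using curry2_exists[OF b _ _ uv _ g(2,3)] h k \<gamma> hk g(1) by blast
  then show "\<exists>\<alpha>. \<alpha> \<in> Two SY \<and> src2 SY \<alpha> = h \<and> tgt2 SY \<alpha> = k \<and>
      hcmp SX (id2 SX (pb (R b), ev b, b)) (map2c pullback_fun \<alpha>) = \<gamma>"
    using map2_pullback_fun[OF \<alpha>(1,4)]
    by (intro exI[of _ "(e, \<alpha>, R b)"]) (simp add: hk g slice_def)
next
  fix b \<alpha> \<beta>
  assume b: "b \<in> Obj SX" and \<alpha>: "\<alpha> \<in> Two SY" and \<beta>: "\<beta> \<in> Two SY"
    and st: "src2 SY \<alpha> = src2 SY \<beta>" "tgt2 SY \<alpha> = tgt2 SY \<beta>" "tgt SY (src2 SY \<alpha>) = R b"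
    and eq: "hcmp SX (id2 SX (pb (R b), ev b, b)) (map2c pullback_fun \<alpha>)
      = hcmp SX (id2 SX (pb (R b), ev b, b)) (map2c pullback_fun \<beta>)"
  obtain e u v where hk: "\<alpha> = (e, u, R b)" "\<beta> = (e, v, R b)"
    and uv2: "src2 K u = src2 K v" "tgt2 K u = tgt2 K v"
    using st by (cases \<alpha>; cases \<beta>) (simp add: slice_def)
  obtain u' v' where uv: "base_change2 e u (R b) u'" "base_change2 e v (R b) v'"
    using base_change2_exists \<alpha> \<beta> hk by blast
  have "hcmp K (id2 K (ev b)) u' = hcmp K (id2 K (ev b)) v'"
    using eq map2_pullback_fun[of e u "R b", OF _ uv(1)] map2_pullback_fun[of e v "R b", OF _ uv(2)] \<alpha> \<beta>
    by (simp add: hk slice_def)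
  from curry2_unique[OF b _ _ uv2 uv this] show "\<alpha> = \<beta>" using \<alpha> \<beta> hk by blast
qed

lemma powerful: "powerful K p"
  using p_Mor pullback_2functor_pullback_fun couniversal_arrows.two_adjunction_G[OF couniversal_arrows_ev]
  unfolding powerful_def right_2adjoint_def by blast

end


section \<open>Small sets\<close>

text \<open>Smallness is stated for sets over arbitrary types, so that tuples, lists and functions can be used
  freely and are replaced by codes in the universe only at the end. For a small set, \<open>code\<close> is some
  injection that witnesses this.\<close>

definition small :: "('u \<Rightarrow> 'u \<Rightarrow> bool) \<Rightarrow> 'a set \<Rightarrow> bool" where
  "small E S \<longleftrightarrow> (\<exists>c. inj_on c S \<and> in_universe E (c ` S))"

definition code :: "('u \<Rightarrow> 'u \<Rightarrow> bool) \<Rightarrow> 'a set \<Rightarrow> 'a \<Rightarrow> 'u" where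
  "code E S = (SOME c. inj_on c S \<and> in_universe E (c ` S))"

definition decode :: "('u \<Rightarrow> 'u \<Rightarrow> bool) \<Rightarrow> 'a set \<Rightarrow> 'u \<Rightarrow> 'a" where
  "decode E S = inv_into S (code E S)"

lemma code_small:
  assumes "small E S"
  shows "inj_on (code E S) S" "in_universe E (code E S ` S)"
  using someI_ex[OF assms[unfolded small_def]] by (simp_all add: code_def)

lemma decode_code: "small E S \<Longrightarrow> s \<in> S \<Longrightarrow> decode E S (code E S s) = s"
  by (simp add: decode_def code_small)

context grothendieck_universe
begin

lemma in_universe_subset: "in_universe E S \<Longrightarrow> T \<subseteq> S \<Longrightarrow> in_universe E T"
  using subset unfolding in_universe_def by metis

lemma in_universe_pair: "in_universe E {x, y}"
  using pair[of x y] unfolding in_universe_def by metis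

lemma in_universe_UN:
  assumes "in_universe E I" "\<And>i. i \<in> I \<Longrightarrow> in_universe E (A i)"
  shows "in_universe E (\<Union>i\<in>I. A i)"
proof -
  obtain x where x: "I = {z. E z x}" using assms(1) by (auto simp: in_universe_def)
  have "\<forall>i\<in>I. \<exists>y. A i = {z. E z y}" using assms(2) by (auto simp: in_universe_def)
  then obtain f where f: "\<And>i. i \<in> I \<Longrightarrow> A i = {z. E z (f i)}" by metis
  obtain y where "{z. E z y} = (\<Union>i\<in>{i. E i x}. {z. E z (f i)})" using union by blast
  then have "(\<Union>i\<in>I. A i) = {z. E z y}" using f x by auto
  then show ?thesis unfolding in_universe_def by blast
qed

lemma in_universe_image:
  assumes "in_universe E S"
  shows "in_universe E (f ` S)"
proof -
  have "in_universe E {f i}" for i using in_universe_pair[of "f i" "f i"] by simp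
  then have "in_universe E (\<Union>i\<in>S. {f i})" by (intro in_universe_UN assms)
  then show ?thesis by (metis UNION_singleton_eq_range)
qed

lemma small_iff: "small E S \<longleftrightarrow> (\<exists>c U. inj_on c S \<and> c ` S \<subseteq> U \<and> in_universe E U)"
  unfolding small_def using in_universe_subset by blast

lemma small_in_universe: "in_universe E S \<Longrightarrow> small E S"
  unfolding small_def by (intro exI[of _ "\<lambda>x. x"]) simp

lemma small_subset: "small E S \<Longrightarrow> T \<subseteq> S \<Longrightarrow> small E T"
  unfolding small_iff by (meson image_mono inj_on_subset subset_trans)

lemma small_inj:
  assumes "inj_on f S" "f ` S \<subseteq> T" "small E T"
  shows "small E S"
proof -
  obtain c where "inj_on c T" "in_universe E (c ` T)" using assms(3) small_def by metis
  then have "inj_on (c \<circ> f) S" "(c \<circ> f) ` S \<subseteq> c ` T"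
    using assms by (auto intro: comp_inj_on inj_on_subset)
  then show ?thesis using \<open>in_universe E (c ` T)\<close> small_iff by metis
qed

text \<open>An injection of pairs into the universe is the coding of Kuratowski.\<close>

lemma ex_pairing: "\<exists>f :: 'u \<times> 'u \<Rightarrow> 'u. inj f"
proof -
  have "\<exists>d. \<forall>x y. {z. E z (d x y)} = {x, y}" by (intro choice allI pair)
  then obtain d where d: "\<And>x y. {z. E z (d x y)} = {x, y}" by metis
  have deq: "d x y = d x' y' \<longleftrightarrow> {x, y} = {x', y'}" for x y x' y'
  proof
    show "{x, y} = {x', y'}" if "d x y = d x' y'" using that d[of x y] d[of x' y'] by simp
    show "d x y = d x' y'" if eq: "{x, y} = {x', y'}"
    proof (rule extensionality)
      show "E z (d x y) \<longleftrightarrow> E z (d x' y')" for z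
        using d[of x y] d[of x' y'] eq by (metis mem_Collect_eq)
    qed
  qed
  have "inj (\<lambda>(x, y). d (d x x) (d x y))"
    by (rule injI) (auto simp: deq doubleton_eq_iff)
  then show ?thesis by blast
qed

text \<open>The fibres may need different injections; they are combined by pairing the code of the index with the
  code of the element, and the axiom of union bounds the resulting set.\<close>

lemma small_Sigma:
  assumes "small E A" "\<And>a. a \<in> A \<Longrightarrow> small E (B a)"
  shows "small E (Sigma A B)"
proof -
  obtain f :: "'u \<times> 'u \<Rightarrow> 'u" where f: "inj f" using ex_pairing by blast
  obtain c where c: "inj_on c A" "in_universe E (c ` A)" using assms(1) small_def by metis
  have "\<forall>a\<in>A. \<exists>d. inj_on d (B a) \<and> in_universe E (d ` B a)" using assms(2) by (simp add: small_def)
  then obtain d where d: "\<And>a. a \<in> A \<Longrightarrow> inj_on (d a) (B a) \<and> in_universe E (d a ` B a)" by metis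
  let ?k = "\<lambda>(a, b). f (c a, d a b)"
  have "inj_on ?k (Sigma A B)"
  proof (rule inj_onI)
    fix x y assume xy: "x \<in> Sigma A B" "y \<in> Sigma A B" "?k x = ?k y"
    obtain a b a' b' where ab: "x = (a, b)" "y = (a', b')" by (cases x; cases y)
    have e: "c a = c a'" "d a b = d a' b'" using injD[OF f, of "(c a, d a b)" "(c a', d a' b')"] xy ab by auto
    then have "a = a'" using inj_onD[OF c(1)] xy ab by auto
    moreover from this have "b = b'" using inj_onD[of "d a" "B a" b b'] d xy ab e by auto
    ultimately show "x = y" by (simp add: ab)
  qed
  moreover have "?k ` Sigma A B \<subseteq> (\<Union>x\<in>c ` A. (\<lambda>y. f (x, y)) ` d (inv_into A c x) ` B (inv_into A c x))"
  proof clarify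
    fix a b assume "a \<in> A" "b \<in> B a"
    then show "f (c a, d a b) \<in> (\<Union>x\<in>c ` A. (\<lambda>y. f (x, y)) ` d (inv_into A c x) ` B (inv_into A c x))"
      using inv_into_f_f[OF c(1)] by (intro UN_I[of "c a"]) auto
  qed
  moreover have "in_universe E \<dots>"
    using c d by (intro in_universe_UN in_universe_image) auto
  ultimately show ?thesis using small_iff by blast
qed

lemma small_Times: "small E A \<Longrightarrow> small E B \<Longrightarrow> small E (A \<times> B)"
  by (rule small_Sigma)

lemma small_Pow:
  assumes "small E A"
  shows "small E (Pow A)"
proof -
  obtain c where c: "inj_on c A" "in_universe E (c ` A)" using assms small_def by metis
  then obtain x where x: "c ` A = {z. E z x}" by (auto simp: in_universe_def)
  obtain q where q: "{z. E z q} = {y. \<forall>z. E z y \<longrightarrow> E z x}" using power by blast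
  have "\<forall>S\<in>Pow A. \<exists>y. {z. E z y} = c ` S" using subset[of _ x] x by (metis PowD image_mono)
  then obtain k where k: "\<And>S. S \<in> Pow A \<Longrightarrow> {z. E z (k S)} = c ` S" by metis
  have "inj_on k (Pow A)"
    by (rule inj_onI) (metis k c(1) PowD inj_on_image_eq_iff)
  moreover have "k ` Pow A \<subseteq> {z. E z q}"
    unfolding q using k x by blast
  ultimately show ?thesis using small_iff in_universe_def by metis
qed

text \<open>A function that is fixed outside \<open>A\<close> is determined by its graph, a subset of the product.\<close>

lemma small_PiE:
  assumes "small E A" "small E B"
  shows "small E (A \<rightarrow>\<^sub>E B)"
proof (rule small_inj[OF _ _ small_Pow[OF small_Times[OF assms]]])
  let ?g = "\<lambda>f. (\<lambda>a. (a, f a)) ` A"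
  show "inj_on ?g (A \<rightarrow>\<^sub>E B)"
  proof (rule inj_onI)
    fix f g assume fg: "f \<in> A \<rightarrow>\<^sub>E B" "g \<in> A \<rightarrow>\<^sub>E B" "?g f = ?g g"
    show "f = g"
    proof (rule PiE_ext[OF fg(1,2)])
      fix a assume "a \<in> A"
      then have "(a, f a) \<in> ?g g" using fg(3) by (metis image_eqI)
      then show "f a = g a" by auto
    qed
  qed
  show "?g ` (A \<rightarrow>\<^sub>E B) \<subseteq> Pow (A \<times> B)" by auto
qed

text \<open>The length has to be fixed: if all elements of the universe are finite, the lists of all lengths
  over a nonempty small set do not form a small set.\<close>

lemma small_lists_length:
  assumes "small E A"
  shows "small E {xs. set xs \<subseteq> A \<and> length xs = n}"
proof (induction n)
  case 0
  have "in_universe E ((\<lambda>_. undefined) ` {xs. set xs \<subseteq> A \<and> length xs = 0})"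
    by (rule in_universe_subset[OF in_universe_pair[of undefined undefined]]) auto
  then show ?case unfolding small_def by (intro exI[of _ "\<lambda>_. undefined"]) (auto simp: inj_on_def)
next
  case (Suc n)
  show ?case
  proof (rule small_inj[OF _ _ small_Times[OF assms Suc], of "\<lambda>xs. (hd xs, tl xs)"])
    show "inj_on (\<lambda>xs. (hd xs, tl xs)) {xs. set xs \<subseteq> A \<and> length xs = Suc n}"
    proof (rule inj_onI)
      fix x y :: "'a list"
      assume "x \<in> {xs. set xs \<subseteq> A \<and> length xs = Suc n}" "y \<in> {xs. set xs \<subseteq> A \<and> length xs = Suc n}"
        "(hd x, tl x) = (hd y, tl y)"
      then show "x = y" by (cases x; cases y) simp_all
    qed
    show "(\<lambda>xs. (hd xs, tl xs)) ` {xs. set xs \<subseteq> A \<and> length xs = Suc n}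
        \<subseteq> A \<times> {xs. set xs \<subseteq> A \<and> length xs = n}"
    proof (rule image_subsetI)
      fix x assume "x \<in> {xs. set xs \<subseteq> A \<and> length xs = Suc n}"
      then show "(hd x, tl x) \<in> A \<times> {xs. set xs \<subseteq> A \<and> length xs = n}" by (cases x) simp_all
    qed
  qed
qed

end


section \<open>Paths and composites in virtual double categories\<close>

lemma cpath_end_append: "cpath_end A u (xs @ ys) = cpath_end A (cpath_end A u xs) ys"
  by (induction xs arbitrary: u) auto

lemma hpath_append:
  "hpath A a (xs @ ys) b \<longleftrightarrow> (\<exists>c. hpath A a xs c \<and> hpath A c ys b)" if "\<And>\<Gamma>. \<Gamma> \<in> Hor A \<Longrightarrow> hsrc A \<Gamma> \<in> Ob A \<and> htgt A \<Gamma> \<in> Ob A"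
proof (induction xs arbitrary: a)
  case Nil
  have "a \<in> Ob A" if "hpath A a ys b" using that \<open>\<And>\<Gamma>. \<Gamma> \<in> Hor A \<Longrightarrow> _\<close> by (cases ys) auto
  then show ?case by auto
qed auto

text \<open>Boundaries alone, and operations with the right boundaries, already support the calculus of
  paths; the equations of a virtual double category are a separate matter.\<close>

locale vdc_graph =
  fixes A :: "'u vdc"
  assumes vdom_in: "u \<in> Ver A \<Longrightarrow> vdom A u \<in> Ob A"
    and vcod_in: "u \<in> Ver A \<Longrightarrow> vcod A u \<in> Ob A"
    and hsrc_in: "\<Gamma> \<in> Hor A \<Longrightarrow> hsrc A \<Gamma> \<in> Ob A"
    and htgt_in: "\<Gamma> \<in> Hor A \<Longrightarrow> htgt A \<Gamma> \<in> Ob A"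
    and ctgt_in: "\<theta> \<in> Cel A \<Longrightarrow> ctgt A \<theta> \<in> Hor A"
    and cleft_in: "\<theta> \<in> Cel A \<Longrightarrow> cleft A \<theta> \<in> Ver A"
    and cright_in: "\<theta> \<in> Cel A \<Longrightarrow> cright A \<theta> \<in> Ver A"
    and ctop_path: "\<theta> \<in> Cel A \<Longrightarrow> hpath A (vdom A (cleft A \<theta>)) (ctop A \<theta>) (vdom A (cright A \<theta>))"
    and cod_cleft: "\<theta> \<in> Cel A \<Longrightarrow> vcod A (cleft A \<theta>) = hsrc A (ctgt A \<theta>)"
    and cod_cright: "\<theta> \<in> Cel A \<Longrightarrow> vcod A (cright A \<theta>) = htgt A (ctgt A \<theta>)"
begin

lemma hpath_appendI: "hpath A a xs c \<Longrightarrow> hpath A c ys b \<Longrightarrow> hpath A a (xs @ ys) b"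
  using hpath_append[of A] hsrc_in htgt_in by blast

lemma hpath_appendD: "hpath A a (xs @ ys) b \<Longrightarrow> \<exists>c. hpath A a xs c \<and> hpath A c ys b"
  using hpath_append[of A] hsrc_in htgt_in by blast

lemma hpath_Ob: "hpath A a \<Gamma>s b \<Longrightarrow> a \<in> Ob A \<and> b \<in> Ob A"
  by (induction \<Gamma>s arbitrary: a) (auto simp: hsrc_in)

lemma hpath_Hor: "hpath A a \<Gamma>s b \<Longrightarrow> set \<Gamma>s \<subseteq> Hor A"
  by (induction \<Gamma>s arbitrary: a) auto

lemma hpath_end_unique: "hpath A a \<Gamma>s b \<Longrightarrow> hpath A a \<Gamma>s b' \<Longrightarrow> b = b'"
  by (induction \<Gamma>s arbitrary: a) auto

lemma ctop_Hor: "\<theta> \<in> Cel A \<Longrightarrow> set (ctop A \<theta>) \<subseteq> Hor A"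
  using ctop_path hpath_Hor by blast

lemma cpath_Ver: "cpath A u \<theta>s \<Longrightarrow> u \<in> Ver A \<and> cpath_end A u \<theta>s \<in> Ver A"
  by (induction \<theta>s arbitrary: u) (auto simp: cleft_in)

lemma cpath_Cel: "cpath A u \<theta>s \<Longrightarrow> set \<theta>s \<subseteq> Cel A"
  by (induction \<theta>s arbitrary: u) auto

lemma cpath_append: "cpath A u (xs @ ys) \<longleftrightarrow> cpath A u xs \<and> cpath A (cpath_end A u xs) ys"
proof (induction xs arbitrary: u)
  case Nil
  then show ?case using cpath_Ver by auto
qed auto

lemma cpath_hpath_ctgt:
  "cpath A u \<theta>s \<Longrightarrow> hpath A (vcod A u) (map (ctgt A) \<theta>s) (vcod A (cpath_end A u \<theta>s))"
proof (induction \<theta>s arbitrary: u)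
  case (Cons \<theta> \<theta>s)
  then show ?case using Cons.IH[of "cright A \<theta>"] by (auto simp: ctgt_in cod_cleft cod_cright)
qed (simp add: vcod_in)

lemma cpath_hpath_ctop:
  "cpath A u \<theta>s \<Longrightarrow> hpath A (vdom A u) (concat (map (ctop A) \<theta>s)) (vdom A (cpath_end A u \<theta>s))"
proof (induction \<theta>s arbitrary: u)
  case (Cons \<theta> \<theta>s)
  then show ?case using Cons.IH[of "cright A \<theta>"] ctop_path by (auto intro!: hpath_appendI)
qed (simp add: vdom_in)

lemma composableD:
  assumes "composable A \<kappa> u \<theta>s"
  shows "\<kappa> \<in> Cel A" "cpath A u \<theta>s" "map (ctgt A) \<theta>s = ctop A \<kappa>" "vcod A u = vdom A (cleft A \<kappa>)"
    "u \<in> Ver A" "cpath_end A u \<theta>s \<in> Ver A" "set \<theta>s \<subseteq> Cel A"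
    "vcod A (cpath_end A u \<theta>s) = vdom A (cright A \<kappa>)"
proof -
  show *: "\<kappa> \<in> Cel A" "cpath A u \<theta>s" "map (ctgt A) \<theta>s = ctop A \<kappa>" "vcod A u = vdom A (cleft A \<kappa>)"
    using assms by (simp_all add: composable_def)
  show "u \<in> Ver A" "cpath_end A u \<theta>s \<in> Ver A" "set \<theta>s \<subseteq> Cel A"
    using * cpath_Ver cpath_Cel by auto
  show "vcod A (cpath_end A u \<theta>s) = vdom A (cright A \<kappa>)"
    using cpath_hpath_ctgt[OF *(2)] ctop_path[OF *(1)] * hpath_end_unique by auto
qed

lemma composable_single:
  assumes "\<kappa> \<in> Cel A" "\<theta> \<in> Cel A" "ctop A \<kappa> = [ctgt A \<theta>]"
  shows "composable A \<kappa> (cleft A \<theta>) [\<theta>]"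
proof -
  have "vdom A (cleft A \<kappa>) = hsrc A (ctgt A \<theta>)" using ctop_path[OF assms(1)] assms(3) by simp
  then show ?thesis using assms by (simp add: composable_def cright_in cod_cleft)
qed

lemma ctop_single:
  assumes "\<kappa> \<in> Cel A" "ctop A \<kappa> = [\<Gamma>]"
  shows "vdom A (cleft A \<kappa>) = hsrc A \<Gamma>" "vdom A (cright A \<kappa>) = htgt A \<Gamma>"
  using ctop_path[OF assms(1)] assms(2) by auto

end

locale vdc_operations = vdc_graph +
  assumes vid_in: "a \<in> Ob A \<Longrightarrow> vid A a \<in> Ver A"
    and dom_vid: "a \<in> Ob A \<Longrightarrow> vdom A (vid A a) = a"
    and cod_vid: "a \<in> Ob A \<Longrightarrow> vcod A (vid A a) = a"
    and vcomp_in: "\<lbrakk>u \<in> Ver A; v \<in> Ver A; vcod A u = vdom A v\<rbrakk> \<Longrightarrow> vcomp A v u \<in> Ver A"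
    and dom_vcomp: "\<lbrakk>u \<in> Ver A; v \<in> Ver A; vcod A u = vdom A v\<rbrakk> \<Longrightarrow> vdom A (vcomp A v u) = vdom A u"
    and cod_vcomp: "\<lbrakk>u \<in> Ver A; v \<in> Ver A; vcod A u = vdom A v\<rbrakk> \<Longrightarrow> vcod A (vcomp A v u) = vcod A v"
    and cid_in: "\<Gamma> \<in> Hor A \<Longrightarrow> cid A \<Gamma> \<in> Cel A"
    and top_cid: "\<Gamma> \<in> Hor A \<Longrightarrow> ctop A (cid A \<Gamma>) = [\<Gamma>]"
    and tgt_cid: "\<Gamma> \<in> Hor A \<Longrightarrow> ctgt A (cid A \<Gamma>) = \<Gamma>"
    and left_cid: "\<Gamma> \<in> Hor A \<Longrightarrow> cleft A (cid A \<Gamma>) = vid A (hsrc A \<Gamma>)"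
    and right_cid: "\<Gamma> \<in> Hor A \<Longrightarrow> cright A (cid A \<Gamma>) = vid A (htgt A \<Gamma>)"
    and mcomp_in: "composable A \<kappa> u \<theta>s \<Longrightarrow> mcomp A \<kappa> u \<theta>s \<in> Cel A"
    and top_mcomp: "composable A \<kappa> u \<theta>s \<Longrightarrow> ctop A (mcomp A \<kappa> u \<theta>s) = concat (map (ctop A) \<theta>s)"
    and tgt_mcomp: "composable A \<kappa> u \<theta>s \<Longrightarrow> ctgt A (mcomp A \<kappa> u \<theta>s) = ctgt A \<kappa>"
    and left_mcomp: "composable A \<kappa> u \<theta>s \<Longrightarrow> cleft A (mcomp A \<kappa> u \<theta>s) = vcomp A (cleft A \<kappa>) u"
    and right_mcomp: "composable A \<kappa> u \<theta>s
          \<Longrightarrow> cright A (mcomp A \<kappa> u \<theta>s) = vcomp A (cright A \<kappa>) (cpath_end A u \<theta>s)"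
begin

lemmas boundary_rules = vdom_in vcod_in hsrc_in htgt_in ctgt_in cleft_in cright_in cod_cleft cod_cright
  vid_in dom_vid cod_vid vcomp_in dom_vcomp cod_vcomp cid_in top_cid tgt_cid left_cid right_cid
  mcomp_in top_mcomp tgt_mcomp left_mcomp right_mcomp

text \<open>On the right-hand side of the associativity law, the composites of the blocks form a path whose
  left end is \<open>v \<circ> u\<close>, because every block starts at the vertical morphism at which the previous one
  ends, also when it is empty.\<close>

lemma block_comps:
  assumes "cpath A v \<theta>s" "cpath A u (concat \<chi>ss)" "vcod A u = vdom A v"
    "map (map (ctgt A)) \<chi>ss = map (ctop A) \<theta>s"
  shows "cpath A (vcomp A v u) (block_comps A u \<theta>s \<chi>ss)
    \<and> cpath_end A (vcomp A v u) (block_comps A u \<theta>s \<chi>ss)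
        = vcomp A (cpath_end A v \<theta>s) (cpath_end A u (concat \<chi>ss))
    \<and> map (ctgt A) (block_comps A u \<theta>s \<chi>ss) = map (ctgt A) \<theta>s
    \<and> concat (map (ctop A) (block_comps A u \<theta>s \<chi>ss)) = concat (map (ctop A) (concat \<chi>ss))"
  using assms
proof (induction \<theta>s arbitrary: u v \<chi>ss)
  case Nil
  then show ?case by (auto simp: vcomp_in)
next
  case (Cons \<theta> \<theta>s)
  obtain \<chi>s \<chi>ss' where \<chi>: "\<chi>ss = \<chi>s # \<chi>ss'" using Cons.prems(4) by (cases \<chi>ss) auto
  have c: "composable A \<theta> u \<chi>s"
    using Cons.prems by (auto simp: \<chi> composable_def cpath_append)
  have "vcod A (cpath_end A u \<chi>s) = vdom A (cright A \<theta>)" using composableD(8)[OF c] .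
  then show ?case
    using Cons.IH[of "cright A \<theta>" "cpath_end A u \<chi>s" \<chi>ss'] Cons.prems c
    by (auto simp: \<chi> cpath_append cpath_end_append mcomp_in left_mcomp right_mcomp tgt_mcomp top_mcomp)
qed

lemma composable_block_comps:
  assumes "composable A \<kappa> v \<theta>s" "cpath A u (concat \<chi>ss)" "vcod A u = vdom A v"
    "map (map (ctgt A)) \<chi>ss = map (ctop A) \<theta>s"
  shows "composable A \<kappa> (vcomp A v u) (block_comps A u \<theta>s \<chi>ss)"
  using block_comps[OF composableD(2)[OF assms(1)] assms(2-4)] composableD[OF assms(1)] cpath_Ver[OF assms(2)]
    assms(3) by (simp add: composable_def cod_vcomp)

lemma cpath_cids: "hpath A a \<Gamma>s b \<Longrightarrow> cpath A (vid A a) (map (cid A) \<Gamma>s) \<and> cpath_end A (vid A a) (map (cid A) \<Gamma>s) = vid A b"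
proof (induction \<Gamma>s arbitrary: a)
  case (Cons \<Gamma> \<Gamma>s)
  then show ?case using Cons.IH[of "htgt A \<Gamma>"] by (auto simp: boundary_rules)
qed (auto simp: boundary_rules)

lemma composable_cids:
  assumes "\<kappa> \<in> Cel A"
  shows "composable A \<kappa> (vid A (vdom A (cleft A \<kappa>))) (map (cid A) (ctop A \<kappa>))"
proof -
  have "map (ctgt A) (map (cid A) (ctop A \<kappa>)) = ctop A \<kappa>"
    using ctop_Hor[OF assms] by (auto intro!: map_idI simp: boundary_rules)
  then show ?thesis
    using assms cpath_cids[OF ctop_path[OF assms]] by (simp add: composable_def boundary_rules del: map_map)
qed

lemma composable_mcomp:
  assumes "composable A \<kappa> v \<theta>s" "cpath A u (concat \<chi>ss)" "vcod A u = vdom A v"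
    "map (map (ctgt A)) \<chi>ss = map (ctop A) \<theta>s"
  shows "composable A (mcomp A \<kappa> v \<theta>s) u (concat \<chi>ss)"
proof -
  have "map (ctgt A) (concat \<chi>ss) = concat (map (ctop A) \<theta>s)"
    by (simp add: map_concat assms(4))
  moreover have "cleft A \<kappa> \<in> Ver A" using composableD[OF assms(1)] by (simp add: cleft_in)
  ultimately show ?thesis
    using assms composableD[OF assms(1)] by (simp add: composable_def mcomp_in top_mcomp left_mcomp dom_vcomp)
qed

end

sublocale virtual_double_category \<subseteq> vdc_operations
  by unfold_locales (simp_all add: vdom_Ob vcod_Ob vid_Ver vdom_vid vcod_vid vcomp_Ver vdom_vcomp vcod_vcomp
      hsrc_Ob htgt_Ob ctgt_Hor cleft_Ver cright_Ver ctop_hpath vcod_cleft vcod_cright cid_Cel ctop_cid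
      ctgt_cid cleft_cid cright_cid mcomp_Cel ctop_mcomp ctgt_mcomp cleft_mcomp cright_mcomp)

lemma (in vdc_operations) virtual_double_categoryI:
  assumes "\<And>u. u \<in> Ver A \<Longrightarrow> vcomp A u (vid A (vdom A u)) = u"
    and "\<And>u. u \<in> Ver A \<Longrightarrow> vcomp A (vid A (vcod A u)) u = u"
    and "\<And>u v w. \<lbrakk>u \<in> Ver A; v \<in> Ver A; w \<in> Ver A; vcod A u = vdom A v; vcod A v = vdom A w\<rbrakk>
          \<Longrightarrow> vcomp A (vcomp A w v) u = vcomp A w (vcomp A v u)"
    and "\<And>\<kappa>. \<kappa> \<in> Cel A \<Longrightarrow> mcomp A \<kappa> (vid A (vdom A (cleft A \<kappa>))) (map (cid A) (ctop A \<kappa>)) = \<kappa>"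
    and "\<And>\<theta>. \<theta> \<in> Cel A \<Longrightarrow> mcomp A (cid A (ctgt A \<theta>)) (cleft A \<theta>) [\<theta>] = \<theta>"
    and "\<And>\<kappa> u v \<theta>s \<chi>ss. \<lbrakk>composable A \<kappa> v \<theta>s; cpath A u (concat \<chi>ss); vcod A u = vdom A v;
            map (map (ctgt A)) \<chi>ss = map (ctop A) \<theta>s\<rbrakk>
          \<Longrightarrow> mcomp A (mcomp A \<kappa> v \<theta>s) u (concat \<chi>ss)
            = mcomp A \<kappa> (vcomp A v u) (block_comps A u \<theta>s \<chi>ss)"
  shows "virtual_double_category A"
  by unfold_locales (simp_all add: boundary_rules ctop_path assms)

context virtual_double_category
begin

lemma vcomp_vid_right': "u \<in> Ver A \<Longrightarrow> vdom A u = a \<Longrightarrow> vcomp A u (vid A a) = u"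
  and vcomp_vid_left': "u \<in> Ver A \<Longrightarrow> vcod A u = a \<Longrightarrow> vcomp A (vid A a) u = u"
  using vcomp_vid_right vcomp_vid_left by auto

text \<open>If every block has length one, all composites in the associativity law are unary, and the leftmost
  vertical morphism of each block can be read off from its only member.\<close>

lemma block_comps_singles:
  "length \<theta>s = length \<chi>s \<Longrightarrow> cpath A u \<chi>s \<Longrightarrow>
    block_comps A u \<theta>s (map (\<lambda>\<chi>. [\<chi>]) \<chi>s) = map2 (\<lambda>\<theta> \<chi>. mcomp A \<theta> (cleft A \<chi>) [\<chi>]) \<theta>s \<chi>s"
proof (induction \<chi>s arbitrary: u \<theta>s)
  case (Cons \<chi> \<chi>s)
  then show ?case by (cases \<theta>s) auto
qed simp

lemma mcomp_assoc_singles: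
  assumes "composable A \<kappa> v \<theta>s" "cpath A u \<chi>s" "vcod A u = vdom A v"
    "map (\<lambda>\<chi>. [ctgt A \<chi>]) \<chi>s = map (ctop A) \<theta>s"
  shows "mcomp A (mcomp A \<kappa> v \<theta>s) u \<chi>s
    = mcomp A \<kappa> (vcomp A v u) (map2 (\<lambda>\<theta> \<chi>. mcomp A \<theta> (cleft A \<chi>) [\<chi>]) \<theta>s \<chi>s)"
proof -
  have c: "concat (map (\<lambda>\<chi>. [\<chi>]) \<chi>s) = \<chi>s" by (induction \<chi>s) auto
  have "length \<theta>s = length \<chi>s" using assms(4) by (metis length_map)
  then show ?thesis
    using mcomp_assoc[of \<kappa> v \<theta>s u "map (\<lambda>\<chi>. [\<chi>]) \<chi>s"] assms by (simp add: c block_comps_singles o_def)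
qed

lemma mcomp_assoc_outer:
  assumes "\<kappa> \<in> Cel A" "ctop A \<kappa> = [ctgt A \<theta>]" "composable A \<theta> u \<chi>s"
  shows "mcomp A (mcomp A \<kappa> (cleft A \<theta>) [\<theta>]) u \<chi>s = mcomp A \<kappa> (vcomp A (cleft A \<theta>) u) [mcomp A \<theta> u \<chi>s]"
  using mcomp_assoc[of \<kappa> "cleft A \<theta>" "[\<theta>]" u "[\<chi>s]"] composableD[OF assms(3)]
    composable_single[OF assms(1) _ assms(2)] by simp

end


section \<open>Virtual double functors\<close>

text \<open>A virtual double functor together with names for its domain and codomain, so that its laws can be
  used as rewrite rules about these.\<close>

locale vfun =
  fixes F :: "'u vdf" and A B :: "'u vdc"
  assumes vdf: "virtual_double_functor F" and fdom_eq: "fdom F = A" and fcod_eq: "fcod F = B"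
begin

lemma vdc_dom: "virtual_double_category A" and vdc_cod: "virtual_double_category B"
  using vdf fdom_eq fcod_eq by (auto simp: virtual_double_functor_def)

lemma fOb_in: "a \<in> Ob A \<Longrightarrow> fOb F a \<in> Ob B"
  and fVer_in: "u \<in> Ver A \<Longrightarrow> fVer F u \<in> Ver B"
  and fHor_in: "\<Gamma> \<in> Hor A \<Longrightarrow> fHor F \<Gamma> \<in> Hor B"
  and fCel_in: "\<theta> \<in> Cel A \<Longrightarrow> fCel F \<theta> \<in> Cel B"
  using virtual_double_functor.fOb_maps[OF vdf] virtual_double_functor.fVer_maps[OF vdf]
    virtual_double_functor.fHor_maps[OF vdf] virtual_double_functor.fCel_maps[OF vdf]
  unfolding fdom_eq fcod_eq by auto

lemmas dom_fVer = virtual_double_functor.fVer_vdom[OF vdf, unfolded fdom_eq fcod_eq]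
lemmas cod_fVer = virtual_double_functor.fVer_vcod[OF vdf, unfolded fdom_eq fcod_eq]
lemmas fVer_id = virtual_double_functor.fVer_vid[OF vdf, unfolded fdom_eq fcod_eq]
lemmas fVer_comp = virtual_double_functor.fVer_vcomp[OF vdf, unfolded fdom_eq fcod_eq]
lemmas src_fHor = virtual_double_functor.fHor_hsrc[OF vdf, unfolded fdom_eq fcod_eq]
lemmas tgt_fHor = virtual_double_functor.fHor_htgt[OF vdf, unfolded fdom_eq fcod_eq]
lemmas top_fCel = virtual_double_functor.fCel_ctop[OF vdf, unfolded fdom_eq fcod_eq]
lemmas tgt_fCel = virtual_double_functor.fCel_ctgt[OF vdf, unfolded fdom_eq fcod_eq]
lemmas left_fCel = virtual_double_functor.fCel_cleft[OF vdf, unfolded fdom_eq fcod_eq]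
lemmas right_fCel = virtual_double_functor.fCel_cright[OF vdf, unfolded fdom_eq fcod_eq]
lemmas fCel_id = virtual_double_functor.fCel_cid[OF vdf, unfolded fdom_eq fcod_eq]
lemmas fCel_comp = virtual_double_functor.fCel_mcomp[OF vdf, unfolded fdom_eq fcod_eq]

lemmas fun_rules = fOb_in fVer_in fHor_in fCel_in dom_fVer cod_fVer fVer_id fVer_comp src_fHor tgt_fHor
  top_fCel tgt_fCel left_fCel right_fCel fCel_id fCel_comp

end

sublocale vfun \<subseteq> A: virtual_double_category A by (rule vdc_dom)
sublocale vfun \<subseteq> B: virtual_double_category B by (rule vdc_cod)

text \<open>Paths and composability are preserved by every map that respects boundaries. This is needed for maps
  that are not yet known to be virtual double functors, or whose domain is not yet known to satisfy the
  equations of a virtual double category.\<close>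

definition boundary_map ::
  "'u vdc \<Rightarrow> 'u vdc \<Rightarrow> ('u \<Rightarrow> 'u) \<Rightarrow> ('u \<Rightarrow> 'u) \<Rightarrow> ('u \<Rightarrow> 'u) \<Rightarrow> ('u \<Rightarrow> 'u) \<Rightarrow> bool" where
  "boundary_map A B fO fV fH fC \<longleftrightarrow>
    (\<forall>a\<in>Ob A. fO a \<in> Ob B) \<and>
    (\<forall>u\<in>Ver A. fV u \<in> Ver B \<and> vdom B (fV u) = fO (vdom A u) \<and> vcod B (fV u) = fO (vcod A u)) \<and>
    (\<forall>\<Gamma>\<in>Hor A. fH \<Gamma> \<in> Hor B \<and> hsrc B (fH \<Gamma>) = fO (hsrc A \<Gamma>) \<and> htgt B (fH \<Gamma>) = fO (htgt A \<Gamma>)) \<and>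
    (\<forall>\<theta>\<in>Cel A. fC \<theta> \<in> Cel B \<and> ctop B (fC \<theta>) = map fH (ctop A \<theta>) \<and> ctgt B (fC \<theta>) = fH (ctgt A \<theta>) \<and>
      cleft B (fC \<theta>) = fV (cleft A \<theta>) \<and> cright B (fC \<theta>) = fV (cright A \<theta>))"

lemma boundary_map_cpath:
  "boundary_map A B fO fV fH fC \<Longrightarrow> cpath A u \<theta>s
    \<Longrightarrow> cpath B (fV u) (map fC \<theta>s) \<and> cpath_end B (fV u) (map fC \<theta>s) = fV (cpath_end A u \<theta>s)"
proof (induction \<theta>s arbitrary: u)
  case (Cons \<theta> \<theta>s)
  then show ?case using Cons.IH[of "cright A \<theta>"] by (auto simp: boundary_map_def)
qed (auto simp: boundary_map_def)

lemma boundary_map_composable: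
  assumes "vdc_graph A" "boundary_map A B fO fV fH fC" "composable A \<kappa> u \<theta>s"
  shows "composable B (fC \<kappa>) (fV u) (map fC \<theta>s)"
proof -
  interpret vdc_graph A by fact
  note * = composableD[OF assms(3)]
  have "map (ctgt B) (map fC \<theta>s) = map fH (map (ctgt A) \<theta>s)"
    using *(7) assms(2) by (auto simp: boundary_map_def)
  then show ?thesis
    using * assms(2) boundary_map_cpath[OF assms(2) *(2)]
    by (simp add: composable_def boundary_map_def cleft_in del: map_map)
qed

context vfun
begin

lemma boundary_map: "boundary_map A B (fOb F) (fVer F) (fHor F) (fCel F)"
  by (simp add: boundary_map_def fun_rules)

lemmas cpath_fCel = boundary_map_cpath[OF boundary_map]
lemmas composable_fCel = boundary_map_composable[OF A.vdc_graph_axioms boundary_map]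

lemma extensional: "fOb F \<in> extensional (Ob A)" "fVer F \<in> extensional (Ver A)"
  "fHor F \<in> extensional (Hor A)" "fCel F \<in> extensional (Cel A)"
  using virtual_double_functor.fOb_maps[OF vdf] virtual_double_functor.fVer_maps[OF vdf]
    virtual_double_functor.fHor_maps[OF vdf] virtual_double_functor.fCel_maps[OF vdf]
  unfolding fdom_eq fcod_eq by (auto simp: PiE_def)

end

lemma vfun_iff: "virtual_double_functor F \<longleftrightarrow> vfun F (fdom F) (fcod F)"
  by (simp add: vfun_def)

lemma vfunI:
  assumes "virtual_double_category A" "virtual_double_category B" "fdom F = A" "fcod F = B"
    and "boundary_map A B (fOb F) (fVer F) (fHor F) (fCel F)"
    and "fOb F \<in> extensional (Ob A)" "fVer F \<in> extensional (Ver A)"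
      "fHor F \<in> extensional (Hor A)" "fCel F \<in> extensional (Cel A)"
    and "\<And>a. a \<in> Ob A \<Longrightarrow> fVer F (vid A a) = vid B (fOb F a)"
    and "\<And>u v. \<lbrakk>u \<in> Ver A; v \<in> Ver A; vcod A u = vdom A v\<rbrakk>
      \<Longrightarrow> fVer F (vcomp A v u) = vcomp B (fVer F v) (fVer F u)"
    and "\<And>\<Gamma>. \<Gamma> \<in> Hor A \<Longrightarrow> fCel F (cid A \<Gamma>) = cid B (fHor F \<Gamma>)"
    and "\<And>\<kappa> u \<theta>s. composable A \<kappa> u \<theta>s
      \<Longrightarrow> fCel F (mcomp A \<kappa> u \<theta>s) = mcomp B (fCel F \<kappa>) (fVer F u) (map (fCel F) \<theta>s)"
  shows "vfun F A B"
  unfolding vfun_def virtual_double_functor_def virtual_double_functor_axioms_def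
  using assms by (simp add: boundary_map_def PiE_def Pi_def)

lemma vfun_eqI:
  assumes "vfun F A B" "vfun G A B"
    and "\<And>a. a \<in> Ob A \<Longrightarrow> fOb F a = fOb G a" "\<And>u. u \<in> Ver A \<Longrightarrow> fVer F u = fVer G u"
    and "\<And>\<Gamma>. \<Gamma> \<in> Hor A \<Longrightarrow> fHor F \<Gamma> = fHor G \<Gamma>" "\<And>\<theta>. \<theta> \<in> Cel A \<Longrightarrow> fCel F \<theta> = fCel G \<theta>"
  shows "F = G"
proof -
  note f = vfun.extensional[OF assms(1)] and g = vfun.extensional[OF assms(2)]
  have "fdom F = fdom G" "fcod F = fcod G" using assms(1,2) by (simp_all add: vfun_def)
  moreover have "fOb F = fOb G" by (rule extensionalityI[OF f(1) g(1)]) (rule assms)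
  moreover have "fVer F = fVer G" by (rule extensionalityI[OF f(2) g(2)]) (rule assms)
  moreover have "fHor F = fHor G" by (rule extensionalityI[OF f(3) g(3)]) (rule assms)
  moreover have "fCel F = fCel G" by (rule extensionalityI[OF f(4) g(4)]) (rule assms)
  ultimately show ?thesis by (cases F; cases G) simp
qed

lemma vfun_id:
  assumes "virtual_double_category A"
  shows "vfun (id_vdf A) A A"
proof -
  interpret virtual_double_category A by fact
  have top: "map (\<lambda>\<Gamma>\<in>Hor A. \<Gamma>) (ctop A \<theta>) = ctop A \<theta>" if "\<theta> \<in> Cel A" for \<theta>
    using ctop_Hor[OF that] by (intro map_idI) auto
  have cells: "map (\<lambda>\<theta>\<in>Cel A. \<theta>) \<theta>s = \<theta>s" if "composable A \<kappa> u \<theta>s" for \<kappa> u \<theta>s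
    using composableD(7)[OF that] by (intro map_idI) auto
  show ?thesis
    by (rule vfunI)
      (use assms in \<open>simp_all add: id_vdf_def boundary_map_def boundary_rules top cells composableD\<close>)
qed

lemma comp_vdf_simps:
  "fdom (comp_vdf G F) = fdom F" "fcod (comp_vdf G F) = fcod G"
  "a \<in> Ob (fdom F) \<Longrightarrow> fOb (comp_vdf G F) a = fOb G (fOb F a)"
  "u \<in> Ver (fdom F) \<Longrightarrow> fVer (comp_vdf G F) u = fVer G (fVer F u)"
  "\<Gamma> \<in> Hor (fdom F) \<Longrightarrow> fHor (comp_vdf G F) \<Gamma> = fHor G (fHor F \<Gamma>)"
  "\<theta> \<in> Cel (fdom F) \<Longrightarrow> fCel (comp_vdf G F) \<theta> = fCel G (fCel F \<theta>)"
  by (simp_all add: comp_vdf_def compose_def)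

lemma id_vdf_simps:
  "fdom (id_vdf A) = A" "fcod (id_vdf A) = A"
  "a \<in> Ob A \<Longrightarrow> fOb (id_vdf A) a = a" "u \<in> Ver A \<Longrightarrow> fVer (id_vdf A) u = u"
  "\<Gamma> \<in> Hor A \<Longrightarrow> fHor (id_vdf A) \<Gamma> = \<Gamma>" "\<theta> \<in> Cel A \<Longrightarrow> fCel (id_vdf A) \<theta> = \<theta>"
  by (simp_all add: id_vdf_def)

lemma vfun_comp:
  assumes "vfun F A B" "vfun G B C"
  shows "vfun (comp_vdf G F) A C"
proof -
  interpret F: vfun F A B by fact
  interpret G: vfun G B C by fact
  note simps = comp_vdf_simps[where F=F, unfolded F.fdom_eq] G.fcod_eq
  have top: "map (\<lambda>\<Gamma>. fHor (comp_vdf G F) \<Gamma>) (ctop A \<theta>) = map (fHor G) (map (fHor F) (ctop A \<theta>))"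
    if "\<theta> \<in> Cel A" for \<theta>
    using F.A.ctop_Hor[OF that] by (auto simp: simps)
  have cells: "map (fCel (comp_vdf G F)) \<theta>s = map (fCel G) (map (fCel F) \<theta>s)" if "composable A \<kappa> u \<theta>s" for \<kappa> u \<theta>s
    using F.A.composableD(7)[OF that] by (auto simp: simps)
  have bm: "boundary_map A C (fOb (comp_vdf G F)) (fVer (comp_vdf G F)) (fHor (comp_vdf G F)) (fCel (comp_vdf G F))"
    unfolding boundary_map_def
    by (simp add: simps F.fun_rules G.fun_rules F.A.boundary_rules top del: map_map)
  show ?thesis
  proof (rule vfunI[OF F.vdc_dom G.vdc_cod _ _ bm])
    show "fOb (comp_vdf G F) \<in> extensional (Ob A)" "fVer (comp_vdf G F) \<in> extensional (Ver A)"
      "fHor (comp_vdf G F) \<in> extensional (Hor A)" "fCel (comp_vdf G F) \<in> extensional (Cel A)"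
      by (simp_all add: comp_vdf_def F.fdom_eq)
    fix \<kappa> u \<theta>s assume c: "composable A \<kappa> u \<theta>s"
    show "fCel (comp_vdf G F) (mcomp A \<kappa> u \<theta>s)
      = mcomp C (fCel (comp_vdf G F) \<kappa>) (fVer (comp_vdf G F) u) (map (fCel (comp_vdf G F)) \<theta>s)"
      using F.A.composableD[OF c] F.composable_fCel[OF c] c
      by (simp add: simps cells[OF c] F.fun_rules G.fun_rules F.A.boundary_rules del: map_map)
  qed (simp_all add: simps F.fun_rules G.fun_rules F.A.boundary_rules)
qed


section \<open>Vertical transformations\<close>

text \<open>For a single multicell, the argument of \<open>mcomp\<close> for the leftmost vertical morphism is redundant.\<close>

definition ucomp :: "'u vdc \<Rightarrow> 'u \<Rightarrow> 'u \<Rightarrow> 'u" where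
  "ucomp A \<kappa> \<theta> = mcomp A \<kappa> (cleft A \<theta>) [\<theta>]"

context virtual_double_category
begin

lemma ucomp_rules:
  assumes "\<kappa> \<in> Cel A" "\<theta> \<in> Cel A" "ctop A \<kappa> = [ctgt A \<theta>]"
  shows "ucomp A \<kappa> \<theta> \<in> Cel A" "ctop A (ucomp A \<kappa> \<theta>) = ctop A \<theta>" "ctgt A (ucomp A \<kappa> \<theta>) = ctgt A \<kappa>"
    "cleft A (ucomp A \<kappa> \<theta>) = vcomp A (cleft A \<kappa>) (cleft A \<theta>)"
    "cright A (ucomp A \<kappa> \<theta>) = vcomp A (cright A \<kappa>) (cright A \<theta>)"
  using composable_single[OF assms] by (simp_all add: ucomp_def boundary_rules)

lemma ucomp_assoc:
  assumes "\<kappa> \<in> Cel A" "\<theta> \<in> Cel A" "\<chi> \<in> Cel A" "ctop A \<kappa> = [ctgt A \<theta>]" "ctop A \<theta> = [ctgt A \<chi>]"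
  shows "ucomp A (ucomp A \<kappa> \<theta>) \<chi> = ucomp A \<kappa> (ucomp A \<theta> \<chi>)"
  using mcomp_assoc_outer[OF assms(1,4) composable_single[OF assms(2,3,5)]]
    ucomp_rules(4)[OF assms(2,3,5)] by (simp add: ucomp_def)

lemma ucomp_cid_left: "\<theta> \<in> Cel A \<Longrightarrow> ctgt A \<theta> = \<Gamma> \<Longrightarrow> ucomp A (cid A \<Gamma>) \<theta> = \<theta>"
  using mcomp_cid_left by (auto simp: ucomp_def)

lemma ucomp_cid_right: "\<theta> \<in> Cel A \<Longrightarrow> ctop A \<theta> = [\<Gamma>] \<Longrightarrow> ucomp A \<theta> (cid A \<Gamma>) = \<theta>"
  using mcomp_cid_right[of \<theta>] ctop_single[of \<theta> \<Gamma>] ctop_Hor[of \<theta>] by (simp add: ucomp_def boundary_rules)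

lemma ucomp_mcomp:
  assumes "\<kappa> \<in> Cel A" "ctop A \<kappa> = [ctgt A \<theta>]" "composable A \<theta> u \<chi>s"
  shows "ucomp A \<kappa> (mcomp A \<theta> u \<chi>s) = mcomp A (ucomp A \<kappa> \<theta>) u \<chi>s"
  using mcomp_assoc_outer[OF assms] by (simp add: ucomp_def left_mcomp[OF assms(3)])

lemma mcomp_ucomp:
  assumes "composable A \<kappa> v \<theta>s" "cpath A u \<chi>s" "vcod A u = vdom A v"
    "map (\<lambda>\<chi>. [ctgt A \<chi>]) \<chi>s = map (ctop A) \<theta>s"
  shows "mcomp A (mcomp A \<kappa> v \<theta>s) u \<chi>s = mcomp A \<kappa> (vcomp A v u) (map2 (ucomp A) \<theta>s \<chi>s)"
  using mcomp_assoc_singles[OF assms] by (simp add: ucomp_def)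

end

lemma (in vfun) fCel_ucomp:
  assumes "\<kappa> \<in> Cel A" "\<theta> \<in> Cel A" "ctop A \<kappa> = [ctgt A \<theta>]"
  shows "fCel F (ucomp A \<kappa> \<theta>) = ucomp B (fCel F \<kappa>) (fCel F \<theta>)"
  using A.composable_single[OF assms] assms by (simp add: ucomp_def fun_rules)

locale vtrans =
  fixes \<alpha> :: "'u vtr" and F G :: "'u vdf" and A B :: "'u vdc"
  assumes vtr: "vertical_transformation \<alpha>" and tdom_eq: "tdom \<alpha> = F" and tcod_eq: "tcod \<alpha> = G"
    and fdom_eq: "fdom F = A" and fcod_eq: "fcod F = B"
begin

lemma vfun_tdom: "vfun F A B"
  using vtr tdom_eq fdom_eq fcod_eq by (auto simp: vertical_transformation_def vfun_def)

lemma vfun_tcod: "vfun G A B"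
  using vtr tdom_eq tcod_eq fdom_eq fcod_eq vertical_transformation.same_dom[OF vtr]
    vertical_transformation.same_cod[OF vtr] by (auto simp: vertical_transformation_def vfun_def)

lemma tOb_in: "a \<in> Ob A \<Longrightarrow> tOb \<alpha> a \<in> Ver B"
  and tHor_in: "\<Gamma> \<in> Hor A \<Longrightarrow> tHor \<alpha> \<Gamma> \<in> Cel B"
  and extensional: "tOb \<alpha> \<in> extensional (Ob A)" "tHor \<alpha> \<in> extensional (Hor A)"
  using vertical_transformation.tOb_maps[OF vtr] vertical_transformation.tHor_maps[OF vtr]
  by (auto simp: tdom_eq fdom_eq fcod_eq PiE_def)

lemmas dom_tOb = vertical_transformation.vdom_tOb[OF vtr, unfolded tdom_eq tcod_eq fdom_eq fcod_eq]
lemmas cod_tOb = vertical_transformation.vcod_tOb[OF vtr, unfolded tdom_eq tcod_eq fdom_eq fcod_eq]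
lemmas tOb_nat = vertical_transformation.tOb_natural[OF vtr, unfolded tdom_eq tcod_eq fdom_eq fcod_eq]
lemmas top_tHor = vertical_transformation.ctop_tHor[OF vtr, unfolded tdom_eq tcod_eq fdom_eq fcod_eq]
lemmas tgt_tHor = vertical_transformation.ctgt_tHor[OF vtr, unfolded tdom_eq tcod_eq fdom_eq fcod_eq]
lemmas left_tHor = vertical_transformation.cleft_tHor[OF vtr, unfolded tdom_eq tcod_eq fdom_eq fcod_eq]
lemmas right_tHor = vertical_transformation.cright_tHor[OF vtr, unfolded tdom_eq tcod_eq fdom_eq fcod_eq]
lemmas tHor_nat = vertical_transformation.tHor_natural[OF vtr, unfolded tdom_eq tcod_eq fdom_eq fcod_eq,
    folded ucomp_def]

lemmas trans_rules = tOb_in tHor_in dom_tOb cod_tOb top_tHor tgt_tHor left_tHor right_tHor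

end

sublocale vtrans \<subseteq> F: vfun F A B by (rule vfun_tdom)
sublocale vtrans \<subseteq> G: vfun G A B by (rule vfun_tcod)

lemma cpath_components:
  assumes "hpath A a \<Gamma>s b" "\<And>a. a \<in> Ob A \<Longrightarrow> tO a \<in> Ver B"
    "\<And>\<Gamma>. \<Gamma> \<in> Hor A \<Longrightarrow> tH \<Gamma> \<in> Cel B \<and> cleft B (tH \<Gamma>) = tO (hsrc A \<Gamma>) \<and> cright B (tH \<Gamma>) = tO (htgt A \<Gamma>)"
  shows "cpath B (tO a) (map tH \<Gamma>s) \<and> cpath_end B (tO a) (map tH \<Gamma>s) = tO b"
  using assms(1)
proof (induction \<Gamma>s arbitrary: a)
  case (Cons \<Gamma> \<Gamma>s)
  then show ?case using Cons.IH[of "htgt A \<Gamma>"] assms(3)[of \<Gamma>] by auto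
qed (auto simp: assms(2))

lemma (in vtrans) cpath_tHor:
  "hpath A a \<Gamma>s b \<Longrightarrow> cpath B (tOb \<alpha> a) (map (tHor \<alpha>) \<Gamma>s) \<and> cpath_end B (tOb \<alpha> a) (map (tHor \<alpha>) \<Gamma>s) = tOb \<alpha> b"
  by (rule cpath_components[where A=A and tO="tOb \<alpha>" and tH="tHor \<alpha>"]) (simp_all add: trans_rules)

lemma (in vtrans) composable_tHor:
  assumes "\<theta> \<in> Cel A"
  shows "composable B (fCel G \<theta>) (tOb \<alpha> (vdom A (cleft A \<theta>))) (map (tHor \<alpha>) (ctop A \<theta>))"
proof -
  have "map (ctgt B) (map (tHor \<alpha>) (ctop A \<theta>)) = map (fHor G) (ctop A \<theta>)"
    using F.A.ctop_Hor[OF assms] by (auto simp: trans_rules)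
  then show ?thesis
    using assms cpath_tHor[OF F.A.ctop_path[OF assms]]
    by (simp add: composable_def trans_rules G.fun_rules F.A.boundary_rules del: map_map)
qed

lemma vtrans_iff:
  "vertical_transformation \<alpha> \<longleftrightarrow> vtrans \<alpha> (tdom \<alpha>) (tcod \<alpha>) (fdom (tdom \<alpha>)) (fcod (tdom \<alpha>))"
  by (simp add: vtrans_def)

lemma vtransI:
  assumes "vfun F A B" "vfun G A B" "tdom \<alpha> = F" "tcod \<alpha> = G"
    and "tOb \<alpha> \<in> extensional (Ob A)" "tHor \<alpha> \<in> extensional (Hor A)"
    and "\<And>a. a \<in> Ob A \<Longrightarrow> tOb \<alpha> a \<in> Ver B \<and> vdom B (tOb \<alpha> a) = fOb F a \<and> vcod B (tOb \<alpha> a) = fOb G a"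
    and "\<And>u. u \<in> Ver A
      \<Longrightarrow> vcomp B (tOb \<alpha> (vcod A u)) (fVer F u) = vcomp B (fVer G u) (tOb \<alpha> (vdom A u))"
    and "\<And>\<Gamma>. \<Gamma> \<in> Hor A \<Longrightarrow> tHor \<alpha> \<Gamma> \<in> Cel B \<and> ctop B (tHor \<alpha> \<Gamma>) = [fHor F \<Gamma>] \<and> ctgt B (tHor \<alpha> \<Gamma>) = fHor G \<Gamma>
      \<and> cleft B (tHor \<alpha> \<Gamma>) = tOb \<alpha> (hsrc A \<Gamma>) \<and> cright B (tHor \<alpha> \<Gamma>) = tOb \<alpha> (htgt A \<Gamma>)"
    and "\<And>\<theta>. \<theta> \<in> Cel A \<Longrightarrow> ucomp B (tHor \<alpha> (ctgt A \<theta>)) (fCel F \<theta>)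
      = mcomp B (fCel G \<theta>) (tOb \<alpha> (vdom A (cleft A \<theta>))) (map (tHor \<alpha>) (ctop A \<theta>))"
  shows "vtrans \<alpha> F G A B"
  unfolding vtrans_def vertical_transformation_def vertical_transformation_axioms_def
  using assms by (simp add: vfun_def PiE_def Pi_def ucomp_def)

lemma vtrans_eqI:
  assumes "vtrans \<alpha> F G A B" "vtrans \<beta> F G A B"
    and "\<And>a. a \<in> Ob A \<Longrightarrow> tOb \<alpha> a = tOb \<beta> a" "\<And>\<Gamma>. \<Gamma> \<in> Hor A \<Longrightarrow> tHor \<alpha> \<Gamma> = tHor \<beta> \<Gamma>"
  shows "\<alpha> = \<beta>"
proof -
  note f = vtrans.extensional[OF assms(1)] and g = vtrans.extensional[OF assms(2)]
  have "tdom \<alpha> = tdom \<beta>" "tcod \<alpha> = tcod \<beta>" using assms(1,2) by (simp_all add: vtrans_def)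
  moreover have "tOb \<alpha> = tOb \<beta>" by (rule extensionalityI[OF f(1) g(1)]) (rule assms)
  moreover have "tHor \<alpha> = tHor \<beta>" by (rule extensionalityI[OF f(2) g(2)]) (rule assms)
  ultimately show ?thesis by (cases \<alpha>; cases \<beta>) simp
qed

lemma vtrans_id:
  assumes "vfun F A B"
  shows "vtrans (id_vtr F) F F A B"
proof -
  interpret vfun F A B by fact
  note simps = id_vtr_def fdom_eq fcod_eq
  show ?thesis
  proof (rule vtransI[OF assms assms])
    fix \<theta> assume \<theta>: "\<theta> \<in> Cel A"
    have c: "map (tHor (id_vtr F)) (ctop A \<theta>) = map (cid B) (ctop B (fCel F \<theta>))"
      using A.ctop_Hor[OF \<theta>] \<theta> by (auto simp: simps fun_rules)
    show "ucomp B (tHor (id_vtr F) (ctgt A \<theta>)) (fCel F \<theta>)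
      = mcomp B (fCel F \<theta>) (tOb (id_vtr F) (vdom A (cleft A \<theta>))) (map (tHor (id_vtr F)) (ctop A \<theta>))"
      unfolding c using \<theta> B.mcomp_cid_right[of "fCel F \<theta>"]
      by (simp add: simps fun_rules A.boundary_rules B.ucomp_cid_left)
  qed (simp_all add: simps fun_rules A.boundary_rules B.boundary_rules B.vcomp_vid_right' B.vcomp_vid_left')
qed

lemma vcomp_vtr_simps:
  assumes "vtrans \<alpha> F G A B"
  shows "tdom (vcomp_vtr \<beta> \<alpha>) = F" "tcod (vcomp_vtr \<beta> \<alpha>) = tcod \<beta>"
    "a \<in> Ob A \<Longrightarrow> tOb (vcomp_vtr \<beta> \<alpha>) a = vcomp B (tOb \<beta> a) (tOb \<alpha> a)"
    "\<Gamma> \<in> Hor A \<Longrightarrow> tHor (vcomp_vtr \<beta> \<alpha>) \<Gamma> = ucomp B (tHor \<beta> \<Gamma>) (tHor \<alpha> \<Gamma>)"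
    "tOb (vcomp_vtr \<beta> \<alpha>) \<in> extensional (Ob A)" "tHor (vcomp_vtr \<beta> \<alpha>) \<in> extensional (Hor A)"
proof -
  interpret vtrans \<alpha> F G A B by fact
  show "tdom (vcomp_vtr \<beta> \<alpha>) = F" "tcod (vcomp_vtr \<beta> \<alpha>) = tcod \<beta>"
    "a \<in> Ob A \<Longrightarrow> tOb (vcomp_vtr \<beta> \<alpha>) a = vcomp B (tOb \<beta> a) (tOb \<alpha> a)"
    "\<Gamma> \<in> Hor A \<Longrightarrow> tHor (vcomp_vtr \<beta> \<alpha>) \<Gamma> = ucomp B (tHor \<beta> \<Gamma>) (tHor \<alpha> \<Gamma>)"
    "tOb (vcomp_vtr \<beta> \<alpha>) \<in> extensional (Ob A)" "tHor (vcomp_vtr \<beta> \<alpha>) \<in> extensional (Hor A)"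
    by (simp_all add: vcomp_vtr_def Let_def tdom_eq fdom_eq fcod_eq ucomp_def trans_rules)
qed

text \<open>The naturality condition at a multicell \<open>\<theta>\<close> is pasted from those of \<open>\<alpha>\<close> and \<open>\<beta>\<close>: the component of \<open>\<alpha>\<close>
  is moved past \<open>\<theta>\<close>, then that of \<open>\<beta>\<close>, and by associativity the two rows of components over the top
  of \<open>\<theta>\<close> are composed entry by entry.\<close>

lemma vtrans_vcomp:
  assumes "vtrans \<alpha> F G A B" "vtrans \<beta> G H A B"
  shows "vtrans (vcomp_vtr \<beta> \<alpha>) F H A B"
proof -
  interpret a: vtrans \<alpha> F G A B by fact
  interpret b: vtrans \<beta> G H A B by fact
  note simps = vcomp_vtr_simps[OF assms(1)]
  note rules = a.trans_rules b.trans_rules a.F.fun_rules a.G.fun_rules b.G.fun_rules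
    a.F.A.boundary_rules a.F.B.boundary_rules a.F.B.ucomp_rules
  show ?thesis
  proof (rule vtransI[OF a.vfun_tdom b.vfun_tcod simps(1)])
    show "tcod (vcomp_vtr \<beta> \<alpha>) = H" by (simp add: simps b.tcod_eq)
  next
    fix u assume u: "u \<in> Ver A"
    have "vcomp B (vcomp B (tOb \<beta> (vcod A u)) (tOb \<alpha> (vcod A u))) (fVer F u)
        = vcomp B (tOb \<beta> (vcod A u)) (vcomp B (fVer G u) (tOb \<alpha> (vdom A u)))"
      using u a.tOb_nat[OF u] by (simp add: rules a.F.B.vcomp_assoc)
    also have "\<dots> = vcomp B (vcomp B (tOb \<beta> (vcod A u)) (fVer G u)) (tOb \<alpha> (vdom A u))"
      using u by (simp add: rules a.F.B.vcomp_assoc)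
    also have "\<dots> = vcomp B (fVer H u) (vcomp B (tOb \<beta> (vdom A u)) (tOb \<alpha> (vdom A u)))"
      using u b.tOb_nat[OF u] by (simp add: rules a.F.B.vcomp_assoc)
    finally show "vcomp B (tOb (vcomp_vtr \<beta> \<alpha>) (vcod A u)) (fVer F u)
      = vcomp B (fVer H u) (tOb (vcomp_vtr \<beta> \<alpha>) (vdom A u))" using u by (simp add: simps rules)
  next
    fix \<theta> assume \<theta>: "\<theta> \<in> Cel A"
    let ?x = "vdom A (cleft A \<theta>)"
    have x: "?x \<in> Ob A" using \<theta> by (simp add: rules)
    have hors: "set (ctop A \<theta>) \<subseteq> Hor A" by (rule a.F.A.ctop_Hor[OF \<theta>])
    have "ucomp B (ucomp B (tHor \<beta> (ctgt A \<theta>)) (tHor \<alpha> (ctgt A \<theta>))) (fCel F \<theta>)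
        = ucomp B (tHor \<beta> (ctgt A \<theta>)) (ucomp B (tHor \<alpha> (ctgt A \<theta>)) (fCel F \<theta>))"
    proof -
      have "ucomp B (ucomp B (tHor \<beta> (ctgt A \<theta>)) (tHor \<alpha> (ctgt A \<theta>))) (fCel F \<theta>)
        = mcomp B (ucomp B (tHor \<beta> (ctgt A \<theta>)) (tHor \<alpha> (ctgt A \<theta>))) (cleft B (fCel F \<theta>)) [fCel F \<theta>]"
        by (simp add: ucomp_def)
      also have "\<dots> = ucomp B (tHor \<beta> (ctgt A \<theta>)) (ucomp B (tHor \<alpha> (ctgt A \<theta>)) (fCel F \<theta>))"
        unfolding ucomp_def[of B "tHor \<alpha> (ctgt A \<theta>)" "fCel F \<theta>"]
        by (rule a.F.B.ucomp_mcomp[symmetric])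
          (use \<theta> a.F.B.composable_single[of "tHor \<alpha> (ctgt A \<theta>)" "fCel F \<theta>"] in \<open>simp_all add: rules\<close>)
      finally show ?thesis .
    qed
    also have "\<dots> = ucomp B (tHor \<beta> (ctgt A \<theta>)) (mcomp B (fCel G \<theta>) (tOb \<alpha> ?x) (map (tHor \<alpha>) (ctop A \<theta>)))"
      using a.tHor_nat[OF \<theta>] by simp
    also have "\<dots> = mcomp B (ucomp B (tHor \<beta> (ctgt A \<theta>)) (fCel G \<theta>)) (tOb \<alpha> ?x) (map (tHor \<alpha>) (ctop A \<theta>))"
      by (rule a.F.B.ucomp_mcomp) (use \<theta> a.composable_tHor[OF \<theta>] in \<open>simp_all add: rules\<close>)
    also have "\<dots> = mcomp B (mcomp B (fCel H \<theta>) (tOb \<beta> ?x) (map (tHor \<beta>) (ctop A \<theta>))) (tOb \<alpha> ?x)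
        (map (tHor \<alpha>) (ctop A \<theta>))"
      using b.tHor_nat[OF \<theta>] by simp
    also have "\<dots> = mcomp B (fCel H \<theta>) (vcomp B (tOb \<beta> ?x) (tOb \<alpha> ?x))
        (map2 (ucomp B) (map (tHor \<beta>) (ctop A \<theta>)) (map (tHor \<alpha>) (ctop A \<theta>)))"
      by (rule a.F.B.mcomp_ucomp[OF b.composable_tHor[OF \<theta>]])
        (use x hors a.cpath_tHor[OF a.F.A.ctop_path[OF \<theta>]] in \<open>auto simp: rules\<close>)
    also have "map2 (ucomp B) (map (tHor \<beta>) (ctop A \<theta>)) (map (tHor \<alpha>) (ctop A \<theta>))
        = map (tHor (vcomp_vtr \<beta> \<alpha>)) (ctop A \<theta>)"
      using hors by (induction "ctop A \<theta>" rule: list.induct) (auto simp: simps zip_map1 zip_map2 zip_same_conv_map)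
    finally show "ucomp B (tHor (vcomp_vtr \<beta> \<alpha>) (ctgt A \<theta>)) (fCel F \<theta>)
      = mcomp B (fCel H \<theta>) (tOb (vcomp_vtr \<beta> \<alpha>) ?x) (map (tHor (vcomp_vtr \<beta> \<alpha>)) (ctop A \<theta>))"
      using \<theta> x by (simp add: simps rules)
  qed (simp_all add: simps rules)
qed

lemma vcomp_vtr_assoc:
  assumes "vtrans \<alpha> F G A B" "vtrans \<beta> G H A B" "vtrans \<gamma> H K A B"
  shows "vcomp_vtr (vcomp_vtr \<gamma> \<beta>) \<alpha> = vcomp_vtr \<gamma> (vcomp_vtr \<beta> \<alpha>)"
proof -
  interpret a: vtrans \<alpha> F G A B by fact
  interpret b: vtrans \<beta> G H A B by fact
  interpret c: vtrans \<gamma> H K A B by fact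
  note t = vtrans_vcomp[OF assms(1,2)] vtrans_vcomp[OF assms(2,3)]
  note simps = vcomp_vtr_simps[OF assms(1)] vcomp_vtr_simps[OF assms(2)] vcomp_vtr_simps[OF t(1)]
  show ?thesis
    by (rule vtrans_eqI[OF vtrans_vcomp[OF assms(1) t(2)] vtrans_vcomp[OF t(1) assms(3)]])
      (simp_all add: simps a.trans_rules b.trans_rules c.trans_rules a.F.B.vcomp_assoc a.F.B.ucomp_assoc)
qed

lemma id_vtr_simps:
  assumes "vfun F A B"
  shows "a \<in> Ob A \<Longrightarrow> tOb (id_vtr F) a = vid B (fOb F a)"
    "\<Gamma> \<in> Hor A \<Longrightarrow> tHor (id_vtr F) \<Gamma> = cid B (fHor F \<Gamma>)"
    "tdom (id_vtr F) = F" "tcod (id_vtr F) = F"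
  using assms by (simp_all add: id_vtr_def vfun_def)

lemma vcomp_vtr_id:
  assumes "vtrans \<alpha> F G A B"
  shows "vcomp_vtr \<alpha> (id_vtr F) = \<alpha>" "vcomp_vtr (id_vtr G) \<alpha> = \<alpha>"
proof -
  interpret a: vtrans \<alpha> F G A B by fact
  note i = vtrans_id[OF a.vfun_tdom] vtrans_id[OF a.vfun_tcod]
  note simps = vcomp_vtr_simps[OF assms(1)] vcomp_vtr_simps[OF i(1)] id_vtr_simps[OF a.vfun_tdom]
     id_vtr_simps[OF a.vfun_tcod] 
  show "vcomp_vtr \<alpha> (id_vtr F) = \<alpha>"
    by (rule vtrans_eqI[OF vtrans_vcomp[OF i(1) assms] assms])
      (simp_all add: simps a.trans_rules a.F.B.vcomp_vid_right' a.F.B.ucomp_cid_right)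
  show "vcomp_vtr (id_vtr G) \<alpha> = \<alpha>"
    by (rule vtrans_eqI[OF vtrans_vcomp[OF assms i(2)] assms])
      (simp_all add: simps a.trans_rules a.F.B.vcomp_vid_left' a.F.B.ucomp_cid_left)
qed

text \<open>Horizontal composites are vertical composites of whiskerings (\<open>hcomp_vtr_whisker\<close>). Hence the laws of
  horizontal composition follow from the functoriality of whiskering and from \<open>whisker_exchange\<close>.\<close>

definition whisker_left :: "'u vdf \<Rightarrow> 'u vtr \<Rightarrow> 'u vtr" where
  "whisker_left H \<alpha> = \<lparr>tdom = comp_vdf H (tdom \<alpha>), tcod = comp_vdf H (tcod \<alpha>),
     tOb = compose (Ob (fdom (tdom \<alpha>))) (fVer H) (tOb \<alpha>),
     tHor = compose (Hor (fdom (tdom \<alpha>))) (fCel H) (tHor \<alpha>)\<rparr>"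

definition whisker_right :: "'u vtr \<Rightarrow> 'u vdf \<Rightarrow> 'u vtr" where
  "whisker_right \<beta> G = \<lparr>tdom = comp_vdf (tdom \<beta>) G, tcod = comp_vdf (tcod \<beta>) G,
     tOb = compose (Ob (fdom G)) (tOb \<beta>) (fOb G),
     tHor = compose (Hor (fdom G)) (tHor \<beta>) (fHor G)\<rparr>"

lemma whisker_left_simps:
  assumes "vtrans \<alpha> F G A B"
  shows "tdom (whisker_left H \<alpha>) = comp_vdf H F" "tcod (whisker_left H \<alpha>) = comp_vdf H G"
    "a \<in> Ob A \<Longrightarrow> tOb (whisker_left H \<alpha>) a = fVer H (tOb \<alpha> a)"
    "\<Gamma> \<in> Hor A \<Longrightarrow> tHor (whisker_left H \<alpha>) \<Gamma> = fCel H (tHor \<alpha> \<Gamma>)"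
  using assms by (simp_all add: whisker_left_def vtrans_def compose_def)

lemma whisker_right_simps:
  assumes "vfun G A B" "vtrans \<beta> H K B C"
  shows "tdom (whisker_right \<beta> G) = comp_vdf H G" "tcod (whisker_right \<beta> G) = comp_vdf K G"
    "a \<in> Ob A \<Longrightarrow> tOb (whisker_right \<beta> G) a = tOb \<beta> (fOb G a)"
    "\<Gamma> \<in> Hor A \<Longrightarrow> tHor (whisker_right \<beta> G) \<Gamma> = tHor \<beta> (fHor G \<Gamma>)"
  using assms by (simp_all add: whisker_right_def vfun_def vtrans_def compose_def)

lemma vtrans_whisker_left:
  assumes "vtrans \<alpha> F G A B" "vfun H B C"
  shows "vtrans (whisker_left H \<alpha>) (comp_vdf H F) (comp_vdf H G) A C"
proof -
  interpret a: vtrans \<alpha> F G A B by fact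
  interpret H: vfun H B C by fact
  note simps = whisker_left_simps[OF assms(1)] comp_vdf_simps[where F=F, unfolded a.F.fdom_eq]
    comp_vdf_simps[where F=G, unfolded a.G.fdom_eq]
  note rules = a.trans_rules a.F.fun_rules a.G.fun_rules H.fun_rules a.F.A.boundary_rules a.F.B.boundary_rules
  show ?thesis
  proof (rule vtransI[OF vfun_comp[OF a.vfun_tdom assms(2)] vfun_comp[OF a.vfun_tcod assms(2)]])
    fix u assume u: "u \<in> Ver A"
    show "vcomp C (tOb (whisker_left H \<alpha>) (vcod A u)) (fVer (comp_vdf H F) u)
      = vcomp C (fVer (comp_vdf H G) u) (tOb (whisker_left H \<alpha>) (vdom A u))"
      using u arg_cong[OF a.tOb_nat[OF u], of "fVer H"] by (simp add: simps rules)
  next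
    fix \<theta> assume \<theta>: "\<theta> \<in> Cel A"
    have c: "map (tHor (whisker_left H \<alpha>)) (ctop A \<theta>) = map (fCel H) (map (tHor \<alpha>) (ctop A \<theta>))"
      using a.F.A.ctop_Hor[OF \<theta>] by (auto simp: simps)
    show "ucomp C (tHor (whisker_left H \<alpha>) (ctgt A \<theta>)) (fCel (comp_vdf H F) \<theta>)
      = mcomp C (fCel (comp_vdf H G) \<theta>) (tOb (whisker_left H \<alpha>) (vdom A (cleft A \<theta>)))
          (map (tHor (whisker_left H \<alpha>)) (ctop A \<theta>))"
      using \<theta> arg_cong[OF a.tHor_nat[OF \<theta>], of "fCel H"] a.composable_tHor[OF \<theta>]
      by (simp add: simps rules c H.fCel_ucomp del: map_map)
  qed (simp_all add: simps rules, simp_all add: whisker_left_def a.tdom_eq a.F.fdom_eq)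
qed

lemma vtrans_whisker_right:
  assumes "vfun G A B" "vtrans \<beta> H K B C"
  shows "vtrans (whisker_right \<beta> G) (comp_vdf H G) (comp_vdf K G) A C"
proof -
  interpret b: vtrans \<beta> H K B C by fact
  interpret G: vfun G A B by fact
  note simps = whisker_right_simps[OF assms] comp_vdf_simps[where F=G, unfolded G.fdom_eq]
  note rules = b.trans_rules b.F.fun_rules b.G.fun_rules G.fun_rules G.A.boundary_rules b.F.A.boundary_rules
  show ?thesis
  proof (rule vtransI[OF vfun_comp[OF assms(1) b.vfun_tdom] vfun_comp[OF assms(1) b.vfun_tcod]])
    fix u assume u: "u \<in> Ver A"
    show "vcomp C (tOb (whisker_right \<beta> G) (vcod A u)) (fVer (comp_vdf H G) u)
      = vcomp C (fVer (comp_vdf K G) u) (tOb (whisker_right \<beta> G) (vdom A u))"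
      using u b.tOb_nat[of "fVer G u"] by (simp add: simps rules)
  next
    fix \<theta> assume \<theta>: "\<theta> \<in> Cel A"
    have c: "map (tHor (whisker_right \<beta> G)) (ctop A \<theta>) = map (tHor \<beta>) (map (fHor G) (ctop A \<theta>))"
      using G.A.ctop_Hor[OF \<theta>] by (auto simp: simps)
    show "ucomp C (tHor (whisker_right \<beta> G) (ctgt A \<theta>)) (fCel (comp_vdf H G) \<theta>)
      = mcomp C (fCel (comp_vdf K G) \<theta>) (tOb (whisker_right \<beta> G) (vdom A (cleft A \<theta>)))
          (map (tHor (whisker_right \<beta> G)) (ctop A \<theta>))"
      using \<theta> b.tHor_nat[of "fCel G \<theta>"] by (simp add: simps rules c del: map_map)
  qed (simp_all add: simps rules, simp_all add: whisker_right_def G.fdom_eq)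
qed

lemma hcomp_vtr_whisker:
  assumes "vtrans \<alpha> F G A B" "vtrans \<beta> H K B C"
  shows "hcomp_vtr \<beta> \<alpha> = vcomp_vtr (whisker_right \<beta> G) (whisker_left H \<alpha>)"
proof -
  interpret a: vtrans \<alpha> F G A B by fact
  interpret b: vtrans \<beta> H K B C by fact
  have "compose (Ob A) (fVer H) (tOb \<alpha>) a = fVer H (tOb \<alpha> a)" if "a \<in> Ob A" for a
    using that by (simp add: compose_def)
  then show ?thesis
    by (simp add: hcomp_vtr_def vcomp_vtr_def Let_def whisker_left_def whisker_right_def a.tdom_eq a.tcod_eq
        b.tdom_eq b.tcod_eq a.F.fdom_eq a.G.fdom_eq b.F.fcod_eq comp_vdf_simps compose_def
        a.F.A.hsrc_in cong: restrict_cong)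
qed

text \<open>This is the naturality of \<open>\<beta>\<close> at the components of \<open>\<alpha>\<close>.\<close>

lemma whisker_exchange:
  assumes "vtrans \<alpha> F G A B" "vtrans \<beta> H K B C"
  shows "vcomp_vtr (whisker_right \<beta> G) (whisker_left H \<alpha>) = vcomp_vtr (whisker_left K \<alpha>) (whisker_right \<beta> F)"
proof -
  interpret a: vtrans \<alpha> F G A B by fact
  interpret b: vtrans \<beta> H K B C by fact
  note t = vtrans_whisker_left[OF assms(1) b.vfun_tdom] vtrans_whisker_right[OF a.vfun_tcod assms(2)]
    vtrans_whisker_left[OF assms(1) b.vfun_tcod] vtrans_whisker_right[OF a.vfun_tdom assms(2)]
  note simps = vcomp_vtr_simps[OF t(1)] vcomp_vtr_simps[OF t(4)] whisker_left_simps[OF assms(1)]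
    whisker_right_simps[OF a.vfun_tcod assms(2)] whisker_right_simps[OF a.vfun_tdom assms(2)]
  show ?thesis
  proof (rule vtrans_eqI[OF vtrans_vcomp[OF t(1,2)] vtrans_vcomp[OF t(4,3)]])
    fix a assume a: "a \<in> Ob A"
    then show "tOb (vcomp_vtr (whisker_right \<beta> G) (whisker_left H \<alpha>)) a
      = tOb (vcomp_vtr (whisker_left K \<alpha>) (whisker_right \<beta> F)) a"
      using b.tOb_nat[of "tOb \<alpha> a"] by (simp add: simps a.trans_rules)
  next
    fix \<Gamma> assume \<Gamma>: "\<Gamma> \<in> Hor A"
    then have "vdom B (cleft B (tHor \<alpha> \<Gamma>)) = hsrc B (fHor F \<Gamma>)"
      using a.F.B.ctop_single[of "tHor \<alpha> \<Gamma>"] by (simp add: a.trans_rules)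
    then show "tHor (vcomp_vtr (whisker_right \<beta> G) (whisker_left H \<alpha>)) \<Gamma>
      = tHor (vcomp_vtr (whisker_left K \<alpha>) (whisker_right \<beta> F)) \<Gamma>"
      using \<Gamma> b.tHor_nat[of "tHor \<alpha> \<Gamma>"] by (simp add: simps a.trans_rules ucomp_def b.trans_rules a.F.fun_rules)
  qed
qed

lemma comp_vdf_assoc:
  assumes "vfun F A B" "vfun G B C" "vfun H C D"
  shows "comp_vdf (comp_vdf H G) F = comp_vdf H (comp_vdf G F)"
proof -
  interpret F: vfun F A B by fact
  interpret G: vfun G B C by fact
  interpret H: vfun H C D by fact
  show ?thesis
    by (rule vfun_eqI[OF vfun_comp[OF assms(1) vfun_comp[OF assms(2,3)]] vfun_comp[OF vfun_comp[OF assms(1,2)] assms(3)]])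
      (simp_all add: comp_vdf_simps F.fdom_eq G.fdom_eq F.fun_rules)
qed

lemma comp_vdf_id:
  assumes "vfun F A B"
  shows "comp_vdf F (id_vdf A) = F" "comp_vdf (id_vdf B) F = F"
proof -
  interpret F: vfun F A B by fact
  show "comp_vdf F (id_vdf A) = F"
    by (rule vfun_eqI[OF vfun_comp[OF vfun_id[OF F.vdc_dom] assms] assms]) (simp_all add: comp_vdf_simps id_vdf_simps)
  show "comp_vdf (id_vdf B) F = F"
    by (rule vfun_eqI[OF vfun_comp[OF assms vfun_id[OF F.vdc_cod]] assms])
      (simp_all add: comp_vdf_simps id_vdf_simps F.fdom_eq F.fun_rules)
qed

lemma whisker_left_vcomp:
  assumes "vtrans \<alpha> F G A B" "vtrans \<beta> G H A B" "vfun K B C"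
  shows "whisker_left K (vcomp_vtr \<beta> \<alpha>) = vcomp_vtr (whisker_left K \<beta>) (whisker_left K \<alpha>)"
proof -
  interpret a: vtrans \<alpha> F G A B by fact
  interpret b: vtrans \<beta> G H A B by fact
  interpret K: vfun K B C by fact
  note t = vtrans_vcomp[OF assms(1,2)] vtrans_whisker_left[OF assms(1,3)] vtrans_whisker_left[OF assms(2,3)]
  show ?thesis
    by (rule vtrans_eqI[OF vtrans_whisker_left[OF t(1) assms(3)] vtrans_vcomp[OF t(2,3)]])
      (simp_all add: whisker_left_simps[OF assms(1)] whisker_left_simps[OF assms(2)] whisker_left_simps[OF t(1)]
        vcomp_vtr_simps[OF assms(1)] vcomp_vtr_simps[OF t(2)] a.trans_rules b.trans_rules K.fun_rules K.fCel_ucomp)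
qed

lemma whisker_right_vcomp:
  assumes "vfun K A B" "vtrans \<alpha> F G B C" "vtrans \<beta> G H B C"
  shows "whisker_right (vcomp_vtr \<beta> \<alpha>) K = vcomp_vtr (whisker_right \<beta> K) (whisker_right \<alpha> K)"
proof -
  interpret a: vtrans \<alpha> F G B C by fact
  interpret b: vtrans \<beta> G H B C by fact
  interpret K: vfun K A B by fact
  note t = vtrans_vcomp[OF assms(2,3)] vtrans_whisker_right[OF assms(1,2)] vtrans_whisker_right[OF assms(1,3)]
  show ?thesis
    by (rule vtrans_eqI[OF vtrans_whisker_right[OF assms(1) t(1)] vtrans_vcomp[OF t(2,3)]])
      (simp_all add: whisker_right_simps[OF assms(1,2)] whisker_right_simps[OF assms(1,3)] whisker_right_simps[OF assms(1) t(1)]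
        vcomp_vtr_simps[OF assms(2)] vcomp_vtr_simps[OF t(2)] K.fun_rules)
qed

lemma whisker_left_left:
  assumes "vtrans \<alpha> F G A B" "vfun H B C" "vfun K C D"
  shows "whisker_left K (whisker_left H \<alpha>) = whisker_left (comp_vdf K H) \<alpha>"
proof -
  interpret a: vtrans \<alpha> F G A B by fact
  interpret H: vfun H B C by fact
  note t = vtrans_whisker_left[OF assms(1,2)]
  note e = comp_vdf_assoc[OF a.vfun_tdom assms(2,3)] comp_vdf_assoc[OF a.vfun_tcod assms(2,3)]
  show ?thesis
    by (rule vtrans_eqI[OF vtrans_whisker_left[OF t assms(3)]
          vtrans_whisker_left[OF assms(1) vfun_comp[OF assms(2,3)], unfolded e]])
      (simp_all add: whisker_left_simps[OF t] whisker_left_simps[OF assms(1)] comp_vdf_simps H.fdom_eq a.trans_rules)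
qed

lemma whisker_right_right:
  assumes "vfun F A B" "vfun G B C" "vtrans \<alpha> H K C D"
  shows "whisker_right (whisker_right \<alpha> G) F = whisker_right \<alpha> (comp_vdf G F)"
proof -
  interpret a: vtrans \<alpha> H K C D by fact
  interpret F: vfun F A B by fact
  note t = vtrans_whisker_right[OF assms(2,3)]
  note e = comp_vdf_assoc[OF assms(1,2) a.vfun_tdom] comp_vdf_assoc[OF assms(1,2) a.vfun_tcod]
  show ?thesis
    by (rule vtrans_eqI[OF vtrans_whisker_right[OF assms(1) t, unfolded e]
          vtrans_whisker_right[OF vfun_comp[OF assms(1,2)] assms(3)]])
      (simp_all add: whisker_right_simps[OF assms(1) t] whisker_right_simps[OF assms(2,3)]
        whisker_right_simps[OF vfun_comp[OF assms(1,2)] assms(3)] comp_vdf_simps F.fdom_eq F.fun_rules)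
qed

lemma whisker_left_right:
  assumes "vfun F A B" "vtrans \<alpha> G H B C" "vfun K C D"
  shows "whisker_right (whisker_left K \<alpha>) F = whisker_left K (whisker_right \<alpha> F)"
proof -
  interpret a: vtrans \<alpha> G H B C by fact
  interpret F: vfun F A B by fact
  note t = vtrans_whisker_left[OF assms(2,3)] vtrans_whisker_right[OF assms(1,2)]
  note e = comp_vdf_assoc[OF assms(1) a.vfun_tdom assms(3)] comp_vdf_assoc[OF assms(1) a.vfun_tcod assms(3)]
  show ?thesis
    by (rule vtrans_eqI[OF vtrans_whisker_right[OF assms(1) t(1), unfolded e]
          vtrans_whisker_left[OF t(2) assms(3)]])
      (simp_all add: whisker_right_simps[OF assms(1) t(1)] whisker_left_simps[OF assms(2)]
        whisker_right_simps[OF assms(1,2)] whisker_left_simps[OF t(2)] F.fun_rules)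
qed

lemma whisker_left_id_vdf:
  assumes "vtrans \<alpha> F G A B"
  shows "whisker_left (id_vdf B) \<alpha> = \<alpha>"
proof -
  interpret a: vtrans \<alpha> F G A B by fact
  note e = comp_vdf_id[OF a.vfun_tdom] comp_vdf_id[OF a.vfun_tcod]
  show ?thesis
    by (rule vtrans_eqI[OF vtrans_whisker_left[OF assms vfun_id[OF a.F.vdc_cod], unfolded e] assms])
      (simp_all add: whisker_left_simps[OF assms] id_vdf_simps a.trans_rules)
qed

lemma whisker_right_id_vdf:
  assumes "vtrans \<alpha> F G A B"
  shows "whisker_right \<alpha> (id_vdf A) = \<alpha>"
proof -
  interpret a: vtrans \<alpha> F G A B by fact
  note e = comp_vdf_id[OF a.vfun_tdom] comp_vdf_id[OF a.vfun_tcod]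
  note i = vfun_id[OF a.F.vdc_dom]
  show ?thesis
    by (rule vtrans_eqI[OF vtrans_whisker_right[OF i assms, unfolded e] assms])
      (simp_all add: whisker_right_simps[OF i assms] id_vdf_simps a.trans_rules)
qed

lemma whisker_left_id_vtr:
  assumes "vfun F A B" "vfun G B C"
  shows "whisker_left G (id_vtr F) = id_vtr (comp_vdf G F)"
proof -
  interpret F: vfun F A B by fact
  interpret G: vfun G B C by fact
  note i = vtrans_id[OF assms(1)] and c = vfun_comp[OF assms]
  show ?thesis
    by (rule vtrans_eqI[OF vtrans_whisker_left[OF i assms(2)] vtrans_id[OF c]])
      (simp_all add: whisker_left_simps[OF i] id_vtr_simps[OF assms(1)] id_vtr_simps[OF c] comp_vdf_simps
        F.fdom_eq F.fun_rules G.fun_rules)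
qed

lemma whisker_right_id_vtr:
  assumes "vfun F A B" "vfun G B C"
  shows "whisker_right (id_vtr G) F = id_vtr (comp_vdf G F)"
proof -
  interpret F: vfun F A B by fact
  interpret G: vfun G B C by fact
  note i = vtrans_id[OF assms(2)] and c = vfun_comp[OF assms]
  show ?thesis
    by (rule vtrans_eqI[OF vtrans_whisker_right[OF assms(1) i] vtrans_id[OF c]])
      (simp_all add: whisker_right_simps[OF assms(1) i] id_vtr_simps[OF assms(2)] id_vtr_simps[OF c] comp_vdf_simps
        F.fdom_eq F.fun_rules G.fun_rules)
qed

lemma vtrans_hcomp:
  assumes "vtrans \<alpha> F G A B" "vtrans \<beta> H K B C"
  shows "vtrans (hcomp_vtr \<beta> \<alpha>) (comp_vdf H F) (comp_vdf K G) A C"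
  unfolding hcomp_vtr_whisker[OF assms]
  by (rule vtrans_vcomp[OF vtrans_whisker_left[OF assms(1) vtrans.vfun_tdom[OF assms(2)]]
        vtrans_whisker_right[OF vtrans.vfun_tcod[OF assms(1)] assms(2)]])

lemma hcomp_id_left:
  assumes "vtrans \<alpha> F G A B" "vfun H B C"
  shows "hcomp_vtr (id_vtr H) \<alpha> = whisker_left H \<alpha>"
proof -
  interpret a: vtrans \<alpha> F G A B by fact
  show ?thesis
    using vcomp_vtr_id(2)[OF vtrans_whisker_left[OF assms]]
    by (simp add: hcomp_vtr_whisker[OF assms(1) vtrans_id[OF assms(2)]] whisker_right_id_vtr[OF a.vfun_tcod assms(2)])
qed

lemma hcomp_id_right:
  assumes "vfun F A B" "vtrans \<beta> H K B C"
  shows "hcomp_vtr \<beta> (id_vtr F) = whisker_right \<beta> F"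
proof -
  interpret b: vtrans \<beta> H K B C by fact
  show ?thesis
    using vcomp_vtr_id(1)[OF vtrans_whisker_right[OF assms]]
    by (simp add: hcomp_vtr_whisker[OF vtrans_id[OF assms(1)] assms(2)] whisker_left_id_vtr[OF assms(1) b.vfun_tdom])
qed

lemma hcomp_vtr_assoc:
  assumes "vtrans \<alpha> F G A B" "vtrans \<beta> H K B C" "vtrans \<gamma> L M C D"
  shows "hcomp_vtr (hcomp_vtr \<gamma> \<beta>) \<alpha> = hcomp_vtr \<gamma> (hcomp_vtr \<beta> \<alpha>)"
proof -
  interpret a: vtrans \<alpha> F G A B by fact
  interpret b: vtrans \<beta> H K B C by fact
  interpret c: vtrans \<gamma> L M C D by fact
  let ?\<gamma> = "whisker_right \<gamma> (comp_vdf K G)" and ?\<beta> = "whisker_left L (whisker_right \<beta> G)"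
    and ?\<alpha> = "whisker_left (comp_vdf L H) \<alpha>"
  note w = vtrans_whisker_left[OF assms(1) b.vfun_tdom] vtrans_whisker_right[OF a.vfun_tcod assms(2)]
    vtrans_whisker_left[OF assms(2) c.vfun_tdom] vtrans_whisker_right[OF b.vfun_tcod assms(3)]
  have t: "vtrans ?\<alpha> (comp_vdf L (comp_vdf H F)) (comp_vdf L (comp_vdf H G)) A D"
    "vtrans ?\<beta> (comp_vdf L (comp_vdf H G)) (comp_vdf L (comp_vdf K G)) A D"
    "vtrans ?\<gamma> (comp_vdf L (comp_vdf K G)) (comp_vdf M (comp_vdf K G)) A D"
    using vtrans_whisker_left[OF assms(1) vfun_comp[OF b.vfun_tdom c.vfun_tdom]]
      comp_vdf_assoc[OF a.vfun_tdom b.vfun_tdom c.vfun_tdom] comp_vdf_assoc[OF a.vfun_tcod b.vfun_tdom c.vfun_tdom]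
      vtrans_whisker_left[OF w(2) c.vfun_tdom]
      vtrans_whisker_right[OF vfun_comp[OF a.vfun_tcod b.vfun_tcod] assms(3)] by simp_all
  have "hcomp_vtr (hcomp_vtr \<gamma> \<beta>) \<alpha> = vcomp_vtr (whisker_right (hcomp_vtr \<gamma> \<beta>) G) ?\<alpha>"
    by (rule hcomp_vtr_whisker[OF assms(1) vtrans_hcomp[OF assms(2,3)]])
  also have "whisker_right (hcomp_vtr \<gamma> \<beta>) G = vcomp_vtr ?\<gamma> ?\<beta>"
    unfolding hcomp_vtr_whisker[OF assms(2,3)] whisker_right_vcomp[OF a.vfun_tcod w(3,4)]
    by (simp add: whisker_left_right[OF a.vfun_tcod assms(2) c.vfun_tdom]
        whisker_right_right[OF a.vfun_tcod b.vfun_tcod assms(3)])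
  finally have 1: "hcomp_vtr (hcomp_vtr \<gamma> \<beta>) \<alpha> = vcomp_vtr (vcomp_vtr ?\<gamma> ?\<beta>) ?\<alpha>" .
  have "hcomp_vtr \<gamma> (hcomp_vtr \<beta> \<alpha>) = vcomp_vtr ?\<gamma> (whisker_left L (hcomp_vtr \<beta> \<alpha>))"
    by (rule hcomp_vtr_whisker[OF vtrans_hcomp[OF assms(1,2)] assms(3)])
  also have "whisker_left L (hcomp_vtr \<beta> \<alpha>) = vcomp_vtr ?\<beta> ?\<alpha>"
    unfolding hcomp_vtr_whisker[OF assms(1,2)] whisker_left_vcomp[OF w(1,2) c.vfun_tdom]
    by (simp add: whisker_left_left[OF assms(1) b.vfun_tdom c.vfun_tdom])
  finally show ?thesis using 1 vcomp_vtr_assoc[OF t] by simp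
qed

text \<open>Both sides are composites of four whiskerings that differ only in the order of the middle two.\<close>

lemma hcomp_vtr_interchange:
  assumes "vtrans \<alpha> F F' A B" "vtrans \<alpha>' F' F'' A B" "vtrans \<beta> G G' B C" "vtrans \<beta>' G' G'' B C"
  shows "hcomp_vtr (vcomp_vtr \<beta>' \<beta>) (vcomp_vtr \<alpha>' \<alpha>) = vcomp_vtr (hcomp_vtr \<beta>' \<alpha>') (hcomp_vtr \<beta> \<alpha>)"
proof -
  interpret a: vtrans \<alpha> F F' A B by fact
  interpret a': vtrans \<alpha>' F' F'' A B by fact
  interpret b: vtrans \<beta> G G' B C by fact
  interpret b': vtrans \<beta>' G' G'' B C by fact
  note w = vtrans_whisker_left[OF assms(1) b.vfun_tdom] vtrans_whisker_left[OF assms(2) b.vfun_tdom]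
    vtrans_whisker_right[OF a'.vfun_tcod assms(3)] vtrans_whisker_right[OF a'.vfun_tcod assms(4)]
    vtrans_whisker_right[OF a.vfun_tcod assms(3)] vtrans_whisker_left[OF assms(2) b'.vfun_tdom]
  let ?B' = "whisker_right \<beta>' F''" and ?B = "whisker_right \<beta> F''" and ?A' = "whisker_left G \<alpha>'" and ?A = "whisker_left G \<alpha>"
  have "hcomp_vtr (vcomp_vtr \<beta>' \<beta>) (vcomp_vtr \<alpha>' \<alpha>) = vcomp_vtr (vcomp_vtr ?B' ?B) (vcomp_vtr ?A' ?A)"
    using hcomp_vtr_whisker[OF vtrans_vcomp[OF assms(1,2)] vtrans_vcomp[OF assms(3,4)]]
    by (simp add: whisker_left_vcomp[OF assms(1,2) b.vfun_tdom] whisker_right_vcomp[OF a'.vfun_tcod assms(3,4)])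
  also have "\<dots> = vcomp_vtr ?B' (vcomp_vtr (vcomp_vtr ?B ?A') ?A)"
    using vcomp_vtr_assoc[OF vtrans_vcomp[OF w(1,2)] w(3,4)] vcomp_vtr_assoc[OF w(1,2,3)] by simp
  also have "vcomp_vtr ?B ?A' = vcomp_vtr (whisker_left G' \<alpha>') (whisker_right \<beta> F')"
    by (rule whisker_exchange[OF assms(2,3)])
  also have "vcomp_vtr ?B' (vcomp_vtr (vcomp_vtr (whisker_left G' \<alpha>') (whisker_right \<beta> F')) ?A)
      = vcomp_vtr (vcomp_vtr ?B' (whisker_left G' \<alpha>')) (vcomp_vtr (whisker_right \<beta> F') ?A)"
    using vcomp_vtr_assoc[OF vtrans_vcomp[OF w(1,5)] w(6,4)] vcomp_vtr_assoc[OF w(1,5,6)] by simp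
  finally show ?thesis
    by (simp add: hcomp_vtr_whisker[OF assms(1,3)] hcomp_vtr_whisker[OF assms(2,4)])
qed


section \<open>The 2-category of virtual double categories\<close>

lemma VDBL_simps:
  "Obj (VDBL E) = {A. large_vdc E A}"
  "F \<in> Mor (VDBL E) \<longleftrightarrow> vfun F (fdom F) (fcod F) \<and> large_vdc E (fdom F) \<and> large_vdc E (fcod F)"
  "\<alpha> \<in> Two (VDBL E) \<longleftrightarrow> vtrans \<alpha> (tdom \<alpha>) (tcod \<alpha>) (fdom (tdom \<alpha>)) (fcod (tdom \<alpha>)) \<and>
    large_vdc E (fdom (tdom \<alpha>)) \<and> large_vdc E (fcod (tdom \<alpha>))"
  "src (VDBL E) = fdom" "tgt (VDBL E) = fcod" "src2 (VDBL E) = tdom" "tgt2 (VDBL E) = tcod"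
  "idm (VDBL E) = id_vdf" "cmp (VDBL E) = comp_vdf" "id2 (VDBL E) = id_vtr" "vcmp (VDBL E) = vcomp_vtr"
  "hcmp (VDBL E) = hcomp_vtr"
  by (auto simp: VDBL_def vfun_iff[symmetric] vtrans_iff[symmetric])

lemma MorE_VDBL:
  assumes "F \<in> Mor (VDBL E)"
  obtains A B where "vfun F A B" "large_vdc E A" "large_vdc E B" "fdom F = A" "fcod F = B"
  using assms by (auto simp: VDBL_simps)

lemma MorI_VDBL: "vfun F A B \<Longrightarrow> large_vdc E A \<Longrightarrow> large_vdc E B \<Longrightarrow> F \<in> Mor (VDBL E)"
  by (auto simp: VDBL_simps vfun_def)

lemma TwoE_VDBL:
  assumes "\<alpha> \<in> Two (VDBL E)"
  obtains F G A B where "vtrans \<alpha> F G A B" "large_vdc E A" "large_vdc E B" "tdom \<alpha> = F" "tcod \<alpha> = G"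
    "fdom F = A" "fcod F = B" "fdom G = A" "fcod G = B"
proof -
  have v: "vtrans \<alpha> (tdom \<alpha>) (tcod \<alpha>) (fdom (tdom \<alpha>)) (fcod (tdom \<alpha>))"
    using assms by (simp add: VDBL_simps)
  show thesis
    using that[OF v] assms vtrans.vfun_tcod[OF v] by (simp add: VDBL_simps vfun_def)
qed

lemma TwoI_VDBL: "vtrans \<alpha> F G A B \<Longrightarrow> large_vdc E A \<Longrightarrow> large_vdc E B \<Longrightarrow> \<alpha> \<in> Two (VDBL E)"
  by (auto simp: VDBL_simps vtrans_def)

lemma vfun_eqs: "vfun F A B \<Longrightarrow> fdom F = A \<and> fcod F = B"
  by (simp add: vfun_def)

lemma vtrans_eqs: "vtrans \<alpha> F G A B \<Longrightarrow> tdom \<alpha> = F \<and> tcod \<alpha> = G \<and> fdom F = A \<and> fcod F = B \<and> fdom G = A \<and> fcod G = B"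
  using vtrans.vfun_tcod[of \<alpha> F G A B] by (simp add: vtrans_def vfun_def)

lemma two_category_VDBL: "two_category (VDBL E)"
proof (unfold_locales, unfold VDBL_simps(4-12))
  fix a f g h
  show "fdom f \<in> Obj (VDBL E)" "fcod f \<in> Obj (VDBL E)" if "f \<in> Mor (VDBL E)"
    using that by (simp_all add: VDBL_simps)
  assume "a \<in> Obj (VDBL E)"
  then have a: "large_vdc E a" "virtual_double_category a" by (simp_all add: VDBL_simps large_vdc_def)
  show "id_vdf a \<in> Mor (VDBL E)" using MorI_VDBL[OF vfun_id[OF a(2)] a(1,1)] by (simp add: VDBL_simps)
  show "fdom (id_vdf a) = a" "fcod (id_vdf a) = a"
    by (simp_all add: VDBL_simps id_vdf_simps)
next
  fix f assume f: "f \<in> Mor (VDBL E)"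
  from f obtain A B where F: "vfun f A B" "large_vdc E A" "large_vdc E B" "fdom f = A" "fcod f = B"
    by (rule MorE_VDBL)
  show "comp_vdf f (id_vdf (fdom f)) = f" "comp_vdf (id_vdf (fcod f)) f = f"
    using comp_vdf_id[OF F(1)] by (simp_all add: VDBL_simps F)
  show "id_vtr f \<in> Two (VDBL E)"
    using TwoI_VDBL[OF vtrans_id[OF F(1)] F(2,3)] by (simp add: VDBL_simps)
  show "tdom (id_vtr f) = f" "tcod (id_vtr f) = f"
    by (simp_all add: VDBL_simps id_vtr_def)
  fix g assume g: "g \<in> Mor (VDBL E)" and fg: "fcod f = fdom g"
  then obtain C where G: "vfun g B C" "large_vdc E C" "fcod g = C"
    using F(5) by (auto elim!: MorE_VDBL simp: VDBL_simps)
  show "comp_vdf g f \<in> Mor (VDBL E)"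
    using MorI_VDBL[OF vfun_comp[OF F(1) G(1)] F(2) G(2)] by (simp add: VDBL_simps)
  show "fdom (comp_vdf g f) = fdom f" "fcod (comp_vdf g f) = fcod g"
    by (simp_all add: VDBL_simps comp_vdf_simps)
  show "hcomp_vtr (id_vtr g) (id_vtr f) = id_vtr (comp_vdf g f)"
    by (simp add: VDBL_simps hcomp_id_left[OF vtrans_id[OF F(1)] G(1)] whisker_left_id_vtr[OF F(1) G(1)])
  fix h assume h: "h \<in> Mor (VDBL E)" and gh: "fcod g = fdom h"
  then obtain D where H: "vfun h C D"
    using G(3) by (auto elim!: MorE_VDBL simp: VDBL_simps)
  show "comp_vdf (comp_vdf h g) f = comp_vdf h (comp_vdf g f)"
    using comp_vdf_assoc[OF F(1) G(1) H] by (simp add: VDBL_simps)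
next
  fix \<alpha> assume "\<alpha> \<in> Two (VDBL E)"
  then obtain F G A B where a: "vtrans \<alpha> F G A B" "large_vdc E A" "large_vdc E B" "tdom \<alpha> = F" "tcod \<alpha> = G"
    "fdom F = A" "fcod F = B" "fdom G = A" "fcod G = B" by (rule TwoE_VDBL)
  interpret a: vtrans \<alpha> F G A B by (rule a(1))
  show "tdom \<alpha> \<in> Mor (VDBL E)" "tcod \<alpha> \<in> Mor (VDBL E)"
    using MorI_VDBL[OF a.vfun_tdom a(2,3)] MorI_VDBL[OF a.vfun_tcod a(2,3)] by (simp_all add: VDBL_simps a)
  show "fdom (tdom \<alpha>) = fdom (tcod \<alpha>)"
    "fcod (tdom \<alpha>) = fcod (tcod \<alpha>)"
    by (simp_all add: VDBL_simps a)
  show "vcomp_vtr \<alpha> (id_vtr (tdom \<alpha>)) = \<alpha>" "vcomp_vtr (id_vtr (tcod \<alpha>)) \<alpha> = \<alpha>"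
    using vcomp_vtr_id[OF a(1)] by (simp_all add: VDBL_simps a)
  show "hcomp_vtr \<alpha> (id_vtr (id_vdf (fdom (tdom \<alpha>)))) = \<alpha>"
    by (simp add: VDBL_simps a hcomp_id_right[OF vfun_id[OF a.F.vdc_dom] a(1)] whisker_right_id_vdf[OF a(1)])
  show "hcomp_vtr (id_vtr (id_vdf (fcod (tdom \<alpha>)))) \<alpha> = \<alpha>"
    by (simp add: VDBL_simps a hcomp_id_left[OF a(1) vfun_id[OF a.F.vdc_cod]] whisker_left_id_vdf[OF a(1)])
  show "vcomp_vtr \<beta> \<alpha> \<in> Two (VDBL E)" "tdom (vcomp_vtr \<beta> \<alpha>) = tdom \<alpha>"
    "tcod (vcomp_vtr \<beta> \<alpha>) = tcod \<beta>"
    if \<beta>: "\<beta> \<in> Two (VDBL E)" and ab: "tcod \<alpha> = tdom \<beta>" for \<beta>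
  proof -
    obtain H where b: "vtrans \<beta> G H A B" "tcod \<beta> = H"
      using \<beta> ab a by (auto elim!: TwoE_VDBL simp: VDBL_simps)
    show "vcomp_vtr \<beta> \<alpha> \<in> Two (VDBL E)" "tdom (vcomp_vtr \<beta> \<alpha>) = tdom \<alpha>"
      "tcod (vcomp_vtr \<beta> \<alpha>) = tcod \<beta>"
      using TwoI_VDBL[OF vtrans_vcomp[OF a(1) b(1)] a(2,3)] vtrans_eqs[OF vtrans_vcomp[OF a(1) b(1)]]
      by (simp_all add: VDBL_simps a b)
  qed
  show "vcomp_vtr (vcomp_vtr \<gamma> \<beta>) \<alpha> = vcomp_vtr \<gamma> (vcomp_vtr \<beta> \<alpha>)"
    if \<beta>: "\<beta> \<in> Two (VDBL E)" and \<gamma>: "\<gamma> \<in> Two (VDBL E)" and ab: "tcod \<alpha> = tdom \<beta>"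
      and bc: "tcod \<beta> = tdom \<gamma>" for \<beta> \<gamma>
  proof -
    obtain H where b': "vtrans \<beta> G H A B" "tcod \<beta> = H"
      using \<beta> ab a by (auto elim!: TwoE_VDBL simp: VDBL_simps)
    note b = b' vtrans_eqs[OF b'(1)]
    obtain K where c: "vtrans \<gamma> H K A B"
      using \<gamma> bc b by (auto elim!: TwoE_VDBL simp: VDBL_simps)
    show ?thesis using vcomp_vtr_assoc[OF a(1) b(1) c] by (simp add: VDBL_simps)
  qed
  have next2: "\<exists>H K C. vtrans \<beta> H K B C \<and> large_vdc E C \<and> tdom \<beta> = H \<and> tcod \<beta> = K \<and> fcod H = C"
    if "\<beta> \<in> Two (VDBL E)" "fcod (tdom \<alpha>) = fdom (tdom \<beta>)" for \<beta>
    using that a by (auto elim!: TwoE_VDBL simp: VDBL_simps)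
  show "hcomp_vtr \<beta> \<alpha> \<in> Two (VDBL E)"
    "tdom (hcomp_vtr \<beta> \<alpha>) = comp_vdf (tdom \<beta>) (tdom \<alpha>)"
    "tcod (hcomp_vtr \<beta> \<alpha>) = comp_vdf (tcod \<beta>) (tcod \<alpha>)"
    if \<beta>: "\<beta> \<in> Two (VDBL E)" and ab: "fcod (tdom \<alpha>) = fdom (tdom \<beta>)" for \<beta>
  proof -
    obtain H K C where b: "vtrans \<beta> H K B C" "large_vdc E C" "tdom \<beta> = H" "tcod \<beta> = K"
      using next2[OF \<beta> ab] by blast
    show "hcomp_vtr \<beta> \<alpha> \<in> Two (VDBL E)"
      "tdom (hcomp_vtr \<beta> \<alpha>) = comp_vdf (tdom \<beta>) (tdom \<alpha>)"
      "tcod (hcomp_vtr \<beta> \<alpha>) = comp_vdf (tcod \<beta>) (tcod \<alpha>)"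
      using TwoI_VDBL[OF vtrans_hcomp[OF a(1) b(1)] a(2) b(2)] vtrans_eqs[OF vtrans_hcomp[OF a(1) b(1)]]
      by (simp_all add: VDBL_simps a b)
  qed
  show "hcomp_vtr (hcomp_vtr \<gamma> \<beta>) \<alpha> = hcomp_vtr \<gamma> (hcomp_vtr \<beta> \<alpha>)"
    if \<beta>: "\<beta> \<in> Two (VDBL E)" and \<gamma>: "\<gamma> \<in> Two (VDBL E)"
      and ab: "fcod (tdom \<alpha>) = fdom (tdom \<beta>)"
      and bc: "fcod (tdom \<beta>) = fdom (tdom \<gamma>)" for \<beta> \<gamma>
  proof -
    obtain H K C where b: "vtrans \<beta> H K B C" "tdom \<beta> = H" "tcod \<beta> = K" "fcod H = C"
      using next2[OF \<beta> ab] by blast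
    obtain L M D where c: "vtrans \<gamma> L M C D"
      using \<gamma> bc b by (auto elim!: TwoE_VDBL simp: VDBL_simps)
    show ?thesis using hcomp_vtr_assoc[OF a(1) b(1) c] by (simp add: VDBL_simps)
  qed
  show "hcomp_vtr (vcomp_vtr \<beta>' \<beta>) (vcomp_vtr \<alpha>' \<alpha>)
      = vcomp_vtr (hcomp_vtr \<beta>' \<alpha>') (hcomp_vtr \<beta> \<alpha>)"
    if \<alpha>': "\<alpha>' \<in> Two (VDBL E)" and \<beta>: "\<beta> \<in> Two (VDBL E)" and \<beta>': "\<beta>' \<in> Two (VDBL E)"
      and aa: "tcod \<alpha> = tdom \<alpha>'" and bb: "tcod \<beta> = tdom \<beta>'"
      and ab: "fcod (tdom \<alpha>) = fdom (tdom \<beta>)" for \<alpha>' \<beta> \<beta>'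
  proof -
    obtain H K C where b: "vtrans \<beta> H K B C" "tdom \<beta> = H" "tcod \<beta> = K"
      using next2[OF \<beta> ab] by blast
    obtain G' where a': "vtrans \<alpha>' G G' A B"
      using \<alpha>' aa a by (auto elim!: TwoE_VDBL simp: VDBL_simps)
    obtain K' where b': "vtrans \<beta>' K K' B C"
      using \<beta>' bb b vtrans_eqs[OF b(1)] by (auto elim!: TwoE_VDBL simp: VDBL_simps)
    show ?thesis using hcomp_vtr_interchange[OF a(1) a' b(1) b'] by (simp add: VDBL_simps)
  qed
qed


section \<open>Functors and transformations from families of maps\<close>

definition mk_vdf :: "'u vdc \<Rightarrow> 'u vdc \<Rightarrow> ('u \<Rightarrow> 'u) \<Rightarrow> ('u \<Rightarrow> 'u) \<Rightarrow> ('u \<Rightarrow> 'u) \<Rightarrow> ('u \<Rightarrow> 'u) \<Rightarrow> 'u vdf" where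
  "mk_vdf A B fO fV fH fC = \<lparr>fdom = A, fcod = B, fOb = restrict fO (Ob A), fVer = restrict fV (Ver A),
     fHor = restrict fH (Hor A), fCel = restrict fC (Cel A)\<rparr>"

lemma mk_vdf_simps:
  "fdom (mk_vdf A B fO fV fH fC) = A" "fcod (mk_vdf A B fO fV fH fC) = B"
  "a \<in> Ob A \<Longrightarrow> fOb (mk_vdf A B fO fV fH fC) a = fO a"
  "u \<in> Ver A \<Longrightarrow> fVer (mk_vdf A B fO fV fH fC) u = fV u"
  "\<Gamma> \<in> Hor A \<Longrightarrow> fHor (mk_vdf A B fO fV fH fC) \<Gamma> = fH \<Gamma>"
  "\<theta> \<in> Cel A \<Longrightarrow> fCel (mk_vdf A B fO fV fH fC) \<theta> = fC \<theta>"
  by (simp_all add: mk_vdf_def)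

lemma vfun_mk_vdf:
  assumes "virtual_double_category A" "virtual_double_category B" "boundary_map A B fO fV fH fC"
    and "\<And>a. a \<in> Ob A \<Longrightarrow> fV (vid A a) = vid B (fO a)"
    and "\<And>u v. \<lbrakk>u \<in> Ver A; v \<in> Ver A; vcod A u = vdom A v\<rbrakk> \<Longrightarrow> fV (vcomp A v u) = vcomp B (fV v) (fV u)"
    and "\<And>\<Gamma>. \<Gamma> \<in> Hor A \<Longrightarrow> fC (cid A \<Gamma>) = cid B (fH \<Gamma>)"
    and "\<And>\<kappa> u \<theta>s. composable A \<kappa> u \<theta>s \<Longrightarrow> fC (mcomp A \<kappa> u \<theta>s) = mcomp B (fC \<kappa>) (fV u) (map fC \<theta>s)"
  shows "vfun (mk_vdf A B fO fV fH fC) A B"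
proof -
  interpret A: virtual_double_category A by fact
  have tops: "map (fHor (mk_vdf A B fO fV fH fC)) (ctop A \<theta>) = map fH (ctop A \<theta>)" if "\<theta> \<in> Cel A" for \<theta>
    using A.ctop_Hor[OF that] by (auto simp: mk_vdf_simps)
  have cells: "map (fCel (mk_vdf A B fO fV fH fC)) \<theta>s = map fC \<theta>s" if "composable A \<kappa> u \<theta>s" for \<kappa> u \<theta>s
    using A.composableD(7)[OF that] by (auto simp: mk_vdf_simps)
  show ?thesis
  proof (rule vfunI[OF assms(1,2)])
    show "boundary_map A B (fOb (mk_vdf A B fO fV fH fC)) (fVer (mk_vdf A B fO fV fH fC))
      (fHor (mk_vdf A B fO fV fH fC)) (fCel (mk_vdf A B fO fV fH fC))"
      using assms(3) by (simp add: boundary_map_def tops) (simp add: mk_vdf_simps A.boundary_rules)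
    fix \<kappa> u \<theta>s assume c: "composable A \<kappa> u \<theta>s"
    show "fCel (mk_vdf A B fO fV fH fC) (mcomp A \<kappa> u \<theta>s) = mcomp B (fCel (mk_vdf A B fO fV fH fC) \<kappa>)
      (fVer (mk_vdf A B fO fV fH fC) u) (map (fCel (mk_vdf A B fO fV fH fC)) \<theta>s)"
      using A.composableD[OF c] c assms(7)[OF c] by (simp add: cells[OF c] mk_vdf_simps A.boundary_rules)
  qed (simp_all add: mk_vdf_simps A.boundary_rules assms, simp_all add: mk_vdf_def)
qed

definition mk_vtr :: "'u vdf \<Rightarrow> 'u vdf \<Rightarrow> ('u \<Rightarrow> 'u) \<Rightarrow> ('u \<Rightarrow> 'u) \<Rightarrow> 'u vtr" where
  "mk_vtr F G tO tH = \<lparr>tdom = F, tcod = G, tOb = restrict tO (Ob (fdom F)), tHor = restrict tH (Hor (fdom F))\<rparr>"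

lemma mk_vtr_simps:
  "tdom (mk_vtr F G tO tH) = F" "tcod (mk_vtr F G tO tH) = G"
  "a \<in> Ob (fdom F) \<Longrightarrow> tOb (mk_vtr F G tO tH) a = tO a"
  "\<Gamma> \<in> Hor (fdom F) \<Longrightarrow> tHor (mk_vtr F G tO tH) \<Gamma> = tH \<Gamma>"
  by (simp_all add: mk_vtr_def)

lemma vtrans_mk_vtr:
  assumes "vfun F A B" "vfun G A B"
    and "\<And>a. a \<in> Ob A \<Longrightarrow> tO a \<in> Ver B \<and> vdom B (tO a) = fOb F a \<and> vcod B (tO a) = fOb G a"
    and "\<And>u. u \<in> Ver A \<Longrightarrow> vcomp B (tO (vcod A u)) (fVer F u) = vcomp B (fVer G u) (tO (vdom A u))"
    and "\<And>\<Gamma>. \<Gamma> \<in> Hor A \<Longrightarrow> tH \<Gamma> \<in> Cel B \<and> ctop B (tH \<Gamma>) = [fHor F \<Gamma>] \<and> ctgt B (tH \<Gamma>) = fHor G \<Gamma>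
      \<and> cleft B (tH \<Gamma>) = tO (hsrc A \<Gamma>) \<and> cright B (tH \<Gamma>) = tO (htgt A \<Gamma>)"
    and "\<And>\<theta>. \<theta> \<in> Cel A \<Longrightarrow> ucomp B (tH (ctgt A \<theta>)) (fCel F \<theta>)
      = mcomp B (fCel G \<theta>) (tO (vdom A (cleft A \<theta>))) (map tH (ctop A \<theta>))"
  shows "vtrans (mk_vtr F G tO tH) F G A B"
proof -
  interpret F: vfun F A B by fact
  note simps = mk_vtr_simps[where F=F, unfolded F.fdom_eq]
  have tops: "map (tHor (mk_vtr F G tO tH)) (ctop A \<theta>) = map tH (ctop A \<theta>)" if "\<theta> \<in> Cel A" for \<theta>
    using F.A.ctop_Hor[OF that] by (auto simp: simps)
  show ?thesis
  proof (rule vtransI[OF assms(1,2)])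
    show "tOb (mk_vtr F G tO tH) \<in> extensional (Ob A)" "tHor (mk_vtr F G tO tH) \<in> extensional (Hor A)"
      by (simp_all add: mk_vtr_def F.fdom_eq)
  qed (simp_all add: simps tops F.A.boundary_rules assms)
qed


section \<open>Pullbacks of virtual double categories\<close>

text \<open>Any injective pairing of elements of the universe serves to code the elements of a pullback.\<close>

definition pairing :: "'u \<times> 'u \<Rightarrow> 'u" where
  "pairing = (SOME f. inj f)"

definition pair_code :: "'u \<Rightarrow> 'u \<Rightarrow> 'u" where
  "pair_code x y = pairing (x, y)"

definition pair_fst :: "'u \<Rightarrow> 'u" where
  "pair_fst p = fst (inv pairing p)"

definition pair_snd :: "'u \<Rightarrow> 'u" where
  "pair_snd p = snd (inv pairing p)"

definition fibre_pairs :: "('u \<Rightarrow> 'u) \<Rightarrow> 'u set \<Rightarrow> ('u \<Rightarrow> 'u) \<Rightarrow> 'u set \<Rightarrow> 'u set" where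
  "fibre_pairs f S g T = {pair_code a x |a x. a \<in> S \<and> x \<in> T \<and> f a = g x}"

definition vdc_pullback :: "'u vdf \<Rightarrow> 'u vdf \<Rightarrow> 'u vdc" where
  "vdc_pullback F P = (let A = fdom F; X = fdom P in
    \<lparr>Ob = fibre_pairs (fOb F) (Ob A) (fOb P) (Ob X),
     Ver = fibre_pairs (fVer F) (Ver A) (fVer P) (Ver X),
     vdom = (\<lambda>p. pair_code (vdom A (pair_fst p)) (vdom X (pair_snd p))),
     vcod = (\<lambda>p. pair_code (vcod A (pair_fst p)) (vcod X (pair_snd p))),
     vid = (\<lambda>p. pair_code (vid A (pair_fst p)) (vid X (pair_snd p))),
     vcomp = (\<lambda>q p. pair_code (vcomp A (pair_fst q) (pair_fst p)) (vcomp X (pair_snd q) (pair_snd p))),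
     Hor = fibre_pairs (fHor F) (Hor A) (fHor P) (Hor X),
     hsrc = (\<lambda>p. pair_code (hsrc A (pair_fst p)) (hsrc X (pair_snd p))),
     htgt = (\<lambda>p. pair_code (htgt A (pair_fst p)) (htgt X (pair_snd p))),
     Cel = fibre_pairs (fCel F) (Cel A) (fCel P) (Cel X),
     ctop = (\<lambda>p. map2 pair_code (ctop A (pair_fst p)) (ctop X (pair_snd p))),
     ctgt = (\<lambda>p. pair_code (ctgt A (pair_fst p)) (ctgt X (pair_snd p))),
     cleft = (\<lambda>p. pair_code (cleft A (pair_fst p)) (cleft X (pair_snd p))),
     cright = (\<lambda>p. pair_code (cright A (pair_fst p)) (cright X (pair_snd p))),
     cid = (\<lambda>p. pair_code (cid A (pair_fst p)) (cid X (pair_snd p))),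
     mcomp = (\<lambda>k u ts. pair_code (mcomp A (pair_fst k) (pair_fst u) (map pair_fst ts))
        (mcomp X (pair_snd k) (pair_snd u) (map pair_snd ts)))\<rparr>)"

definition pullback_fst :: "'u vdf \<Rightarrow> 'u vdf \<Rightarrow> 'u vdf" where
  "pullback_fst F P = mk_vdf (vdc_pullback F P) (fdom F) pair_fst pair_fst pair_fst pair_fst"

definition pullback_snd :: "'u vdf \<Rightarrow> 'u vdf \<Rightarrow> 'u vdf" where
  "pullback_snd F P = mk_vdf (vdc_pullback F P) (fdom P) pair_snd pair_snd pair_snd pair_snd"

context grothendieck_universe
begin

lemma inj_pairing: "inj (pairing :: 'u \<times> 'u \<Rightarrow> 'u)"
  unfolding pairing_def using someI_ex[OF ex_pairing] .

lemma pair_simps [simp]: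
  fixes x y :: 'u
  shows "pair_fst (pair_code x y) = x" "pair_snd (pair_code x y) = y"
  by (simp_all add: pair_code_def pair_fst_def pair_snd_def inv_f_f[OF inj_pairing])

lemma pair_eq_iff [simp]: "pair_code (x :: 'u) y = pair_code x' y' \<longleftrightarrow> x = x' \<and> y = y'"
  using pair_simps by metis

lemma pair_code_in_fibre_pairs [simp]:
  "pair_code a x \<in> fibre_pairs f (S :: 'u set) g T \<longleftrightarrow> a \<in> S \<and> x \<in> T \<and> f a = g x"
  by (auto simp: fibre_pairs_def)

lemma fibre_pairsD:
  assumes "p \<in> fibre_pairs f (S :: 'u set) g T"
  shows "pair_fst p \<in> S" "pair_snd p \<in> T" "f (pair_fst p) = g (pair_snd p)"
    "pair_code (pair_fst p) (pair_snd p) = p"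
  using assms by (auto simp: fibre_pairs_def)

lemma in_universe_fibre_pairs:
  assumes "in_universe E S" "in_universe E T"
  shows "in_universe E (fibre_pairs f S g T)"
proof (rule in_universe_subset)
  show "in_universe E (\<Union>a\<in>S. pair_code a ` T)"
    by (intro in_universe_UN in_universe_image assms)
qed (auto simp: fibre_pairs_def)

lemma map_pair_map2:
  fixes xs ys :: "'u list"
  shows "length xs = length ys \<Longrightarrow> map pair_fst (map2 pair_code xs ys) = xs"
  "length xs = length ys \<Longrightarrow> map pair_snd (map2 pair_code xs ys) = ys"
  by (induction xs ys rule: list_induct2) auto

lemma concat_map2_pair:
  fixes f g :: "'x \<Rightarrow> 'u list"
  shows "(\<And>t. t \<in> set ts \<Longrightarrow> length (f t) = length (g t)) \<Longrightarrow>
    concat (map (\<lambda>t. map2 pair_code (f t) (g t)) ts) = map2 pair_code (concat (map f ts)) (concat (map g ts))"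
  by (induction ts) auto

end

locale vdc_cospan = grothendieck_universe E + F: vfun F A Y + P: vfun P X Y
  for E :: "'u \<Rightarrow> 'u \<Rightarrow> bool" and F P :: "'u vdf" and A X Y :: "'u vdc"
begin

abbreviation "PB \<equiv> vdc_pullback F P"

lemma PB_sel:
  "Ob PB = fibre_pairs (fOb F) (Ob A) (fOb P) (Ob X)"
  "Ver PB = fibre_pairs (fVer F) (Ver A) (fVer P) (Ver X)"
  "Hor PB = fibre_pairs (fHor F) (Hor A) (fHor P) (Hor X)"
  "Cel PB = fibre_pairs (fCel F) (Cel A) (fCel P) (Cel X)"
  "vdom PB p = pair_code (vdom A (pair_fst p)) (vdom X (pair_snd p))"
  "vcod PB p = pair_code (vcod A (pair_fst p)) (vcod X (pair_snd p))"
  "vid PB p = pair_code (vid A (pair_fst p)) (vid X (pair_snd p))"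
  "vcomp PB q p = pair_code (vcomp A (pair_fst q) (pair_fst p)) (vcomp X (pair_snd q) (pair_snd p))"
  "hsrc PB p = pair_code (hsrc A (pair_fst p)) (hsrc X (pair_snd p))"
  "htgt PB p = pair_code (htgt A (pair_fst p)) (htgt X (pair_snd p))"
  "ctop PB p = map2 pair_code (ctop A (pair_fst p)) (ctop X (pair_snd p))"
  "ctgt PB p = pair_code (ctgt A (pair_fst p)) (ctgt X (pair_snd p))"
  "cleft PB p = pair_code (cleft A (pair_fst p)) (cleft X (pair_snd p))"
  "cright PB p = pair_code (cright A (pair_fst p)) (cright X (pair_snd p))"
  "cid PB p = pair_code (cid A (pair_fst p)) (cid X (pair_snd p))"
  "mcomp PB k u ts = pair_code (mcomp A (pair_fst k) (pair_fst u) (map pair_fst ts))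
        (mcomp X (pair_snd k) (pair_snd u) (map pair_snd ts))"
  by (simp_all add: vdc_pullback_def F.fdom_eq P.fdom_eq Let_def)

lemma PB_mem:
  "pair_code a x \<in> Ob PB \<longleftrightarrow> a \<in> Ob A \<and> x \<in> Ob X \<and> fOb F a = fOb P x"
  "pair_code a x \<in> Ver PB \<longleftrightarrow> a \<in> Ver A \<and> x \<in> Ver X \<and> fVer F a = fVer P x"
  "pair_code a x \<in> Hor PB \<longleftrightarrow> a \<in> Hor A \<and> x \<in> Hor X \<and> fHor F a = fHor P x"
  "pair_code a x \<in> Cel PB \<longleftrightarrow> a \<in> Cel A \<and> x \<in> Cel X \<and> fCel F a = fCel P x"
  by (simp_all add: PB_sel)

lemmas PB_ObD = fibre_pairsD[where f="fOb F" and g="fOb P" and S="Ob A" and T="Ob X", folded PB_sel(1)]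
lemmas PB_VerD = fibre_pairsD[where f="fVer F" and g="fVer P" and S="Ver A" and T="Ver X", folded PB_sel(2)]
lemmas PB_HorD = fibre_pairsD[where f="fHor F" and g="fHor P" and S="Hor A" and T="Hor X", folded PB_sel(3)]
lemmas PB_CelD = fibre_pairsD[where f="fCel F" and g="fCel P" and S="Cel A" and T="Cel X", folded PB_sel(4)]

lemma PB_ctop:
  assumes "\<theta> \<in> Cel PB"
  shows "length (ctop A (pair_fst \<theta>)) = length (ctop X (pair_snd \<theta>))"
    "map (fHor F) (ctop A (pair_fst \<theta>)) = map (fHor P) (ctop X (pair_snd \<theta>))"
    "map pair_fst (ctop PB \<theta>) = ctop A (pair_fst \<theta>)" "map pair_snd (ctop PB \<theta>) = ctop X (pair_snd \<theta>)"
proof -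
  note * = PB_CelD[OF assms]
  show e: "map (fHor F) (ctop A (pair_fst \<theta>)) = map (fHor P) (ctop X (pair_snd \<theta>))"
    using F.top_fCel[OF *(1)] P.top_fCel[OF *(2)] *(3) by simp
  show l: "length (ctop A (pair_fst \<theta>)) = length (ctop X (pair_snd \<theta>))"
    using arg_cong[OF e, of length] by simp
  show "map pair_fst (ctop PB \<theta>) = ctop A (pair_fst \<theta>)" "map pair_snd (ctop PB \<theta>) = ctop X (pair_snd \<theta>)"
    unfolding PB_sel using map_pair_map2[OF l] by simp_all
qed

lemma PB_hpath:
  assumes "length \<Gamma>s = length \<Phi>s" "hpath A a \<Gamma>s b" "hpath X x \<Phi>s y" "map (fHor F) \<Gamma>s = map (fHor P) \<Phi>s"
    "fOb F a = fOb P x"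
  shows "hpath PB (pair_code a x) (map2 pair_code \<Gamma>s \<Phi>s) (pair_code b y)"
  using assms
proof (induction \<Gamma>s \<Phi>s arbitrary: a x rule: list_induct2)
  case Nil
  then show ?case by (auto simp: PB_sel)
next
  case (Cons \<Gamma> \<Gamma>s \<Phi> \<Phi>s)
  have "fOb F (htgt A \<Gamma>) = fOb P (htgt X \<Phi>)"
    using Cons.prems F.tgt_fHor[of \<Gamma>] P.tgt_fHor[of \<Phi>] by simp
  then show ?case using Cons by (simp add: PB_sel)
qed

lemma vdc_graph_PB: "vdc_graph PB"
proof
  fix \<theta> assume \<theta>: "\<theta> \<in> Cel PB"
  note * = PB_CelD[OF \<theta>]
  note e = F.left_fCel[OF *(1)] P.left_fCel[OF *(2)] F.right_fCel[OF *(1)] P.right_fCel[OF *(2)]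
    F.tgt_fCel[OF *(1)] P.tgt_fCel[OF *(2)]
  show "ctgt PB \<theta> \<in> Hor PB" "cleft PB \<theta> \<in> Ver PB" "cright PB \<theta> \<in> Ver PB"
    using * e by (simp_all add: PB_sel F.A.boundary_rules P.A.boundary_rules)
  have l: "fVer F (cleft A (pair_fst \<theta>)) = fVer P (cleft X (pair_snd \<theta>))" using * e by simp
  have "fOb F (vdom A (cleft A (pair_fst \<theta>))) = fOb P (vdom X (cleft X (pair_snd \<theta>)))"
    using arg_cong[OF l, of "vdom Y"] * by (simp add: F.fun_rules P.fun_rules F.A.boundary_rules P.A.boundary_rules)
  from PB_hpath[OF PB_ctop(1)[OF \<theta>] F.A.ctop_path[OF *(1)] P.A.ctop_path[OF *(2)] PB_ctop(2)[OF \<theta>] this]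
  show "hpath PB (vdom PB (cleft PB \<theta>)) (ctop PB \<theta>) (vdom PB (cright PB \<theta>))" by (simp add: PB_sel)
  show "vcod PB (cleft PB \<theta>) = hsrc PB (ctgt PB \<theta>)" "vcod PB (cright PB \<theta>) = htgt PB (ctgt PB \<theta>)"
    using * by (simp_all add: PB_sel F.A.boundary_rules P.A.boundary_rules)
next
  fix u assume "u \<in> Ver PB"
  note * = PB_VerD[OF this]
  show "vdom PB u \<in> Ob PB" "vcod PB u \<in> Ob PB"
    using * F.dom_fVer[OF *(1)] P.dom_fVer[OF *(2)] F.cod_fVer[OF *(1)] P.cod_fVer[OF *(2)]
    by (simp_all add: PB_sel F.A.boundary_rules P.A.boundary_rules)
next
  fix u assume "u \<in> Hor PB"
  note * = PB_HorD[OF this]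
  show "hsrc PB u \<in> Ob PB" "htgt PB u \<in> Ob PB"
    using * F.src_fHor[OF *(1)] P.src_fHor[OF *(2)] F.tgt_fHor[OF *(1)] P.tgt_fHor[OF *(2)]
    by (simp_all add: PB_sel F.A.boundary_rules P.A.boundary_rules)
qed

lemma boundary_map_fst: "boundary_map PB A pair_fst pair_fst pair_fst pair_fst"
  and boundary_map_snd: "boundary_map PB X pair_snd pair_snd pair_snd pair_snd"
  unfolding boundary_map_def
  by (auto dest: PB_ObD PB_VerD PB_HorD PB_CelD simp: PB_ctop) (simp_all add: PB_sel)

lemma PB_composableD:
  assumes c: "composable PB k u ts"
  shows "composable A (pair_fst k) (pair_fst u) (map pair_fst ts)"
    "composable X (pair_snd k) (pair_snd u) (map pair_snd ts)"
    "map (fCel F) (map pair_fst ts) = map (fCel P) (map pair_snd ts)"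
    "cpath_end PB u ts = pair_code (cpath_end A (pair_fst u) (map pair_fst ts)) (cpath_end X (pair_snd u) (map pair_snd ts))"
proof -
  interpret PB: vdc_graph PB by (rule vdc_graph_PB)
  note * = PB.composableD[OF c]
  show "composable A (pair_fst k) (pair_fst u) (map pair_fst ts)"
    "composable X (pair_snd k) (pair_snd u) (map pair_snd ts)"
    using boundary_map_composable[OF vdc_graph_PB boundary_map_fst c]
      boundary_map_composable[OF vdc_graph_PB boundary_map_snd c] by auto
  show "map (fCel F) (map pair_fst ts) = map (fCel P) (map pair_snd ts)"
    using *(7) by (auto simp: PB_CelD)
  show "cpath_end PB u ts = pair_code (cpath_end A (pair_fst u) (map pair_fst ts)) (cpath_end X (pair_snd u) (map pair_snd ts))"
    using PB_VerD(4)[OF *(6)] boundary_map_cpath[OF boundary_map_fst *(2)] boundary_map_cpath[OF boundary_map_snd *(2)]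
    by simp
qed

text \<open>Composites of pairs stay in the pullback because \<open>F\<close> and \<open>P\<close> preserve composites and agree on the
  factors.\<close>

lemma vdc_operations_PB: "vdc_operations PB"
proof (intro vdc_operations.intro vdc_graph_PB vdc_operations_axioms.intro)
  interpret PB: vdc_graph PB by (rule vdc_graph_PB)
  fix k u ts assume c: "composable PB k u ts"
  note * = PB.composableD[OF c] and cs = PB_composableD[OF c]
  note kD = PB_CelD[OF *(1)] and uD = PB_VerD[OF *(5)]
  show "mcomp PB k u ts \<in> Cel PB"
    using F.fCel_comp[OF cs(1)] P.fCel_comp[OF cs(2)] kD uD cs
    by (simp add: PB_sel F.A.mcomp_in P.A.mcomp_in del: map_map)
  have "ctop PB = (\<lambda>t. map2 pair_code (ctop A (pair_fst t)) (ctop X (pair_snd t)))"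
    by (rule ext) (simp add: PB_sel)
  moreover have "length (ctop A (pair_fst t)) = length (ctop X (pair_snd t))" if "t \<in> set ts" for t
    using that *(7) PB_ctop(1) by blast
  ultimately have "concat (map (ctop PB) ts)
      = map2 pair_code (concat (map (\<lambda>t. ctop A (pair_fst t)) ts)) (concat (map (\<lambda>t. ctop X (pair_snd t)) ts))"
    using concat_map2_pair[of ts "\<lambda>t. ctop A (pair_fst t)" "\<lambda>t. ctop X (pair_snd t)"] by simp
  then show "ctop PB (mcomp PB k u ts) = concat (map (ctop PB) ts)"
    using cs by (simp add: PB_sel F.A.top_mcomp P.A.top_mcomp o_def)
  show "ctgt PB (mcomp PB k u ts) = ctgt PB k" "cleft PB (mcomp PB k u ts) = vcomp PB (cleft PB k) u"
    "cright PB (mcomp PB k u ts) = vcomp PB (cright PB k) (cpath_end PB u ts)"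
    unfolding cs(4) using cs by (simp_all add: PB_sel F.A.boundary_rules P.A.boundary_rules)
qed (simp_all add: PB_mem PB_sel(5-) PB_ObD PB_VerD PB_HorD F.fun_rules P.fun_rules F.A.boundary_rules P.A.boundary_rules)

lemma map_block_comps:
  "map pair_fst (block_comps PB u \<theta>s \<chi>ss) = block_comps A (pair_fst u) (map pair_fst \<theta>s) (map (map pair_fst) \<chi>ss)"
  "map pair_snd (block_comps PB u \<theta>s \<chi>ss) = block_comps X (pair_snd u) (map pair_snd \<theta>s) (map (map pair_snd) \<chi>ss)"
proof -
  have e: "pair_fst (cpath_end PB u \<chi>s) = cpath_end A (pair_fst u) (map pair_fst \<chi>s)"
    "pair_snd (cpath_end PB u \<chi>s) = cpath_end X (pair_snd u) (map pair_snd \<chi>s)" for u \<chi>s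
    by (induction \<chi>s arbitrary: u) (simp_all add: PB_sel)
  show "map pair_fst (block_comps PB u \<theta>s \<chi>ss) = block_comps A (pair_fst u) (map pair_fst \<theta>s) (map (map pair_fst) \<chi>ss)"
    "map pair_snd (block_comps PB u \<theta>s \<chi>ss) = block_comps X (pair_snd u) (map pair_snd \<theta>s) (map (map pair_snd) \<chi>ss)"
    by (induction PB u \<theta>s \<chi>ss rule: block_comps.induct) (simp_all add: e, simp_all add: PB_sel)
qed

lemma virtual_double_category_PB: "virtual_double_category PB"
proof (rule vdc_operations.virtual_double_categoryI[OF vdc_operations_PB])
  interpret PB: vdc_operations PB by (rule vdc_operations_PB)
  show "vcomp PB u (vid PB (vdom PB u)) = u" "vcomp PB (vid PB (vcod PB u)) u = u" if "u \<in> Ver PB" for u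
    using PB_VerD[OF that] by (simp_all add: PB_sel F.A.vcomp_vid_right P.A.vcomp_vid_right F.A.vcomp_vid_left
        P.A.vcomp_vid_left)
  show "vcomp PB (vcomp PB w v) u = vcomp PB w (vcomp PB v u)"
    if "u \<in> Ver PB" "v \<in> Ver PB" "w \<in> Ver PB" "vcod PB u = vdom PB v" "vcod PB v = vdom PB w" for u v w
    using that by (simp add: PB_VerD PB_sel(5,6,8) F.A.vcomp_assoc P.A.vcomp_assoc)
  show "mcomp PB \<kappa> (vid PB (vdom PB (cleft PB \<kappa>))) (map (cid PB) (ctop PB \<kappa>)) = \<kappa>" if \<kappa>: "\<kappa> \<in> Cel PB" for \<kappa>
  proof -
    have "map pair_fst (map (cid PB) (ctop PB \<kappa>)) = map (cid A) (map pair_fst (ctop PB \<kappa>))"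
      "map pair_snd (map (cid PB) (ctop PB \<kappa>)) = map (cid X) (map pair_snd (ctop PB \<kappa>))"
      by (simp_all add: PB_sel(15))
    then show ?thesis
      using PB_CelD[OF \<kappa>] unfolding PB_sel(16) PB_ctop[OF \<kappa>]
      by (simp add: PB_sel F.A.mcomp_cid_right P.A.mcomp_cid_right del: map_map)
  qed
  show "mcomp PB (cid PB (ctgt PB \<theta>)) (cleft PB \<theta>) [\<theta>] = \<theta>" if "\<theta> \<in> Cel PB" for \<theta>
    using PB_CelD[OF that] by (simp add: PB_sel F.A.mcomp_cid_left P.A.mcomp_cid_left)
  show "mcomp PB (mcomp PB \<kappa> v \<theta>s) u (concat \<chi>ss) = mcomp PB \<kappa> (vcomp PB v u) (block_comps PB u \<theta>s \<chi>ss)"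
    if c: "composable PB \<kappa> v \<theta>s" "cpath PB u (concat \<chi>ss)" "vcod PB u = vdom PB v"
      "map (map (ctgt PB)) \<chi>ss = map (ctop PB) \<theta>s" for \<kappa> u v \<theta>s \<chi>ss
  proof -
    note cs = PB_composableD[OF c(1)]
    note p = boundary_map_cpath[OF boundary_map_fst c(2)] boundary_map_cpath[OF boundary_map_snd c(2)]
    have \<theta>: "\<And>\<theta>. \<theta> \<in> set \<theta>s \<Longrightarrow> \<theta> \<in> Cel PB" using PB.composableD(7)[OF c(1)] by auto
    have "map (map (ctgt A)) (map (map pair_fst) \<chi>ss) = map (map pair_fst) (map (map (ctgt PB)) \<chi>ss)"
      "map (map (ctgt X)) (map (map pair_snd) \<chi>ss) = map (map pair_snd) (map (map (ctgt PB)) \<chi>ss)"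
      by (simp_all add: PB_sel(12))
    then have t: "map (map (ctgt A)) (map (map pair_fst) \<chi>ss) = map (ctop A) (map pair_fst \<theta>s)"
      "map (map (ctgt X)) (map (map pair_snd) \<chi>ss) = map (ctop X) (map pair_snd \<theta>s)"
      unfolding c(4) using \<theta> by (simp_all add: PB_ctop)
    have v: "vcod A (pair_fst u) = vdom A (pair_fst v)" "vcod X (pair_snd u) = vdom X (pair_snd v)"
      using c(3) by (simp_all add: PB_sel)
    show ?thesis
      using F.A.mcomp_assoc[OF cs(1) _ v(1) t(1)] P.A.mcomp_assoc[OF cs(2) _ v(2) t(2)] p
      by (simp add: PB_sel(8,16) map_block_comps map_concat)
  qed
qed

lemma vfun_pullback_fst: "vfun (pullback_fst F P) PB A"
  and vfun_pullback_snd: "vfun (pullback_snd F P) PB X"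
  unfolding pullback_fst_def pullback_snd_def F.fdom_eq P.fdom_eq
  by (intro vfun_mk_vdf virtual_double_category_PB F.vdc_dom P.vdc_dom boundary_map_fst boundary_map_snd;
      simp add: PB_sel)+

lemma pullback_simps:
  "fdom (pullback_fst F P) = PB" "fcod (pullback_fst F P) = A"
  "fdom (pullback_snd F P) = PB" "fcod (pullback_snd F P) = X"
  "a \<in> Ob PB \<Longrightarrow> fOb (pullback_fst F P) a = pair_fst a" "a \<in> Ob PB \<Longrightarrow> fOb (pullback_snd F P) a = pair_snd a"
  "u \<in> Ver PB \<Longrightarrow> fVer (pullback_fst F P) u = pair_fst u" "u \<in> Ver PB \<Longrightarrow> fVer (pullback_snd F P) u = pair_snd u"
  "\<Gamma> \<in> Hor PB \<Longrightarrow> fHor (pullback_fst F P) \<Gamma> = pair_fst \<Gamma>" "\<Gamma> \<in> Hor PB \<Longrightarrow> fHor (pullback_snd F P) \<Gamma> = pair_snd \<Gamma>"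
  "\<theta> \<in> Cel PB \<Longrightarrow> fCel (pullback_fst F P) \<theta> = pair_fst \<theta>" "\<theta> \<in> Cel PB \<Longrightarrow> fCel (pullback_snd F P) \<theta> = pair_snd \<theta>"
  by (simp_all add: pullback_fst_def pullback_snd_def mk_vdf_simps F.fdom_eq P.fdom_eq)

lemma large_PB: "large_vdc E A \<Longrightarrow> large_vdc E X \<Longrightarrow> large_vdc E PB"
  by (simp add: large_vdc_def virtual_double_category_PB PB_sel in_universe_fibre_pairs)

lemma pullback_commutes: "comp_vdf F (pullback_fst F P) = comp_vdf P (pullback_snd F P)"
  by (rule vfun_eqI[OF vfun_comp[OF vfun_pullback_fst F.vfun_axioms] vfun_comp[OF vfun_pullback_snd P.vfun_axioms]])
    (simp_all add: comp_vdf_simps pullback_simps PB_ObD PB_VerD PB_HorD PB_CelD)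

lemma pullback_fun_eqI:
  assumes "vfun H W PB" "vfun K W PB" "comp_vdf (pullback_fst F P) H = comp_vdf (pullback_fst F P) K"
    "comp_vdf (pullback_snd F P) H = comp_vdf (pullback_snd F P) K"
  shows "H = K"
proof -
  interpret H: vfun H W PB by fact
  interpret K: vfun K W PB by fact
  note s = comp_vdf_simps[where F=H, unfolded H.fdom_eq] comp_vdf_simps[where F=K, unfolded K.fdom_eq]
    pullback_simps H.fun_rules K.fun_rules
  show ?thesis
  proof (rule vfun_eqI[OF assms(1,2)])
    show "fOb H a = fOb K a" if "a \<in> Ob W" for a
    proof -
      have "pair_fst (fOb H a) = pair_fst (fOb K a)" "pair_snd (fOb H a) = pair_snd (fOb K a)"
        using arg_cong[OF assms(3), of "\<lambda>F. fOb F a"] arg_cong[OF assms(4), of "\<lambda>F. fOb F a"] that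
        by (simp_all add: s)
      then show ?thesis
        using PB_ObD(4)[OF H.fOb_in[OF that]] PB_ObD(4)[OF K.fOb_in[OF that]] by metis
    qed
    show "fVer H a = fVer K a" if "a \<in> Ver W" for a
    proof -
      have "pair_fst (fVer H a) = pair_fst (fVer K a)" "pair_snd (fVer H a) = pair_snd (fVer K a)"
        using arg_cong[OF assms(3), of "\<lambda>F. fVer F a"] arg_cong[OF assms(4), of "\<lambda>F. fVer F a"] that
        by (simp_all add: s)
      then show ?thesis
        using PB_VerD(4)[OF H.fVer_in[OF that]] PB_VerD(4)[OF K.fVer_in[OF that]] by metis
    qed
    show "fHor H a = fHor K a" if "a \<in> Hor W" for a
    proof -
      have "pair_fst (fHor H a) = pair_fst (fHor K a)" "pair_snd (fHor H a) = pair_snd (fHor K a)"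
        using arg_cong[OF assms(3), of "\<lambda>F. fHor F a"] arg_cong[OF assms(4), of "\<lambda>F. fHor F a"] that
        by (simp_all add: s)
      then show ?thesis
        using PB_HorD(4)[OF H.fHor_in[OF that]] PB_HorD(4)[OF K.fHor_in[OF that]] by metis
    qed
    show "fCel H a = fCel K a" if "a \<in> Cel W" for a
    proof -
      have "pair_fst (fCel H a) = pair_fst (fCel K a)" "pair_snd (fCel H a) = pair_snd (fCel K a)"
        using arg_cong[OF assms(3), of "\<lambda>F. fCel F a"] arg_cong[OF assms(4), of "\<lambda>F. fCel F a"] that
        by (simp_all add: s)
      then show ?thesis
        using PB_CelD(4)[OF H.fCel_in[OF that]] PB_CelD(4)[OF K.fCel_in[OF that]] by metis
    qed
  qed
qed

lemma pullback_fun_exists: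
  assumes "vfun f W A" "vfun g W X" "comp_vdf F f = comp_vdf P g"
  shows "\<exists>h. vfun h W PB \<and> comp_vdf (pullback_fst F P) h = f \<and> comp_vdf (pullback_snd F P) h = g"
proof -
  interpret f: vfun f W A by fact
  interpret g: vfun g W X by fact
  define h where "h = mk_vdf W PB (\<lambda>a. pair_code (fOb f a) (fOb g a)) (\<lambda>a. pair_code (fVer f a) (fVer g a))
    (\<lambda>a. pair_code (fHor f a) (fHor g a)) (\<lambda>a. pair_code (fCel f a) (fCel g a))"
  note s = comp_vdf_simps[where F=f, unfolded f.fdom_eq] comp_vdf_simps[where F=g, unfolded g.fdom_eq]
  have eO: "fOb F (fOb f a) = fOb P (fOb g a)" if "a \<in> Ob W" for a
    using arg_cong[OF assms(3), of "\<lambda>F. fOb F a"] that by (simp add: s)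
  have eV: "fVer F (fVer f a) = fVer P (fVer g a)" if "a \<in> Ver W" for a
    using arg_cong[OF assms(3), of "\<lambda>F. fVer F a"] that by (simp add: s)
  have eH: "fHor F (fHor f a) = fHor P (fHor g a)" if "a \<in> Hor W" for a
    using arg_cong[OF assms(3), of "\<lambda>F. fHor F a"] that by (simp add: s)
  have eC: "fCel F (fCel f a) = fCel P (fCel g a)" if "a \<in> Cel W" for a
    using arg_cong[OF assms(3), of "\<lambda>F. fCel F a"] that by (simp add: s)
  have tops: "map2 pair_code (map u xs) (map v xs) = map (\<lambda>a. pair_code (u a) (v a)) xs" for u v :: "'u \<Rightarrow> 'u" and xs
    by (induction xs) auto
  have "vfun h W PB"
    unfolding h_def
    by (rule vfun_mk_vdf[OF f.vdc_dom virtual_double_category_PB])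
      (simp_all add: boundary_map_def PB_sel f.fun_rules g.fun_rules eO eV eH eC tops o_def)
  moreover have "comp_vdf (pullback_fst F P) h = f"
    by (rule vfun_eqI[OF vfun_comp[OF calculation vfun_pullback_fst] assms(1)])
      (simp_all add: h_def comp_vdf_simps mk_vdf_simps pullback_simps PB_sel eO eV eH eC f.fun_rules g.fun_rules)
  moreover have "comp_vdf (pullback_snd F P) h = g"
    by (rule vfun_eqI[OF vfun_comp[OF \<open>vfun h W PB\<close> vfun_pullback_snd] assms(2)])
      (simp_all add: h_def comp_vdf_simps mk_vdf_simps pullback_simps PB_sel eO eV eH eC f.fun_rules g.fun_rules)
  ultimately show ?thesis by blast
qed

lemma ucomp_PB: "ucomp PB k t = pair_code (ucomp A (pair_fst k) (pair_fst t)) (ucomp X (pair_snd k) (pair_snd t))"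
  by (simp add: ucomp_def PB_sel)

lemma pullback_trans_eqI:
  assumes "vtrans \<gamma> H K W PB" "vtrans \<delta> H K W PB"
    "whisker_left (pullback_fst F P) \<gamma> = whisker_left (pullback_fst F P) \<delta>"
    "whisker_left (pullback_snd F P) \<gamma> = whisker_left (pullback_snd F P) \<delta>"
  shows "\<gamma> = \<delta>"
proof -
  interpret c: vtrans \<gamma> H K W PB by fact
  interpret d: vtrans \<delta> H K W PB by fact
  note s = whisker_left_simps[OF assms(1)] whisker_left_simps[OF assms(2)] pullback_simps c.trans_rules d.trans_rules
  show ?thesis
  proof (rule vtrans_eqI[OF assms(1,2)])
    show "tOb \<gamma> a = tOb \<delta> a" if "a \<in> Ob W" for a
    proof -
      have "pair_fst (tOb \<gamma> a) = pair_fst (tOb \<delta> a)" "pair_snd (tOb \<gamma> a) = pair_snd (tOb \<delta> a)"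
        using arg_cong[OF assms(3), of "\<lambda>F. tOb F a"] arg_cong[OF assms(4), of "\<lambda>F. tOb F a"] that
        by (simp_all add: s)
      then show ?thesis
        using PB_VerD(4)[OF c.tOb_in[OF that]] PB_VerD(4)[OF d.tOb_in[OF that]] by metis
    qed
    show "tHor \<gamma> a = tHor \<delta> a" if "a \<in> Hor W" for a
    proof -
      have "pair_fst (tHor \<gamma> a) = pair_fst (tHor \<delta> a)" "pair_snd (tHor \<gamma> a) = pair_snd (tHor \<delta> a)"
        using arg_cong[OF assms(3), of "\<lambda>F. tHor F a"] arg_cong[OF assms(4), of "\<lambda>F. tHor F a"] that
        by (simp_all add: s)
      then show ?thesis
        using PB_CelD(4)[OF c.tHor_in[OF that]] PB_CelD(4)[OF d.tHor_in[OF that]] by metis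
    qed
  qed
qed

text \<open>The components of the mediating transformation are the pairs of components; they lie in the pullback
  by the assumption on the whiskerings with \<open>F\<close> and \<open>P\<close>.\<close>

lemma pullback_trans_exists:
  assumes "vfun H W PB" "vfun K W PB"
    "vtrans \<alpha> (comp_vdf (pullback_fst F P) H) (comp_vdf (pullback_fst F P) K) W A"
    "vtrans \<beta> (comp_vdf (pullback_snd F P) H) (comp_vdf (pullback_snd F P) K) W X"
    "whisker_left F \<alpha> = whisker_left P \<beta>"
  shows "\<exists>\<gamma>. vtrans \<gamma> H K W PB \<and> whisker_left (pullback_fst F P) \<gamma> = \<alpha> \<and> whisker_left (pullback_snd F P) \<gamma> = \<beta>"
proof -
  interpret H: vfun H W PB by fact
  interpret K: vfun K W PB by fact
  interpret a: vtrans \<alpha> "comp_vdf (pullback_fst F P) H" "comp_vdf (pullback_fst F P) K" W A by fact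
  interpret b: vtrans \<beta> "comp_vdf (pullback_snd F P) H" "comp_vdf (pullback_snd F P) K" W X by fact
  define \<gamma> where "\<gamma> = mk_vtr H K (\<lambda>a. pair_code (tOb \<alpha> a) (tOb \<beta> a)) (\<lambda>a. pair_code (tHor \<alpha> a) (tHor \<beta> a))"
  note s = comp_vdf_simps[where F=H, unfolded H.fdom_eq] comp_vdf_simps[where F=K, unfolded K.fdom_eq]
    pullback_simps H.fun_rules K.fun_rules
  have eO: "fVer F (tOb \<alpha> a) = fVer P (tOb \<beta> a)" if "a \<in> Ob W" for a
    using arg_cong[OF assms(5), of "\<lambda>F. tOb F a"] that
    by (simp add: whisker_left_simps[OF assms(3)] whisker_left_simps[OF assms(4)])
  have eH: "fCel F (tHor \<alpha> a) = fCel P (tHor \<beta> a)" if "a \<in> Hor W" for a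
    using arg_cong[OF assms(5), of "\<lambda>F. tHor F a"] that
    by (simp add: whisker_left_simps[OF assms(3)] whisker_left_simps[OF assms(4)])
  have t: "vtrans \<gamma> H K W PB"
    unfolding \<gamma>_def
  proof (rule vtrans_mk_vtr[OF assms(1,2)])
    fix w assume w: "w \<in> Ob W"
    show "pair_code (tOb \<alpha> w) (tOb \<beta> w) \<in> Ver PB \<and> vdom PB (pair_code (tOb \<alpha> w) (tOb \<beta> w)) = fOb H w \<and>
        vcod PB (pair_code (tOb \<alpha> w) (tOb \<beta> w)) = fOb K w"
      using w by (simp add: PB_sel(2,5,6) a.trans_rules b.trans_rules eO s PB_ObD(4))
  next
    fix u assume u: "u \<in> Ver W"
    show "vcomp PB (pair_code (tOb \<alpha> (vcod W u)) (tOb \<beta> (vcod W u))) (fVer H u)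
        = vcomp PB (fVer K u) (pair_code (tOb \<alpha> (vdom W u)) (tOb \<beta> (vdom W u)))"
      using u a.tOb_nat[OF u] b.tOb_nat[OF u] by (simp add: PB_sel(8) s)
  next
    fix \<Gamma> assume \<Gamma>: "\<Gamma> \<in> Hor W"
    show "pair_code (tHor \<alpha> \<Gamma>) (tHor \<beta> \<Gamma>) \<in> Cel PB \<and> ctop PB (pair_code (tHor \<alpha> \<Gamma>) (tHor \<beta> \<Gamma>)) = [fHor H \<Gamma>] \<and>
        ctgt PB (pair_code (tHor \<alpha> \<Gamma>) (tHor \<beta> \<Gamma>)) = fHor K \<Gamma> \<and>
        cleft PB (pair_code (tHor \<alpha> \<Gamma>) (tHor \<beta> \<Gamma>)) = pair_code (tOb \<alpha> (hsrc W \<Gamma>)) (tOb \<beta> (hsrc W \<Gamma>)) \<and>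
        cright PB (pair_code (tHor \<alpha> \<Gamma>) (tHor \<beta> \<Gamma>)) = pair_code (tOb \<alpha> (htgt W \<Gamma>)) (tOb \<beta> (htgt W \<Gamma>))"
      using \<Gamma> by (simp add: PB_sel(4,11-14) a.trans_rules b.trans_rules eH s PB_HorD(4))
  next
    fix \<theta> assume \<theta>: "\<theta> \<in> Cel W"
    show "ucomp PB (pair_code (tHor \<alpha> (ctgt W \<theta>)) (tHor \<beta> (ctgt W \<theta>))) (fCel H \<theta>)
        = mcomp PB (fCel K \<theta>) (pair_code (tOb \<alpha> (vdom W (cleft W \<theta>))) (tOb \<beta> (vdom W (cleft W \<theta>))))
           (map (\<lambda>a. pair_code (tHor \<alpha> a) (tHor \<beta> a)) (ctop W \<theta>))"
      using \<theta> a.tHor_nat[OF \<theta>] b.tHor_nat[OF \<theta>] by (simp add: ucomp_PB PB_sel(16) s o_def)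
  qed
  have "whisker_left (pullback_fst F P) \<gamma> = \<alpha>" "whisker_left (pullback_snd F P) \<gamma> = \<beta>"
    by (rule vtrans_eqI[OF vtrans_whisker_left[OF t vfun_pullback_fst] assms(3)]
        vtrans_eqI[OF vtrans_whisker_left[OF t vfun_pullback_snd] assms(4)];
        simp add: whisker_left_simps[OF t]; simp add: \<gamma>_def mk_vtr_simps H.fdom_eq pullback_simps
          PB_sel a.trans_rules b.trans_rules eO eH)+
  with t show ?thesis by blast
qed

lemma two_pullback_VDBL:
  assumes "large_vdc E A" "large_vdc E X" "large_vdc E Y"
  shows "two_pullback (VDBL E) F P (pullback_fst F P) (pullback_snd F P)"
proof -
  let ?K = "VDBL E" and ?a = "pullback_fst F P" and ?b = "pullback_snd F P"
  note PB = large_PB[OF assms(1,2)]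
  have eqs: "fdom F = A" "fcod F = Y" "fdom P = X" "fcod P = Y" "fdom ?a = PB" "fcod ?a = A" "fdom ?b = PB" "fcod ?b = X"
    by (simp_all add: F.fdom_eq F.fcod_eq P.fdom_eq P.fcod_eq pullback_simps)
  have mors: "F \<in> Mor ?K" "P \<in> Mor ?K" "?a \<in> Mor ?K" "?b \<in> Mor ?K"
    using MorI_VDBL[OF F.vfun_axioms] MorI_VDBL[OF P.vfun_axioms] MorI_VDBL[OF vfun_pullback_fst]
      MorI_VDBL[OF vfun_pullback_snd] assms PB by simp_all
  have one: "\<exists>!h. h \<in> Mor ?K \<and> fdom h = fdom f \<and> fcod h = PB \<and> comp_vdf ?a h = f \<and> comp_vdf ?b h = g"
    if f: "f \<in> Mor ?K" and g: "g \<in> Mor ?K" and e: "fdom f = fdom g" "fcod f = A" "fcod g = X" "comp_vdf F f = comp_vdf P g" for f g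
  proof -
    have fg: "vfun f (fdom f) A" "vfun g (fdom f) X" "large_vdc E (fdom f)"
      using f g e by (auto simp: VDBL_simps)
    obtain h where "vfun h (fdom f) PB" "comp_vdf ?a h = f" "comp_vdf ?b h = g"
      using pullback_fun_exists[OF fg(1,2) e(4)] by blast
    then have "h \<in> Mor ?K \<and> fdom h = fdom f \<and> fcod h = PB \<and> comp_vdf ?a h = f \<and> comp_vdf ?b h = g"
      using MorI_VDBL fg(3) PB vfun_eqs by blast
    moreover have "h = k" if "h \<in> Mor ?K \<and> fdom h = fdom f \<and> fcod h = PB \<and> comp_vdf ?a h = f \<and> comp_vdf ?b h = g"
      "k \<in> Mor ?K \<and> fdom k = fdom f \<and> fcod k = PB \<and> comp_vdf ?a k = f \<and> comp_vdf ?b k = g" for h k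
    proof -
      have v: "vfun h (fdom f) PB" "vfun k (fdom f) PB" using that by (simp_all add: VDBL_simps vfun_def)
      show ?thesis by (rule pullback_fun_eqI[OF v]) (use that in simp_all)
    qed
    ultimately show ?thesis by blast
  qed
  have two: "\<exists>!\<gamma>. \<gamma> \<in> Two ?K \<and> tdom \<gamma> = h \<and> tcod \<gamma> = k \<and> hcomp_vtr (id_vtr ?a) \<gamma> = \<alpha> \<and> hcomp_vtr (id_vtr ?b) \<gamma> = \<beta>"
    if h: "h \<in> Mor ?K" and k: "k \<in> Mor ?K" and \<alpha>: "\<alpha> \<in> Two ?K" and \<beta>: "\<beta> \<in> Two ?K"
      and hk: "fdom h = fdom k" "fcod h = PB" "fcod k = PB" "tdom \<alpha> = comp_vdf ?a h" "tcod \<alpha> = comp_vdf ?a k"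
      "tdom \<beta> = comp_vdf ?b h" "tcod \<beta> = comp_vdf ?b k"
      "hcomp_vtr (id_vtr F) \<alpha> = hcomp_vtr (id_vtr P) \<beta>" for h k \<alpha> \<beta>
  proof -
    let ?W = "fdom h"
    have fg: "vfun h ?W PB" "vfun k ?W PB" "large_vdc E ?W"
      using h k hk by (auto simp: VDBL_simps)
    have a: "vtrans \<alpha> (comp_vdf ?a h) (comp_vdf ?a k) ?W A"
      using \<alpha> hk by (simp add: VDBL_simps comp_vdf_simps eqs)
    have b: "vtrans \<beta> (comp_vdf ?b h) (comp_vdf ?b k) ?W X"
      using \<beta> hk by (simp add: VDBL_simps comp_vdf_simps eqs)
    have w: "whisker_left F \<alpha> = whisker_left P \<beta>"
      using hk(8) by (simp add: hcomp_id_left[OF a F.vfun_axioms] hcomp_id_left[OF b P.vfun_axioms])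
    have h1: "hcomp_vtr (id_vtr ?a) \<gamma> = whisker_left ?a \<gamma>" "hcomp_vtr (id_vtr ?b) \<gamma> = whisker_left ?b \<gamma>"
      if "vtrans \<gamma> h k ?W PB" for \<gamma>
      using hcomp_id_left[OF that vfun_pullback_fst] hcomp_id_left[OF that vfun_pullback_snd] by simp_all
    obtain \<gamma> where \<gamma>: "vtrans \<gamma> h k ?W PB" "whisker_left ?a \<gamma> = \<alpha>" "whisker_left ?b \<gamma> = \<beta>"
      using pullback_trans_exists[OF fg(1,2) a b w] by blast
    then have "\<gamma> \<in> Two ?K \<and> tdom \<gamma> = h \<and> tcod \<gamma> = k \<and> hcomp_vtr (id_vtr ?a) \<gamma> = \<alpha> \<and> hcomp_vtr (id_vtr ?b) \<gamma> = \<beta>"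
      using TwoI_VDBL[OF \<gamma>(1) fg(3) PB] vtrans_eqs[OF \<gamma>(1)] h1[OF \<gamma>(1)] by simp
    moreover have "\<gamma>' = \<gamma>''" if t: "\<gamma>' \<in> Two ?K \<and> tdom \<gamma>' = h \<and> tcod \<gamma>' = k \<and> hcomp_vtr (id_vtr ?a) \<gamma>' = \<alpha> \<and> hcomp_vtr (id_vtr ?b) \<gamma>' = \<beta>"
      "\<gamma>'' \<in> Two ?K \<and> tdom \<gamma>'' = h \<and> tcod \<gamma>'' = k \<and> hcomp_vtr (id_vtr ?a) \<gamma>'' = \<alpha> \<and> hcomp_vtr (id_vtr ?b) \<gamma>'' = \<beta>" for \<gamma>' \<gamma>''
    proof -
      have v: "vtrans \<gamma>' h k ?W PB" "vtrans \<gamma>'' h k ?W PB" using t hk by (simp_all add: VDBL_simps vtrans_def)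
      show ?thesis by (rule pullback_trans_eqI[OF v]) (use t h1[OF v(1)] h1[OF v(2)] in simp_all)
    qed
    ultimately show ?thesis by blast
  qed
  show ?thesis
    unfolding two_pullback_def VDBL_simps(4-12) eqs
    by (intro conjI ballI impI mors pullback_commutes refl; elim conjE; (rule one | rule two); assumption)
qed

end


section \<open>Discrete Conduche functors\<close>

text \<open>Functors between categories that lift factorizations uniquely are called discrete Conduche functors;
  this is the analogue for virtual double categories. The nullary composites make it necessary to
  recover the leftmost vertical morphism \<open>w\<close> as well.\<close>

locale discrete_conduche = vfun P X Y for P :: "'u vdf" and X Y :: "'u vdc" +
  assumes vid_reflect: "\<lbrakk>w \<in> Ver X; y \<in> Ob Y; fVer P w = vid Y y\<rbrakk> \<Longrightarrow> w = vid X (vdom X w)"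
    and vcomp_factor: "\<lbrakk>w \<in> Ver X; u \<in> Ver Y; v \<in> Ver Y; vcod Y u = vdom Y v; fVer P w = vcomp Y v u\<rbrakk>
      \<Longrightarrow> \<exists>w2 w1. w1 \<in> Ver X \<and> w2 \<in> Ver X \<and> vcod X w1 = vdom X w2 \<and> fVer P w1 = u \<and> fVer P w2 = v \<and> w = vcomp X w2 w1"
    and vcomp_unique: "\<lbrakk>w1 \<in> Ver X; w2 \<in> Ver X; vcod X w1 = vdom X w2; w1' \<in> Ver X; w2' \<in> Ver X; vcod X w1' = vdom X w2';
        fVer P w1 = fVer P w1'; fVer P w2 = fVer P w2'; vcomp X w2 w1 = vcomp X w2' w1'\<rbrakk> \<Longrightarrow> w1 = w1' \<and> w2 = w2'"
    and cid_reflect: "\<lbrakk>\<theta> \<in> Cel X; \<Psi> \<in> Hor Y; fCel P \<theta> = cid Y \<Psi>\<rbrakk> \<Longrightarrow> \<theta> = cid X (ctgt X \<theta>)"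
    and mcomp_factor: "\<lbrakk>\<theta> \<in> Cel X; composable Y \<kappa> u \<nu>s; fCel P \<theta> = mcomp Y \<kappa> u \<nu>s\<rbrakk>
      \<Longrightarrow> \<exists>k w ths. composable X k w ths \<and> fCel P k = \<kappa> \<and> fVer P w = u \<and> map (fCel P) ths = \<nu>s \<and> \<theta> = mcomp X k w ths"
    and mcomp_unique: "\<lbrakk>composable X k w ths; composable X k' w' ths'; fCel P k = fCel P k'; fVer P w = fVer P w';
        map (fCel P) ths = map (fCel P) ths'; mcomp X k w ths = mcomp X k' w' ths'\<rbrakk> \<Longrightarrow> k = k' \<and> w = w' \<and> ths = ths'"

lemma ex1_unique: "\<exists>!x. Q x \<Longrightarrow> Q x \<Longrightarrow> Q y \<Longrightarrow> x = y"
  by blast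

locale opfibration = vfun P X Y for P :: "'u vdf" and X Y :: "'u vdc" +
  assumes opfib: "discrete_opfibration P"
begin

lemma vlift:
  assumes "x \<in> Ob X" "v \<in> Ver Y" "vdom Y v = fOb P x"
  shows "vlift P x v \<in> Ver X" "vdom X (vlift P x v) = x" "fVer P (vlift P x v) = v"
  using theI'[OF discrete_opfibration.vertical_lift[OF opfib, of x v]] assms
  unfolding vlift_def fdom_eq fcod_eq by auto

lemma vertical_eqI:
  assumes "w \<in> Ver X" "w' \<in> Ver X" "vdom X w = vdom X w'" "fVer P w = fVer P w'"
  shows "w = w'"
  using discrete_opfibration.vertical_lift[OF opfib, of "vdom X w" "fVer P w"] assms
  unfolding fdom_eq fcod_eq by (metis A.vdom_in dom_fVer fVer_in)

lemma vlift_eq: "w \<in> Ver X \<Longrightarrow> vlift P (vdom X w) (fVer P w) = w"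
  by (rule vertical_eqI) (simp_all add: vlift A.boundary_rules fun_rules)

text \<open>The two multicells are lifts of the same multicell along the same path: the right end of their tops
  is determined by the left end, and their vertical boundaries are the lifts prescribed by the ends.\<close>

lemma multicell_eqI:
  assumes "\<theta> \<in> Cel X" "\<theta>' \<in> Cel X" "ctop X \<theta> = ctop X \<theta>'" "vdom X (cleft X \<theta>) = vdom X (cleft X \<theta>')"
    "fCel P \<theta> = fCel P \<theta>'"
  shows "\<theta> = \<theta>'"
proof -
  let ?x = "vdom X (cleft X \<theta>)" and ?y = "vdom X (cright X \<theta>)"
  have y: "vdom X (cright X \<theta>') = ?y"
    using A.hpath_end_unique A.ctop_path[OF assms(1)] A.ctop_path[OF assms(2)] assms(3,4) by metis
  have ex1: "\<exists>!\<theta>''. \<theta>'' \<in> Cel X \<and> ctop X \<theta>'' = ctop X \<theta> \<and>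
      cleft X \<theta>'' = vlift P ?x (cleft Y (fCel P \<theta>)) \<and> cright X \<theta>'' = vlift P ?y (cright Y (fCel P \<theta>)) \<and> fCel P \<theta>'' = fCel P \<theta>"
    using discrete_opfibration.multicell_lift[OF opfib, of ?x "ctop X \<theta>" ?y "fCel P \<theta>"] assms(1) A.ctop_path
    unfolding fdom_eq fcod_eq by (simp add: fun_rules A.boundary_rules)
  have lifted: "cleft X t = vlift P ?x (cleft Y (fCel P \<theta>)) \<and> cright X t = vlift P ?y (cright Y (fCel P \<theta>))"
    if t: "t \<in> Cel X" "vdom X (cleft X t) = ?x" "vdom X (cright X t) = ?y" "fCel P t = fCel P \<theta>" for t
    unfolding t(2-4)[symmetric]
    using t(1) vlift_eq[of "cleft X t"] vlift_eq[of "cright X t"] left_fCel[of t] right_fCel[of t]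
    by (simp add: A.boundary_rules)
  show ?thesis
  proof (rule ex1_unique[OF ex1])
    show "\<theta> \<in> Cel X \<and> ctop X \<theta> = ctop X \<theta> \<and> cleft X \<theta> = vlift P ?x (cleft Y (fCel P \<theta>)) \<and>
        cright X \<theta> = vlift P ?y (cright Y (fCel P \<theta>)) \<and> fCel P \<theta> = fCel P \<theta>"
      using assms(1) lifted[OF assms(1) refl refl refl] by blast
    show "\<theta>' \<in> Cel X \<and> ctop X \<theta>' = ctop X \<theta> \<and> cleft X \<theta>' = vlift P ?x (cleft Y (fCel P \<theta>)) \<and>
        cright X \<theta>' = vlift P ?y (cright Y (fCel P \<theta>)) \<and> fCel P \<theta>' = fCel P \<theta>"
      using assms(2) assms(3,5)[symmetric] lifted[OF assms(2) assms(4)[symmetric] y assms(5)[symmetric]] by blast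
  qed
qed

lemma multicell_lift_exists:
  assumes "hpath X x \<Phi>s x'" "\<nu> \<in> Cel Y" "ctop Y \<nu> = map (fHor P) \<Phi>s" "vdom Y (cleft Y \<nu>) = fOb P x"
  shows "\<exists>\<theta>. \<theta> \<in> Cel X \<and> ctop X \<theta> = \<Phi>s \<and> vdom X (cleft X \<theta>) = x \<and> vdom X (cright X \<theta>) = x' \<and> fCel P \<theta> = \<nu>"
proof -
  have x: "x \<in> Ob X" "x' \<in> Ob X" using A.hpath_Ob[OF assms(1)] by auto
  obtain \<theta> where \<theta>: "\<theta> \<in> Cel X" "ctop X \<theta> = \<Phi>s" "cleft X \<theta> = vlift P x (cleft Y \<nu>)" "fCel P \<theta> = \<nu>"
    using discrete_opfibration.multicell_lift[OF opfib, of x \<Phi>s x' \<nu>] assms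
    unfolding fdom_eq fcod_eq by auto
  have l: "vdom X (cleft X \<theta>) = x" using \<theta>(3) vlift(2)[OF x(1) _ assms(4)] assms(2) by (simp add: B.boundary_rules)
  then have "vdom X (cright X \<theta>) = x'"
    using A.ctop_path[OF \<theta>(1)] assms(1) \<theta>(2) A.hpath_end_unique by metis
  then show ?thesis using \<theta> l by blast
qed

text \<open>The lengths of the tops of \<open>\<nu>s\<close> prescribe how to cut \<open>\<Phi>s\<close> into the tops of the lifts. Each lift has
  the right boundary of the previous one as its left boundary, since a vertical morphism is determined by
  its domain and its image. A nullary multicell is lifted at the domain of this left boundary.\<close>

lemma path_lift_exists:
  assumes "w \<in> Ver X" "cpath Y (fVer P w) \<nu>s" "hpath X (vdom X w) \<Phi>s x'"
    "map (fHor P) \<Phi>s = concat (map (ctop Y) \<nu>s)"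
  shows "\<exists>ths. cpath X w ths \<and> map (fCel P) ths = \<nu>s \<and> concat (map (ctop X) ths) = \<Phi>s"
  using assms
proof (induction \<nu>s arbitrary: w \<Phi>s)
  case Nil
  then show ?case by auto
next
  case (Cons \<nu> \<nu>s)
  let ?n = "length (ctop Y \<nu>)"
  have \<nu>: "\<nu> \<in> Cel Y" "cleft Y \<nu> = fVer P w" "cpath Y (cright Y \<nu>) \<nu>s" using Cons.prems(2) by auto
  have m: "map (fHor P) (take ?n \<Phi>s) = ctop Y \<nu>" "map (fHor P) (drop ?n \<Phi>s) = concat (map (ctop Y) \<nu>s)"
    using Cons.prems(4) by (simp_all add: take_map[symmetric] drop_map[symmetric])
  obtain x1 where x1: "hpath X (vdom X w) (take ?n \<Phi>s) x1" "hpath X x1 (drop ?n \<Phi>s) x'"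
    using A.hpath_appendD[of _ "take ?n \<Phi>s" "drop ?n \<Phi>s"] Cons.prems(3) by auto
  obtain \<theta> where \<theta>: "\<theta> \<in> Cel X" "ctop X \<theta> = take ?n \<Phi>s" "vdom X (cleft X \<theta>) = vdom X w"
    "vdom X (cright X \<theta>) = x1" "fCel P \<theta> = \<nu>"
    using multicell_lift_exists[OF x1(1) \<nu>(1) m(1)[symmetric]] \<nu>(2) Cons.prems(1) by (auto simp: dom_fVer)
  have l: "cleft X \<theta> = w"
    by (rule vertical_eqI) (use \<theta> \<nu> Cons.prems(1) left_fCel[of \<theta>] in \<open>simp_all add: A.boundary_rules\<close>)
  obtain ths where "cpath X (cright X \<theta>) ths" "map (fCel P) ths = \<nu>s" "concat (map (ctop X) ths) = drop ?n \<Phi>s"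
    using Cons.IH[of "cright X \<theta>" "drop ?n \<Phi>s"] \<theta> \<nu> x1(2) m(2) right_fCel[of \<theta>] by (auto simp: A.boundary_rules)
  then show ?case using \<theta> l by (intro exI[of _ "\<theta> # ths"]) simp
qed

lemma path_lift_unique:
  assumes "cpath X w ths" "cpath X w ths'" "map (fCel P) ths = map (fCel P) ths'"
    "concat (map (ctop X) ths) = concat (map (ctop X) ths')"
  shows "ths = ths'"
  using assms
proof (induction ths arbitrary: w ths')
  case (Cons t ths)
  then obtain t' ths'' where t': "ths' = t' # ths''" by (cases ths') auto
  have "map (fHor P) (ctop X t) = map (fHor P) (ctop X t')"
    using Cons.prems t' by (auto simp: top_fCel[symmetric])
  then have "length (ctop X t) = length (ctop X t')" by (metis length_map)
  then have *: "ctop X t = ctop X t'" "concat (map (ctop X) ths) = concat (map (ctop X) ths'')"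
    using Cons.prems(4) by (simp_all add: t')
  have "t = t'" by (rule multicell_eqI) (use Cons.prems * t' in auto)
  then show ?case using Cons.IH[of "cright X t" ths''] Cons.prems * t' by auto
qed simp

text \<open>Let \<open>\<theta>\<close> lie over a composite of \<open>\<kappa>\<close> with a path of multicells. Lift the leftmost vertical morphism at
  the left end of the top of \<open>\<theta>\<close>, then the path along that top, and then \<open>\<kappa>\<close> along the targets of the
  lifted path. The composite of these lifts has the same image and top as \<open>\<theta>\<close>, so it is \<open>\<theta>\<close>. Each of
  these lifts was forced, which gives uniqueness.\<close>

lemma discrete_conduche: "discrete_conduche P X Y"
proof
  fix w y assume w: "w \<in> Ver X" "y \<in> Ob Y" "fVer P w = vid Y y"
  then have y: "y = fOb P (vdom X w)" using dom_fVer[of w] by (simp add: B.boundary_rules)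
  show "w = vid X (vdom X w)"
    by (rule vertical_eqI) (use w y in \<open>simp_all add: A.boundary_rules fun_rules\<close>)
next
  fix w u v assume w: "w \<in> Ver X" and uv: "u \<in> Ver Y" "v \<in> Ver Y" "vcod Y u = vdom Y v" and e: "fVer P w = vcomp Y v u"
  let ?w1 = "vlift P (vdom X w) u"
  have "vdom Y u = fOb P (vdom X w)" using dom_fVer[OF w] uv by (simp add: e B.boundary_rules)
  note w1 = vlift[OF A.vdom_in[OF w] uv(1) this]
  let ?w2 = "vlift P (vcod X ?w1) v"
  have "vdom Y v = fOb P (vcod X ?w1)" using w1 cod_fVer[OF w1(1)] uv(3) by simp
  note w2 = vlift[OF A.vcod_in[OF w1(1)] uv(2) this]
  have e': "w = vcomp X ?w2 ?w1"
    by (rule vertical_eqI) (use w w1 w2 e in \<open>simp_all add: A.boundary_rules fun_rules\<close>)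
  show "\<exists>w2 w1. w1 \<in> Ver X \<and> w2 \<in> Ver X \<and> vcod X w1 = vdom X w2 \<and> fVer P w1 = u \<and> fVer P w2 = v \<and> w = vcomp X w2 w1"
    using w1(1,3) w2(1,3) w2(2)[symmetric] e' by (intro exI[of _ ?w2] exI[of _ ?w1] conjI) assumption+
next
  fix w1 w2 w1' w2' assume w: "w1 \<in> Ver X" "w2 \<in> Ver X" "vcod X w1 = vdom X w2" "w1' \<in> Ver X" "w2' \<in> Ver X" "vcod X w1' = vdom X w2'"
    "fVer P w1 = fVer P w1'" "fVer P w2 = fVer P w2'" "vcomp X w2 w1 = vcomp X w2' w1'"
  have "vdom X w1 = vdom X w1'" using A.dom_vcomp[OF w(1-3)] A.dom_vcomp[OF w(4-6)] w(9) by simp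
  then have "w1 = w1'" using vertical_eqI w by blast
  moreover from this have "w2 = w2'" using vertical_eqI w by metis
  ultimately show "w1 = w1' \<and> w2 = w2'" ..
next
  fix \<theta> \<Psi> assume \<theta>: "\<theta> \<in> Cel X" and \<Psi>: "\<Psi> \<in> Hor Y" and e: "fCel P \<theta> = cid Y \<Psi>"
  have "map (fHor P) (ctop X \<theta>) = [\<Psi>]" using top_fCel[OF \<theta>] \<Psi> by (simp add: e B.boundary_rules)
  then obtain \<Phi> where \<Phi>: "ctop X \<theta> = [\<Phi>]" "fHor P \<Phi> = \<Psi>" by auto
  have \<Phi>': "\<Phi> \<in> Hor X" using A.ctop_Hor[OF \<theta>] \<Phi> by simp
  have "\<theta> = cid X \<Phi>"
    by (rule multicell_eqI) (use \<theta> e \<Phi> \<Phi>' A.ctop_single[OF \<theta> \<Phi>(1)] in \<open>simp_all add: A.boundary_rules fun_rules\<close>)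
  then show "\<theta> = cid X (ctgt X \<theta>)" using \<Phi>' by (simp add: A.boundary_rules)
next
  fix \<theta> \<kappa> u \<nu>s assume \<theta>: "\<theta> \<in> Cel X" and c: "composable Y \<kappa> u \<nu>s" and e: "fCel P \<theta> = mcomp Y \<kappa> u \<nu>s"
  note cD = B.composableD[OF c]
  let ?x = "vdom X (cleft X \<theta>)"
  let ?w = "vlift P ?x u"
  have x: "?x \<in> Ob X" using \<theta> by (simp add: A.boundary_rules)
  have "fOb P ?x = vdom Y (cleft Y (fCel P \<theta>))" using \<theta> by (simp add: A.boundary_rules fun_rules)
  also have "\<dots> = vdom Y u" using c cD by (simp add: e B.boundary_rules)
  finally have ux: "vdom Y u = fOb P ?x" by simp
  note w = vlift[OF x cD(5) ux]
  have m: "map (fHor P) (ctop X \<theta>) = concat (map (ctop Y) \<nu>s)"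
    using top_fCel[OF \<theta>] c by (simp add: e B.boundary_rules)
  obtain ths where ths: "cpath X ?w ths" "map (fCel P) ths = \<nu>s" "concat (map (ctop X) ths) = ctop X \<theta>"
    using path_lift_exists[OF w(1), of \<nu>s "ctop X \<theta>" "vdom X (cright X \<theta>)"] cD(2) A.ctop_path[OF \<theta>] w(2,3) m by auto
  have t: "set ths \<subseteq> Cel X" using A.cpath_Cel[OF ths(1)] .
  have "map (fHor P) (map (ctgt X) ths) = map (ctgt Y) (map (fCel P) ths)"
    using t by (auto simp: tgt_fCel)
  then have "ctop Y \<kappa> = map (fHor P) (map (ctgt X) ths)" using cD(3) ths(2) by simp
  moreover have "vdom Y (cleft Y \<kappa>) = fOb P (vcod X ?w)" using w cD cod_fVer[OF w(1)] by simp
  ultimately obtain k where k: "k \<in> Cel X" "ctop X k = map (ctgt X) ths" "vdom X (cleft X k) = vcod X ?w" "fCel P k = \<kappa>"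
    using multicell_lift_exists[OF A.cpath_hpath_ctgt[OF ths(1)] cD(1)] by auto
  have c': "composable X k ?w ths" using k ths by (simp add: composable_def)
  have "\<theta> = mcomp X k ?w ths"
    by (rule multicell_eqI) (use \<theta> c' k ths w e in \<open>simp_all add: A.boundary_rules fun_rules\<close>)
  then show "\<exists>k w ths. composable X k w ths \<and> fCel P k = \<kappa> \<and> fVer P w = u \<and> map (fCel P) ths = \<nu>s \<and> \<theta> = mcomp X k w ths"
    using c' k ths w by blast
next
  fix k w ths k' w' ths'
  assume c: "composable X k w ths" "composable X k' w' ths'" and e: "fCel P k = fCel P k'" "fVer P w = fVer P w'"
    "map (fCel P) ths = map (fCel P) ths'" "mcomp X k w ths = mcomp X k' w' ths'"
  note cD = A.composableD[OF c(1)] and cD' = A.composableD[OF c(2)]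
  have "vdom X w = vdom X w'" 
  proof -
    have "vdom X (cleft X (mcomp X k w ths)) = vdom X w" "vdom X (cleft X (mcomp X k' w' ths')) = vdom X w'"
      using c cD cD' by (simp_all add: A.boundary_rules)
    then show ?thesis using e(4) by simp
  qed
  then have w: "w = w'" using vertical_eqI cD cD' e by blast
  have "concat (map (ctop X) ths) = concat (map (ctop X) ths')"
    using A.top_mcomp[OF c(1)] A.top_mcomp[OF c(2)] e(4) by simp
  then have t: "ths = ths'" using path_lift_unique cD(2) cD'(2) e(3) w by blast
  have "k = k'" by (rule multicell_eqI) (use cD cD' e w t in auto)
  then show "k = k' \<and> w = w' \<and> ths = ths'" using w t by simp
qed

end


section \<open>Dependent products along discrete Conduche functors\<close>

definition fibre :: "('a \<Rightarrow> 'b) \<Rightarrow> 'a set \<Rightarrow> 'b \<Rightarrow> 'a set" where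
  "fibre f S y = {x \<in> S. f x = y}"

lemma coded:
  assumes "small E D"
  shows "d \<in> D \<Longrightarrow> code E D d \<in> code E D ` D" "d \<in> D \<Longrightarrow> decode E D (code E D d) = d"
    "c \<in> code E D ` D \<Longrightarrow> decode E D c \<in> D" "c \<in> code E D ` D \<Longrightarrow> code E D (decode E D c) = c"
  using decode_code[OF assms] by auto

lemma hpath_cong:
  assumes "Ob A = Ob B" "Hor A = Hor B" "hsrc A = hsrc B" "htgt A = htgt B"
  shows "hpath A a \<Gamma>s b = hpath B a \<Gamma>s b"
  using assms by (induction \<Gamma>s arbitrary: a) simp_all

lemma cpath_end_cong:
  assumes "cright A = cright B"
  shows "cpath_end A u \<theta>s = cpath_end B u \<theta>s"
  using assms by (induction \<theta>s arbitrary: u) simp_all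

text \<open>The dependent product of \<open>Q : Z \<rightarrow> X\<close> along \<open>P : X \<rightarrow> Y\<close>, a virtual double category \<open>R\<close> over \<open>Y\<close>. For each
  of the four sorts of cells, \<open>isO\<close>, \<open>isV\<close>, \<open>isH\<close> and \<open>isC\<close> say which data make up a cell: its image
  in \<open>Y\<close>, a section of \<open>Q\<close> over the lifts of this image, and a boundary with which the values of the
  section have to be compatible. A cell is a code for such data: \<open>mkO\<close> and so on form it, \<open>bO\<close> and so on
  extract the image in \<open>Y\<close>, and \<open>sO\<close> and so on the section. Sections are \<^const>\<open>undefined\<close> away
  from the lifts, so that a cell is determined by its boundary and the values that matter. The boundary of
  a morphism or multicell refers to codes of objects and morphisms, so the sorts are coded one after the
  other.\<close>

locale dependent_product = grothendieck_universe E + P: discrete_conduche P X Y + Q: vfun Q Z X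
  for E :: "'u \<Rightarrow> 'u \<Rightarrow> bool" and P Q :: "'u vdf" and X Y Z :: "'u vdc" +
  assumes large_X: "large_vdc E X" and large_Y: "large_vdc E Y" and large_Z: "large_vdc E Z"
begin

definition isO :: "'u \<Rightarrow> ('u \<Rightarrow> 'u) \<Rightarrow> bool" where
  "isO y s \<longleftrightarrow> y \<in> Ob Y \<and> (\<forall>x\<in>Ob X. fOb P x = y \<longrightarrow> s x \<in> Ob Z \<and> fOb Q (s x) = x)"

definition ObD :: "('u \<times> ('u \<Rightarrow> 'u)) set" where
  "ObD = {(y, s). isO y s \<and> s \<in> extensional (fibre (fOb P) (Ob X) y)}"

definition mkO :: "'u \<Rightarrow> ('u \<Rightarrow> 'u) \<Rightarrow> 'u" where
  "mkO y s = code E ObD (y, restrict s (fibre (fOb P) (Ob X) y))"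

definition bO :: "'u \<Rightarrow> 'u" where "bO a = fst (decode E ObD a)"
definition sO :: "'u \<Rightarrow> 'u \<Rightarrow> 'u" where "sO a = snd (decode E ObD a)"
definition ObR :: "'u set" where "ObR = code E ObD ` ObD"

definition isV :: "'u \<Rightarrow> ('u \<Rightarrow> 'u) \<Rightarrow> 'u \<Rightarrow> 'u \<Rightarrow> bool" where
  "isV v \<sigma> a b \<longleftrightarrow> v \<in> Ver Y \<and> a \<in> ObR \<and> b \<in> ObR \<and> bO a = vdom Y v \<and> bO b = vcod Y v \<and>
    (\<forall>w\<in>Ver X. fVer P w = v \<longrightarrow> \<sigma> w \<in> Ver Z \<and> fVer Q (\<sigma> w) = w \<and>
      vdom Z (\<sigma> w) = sO a (vdom X w) \<and> vcod Z (\<sigma> w) = sO b (vcod X w))"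

definition VerD :: "('u \<times> ('u \<Rightarrow> 'u) \<times> 'u \<times> 'u) set" where
  "VerD = {(v, \<sigma>, a, b). isV v \<sigma> a b \<and> \<sigma> \<in> extensional (fibre (fVer P) (Ver X) v)}"

definition mkV :: "'u \<Rightarrow> ('u \<Rightarrow> 'u) \<Rightarrow> 'u \<Rightarrow> 'u \<Rightarrow> 'u" where
  "mkV v \<sigma> a b = code E VerD (v, restrict \<sigma> (fibre (fVer P) (Ver X) v), a, b)"

definition bV :: "'u \<Rightarrow> 'u" where "bV u = fst (decode E VerD u)"
definition sV :: "'u \<Rightarrow> 'u \<Rightarrow> 'u" where "sV u = fst (snd (decode E VerD u))"
definition domV :: "'u \<Rightarrow> 'u" where "domV u = fst (snd (snd (decode E VerD u)))"
definition codV :: "'u \<Rightarrow> 'u" where "codV u = snd (snd (snd (decode E VerD u)))"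
definition VerR :: "'u set" where "VerR = code E VerD ` VerD"

definition isH :: "'u \<Rightarrow> ('u \<Rightarrow> 'u) \<Rightarrow> 'u \<Rightarrow> 'u \<Rightarrow> bool" where
  "isH v \<sigma> a b \<longleftrightarrow> v \<in> Hor Y \<and> a \<in> ObR \<and> b \<in> ObR \<and> bO a = hsrc Y v \<and> bO b = htgt Y v \<and>
    (\<forall>w\<in>Hor X. fHor P w = v \<longrightarrow> \<sigma> w \<in> Hor Z \<and> fHor Q (\<sigma> w) = w \<and>
      hsrc Z (\<sigma> w) = sO a (hsrc X w) \<and> htgt Z (\<sigma> w) = sO b (htgt X w))"

definition HorD :: "('u \<times> ('u \<Rightarrow> 'u) \<times> 'u \<times> 'u) set" where
  "HorD = {(v, \<sigma>, a, b). isH v \<sigma> a b \<and> \<sigma> \<in> extensional (fibre (fHor P) (Hor X) v)}"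

definition mkH :: "'u \<Rightarrow> ('u \<Rightarrow> 'u) \<Rightarrow> 'u \<Rightarrow> 'u \<Rightarrow> 'u" where
  "mkH v \<sigma> a b = code E HorD (v, restrict \<sigma> (fibre (fHor P) (Hor X) v), a, b)"

definition bH :: "'u \<Rightarrow> 'u" where "bH u = fst (decode E HorD u)"
definition sH :: "'u \<Rightarrow> 'u \<Rightarrow> 'u" where "sH u = fst (snd (decode E HorD u))"
definition srcH :: "'u \<Rightarrow> 'u" where "srcH u = fst (snd (snd (decode E HorD u)))"
definition tgtH :: "'u \<Rightarrow> 'u" where "tgtH u = snd (snd (snd (decode E HorD u)))"
definition HorR :: "'u set" where "HorR = code E HorD ` HorD"

text \<open>The tops of multicells are paths of horizontal morphisms, and \<open>hpath\<close> expects a record. The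
  skeleton \<open>R0\<close> supplies the objects and morphisms; its remaining components are arbitrary.\<close>

definition R0 :: "'u vdc" where
  "R0 = \<lparr>Ob = ObR, Ver = VerR, vdom = domV, vcod = codV, vid = (\<lambda>a. a), vcomp = (\<lambda>v u. u),
     Hor = HorR, hsrc = srcH, htgt = tgtH, Cel = {}, ctop = (\<lambda>\<theta>. []), ctgt = (\<lambda>\<theta>. \<theta>), cleft = (\<lambda>\<theta>. \<theta>),
     cright = (\<lambda>\<theta>. \<theta>), cid = (\<lambda>\<Gamma>. \<Gamma>), mcomp = (\<lambda>\<kappa> u \<theta>s. \<kappa>)\<rparr>"

definition isC :: "'u \<Rightarrow> ('u \<Rightarrow> 'u) \<Rightarrow> 'u list \<Rightarrow> 'u \<Rightarrow> 'u \<Rightarrow> 'u \<Rightarrow> bool" where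
  "isC \<nu> t Hs H u u' \<longleftrightarrow> \<nu> \<in> Cel Y \<and> hpath R0 (domV u) Hs (domV u') \<and> map bH Hs = ctop Y \<nu> \<and>
    H \<in> HorR \<and> bH H = ctgt Y \<nu> \<and> u \<in> VerR \<and> bV u = cleft Y \<nu> \<and> u' \<in> VerR \<and> bV u' = cright Y \<nu> \<and>
    codV u = srcH H \<and> codV u' = tgtH H \<and>
    (\<forall>\<theta>\<in>Cel X. fCel P \<theta> = \<nu> \<longrightarrow> t \<theta> \<in> Cel Z \<and> fCel Q (t \<theta>) = \<theta> \<and>
      ctop Z (t \<theta>) = map2 sH Hs (ctop X \<theta>) \<and> ctgt Z (t \<theta>) = sH H (ctgt X \<theta>) \<and>
      cleft Z (t \<theta>) = sV u (cleft X \<theta>) \<and> cright Z (t \<theta>) = sV u' (cright X \<theta>))"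

definition CelD :: "('u \<times> ('u \<Rightarrow> 'u) \<times> 'u list \<times> 'u \<times> 'u \<times> 'u) set" where
  "CelD = {(\<nu>, t, Hs, H, u, u'). isC \<nu> t Hs H u u' \<and> t \<in> extensional (fibre (fCel P) (Cel X) \<nu>)}"

definition mkC :: "'u \<Rightarrow> ('u \<Rightarrow> 'u) \<Rightarrow> 'u list \<Rightarrow> 'u \<Rightarrow> 'u \<Rightarrow> 'u \<Rightarrow> 'u" where
  "mkC \<nu> t Hs H u u' = code E CelD (\<nu>, restrict t (fibre (fCel P) (Cel X) \<nu>), Hs, H, u, u')"

definition bC :: "'u \<Rightarrow> 'u" where "bC T = fst (decode E CelD T)"
definition sC :: "'u \<Rightarrow> 'u \<Rightarrow> 'u" where "sC T = fst (snd (decode E CelD T))"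
definition topC :: "'u \<Rightarrow> 'u list" where "topC T = fst (snd (snd (decode E CelD T)))"
definition tgtC :: "'u \<Rightarrow> 'u" where "tgtC T = fst (snd (snd (snd (decode E CelD T))))"
definition leftC :: "'u \<Rightarrow> 'u" where "leftC T = fst (snd (snd (snd (snd (decode E CelD T)))))"
definition rightC :: "'u \<Rightarrow> 'u" where "rightC T = snd (snd (snd (snd (snd (decode E CelD T)))))"
definition CelR :: "'u set" where "CelR = code E CelD ` CelD"

text \<open>For lifts of composites the choice is forced (\<open>splitV_eq\<close>, \<open>splitC_eq\<close>); elsewhere it is arbitrary.\<close>

definition splitV :: "'u \<Rightarrow> 'u \<Rightarrow> 'u \<Rightarrow> 'u \<times> 'u" where
  "splitV v u w = (SOME p. fst p \<in> Ver X \<and> snd p \<in> Ver X \<and> vcod X (snd p) = vdom X (fst p) \<and>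
     fVer P (fst p) = v \<and> fVer P (snd p) = u \<and> vcomp X (fst p) (snd p) = w)"

definition splitC :: "'u \<Rightarrow> 'u \<Rightarrow> 'u list \<Rightarrow> 'u \<Rightarrow> 'u \<times> 'u \<times> 'u list" where
  "splitC \<kappa> u \<nu>s \<theta> = (SOME p. composable X (fst p) (fst (snd p)) (snd (snd p)) \<and>
     fCel P (fst p) = \<kappa> \<and> fVer P (fst (snd p)) = u \<and> map (fCel P) (snd (snd p)) = \<nu>s \<and>
     mcomp X (fst p) (fst (snd p)) (snd (snd p)) = \<theta>)"

definition vidR :: "'u \<Rightarrow> 'u" where
  "vidR a = mkV (vid Y (bO a)) (\<lambda>w. vid Z (sO a (vdom X w))) a a"

text \<open>The value of a composite at a lift of its image is the composite of the values at the factors of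
  this lift; likewise for multicells.\<close>

definition vcompR :: "'u \<Rightarrow> 'u \<Rightarrow> 'u" where
  "vcompR v u = mkV (vcomp Y (bV v) (bV u))
     (\<lambda>w. vcomp Z (sV v (fst (splitV (bV v) (bV u) w))) (sV u (snd (splitV (bV v) (bV u) w)))) (domV u) (codV v)"

definition cidR :: "'u \<Rightarrow> 'u" where
  "cidR H = mkC (cid Y (bH H)) (\<lambda>\<theta>. cid Z (sH H (ctgt X \<theta>))) [H] H (vidR (srcH H)) (vidR (tgtH H))"

definition mcompR :: "'u \<Rightarrow> 'u \<Rightarrow> 'u list \<Rightarrow> 'u" where
  "mcompR \<kappa> u ts = mkC (mcomp Y (bC \<kappa>) (bV u) (map bC ts))
     (\<lambda>\<theta>. let p = splitC (bC \<kappa>) (bV u) (map bC ts) \<theta> in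
        mcomp Z (sC \<kappa> (fst p)) (sV u (fst (snd p))) (map2 sC ts (snd (snd p))))
     (concat (map topC ts)) (tgtC \<kappa>) (vcompR (leftC \<kappa>) u)
     (vcompR (rightC \<kappa>) (cpath_end (R0\<lparr>cright := rightC\<rparr>) u ts))"

definition R :: "'u vdc" where
  "R = \<lparr>Ob = ObR, Ver = VerR, vdom = domV, vcod = codV, vid = vidR, vcomp = vcompR,
     Hor = HorR, hsrc = srcH, htgt = tgtH, Cel = CelR, ctop = topC, ctgt = tgtC, cleft = leftC,
     cright = rightC, cid = cidR, mcomp = mcompR\<rparr>"

lemma R_sel:
  "Ob R = ObR" "Ver R = VerR" "vdom R = domV" "vcod R = codV" "vid R = vidR" "vcomp R = vcompR"
  "Hor R = HorR" "hsrc R = srcH" "htgt R = tgtH" "Cel R = CelR" "ctop R = topC" "ctgt R = tgtC"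
  "cleft R = leftC" "cright R = rightC" "cid R = cidR" "mcomp R = mcompR"
  by (simp_all add: R_def)

lemma hpath_R0: "hpath R0 a Hs b = hpath R a Hs b"
  by (rule hpath_cong) (simp_all add: R_def R0_def)

lemma cpath_end_R0: "cpath_end (R0\<lparr>cright := rightC\<rparr>) u ts = cpath_end R u ts"
  by (rule cpath_end_cong) (simp add: R_def)


lemma in_universe_fibre: "in_universe E S \<Longrightarrow> in_universe E (fibre f S y)"
  by (rule in_universe_subset) (auto simp: fibre_def)

lemma carriers_in_universe:
  "in_universe E (Ob X)" "in_universe E (Ver X)" "in_universe E (Hor X)" "in_universe E (Cel X)"
  "in_universe E (Ob Y)" "in_universe E (Ver Y)" "in_universe E (Hor Y)" "in_universe E (Cel Y)"
  "in_universe E (Ob Z)" "in_universe E (Ver Z)" "in_universe E (Hor Z)" "in_universe E (Cel Z)"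
  using large_X large_Y large_Z by (simp_all add: large_vdc_def)

lemma small_sections:
  assumes "in_universe E S" "in_universe E T"
  shows "small E (fibre f S y \<rightarrow>\<^sub>E T)"
  by (intro small_PiE small_in_universe in_universe_fibre assms)

lemma small_ObD: "small E ObD"
proof (rule small_subset)
  show "small E (SIGMA y:Ob Y. fibre (fOb P) (Ob X) y \<rightarrow>\<^sub>E Ob Z)"
    by (intro small_Sigma small_sections small_in_universe carriers_in_universe)
  show "ObD \<subseteq> (SIGMA y:Ob Y. fibre (fOb P) (Ob X) y \<rightarrow>\<^sub>E Ob Z)"
    by (auto simp: ObD_def isO_def fibre_def PiE_def)
qed

lemma in_universe_ObR: "in_universe E ObR"
  unfolding ObR_def by (rule code_small[OF small_ObD])

lemma small_VerD: "small E VerD"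
proof (rule small_subset)
  show "small E (SIGMA v:Ver Y. (fibre (fVer P) (Ver X) v \<rightarrow>\<^sub>E Ver Z) \<times> ObR \<times> ObR)"
    by (intro small_Sigma small_Times small_sections small_in_universe carriers_in_universe in_universe_ObR)
  show "VerD \<subseteq> (SIGMA v:Ver Y. (fibre (fVer P) (Ver X) v \<rightarrow>\<^sub>E Ver Z) \<times> ObR \<times> ObR)"
    by (auto simp: VerD_def isV_def fibre_def PiE_def)
qed

lemma in_universe_VerR: "in_universe E VerR"
  unfolding VerR_def by (rule code_small[OF small_VerD])

lemma small_HorD: "small E HorD"
proof (rule small_subset)
  show "small E (SIGMA v:Hor Y. (fibre (fHor P) (Hor X) v \<rightarrow>\<^sub>E Hor Z) \<times> ObR \<times> ObR)"
    by (intro small_Sigma small_Times small_sections small_in_universe carriers_in_universe in_universe_ObR)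
  show "HorD \<subseteq> (SIGMA v:Hor Y. (fibre (fHor P) (Hor X) v \<rightarrow>\<^sub>E Hor Z) \<times> ObR \<times> ObR)"
    by (auto simp: HorD_def isH_def fibre_def PiE_def)
qed

lemma in_universe_HorR: "in_universe E HorR"
  unfolding HorR_def by (rule code_small[OF small_HorD])

lemma hpath_R0_HorR: "hpath R0 a Hs b \<Longrightarrow> set Hs \<subseteq> HorR"
  by (induction Hs arbitrary: a) (auto simp: R0_def)

lemma small_CelD: "small E CelD"
proof (rule small_subset)
  let ?S = "SIGMA \<nu>:Cel Y. (fibre (fCel P) (Cel X) \<nu> \<rightarrow>\<^sub>E Cel Z) \<times>
      {Hs. set Hs \<subseteq> HorR \<and> length Hs = length (ctop Y \<nu>)} \<times> HorR \<times> VerR \<times> VerR"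
  show "small E ?S"
    by (intro small_Sigma small_Times small_sections small_lists_length small_in_universe carriers_in_universe
        in_universe_HorR in_universe_VerR)
  show "CelD \<subseteq> ?S"
  proof
    fix d assume "d \<in> CelD"
    then obtain \<nu> t Hs H u u' where d: "d = (\<nu>, t, Hs, H, u, u')" and c: "isC \<nu> t Hs H u u'"
      and t: "t \<in> extensional (fibre (fCel P) (Cel X) \<nu>)" by (auto simp: CelD_def)
    have "length Hs = length (ctop Y \<nu>)" using c unfolding isC_def by (metis length_map)
    moreover have "set Hs \<subseteq> HorR" using c hpath_R0_HorR unfolding isC_def by blast
    ultimately show "d \<in> ?S" using c t by (auto simp: d isC_def fibre_def PiE_def)
  qed
qed

lemma in_universe_CelR: "in_universe E CelR"
  unfolding CelR_def by (rule code_small[OF small_CelD])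


lemma mkO:
  assumes "isO y s"
  shows "mkO y s \<in> Ob R" "bO (mkO y s) = y" "x \<in> Ob X \<Longrightarrow> fOb P x = y \<Longrightarrow> sO (mkO y s) x = s x"
proof -
  have d: "(y, restrict s (fibre (fOb P) (Ob X) y)) \<in> ObD"
    using assms by (auto simp: ObD_def isO_def fibre_def)
  show "mkO y s \<in> Ob R" "bO (mkO y s) = y" "x \<in> Ob X \<Longrightarrow> fOb P x = y \<Longrightarrow> sO (mkO y s) x = s x"
    using coded(1,2)[OF small_ObD d] by (simp_all add: mkO_def bO_def sO_def R_sel ObR_def fibre_def)
qed

lemma ObR_D:
  assumes "a \<in> Ob R"
  shows "bO a \<in> Ob Y" "x \<in> Ob X \<Longrightarrow> fOb P x = bO a \<Longrightarrow> sO a x \<in> Ob Z \<and> fOb Q (sO a x) = x"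
  using coded(3)[OF small_ObD, of a] assms
  by (auto simp: R_sel ObR_def bO_def sO_def ObD_def isO_def split_beta)

lemma ObR_eqI:
  assumes "a \<in> Ob R" "b \<in> Ob R" "bO a = bO b" "\<And>x. x \<in> Ob X \<Longrightarrow> fOb P x = bO a \<Longrightarrow> sO a x = sO b x"
  shows "a = b"
proof -
  have d: "decode E ObD a \<in> ObD" "decode E ObD b \<in> ObD"
    using coded(3)[OF small_ObD] assms by (auto simp: R_sel ObR_def)
  have "sO a = sO b"
    by (rule extensionalityI[where A="fibre (fOb P) (Ob X) (bO a)"])
      (use d assms in \<open>auto simp: ObD_def split_beta bO_def sO_def fibre_def\<close>)
  then have "decode E ObD a = decode E ObD b" using assms(3) by (simp add: bO_def sO_def prod_eq_iff)
  then show ?thesis using coded(4)[OF small_ObD] assms(1,2) by (metis R_sel(1) ObR_def)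
qed

lemma mkV:
  assumes "isV v \<sigma> a b"
  shows "mkV v \<sigma> a b \<in> Ver R" "bV (mkV v \<sigma> a b) = v" "vdom R (mkV v \<sigma> a b) = a" "vcod R (mkV v \<sigma> a b) = b"
    "w \<in> Ver X \<Longrightarrow> fVer P w = v \<Longrightarrow> sV (mkV v \<sigma> a b) w = \<sigma> w"
proof -
  have d: "(v, restrict \<sigma> (fibre (fVer P) (Ver X) v), a, b) \<in> VerD"
    using assms by (auto simp: VerD_def isV_def fibre_def)
  show "mkV v \<sigma> a b \<in> Ver R" "bV (mkV v \<sigma> a b) = v" "vdom R (mkV v \<sigma> a b) = a" "vcod R (mkV v \<sigma> a b) = b"
    "w \<in> Ver X \<Longrightarrow> fVer P w = v \<Longrightarrow> sV (mkV v \<sigma> a b) w = \<sigma> w"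
    using coded(1,2)[OF small_VerD d]
    by (simp_all add: mkV_def bV_def sV_def domV_def codV_def R_sel VerR_def fibre_def)
qed

lemma VerR_D:
  assumes "u \<in> Ver R"
  shows "bV u \<in> Ver Y" "vdom R u \<in> Ob R" "vcod R u \<in> Ob R" "bO (vdom R u) = vdom Y (bV u)"
    "bO (vcod R u) = vcod Y (bV u)"
  using coded(3)[OF small_VerD, of u] assms
  by (auto simp: R_sel VerR_def bV_def sV_def domV_def codV_def VerD_def isV_def split_beta)

lemma VerR_s:
  assumes "u \<in> Ver R" "w \<in> Ver X" "bV u = fVer P w"
  shows "sV u w \<in> Ver Z" "fVer Q (sV u w) = w" "vdom Z (sV u w) = sO (vdom R u) (vdom X w)"
    "vcod Z (sV u w) = sO (vcod R u) (vcod X w)"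
  using coded(3)[OF small_VerD, of u] assms
  by (auto simp: R_sel VerR_def bV_def sV_def domV_def codV_def VerD_def isV_def split_beta)

lemma VerR_eqI:
  assumes "u \<in> Ver R" "v \<in> Ver R" "bV u = bV v" "vdom R u = vdom R v" "vcod R u = vcod R v"
    "\<And>w. w \<in> Ver X \<Longrightarrow> fVer P w = bV u \<Longrightarrow> sV u w = sV v w"
  shows "u = v"
proof -
  have d: "decode E VerD u \<in> VerD" "decode E VerD v \<in> VerD"
    using coded(3)[OF small_VerD] assms by (auto simp: R_sel VerR_def)
  have "sV u = sV v"
    by (rule extensionalityI[where A="fibre (fVer P) (Ver X) (bV u)"])
      (use d assms in \<open>auto simp: VerD_def split_beta bV_def sV_def fibre_def\<close>)
  then have "decode E VerD u = decode E VerD v"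
    using assms(3-5) by (simp add: bV_def sV_def domV_def codV_def R_sel prod_eq_iff)
  then show ?thesis using coded(4)[OF small_VerD] assms(1,2) by (metis R_sel(2) VerR_def)
qed

lemma mkH:
  assumes "isH v \<sigma> a b"
  shows "mkH v \<sigma> a b \<in> Hor R" "bH (mkH v \<sigma> a b) = v" "hsrc R (mkH v \<sigma> a b) = a" "htgt R (mkH v \<sigma> a b) = b"
    "w \<in> Hor X \<Longrightarrow> fHor P w = v \<Longrightarrow> sH (mkH v \<sigma> a b) w = \<sigma> w"
proof -
  have d: "(v, restrict \<sigma> (fibre (fHor P) (Hor X) v), a, b) \<in> HorD"
    using assms by (auto simp: HorD_def isH_def fibre_def)
  show "mkH v \<sigma> a b \<in> Hor R" "bH (mkH v \<sigma> a b) = v" "hsrc R (mkH v \<sigma> a b) = a" "htgt R (mkH v \<sigma> a b) = b"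
    "w \<in> Hor X \<Longrightarrow> fHor P w = v \<Longrightarrow> sH (mkH v \<sigma> a b) w = \<sigma> w"
    using coded(1,2)[OF small_HorD d]
    by (simp_all add: mkH_def bH_def sH_def srcH_def tgtH_def R_sel HorR_def fibre_def)
qed

lemma HorR_D:
  assumes "u \<in> Hor R"
  shows "bH u \<in> Hor Y" "hsrc R u \<in> Ob R" "htgt R u \<in> Ob R" "bO (hsrc R u) = hsrc Y (bH u)"
    "bO (htgt R u) = htgt Y (bH u)"
  using coded(3)[OF small_HorD, of u] assms
  by (auto simp: R_sel HorR_def bH_def sH_def srcH_def tgtH_def HorD_def isH_def split_beta)

lemma HorR_s:
  assumes "u \<in> Hor R" "w \<in> Hor X" "bH u = fHor P w"
  shows "sH u w \<in> Hor Z" "fHor Q (sH u w) = w" "hsrc Z (sH u w) = sO (hsrc R u) (hsrc X w)"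
    "htgt Z (sH u w) = sO (htgt R u) (htgt X w)"
  using coded(3)[OF small_HorD, of u] assms
  by (auto simp: R_sel HorR_def bH_def sH_def srcH_def tgtH_def HorD_def isH_def split_beta)

lemma HorR_eqI:
  assumes "u \<in> Hor R" "v \<in> Hor R" "bH u = bH v" "hsrc R u = hsrc R v" "htgt R u = htgt R v"
    "\<And>w. w \<in> Hor X \<Longrightarrow> fHor P w = bH u \<Longrightarrow> sH u w = sH v w"
  shows "u = v"
proof -
  have d: "decode E HorD u \<in> HorD" "decode E HorD v \<in> HorD"
    using coded(3)[OF small_HorD] assms by (auto simp: R_sel HorR_def)
  have "sH u = sH v"
    by (rule extensionalityI[where A="fibre (fHor P) (Hor X) (bH u)"])
      (use d assms in \<open>auto simp: HorD_def split_beta bH_def sH_def fibre_def\<close>)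
  then have "decode E HorD u = decode E HorD v"
    using assms(3-5) by (simp add: bH_def sH_def srcH_def tgtH_def R_sel prod_eq_iff)
  then show ?thesis using coded(4)[OF small_HorD] assms(1,2) by (metis R_sel(7) HorR_def)
qed

lemma isC_iff:
  "isC \<nu> t Hs H u u' \<longleftrightarrow> \<nu> \<in> Cel Y \<and> hpath R (vdom R u) Hs (vdom R u') \<and> map bH Hs = ctop Y \<nu> \<and>
    H \<in> Hor R \<and> bH H = ctgt Y \<nu> \<and> u \<in> Ver R \<and> bV u = cleft Y \<nu> \<and> u' \<in> Ver R \<and> bV u' = cright Y \<nu> \<and>
    vcod R u = hsrc R H \<and> vcod R u' = htgt R H \<and>
    (\<forall>\<theta>\<in>Cel X. fCel P \<theta> = \<nu> \<longrightarrow> t \<theta> \<in> Cel Z \<and> fCel Q (t \<theta>) = \<theta> \<and>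
      ctop Z (t \<theta>) = map2 sH Hs (ctop X \<theta>) \<and> ctgt Z (t \<theta>) = sH H (ctgt X \<theta>) \<and>
      cleft Z (t \<theta>) = sV u (cleft X \<theta>) \<and> cright Z (t \<theta>) = sV u' (cright X \<theta>))"
  unfolding isC_def hpath_R0 by (simp add: R_sel)

lemma mkC:
  assumes "isC \<nu> t Hs H u u'"
  shows "mkC \<nu> t Hs H u u' \<in> Cel R" "bC (mkC \<nu> t Hs H u u') = \<nu>" "ctop R (mkC \<nu> t Hs H u u') = Hs"
    "ctgt R (mkC \<nu> t Hs H u u') = H" "cleft R (mkC \<nu> t Hs H u u') = u" "cright R (mkC \<nu> t Hs H u u') = u'"
    "\<theta> \<in> Cel X \<Longrightarrow> fCel P \<theta> = \<nu> \<Longrightarrow> sC (mkC \<nu> t Hs H u u') \<theta> = t \<theta>"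
proof -
  have d: "(\<nu>, restrict t (fibre (fCel P) (Cel X) \<nu>), Hs, H, u, u') \<in> CelD"
    using assms by (auto simp: CelD_def isC_def fibre_def)
  show "mkC \<nu> t Hs H u u' \<in> Cel R" "bC (mkC \<nu> t Hs H u u') = \<nu>" "ctop R (mkC \<nu> t Hs H u u') = Hs"
    "ctgt R (mkC \<nu> t Hs H u u') = H" "cleft R (mkC \<nu> t Hs H u u') = u" "cright R (mkC \<nu> t Hs H u u') = u'"
    "\<theta> \<in> Cel X \<Longrightarrow> fCel P \<theta> = \<nu> \<Longrightarrow> sC (mkC \<nu> t Hs H u u') \<theta> = t \<theta>"
    using coded(1,2)[OF small_CelD d]
    by (simp_all add: mkC_def bC_def sC_def topC_def tgtC_def leftC_def rightC_def R_sel CelR_def fibre_def)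
qed

lemma CelR_isC:
  assumes "T \<in> Cel R"
  shows "isC (bC T) (sC T) (ctop R T) (ctgt R T) (cleft R T) (cright R T)"
  using coded(3)[OF small_CelD, of T] assms
  by (auto simp: R_sel CelR_def bC_def sC_def topC_def tgtC_def leftC_def rightC_def CelD_def)

lemma CelR_D:
  assumes "T \<in> Cel R"
  shows "bC T \<in> Cel Y" "hpath R (vdom R (cleft R T)) (ctop R T) (vdom R (cright R T))"
    "map bH (ctop R T) = ctop Y (bC T)" "ctgt R T \<in> Hor R" "bH (ctgt R T) = ctgt Y (bC T)"
    "cleft R T \<in> Ver R" "bV (cleft R T) = cleft Y (bC T)" "cright R T \<in> Ver R" "bV (cright R T) = cright Y (bC T)"
    "vcod R (cleft R T) = hsrc R (ctgt R T)" "vcod R (cright R T) = htgt R (ctgt R T)"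
  using CelR_isC[OF assms] unfolding isC_iff by auto

lemma CelR_s:
  assumes "T \<in> Cel R" "\<theta> \<in> Cel X" "bC T = fCel P \<theta>"
  shows "sC T \<theta> \<in> Cel Z" "fCel Q (sC T \<theta>) = \<theta>" "ctop Z (sC T \<theta>) = map2 sH (ctop R T) (ctop X \<theta>)"
    "ctgt Z (sC T \<theta>) = sH (ctgt R T) (ctgt X \<theta>)" "cleft Z (sC T \<theta>) = sV (cleft R T) (cleft X \<theta>)"
    "cright Z (sC T \<theta>) = sV (cright R T) (cright X \<theta>)" "length (ctop R T) = length (ctop X \<theta>)"
proof -
  show "sC T \<theta> \<in> Cel Z" "fCel Q (sC T \<theta>) = \<theta>" "ctop Z (sC T \<theta>) = map2 sH (ctop R T) (ctop X \<theta>)"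
    "ctgt Z (sC T \<theta>) = sH (ctgt R T) (ctgt X \<theta>)" "cleft Z (sC T \<theta>) = sV (cleft R T) (cleft X \<theta>)"
    "cright Z (sC T \<theta>) = sV (cright R T) (cright X \<theta>)"
    using CelR_isC[OF assms(1)] assms(2,3) unfolding isC_iff by auto
  have "map bH (ctop R T) = map (fHor P) (ctop X \<theta>)"
    using CelR_D(3)[OF assms(1)] P.top_fCel[OF assms(2)] assms(3) by simp
  then show "length (ctop R T) = length (ctop X \<theta>)" by (metis length_map)
qed

lemma CelR_eqI:
  assumes "T \<in> Cel R" "T' \<in> Cel R" "bC T = bC T'" "ctop R T = ctop R T'" "ctgt R T = ctgt R T'"
    "cleft R T = cleft R T'" "cright R T = cright R T'"
    "\<And>\<theta>. \<theta> \<in> Cel X \<Longrightarrow> fCel P \<theta> = bC T \<Longrightarrow> sC T \<theta> = sC T' \<theta>"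
  shows "T = T'"
proof -
  have d: "decode E CelD T \<in> CelD" "decode E CelD T' \<in> CelD"
    using coded(3)[OF small_CelD] assms by (auto simp: R_sel CelR_def)
  have "sC T = sC T'"
    by (rule extensionalityI[where A="fibre (fCel P) (Cel X) (bC T)"])
      (use d assms in \<open>auto simp: CelD_def split_beta bC_def sC_def fibre_def\<close>)
  then have "decode E CelD T = decode E CelD T'"
    using assms(3-7) by (simp add: bC_def sC_def topC_def tgtC_def leftC_def rightC_def R_sel prod_eq_iff)
  then show ?thesis using coded(4)[OF small_CelD] assms(1,2) by (metis R_sel(10) CelR_def)
qed

lemma vdc_graph_R: "vdc_graph R"
  by unfold_locales (simp_all add: VerR_D HorR_D CelR_D)

lemma boundary_map_base: "boundary_map R Y bO bV bH bC"
  by (simp add: boundary_map_def ObR_D VerR_D HorR_D CelR_D)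

end


context dependent_product
begin


section \<open>Identities and composites in the dependent product\<close>

lemma splitV_eq:
  assumes "w1 \<in> Ver X" "w2 \<in> Ver X" "vcod X w1 = vdom X w2"
  shows "splitV (fVer P w2) (fVer P w1) (vcomp X w2 w1) = (w2, w1)"
  unfolding splitV_def
proof (rule some_equality)
  fix p assume p: "fst p \<in> Ver X \<and> snd p \<in> Ver X \<and> vcod X (snd p) = vdom X (fst p) \<and>
     fVer P (fst p) = fVer P w2 \<and> fVer P (snd p) = fVer P w1 \<and> vcomp X (fst p) (snd p) = vcomp X w2 w1"
  then show "p = (w2, w1)" using P.vcomp_unique[of "snd p" "fst p" w1 w2] assms by (simp add: prod_eq_iff)
qed (use assms in simp)

lemma splitC_eq:
  assumes "composable X k w ths"
  shows "splitC (fCel P k) (fVer P w) (map (fCel P) ths) (mcomp X k w ths) = (k, w, ths)"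
  unfolding splitC_def
proof (rule some_equality)
  fix p assume p: "composable X (fst p) (fst (snd p)) (snd (snd p)) \<and>
     fCel P (fst p) = fCel P k \<and> fVer P (fst (snd p)) = fVer P w \<and> map (fCel P) (snd (snd p)) = map (fCel P) ths \<and>
     mcomp X (fst p) (fst (snd p)) (snd (snd p)) = mcomp X k w ths"
  then show "p = (k, w, ths)"
    using P.mcomp_unique[of "fst p" "fst (snd p)" "snd (snd p)" k w ths] assms by (simp add: prod_eq_iff)
qed (use assms in simp)

text \<open>Every lift of an identity is an identity, so the values of the identity at identities are all of its
  values.\<close>

lemma vid_R:
  assumes a: "a \<in> Ob R"
  shows "vid R a \<in> Ver R" "bV (vid R a) = vid Y (bO a)" "vdom R (vid R a) = a" "vcod R (vid R a) = a"
    "x \<in> Ob X \<Longrightarrow> bO a = fOb P x \<Longrightarrow> sV (vid R a) (vid X x) = vid Z (sO a x)"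
proof -
  have i: "isV (vid Y (bO a)) (\<lambda>w. vid Z (sO a (vdom X w))) a a"
    unfolding isV_def
  proof (intro conjI ballI impI)
    show "a \<in> ObR" "a \<in> ObR" using a by (simp_all add: R_sel)
    show "vid Y (bO a) \<in> Ver Y" "bO a = vdom Y (vid Y (bO a))" "bO a = vcod Y (vid Y (bO a))"
      using ObR_D(1)[OF a] by (simp_all add: P.B.boundary_rules)
    fix w assume w: "w \<in> Ver X" "fVer P w = vid Y (bO a)"
    have e: "w = vid X (vdom X w)" by (rule P.vid_reflect[OF w(1) ObR_D(1)[OF a] w(2)])
    have x: "vdom X w \<in> Ob X" using w by (simp add: P.A.boundary_rules)
    have px: "fOb P (vdom X w) = bO a"
      using P.dom_fVer[OF w(1)] ObR_D(1)[OF a] by (simp add: w(2) P.B.boundary_rules)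
    have c: "vcod X w = vdom X w" using e x P.A.cod_vid by metis
    show "vid Z (sO a (vdom X w)) \<in> Ver Z" "vdom Z (vid Z (sO a (vdom X w))) = sO a (vdom X w)"
      "vcod Z (vid Z (sO a (vdom X w))) = sO a (vcod X w)"
      using ObR_D(2)[OF a x px] by (simp_all add: c Q.A.boundary_rules)
    show "fVer Q (vid Z (sO a (vdom X w))) = w"
      using ObR_D(2)[OF a x px] e by (simp add: Q.fun_rules)
  qed
  show "vid R a \<in> Ver R" "bV (vid R a) = vid Y (bO a)" "vdom R (vid R a) = a" "vcod R (vid R a) = a"
    using mkV(1-4)[OF i] by (simp_all add: R_sel vidR_def)
  assume x: "x \<in> Ob X" "bO a = fOb P x"
  then show "sV (vid R a) (vid X x) = vid Z (sO a x)"
    using mkV(5)[OF i, of "vid X x"] by (simp add: R_sel vidR_def P.fun_rules P.A.boundary_rules)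
qed

lemma vcomp_R:
  assumes u: "u \<in> Ver R" and v: "v \<in> Ver R" and uv: "vcod R u = vdom R v"
  shows "vcomp R v u \<in> Ver R" "bV (vcomp R v u) = vcomp Y (bV v) (bV u)" "vdom R (vcomp R v u) = vdom R u"
    "vcod R (vcomp R v u) = vcod R v"
    "\<lbrakk>w1 \<in> Ver X; w2 \<in> Ver X; vcod X w1 = vdom X w2; bV u = fVer P w1; bV v = fVer P w2\<rbrakk>
      \<Longrightarrow> sV (vcomp R v u) (vcomp X w2 w1) = vcomp Z (sV v w2) (sV u w1)"
proof -
  note uD = VerR_D[OF u] and vD = VerR_D[OF v]
  let ?s = "\<lambda>w. vcomp Z (sV v (fst (splitV (bV v) (bV u) w))) (sV u (snd (splitV (bV v) (bV u) w)))"
  have uv': "vcod Y (bV u) = vdom Y (bV v)" using uD vD uv by simp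
  have i: "isV (vcomp Y (bV v) (bV u)) ?s (vdom R u) (vcod R v)"
    unfolding isV_def
  proof (intro conjI ballI impI)
    show "vdom R u \<in> ObR" "vcod R v \<in> ObR" using uD vD by (simp_all add: R_sel)
    show "vcomp Y (bV v) (bV u) \<in> Ver Y" "bO (vdom R u) = vdom Y (vcomp Y (bV v) (bV u))"
      "bO (vcod R v) = vcod Y (vcomp Y (bV v) (bV u))"
      using uD vD uv' by (simp_all add: P.B.boundary_rules)
    fix w assume w: "w \<in> Ver X" "fVer P w = vcomp Y (bV v) (bV u)"
    obtain w2 w1 where f: "w1 \<in> Ver X" "w2 \<in> Ver X" "vcod X w1 = vdom X w2" "fVer P w1 = bV u" "fVer P w2 = bV v"
      "w = vcomp X w2 w1"
      using P.vcomp_factor[OF w(1) uD(1) vD(1) uv' w(2)] by blast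
    have s: "splitV (bV v) (bV u) (vcomp X w2 w1) = (w2, w1)" using splitV_eq[OF f(1-3)] f(4,5) by simp
    note s1 = VerR_s[OF u f(1) f(4)[symmetric]] and s2 = VerR_s[OF v f(2) f(5)[symmetric]]
    show "?s w \<in> Ver Z" "fVer Q (?s w) = w" "vdom Z (?s w) = sO (vdom R u) (vdom X w)"
      "vcod Z (?s w) = sO (vcod R v) (vcod X w)"
      unfolding f(6) s using s1 s2 f(1-3) uv by (simp_all add: Q.A.boundary_rules Q.fun_rules P.A.boundary_rules)
  qed
  show "vcomp R v u \<in> Ver R" "bV (vcomp R v u) = vcomp Y (bV v) (bV u)" "vdom R (vcomp R v u) = vdom R u"
    "vcod R (vcomp R v u) = vcod R v"
    using mkV(1-4)[OF i] by (simp_all add: R_sel vcompR_def)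
  assume w: "w1 \<in> Ver X" "w2 \<in> Ver X" "vcod X w1 = vdom X w2" "bV u = fVer P w1" "bV v = fVer P w2"
  then show "sV (vcomp R v u) (vcomp X w2 w1) = vcomp Z (sV v w2) (sV u w1)"
    using mkV(5)[OF i, of "vcomp X w2 w1"] splitV_eq[OF w(1-3)]
    by (simp add: R_sel vcompR_def P.fun_rules P.A.boundary_rules)
qed

lemma cid_R:
  assumes H: "H \<in> Hor R"
  shows "cid R H \<in> Cel R" "bC (cid R H) = cid Y (bH H)" "ctop R (cid R H) = [H]" "ctgt R (cid R H) = H"
    "cleft R (cid R H) = vid R (hsrc R H)" "cright R (cid R H) = vid R (htgt R H)"
    "\<Phi> \<in> Hor X \<Longrightarrow> bH H = fHor P \<Phi> \<Longrightarrow> sC (cid R H) (cid X \<Phi>) = cid Z (sH H \<Phi>)"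
proof -
  note HD = HorR_D[OF H]
  note l = vid_R[OF HD(2)] and r = vid_R[OF HD(3)]
  let ?t = "\<lambda>\<theta>. cid Z (sH H (ctgt X \<theta>))"
  have i: "isC (cid Y (bH H)) ?t [H] H (vid R (hsrc R H)) (vid R (htgt R H))"
    unfolding isC_iff
  proof (intro conjI ballI impI)
    show "cid Y (bH H) \<in> Cel Y" "map bH [H] = ctop Y (cid Y (bH H))" "bH H = ctgt Y (cid Y (bH H))"
      using HD by (simp_all add: P.B.boundary_rules)
    show "H \<in> Hor R" by (rule H)
    show "vid R (hsrc R H) \<in> Ver R" "vid R (htgt R H) \<in> Ver R"
      "vcod R (vid R (hsrc R H)) = hsrc R H" "vcod R (vid R (htgt R H)) = htgt R H"
      using l r by simp_all
    show "bV (vid R (hsrc R H)) = cleft Y (cid Y (bH H))" "bV (vid R (htgt R H)) = cright Y (cid Y (bH H))"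
      using l r HD by (simp_all add: P.B.boundary_rules)
    show "hpath R (vdom R (vid R (hsrc R H))) [H] (vdom R (vid R (htgt R H)))"
      using l r HD H by simp
    fix \<theta> assume \<theta>: "\<theta> \<in> Cel X" "fCel P \<theta> = cid Y (bH H)"
    have e: "\<theta> = cid X (ctgt X \<theta>)" by (rule P.cid_reflect[OF \<theta>(1) HD(1) \<theta>(2)])
    have \<Phi>: "ctgt X \<theta> \<in> Hor X" using \<theta> by (simp add: P.A.boundary_rules)
    have p: "bH H = fHor P (ctgt X \<theta>)"
      using P.tgt_fCel[OF \<theta>(1)] HD(1) by (simp add: \<theta>(2) P.B.boundary_rules)
    note s = HorR_s[OF H \<Phi> p]
    have tl: "ctop X \<theta> = [ctgt X \<theta>]" "cleft X \<theta> = vid X (hsrc X (ctgt X \<theta>))" "cright X \<theta> = vid X (htgt X (ctgt X \<theta>))"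
      using e \<Phi> P.A.top_cid P.A.left_cid P.A.right_cid by metis+
    show "?t \<theta> \<in> Cel Z" "ctop Z (?t \<theta>) = map2 sH [H] (ctop X \<theta>)" "ctgt Z (?t \<theta>) = sH H (ctgt X \<theta>)"
      using s by (simp_all add: Q.A.boundary_rules tl(1))
    show "fCel Q (?t \<theta>) = \<theta>" using s e by (simp add: Q.fun_rules)
    show "cleft Z (?t \<theta>) = sV (vid R (hsrc R H)) (cleft X \<theta>)"
      unfolding tl(2) using s \<Phi> p HD l(5)[of "hsrc X (ctgt X \<theta>)"]
      by (simp add: Q.A.boundary_rules P.A.boundary_rules P.fun_rules)
    show "cright Z (?t \<theta>) = sV (vid R (htgt R H)) (cright X \<theta>)"
      unfolding tl(3) using s \<Phi> p HD r(5)[of "htgt X (ctgt X \<theta>)"]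
      by (simp add: Q.A.boundary_rules P.A.boundary_rules P.fun_rules)
  qed
  show "cid R H \<in> Cel R" "bC (cid R H) = cid Y (bH H)" "ctop R (cid R H) = [H]" "ctgt R (cid R H) = H"
    "cleft R (cid R H) = vid R (hsrc R H)" "cright R (cid R H) = vid R (htgt R H)"
    using mkC(1-6)[OF i] by (simp_all add: R_sel cidR_def)
  assume "\<Phi> \<in> Hor X" "bH H = fHor P \<Phi>"
  then show "sC (cid R H) (cid X \<Phi>) = cid Z (sH H \<Phi>)"
    using mkC(7)[OF i, of "cid X \<Phi>"] by (simp add: R_sel cidR_def P.fun_rules P.A.boundary_rules)
qed

text \<open>Evaluation respects boundaries, so evaluating the entries of a path of multicells at the entries of a
  path of lifts gives a path of multicells in \<open>Z\<close>.\<close>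

lemma eval_cpath:
  assumes "cpath R u Ts" "cpath X w ths" "bV u = fVer P w" "map bC Ts = map (fCel P) ths"
  shows "cpath Z (sV u w) (map2 sC Ts ths) \<and>
    cpath_end Z (sV u w) (map2 sC Ts ths) = sV (cpath_end R u Ts) (cpath_end X w ths) \<and>
    bV (cpath_end R u Ts) = fVer P (cpath_end X w ths) \<and>
    map (ctgt Z) (map2 sC Ts ths) = map2 sH (map (ctgt R) Ts) (map (ctgt X) ths) \<and>
    concat (map (ctop Z) (map2 sC Ts ths)) = map2 sH (concat (map (ctop R) Ts)) (concat (map (ctop X) ths)) \<and>
    map (fCel Q) (map2 sC Ts ths) = ths"
  using assms
proof (induction Ts arbitrary: u w ths)
  case Nil
  then show ?case using VerR_s[of u w] by auto
next
  case (Cons T Ts)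
  then obtain t ths' where t: "ths = t # ths'" by (cases ths) auto
  have T: "T \<in> Cel R" "t \<in> Cel X" "bC T = fCel P t" "cleft R T = u" "cleft X t = w"
    using Cons.prems by (auto simp: t)
  note s = CelR_s[OF T(1-3)]
  have "bV (cright R T) = fVer P (cright X t)" using T by (simp add: CelR_D P.fun_rules)
  then have IH: "cpath Z (sV (cright R T) (cright X t)) (map2 sC Ts ths') \<and>
    cpath_end Z (sV (cright R T) (cright X t)) (map2 sC Ts ths') = sV (cpath_end R (cright R T) Ts) (cpath_end X (cright X t) ths') \<and>
    bV (cpath_end R (cright R T) Ts) = fVer P (cpath_end X (cright X t) ths') \<and>
    map (ctgt Z) (map2 sC Ts ths') = map2 sH (map (ctgt R) Ts) (map (ctgt X) ths') \<and>
    concat (map (ctop Z) (map2 sC Ts ths')) = map2 sH (concat (map (ctop R) Ts)) (concat (map (ctop X) ths')) \<and>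
    map (fCel Q) (map2 sC Ts ths') = ths'"
    using Cons.IH[of "cright R T" "cright X t" ths'] Cons.prems by (simp add: t)
  then show ?case using s T by (simp add: t)
qed

lemma eval_composable:
  assumes "composable R T u Ts" "composable X t w ths" "bC T = fCel P t" "bV u = fVer P w" "map bC Ts = map (fCel P) ths"
  shows "composable Z (sC T t) (sV u w) (map2 sC Ts ths)"
proof -
  interpret R: vdc_graph R by (rule vdc_graph_R)
  note c = R.composableD[OF assms(1)] and d = P.A.composableD[OF assms(2)]
  note e = eval_cpath[OF c(2) d(2) assms(4,5)]
  note s = CelR_s[OF c(1) d(1) assms(3)]
  have "vcod Z (sV u w) = vdom Z (cleft Z (sC T t))"
    using VerR_s[OF c(5) d(5) assms(4)] VerR_s[of "cleft R T" "cleft X t"] s c d assms(3)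
    by (simp add: CelR_D P.fun_rules P.A.boundary_rules)
  then show ?thesis using e s c d by (simp add: composable_def)
qed

lemma base_composable:
  assumes "composable R T u Ts"
  shows "composable Y (bC T) (bV u) (map bC Ts)"
  by (rule boundary_map_composable[OF vdc_graph_R boundary_map_base assms])

text \<open>The last claim, that evaluation preserves composites, characterizes the composite: by the existence
  of factorizations every lift of its image has the form considered there.\<close>

lemma mcomp_R:
  assumes c: "composable R T u Ts"
  shows "mcomp R T u Ts \<in> Cel R" "bC (mcomp R T u Ts) = mcomp Y (bC T) (bV u) (map bC Ts)"
    "ctop R (mcomp R T u Ts) = concat (map (ctop R) Ts)" "ctgt R (mcomp R T u Ts) = ctgt R T"
    "cleft R (mcomp R T u Ts) = vcomp R (cleft R T) u"
    "cright R (mcomp R T u Ts) = vcomp R (cright R T) (cpath_end R u Ts)"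
    "\<lbrakk>composable X t w ths; bC T = fCel P t; bV u = fVer P w; map bC Ts = map (fCel P) ths\<rbrakk>
      \<Longrightarrow> sC (mcomp R T u Ts) (mcomp X t w ths) = mcomp Z (sC T t) (sV u w) (map2 sC Ts ths)"
proof -
  interpret R: vdc_graph R by (rule vdc_graph_R)
  note cD = R.composableD[OF c] and TD = CelR_D[OF R.composableD(1)[OF c]]
  note bc = base_composable[OF c]
  let ?u' = "cpath_end R u Ts"
  note l = vcomp_R[OF cD(5) TD(6) cD(4)] and r = vcomp_R[OF cD(6) TD(8) cD(8)]
  have bend: "cpath_end Y (bV u) (map bC Ts) = bV ?u'"
    using boundary_map_cpath[OF boundary_map_base cD(2)] by simp
  let ?t = "\<lambda>\<theta>. let p = splitC (bC T) (bV u) (map bC Ts) \<theta> in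
        mcomp Z (sC T (fst p)) (sV u (fst (snd p))) (map2 sC Ts (snd (snd p)))"
  have i: "isC (mcomp Y (bC T) (bV u) (map bC Ts)) ?t (concat (map (ctop R) Ts)) (ctgt R T)
      (vcomp R (cleft R T) u) (vcomp R (cright R T) ?u')"
    unfolding isC_iff
  proof (intro conjI ballI impI)
    show "mcomp Y (bC T) (bV u) (map bC Ts) \<in> Cel Y" by (rule P.B.mcomp_in[OF bc])
    show "hpath R (vdom R (vcomp R (cleft R T) u)) (concat (map (ctop R) Ts)) (vdom R (vcomp R (cright R T) ?u'))"
      using R.cpath_hpath_ctop[OF cD(2)] l r by simp
    have "map bH (concat (map (ctop R) Ts)) = concat (map (map bH) (map (ctop R) Ts))" by (rule map_concat)
    also have "map (map bH) (map (ctop R) Ts) = map (ctop Y) (map bC Ts)" using cD(7) by (auto simp: CelR_D)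
    finally show "map bH (concat (map (ctop R) Ts)) = ctop Y (mcomp Y (bC T) (bV u) (map bC Ts))"
      using P.B.top_mcomp[OF bc] by simp
    show "ctgt R T \<in> Hor R" "bH (ctgt R T) = ctgt Y (mcomp Y (bC T) (bV u) (map bC Ts))"
      using TD P.B.tgt_mcomp[OF bc] by simp_all
    show "vcomp R (cleft R T) u \<in> Ver R" "vcomp R (cright R T) ?u' \<in> Ver R"
      "vcod R (vcomp R (cleft R T) u) = hsrc R (ctgt R T)" "vcod R (vcomp R (cright R T) ?u') = htgt R (ctgt R T)"
      using l r TD by simp_all
    show "bV (vcomp R (cleft R T) u) = cleft Y (mcomp Y (bC T) (bV u) (map bC Ts))"
      "bV (vcomp R (cright R T) ?u') = cright Y (mcomp Y (bC T) (bV u) (map bC Ts))"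
      using l r TD P.B.left_mcomp[OF bc] P.B.right_mcomp[OF bc] bend by simp_all
    fix \<theta> assume \<theta>: "\<theta> \<in> Cel X" "fCel P \<theta> = mcomp Y (bC T) (bV u) (map bC Ts)"
    obtain k w ths where f: "composable X k w ths" "fCel P k = bC T" "fVer P w = bV u" "map (fCel P) ths = map bC Ts"
      "\<theta> = mcomp X k w ths"
      using P.mcomp_factor[OF \<theta>(1) bc \<theta>(2)] by blast
    have split: "splitC (bC T) (bV u) (map bC Ts) \<theta> = (k, w, ths)"
      using splitC_eq[OF f(1)] unfolding f(2-5) .
    note xD = P.A.composableD[OF f(1)]
    note e = eval_cpath[OF cD(2) xD(2) f(3)[symmetric] f(4)[symmetric]]
    note ec = eval_composable[OF c f(1) f(2)[symmetric] f(3)[symmetric] f(4)[symmetric]]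
    note s = CelR_s[OF cD(1) xD(1) f(2)[symmetric]]
    have t: "?t \<theta> = mcomp Z (sC T k) (sV u w) (map2 sC Ts ths)" by (simp add: split)
    note us = VerR_s[OF cD(5) xD(5) f(3)[symmetric]]
    show "?t \<theta> \<in> Cel Z" unfolding t by (rule Q.A.mcomp_in[OF ec])
    show "fCel Q (?t \<theta>) = \<theta>"
      unfolding t Q.fCel_comp[OF ec] using s us e by (simp add: f(5))
    show "ctop Z (?t \<theta>) = map2 sH (concat (map (ctop R) Ts)) (ctop X \<theta>)"
      unfolding t Q.A.top_mcomp[OF ec] using e f(1) by (simp add: f(5) P.A.top_mcomp)
    show "ctgt Z (?t \<theta>) = sH (ctgt R T) (ctgt X \<theta>)"
      unfolding t Q.A.tgt_mcomp[OF ec] using s f(1) by (simp add: f(5) P.A.tgt_mcomp)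
    show "cleft Z (?t \<theta>) = sV (vcomp R (cleft R T) u) (cleft X \<theta>)"
      unfolding t unfolding Q.A.left_mcomp[OF ec] f(5) P.A.left_mcomp[OF f(1)]
      using s(5) l(5)[of w "cleft X k"] xD TD f(3) P.left_fCel[OF xD(1), unfolded f(2)]
      by (simp add: P.A.boundary_rules)
    show "cright Z (?t \<theta>) = sV (vcomp R (cright R T) ?u') (cright X \<theta>)"
      unfolding t unfolding Q.A.right_mcomp[OF ec] f(5) P.A.right_mcomp[OF f(1)]
      using s(6) r(5)[of "cpath_end X w ths" "cright X k"] xD TD e P.right_fCel[OF xD(1), unfolded f(2)]
      by (simp add: P.A.boundary_rules)
  qed
  have m: "mcomp R T u Ts = mkC (mcomp Y (bC T) (bV u) (map bC Ts)) ?t (concat (map (ctop R) Ts)) (ctgt R T)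
      (vcomp R (cleft R T) u) (vcomp R (cright R T) ?u')"
    by (simp add: R_sel(16) mcompR_def cpath_end_R0) (simp add: R_sel)
  show "mcomp R T u Ts \<in> Cel R" "bC (mcomp R T u Ts) = mcomp Y (bC T) (bV u) (map bC Ts)"
    "ctop R (mcomp R T u Ts) = concat (map (ctop R) Ts)" "ctgt R (mcomp R T u Ts) = ctgt R T"
    "cleft R (mcomp R T u Ts) = vcomp R (cleft R T) u"
    "cright R (mcomp R T u Ts) = vcomp R (cright R T) ?u'"
    unfolding m by (rule mkC[OF i])+
  assume x: "composable X t w ths" "bC T = fCel P t" "bV u = fVer P w" "map bC Ts = map (fCel P) ths"
  have "fCel P (mcomp X t w ths) = mcomp Y (bC T) (bV u) (map bC Ts)" using P.fCel_comp[OF x(1)] x by simp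
  from mkC(7)[OF i P.A.mcomp_in[OF x(1)] this]
  show "sC (mcomp R T u Ts) (mcomp X t w ths) = mcomp Z (sC T t) (sV u w) (map2 sC Ts ths)"
    unfolding m using splitC_eq[OF x(1)] by (simp add: x)
qed

lemma vdc_operations_R: "vdc_operations R"
  by (intro vdc_operations.intro vdc_graph_R vdc_operations_axioms.intro)
    (simp_all add: vid_R vcomp_R cid_R mcomp_R)

lemma map_factor_concat:
  "map f xs = concat yss \<Longrightarrow> \<exists>xss. xs = concat xss \<and> map (map f) xss = yss"
proof (induction yss arbitrary: xs)
  case (Cons ys yss)
  then obtain xs1 xs2 where "xs = xs1 @ xs2" "map f xs1 = ys" "map f xs2 = concat yss"
    by (auto simp: map_eq_append_conv)
  moreover from this obtain xss where "xs2 = concat xss" "map (map f) xss = yss" using Cons.IH by blast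
  ultimately show ?case by (intro exI[of _ "xs1 # xss"]) simp
qed simp

lemma concat_eq_blocks:
  "concat xss = concat yss \<Longrightarrow> map length xss = map length yss \<Longrightarrow> xss = yss"
proof (induction xss arbitrary: yss)
  case (Cons xs xss)
  then show ?case by (cases yss) auto
qed simp

lemma map2_concat:
  "map length xss = map length yss \<Longrightarrow> map2 f (concat xss) (concat yss) = concat (map2 (map2 f) xss yss)"
proof (induction xss arbitrary: yss)
  case (Cons xs xss)
  then show ?case by (cases yss) auto
qed simp

text \<open>Evaluation also preserves the blocks of composites in the associativity law; the two block structures
  agree because corresponding tops have equal length.\<close>

lemma eval_block_comps:
  assumes "cpath R v Ts" "cpath R u (concat Css)" "vcod R u = vdom R v" "map (map (ctgt R)) Css = map (ctop R) Ts"
    and "cpath X v' ths" "cpath X u' (concat css)" "vcod X u' = vdom X v'" "map (map (ctgt X)) css = map (ctop X) ths"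
    and "bV u = fVer P u'" "map bC Ts = map (fCel P) ths" "map (map bC) Css = map (map (fCel P)) css"
  shows "map2 sC (block_comps R u Ts Css) (block_comps X u' ths css)
    = block_comps Z (sV u u') (map2 sC Ts ths) (map2 (map2 sC) Css css)"
  using assms
proof (induction Ts arbitrary: u v u' v' Css ths css)
  case Nil
  then show ?case by simp
next
  case (Cons T Ts)
  interpret R: vdc_operations R by (rule vdc_operations_R)
  obtain t ths' where t: "ths = t # ths'" using Cons.prems(10) by (cases ths) auto
  obtain C Css' where C: "Css = C # Css'" using Cons.prems(4) by (cases Css) auto
  obtain c css' where c: "css = c # css'" using Cons.prems(11) by (cases css) (auto simp: C)
  have T: "composable R T u C" "composable X t u' c" "bC T = fCel P t" "map bC C = map (fCel P) c"
    using Cons.prems by (auto simp: t C c composable_def R.cpath_append P.A.cpath_append)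
  note e = eval_cpath[OF R.composableD(2)[OF T(1)] P.A.composableD(2)[OF T(2)] Cons.prems(9) T(4)]
  have "map2 sC (block_comps R (cpath_end R u C) Ts Css') (block_comps X (cpath_end X u' c) ths' css')
    = block_comps Z (sV (cpath_end R u C) (cpath_end X u' c)) (map2 sC Ts ths') (map2 (map2 sC) Css' css')"
    by (rule Cons.IH[of "cright R T" _ _ "cright X t"])
      (use Cons.prems R.composableD(8)[OF T(1)] P.A.composableD(8)[OF T(2)] e in
        \<open>auto simp: t C c R.cpath_append P.A.cpath_append\<close>)
  then show ?case
    using mcomp_R(7)[OF T(1,2,3) Cons.prems(9) T(4)] e by (simp add: t C c)
qed

lemma vcomp_R_eqI:
  assumes "u \<in> Ver R" "v \<in> Ver R" "bV u = bV v" "vdom R u = vdom R v" "vcod R u = vcod R v"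
    "\<And>w. w \<in> Ver X \<Longrightarrow> bV u = fVer P w \<Longrightarrow> sV u w = sV v w"
  shows "u = v"
  using VerR_eqI[OF assms(1-5)] assms(6) by metis

lemma vcomp_R_vid:
  assumes u: "u \<in> Ver R"
  shows "vcomp R u (vid R (vdom R u)) = u" "vcomp R (vid R (vcod R u)) u = u"
proof -
  note uD = VerR_D[OF u]
  note i = vid_R[OF uD(2)] and j = vid_R[OF uD(3)]
  note c = vcomp_R[OF i(1) u i(4)] and d = vcomp_R[OF u j(1) j(3)[symmetric]]
  show "vcomp R u (vid R (vdom R u)) = u"
  proof (rule vcomp_R_eqI[OF c(1) u])
    show "bV (vcomp R u (vid R (vdom R u))) = bV u"
      using c i uD by (simp add: P.B.vcomp_vid_right)
    show "vdom R (vcomp R u (vid R (vdom R u))) = vdom R u" "vcod R (vcomp R u (vid R (vdom R u))) = vcod R u"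
      using c i by simp_all
    fix w assume "w \<in> Ver X" "bV (vcomp R u (vid R (vdom R u))) = fVer P w"
    then have w: "w \<in> Ver X" "bV u = fVer P w" using c i uD by (simp_all add: P.B.vcomp_vid_right)
    have "sV (vcomp R u (vid R (vdom R u))) (vcomp X w (vid X (vdom X w))) = vcomp Z (sV u w) (vid Z (sO (vdom R u) (vdom X w)))"
      using c(5)[of "vid X (vdom X w)" w] i(5)[of "vdom X w"] w uD i(2)
      by (simp add: P.A.boundary_rules P.fun_rules)
    then show "sV (vcomp R u (vid R (vdom R u))) w = sV u w"
      using VerR_s[OF u w] w by (simp add: P.A.vcomp_vid_right Q.A.vcomp_vid_right')
  qed
  show "vcomp R (vid R (vcod R u)) u = u"
  proof (rule vcomp_R_eqI[OF d(1) u])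
    show "bV (vcomp R (vid R (vcod R u)) u) = bV u"
      using d j uD by (simp add: P.B.vcomp_vid_left)
    show "vdom R (vcomp R (vid R (vcod R u)) u) = vdom R u" "vcod R (vcomp R (vid R (vcod R u)) u) = vcod R u"
      using d j by simp_all
    fix w assume "w \<in> Ver X" "bV (vcomp R (vid R (vcod R u)) u) = fVer P w"
    then have w: "w \<in> Ver X" "bV u = fVer P w" using d j uD by (simp_all add: P.B.vcomp_vid_left)
    have "sV (vcomp R (vid R (vcod R u)) u) (vcomp X (vid X (vcod X w)) w) = vcomp Z (vid Z (sO (vcod R u) (vcod X w))) (sV u w)"
      using d(5)[of w "vid X (vcod X w)"] j(5)[of "vcod X w"] w uD j(2)
      by (simp add: P.A.boundary_rules P.fun_rules)
    then show "sV (vcomp R (vid R (vcod R u)) u) w = sV u w"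
      using VerR_s[OF u w] w by (simp add: P.A.vcomp_vid_left Q.A.vcomp_vid_left')
  qed
qed

lemma vcomp_R_assoc:
  assumes u: "u \<in> Ver R" and v: "v \<in> Ver R" and w: "w \<in> Ver R" and uv: "vcod R u = vdom R v" and vw: "vcod R v = vdom R w"
  shows "vcomp R (vcomp R w v) u = vcomp R w (vcomp R v u)"
proof -
  note D = VerR_D[OF u] VerR_D[OF v] VerR_D[OF w]
  note c1 = vcomp_R[OF u v uv] and c2 = vcomp_R[OF v w vw]
  have e: "vcod R u = vdom R (vcomp R w v)" "vcod R (vcomp R v u) = vdom R w" using c1 c2 uv vw by simp_all
  note c3 = vcomp_R[OF u c2(1) e(1)] and c4 = vcomp_R[OF c1(1) w e(2)]
  have y: "vcod Y (bV u) = vdom Y (bV v)" "vcod Y (bV v) = vdom Y (bV w)"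
    using D(5,9,10,14) uv vw by simp_all
  show ?thesis
  proof (rule vcomp_R_eqI[OF c3(1) c4(1)])
    show b: "bV (vcomp R (vcomp R w v) u) = bV (vcomp R w (vcomp R v u))"
      using c1 c2 c3 c4 D y by (simp add: P.B.vcomp_assoc)
    show "vdom R (vcomp R (vcomp R w v) u) = vdom R (vcomp R w (vcomp R v u))"
      "vcod R (vcomp R (vcomp R w v) u) = vcod R (vcomp R w (vcomp R v u))"
      using c1 c2 c3 c4 by simp_all
    fix x assume x: "x \<in> Ver X" "bV (vcomp R (vcomp R w v) u) = fVer P x"
    obtain x' x1 where f: "x1 \<in> Ver X" "x' \<in> Ver X" "vcod X x1 = vdom X x'" "fVer P x1 = bV u"
      "fVer P x' = vcomp Y (bV w) (bV v)" "x = vcomp X x' x1"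
      using P.vcomp_factor[of x "bV u" "vcomp Y (bV w) (bV v)"] x c2 c3 D y by (auto simp: P.B.boundary_rules)
    obtain x3 x2 where g: "x2 \<in> Ver X" "x3 \<in> Ver X" "vcod X x2 = vdom X x3" "fVer P x2 = bV v"
      "fVer P x3 = bV w" "x' = vcomp X x3 x2"
      using P.vcomp_factor[of x' "bV v" "bV w"] f D y by auto
    have h: "vcod X x1 = vdom X x2" using f(3) g by (simp add: P.A.boundary_rules)
    note s = VerR_s[OF u f(1) f(4)[symmetric]] VerR_s[OF v g(1) g(4)[symmetric]] VerR_s[OF w g(2) g(5)[symmetric]]
    have "sV (vcomp R (vcomp R w v) u) x = vcomp Z (vcomp Z (sV w x3) (sV v x2)) (sV u x1)"
      using c3(5)[of x1 "vcomp X x3 x2"] c2(5)[of x2 x3] c2(2) f g h by (simp add: P.A.boundary_rules P.fun_rules)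
    moreover have "sV (vcomp R w (vcomp R v u)) x = vcomp Z (sV w x3) (vcomp Z (sV v x2) (sV u x1))"
      using c4(5)[of "vcomp X x2 x1" x3] c1(5)[of x1 x2] c1(2) f g h
      by (simp add: P.A.boundary_rules P.fun_rules P.A.vcomp_assoc)
    moreover have "vcomp Z (vcomp Z (sV w x3) (sV v x2)) (sV u x1) = vcomp Z (sV w x3) (vcomp Z (sV v x2) (sV u x1))"
      by (rule Q.A.vcomp_assoc) (use s uv vw h g in simp_all)
    ultimately show "sV (vcomp R (vcomp R w v) u) x = sV (vcomp R w (vcomp R v u)) x" by simp
  qed
qed

text \<open>A multicell of \<open>X\<close> is its own composite with identities, and evaluation at this factorization reduces
  the unit law to that of \<open>Z\<close>; the same argument applies to \<open>mcomp_R_cid_left\<close>.\<close>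

lemma mcomp_R_cid_right:
  assumes T: "T \<in> Cel R"
  shows "mcomp R T (vid R (vdom R (cleft R T))) (map (cid R) (ctop R T)) = T"
proof -
  interpret R: vdc_operations R by (rule vdc_operations_R)
  note TD = CelR_D[OF T]
  note c = R.composable_cids[OF T]
  note m = mcomp_R[OF c]
  have Hs: "set (ctop R T) \<subseteq> Hor R" by (rule R.ctop_Hor[OF T])
  have a: "vdom R (cleft R T) \<in> Ob R" using VerR_D[OF TD(6)] by simp
  have b0: "bO (vdom R (cleft R T)) = vdom Y (cleft Y (bC T))" using VerR_D[OF TD(6)] TD by simp
  have cids: "map bC (map (cid R) (ctop R T)) = map (cid Y) (ctop Y (bC T))"
    using Hs by (auto simp: cid_R TD(3)[symmetric])
  have base: "bC (mcomp R T (vid R (vdom R (cleft R T))) (map (cid R) (ctop R T))) = bC T"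
    unfolding m(2) cids vid_R(2)[OF a] b0 by (rule P.B.mcomp_cid_right[OF TD(1)])
  have ids: "concat (map (ctop R) (map (cid R) Hs)) = Hs" if "set Hs \<subseteq> Hor R" for Hs
    using that by (induction Hs) (auto simp: cid_R)
  have "cpath_end R (vid R (vdom R (cleft R T))) (map (cid R) (ctop R T)) = vid R (vdom R (cright R T))"
    using R.cpath_cids[OF TD(2)] by simp
  then have bd: "ctop R (mcomp R T (vid R (vdom R (cleft R T))) (map (cid R) (ctop R T))) = ctop R T"
    "ctgt R (mcomp R T (vid R (vdom R (cleft R T))) (map (cid R) (ctop R T))) = ctgt R T"
    "cleft R (mcomp R T (vid R (vdom R (cleft R T))) (map (cid R) (ctop R T))) = cleft R T"
    "cright R (mcomp R T (vid R (vdom R (cleft R T))) (map (cid R) (ctop R T))) = cright R T"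
    using m ids[OF Hs] TD by (simp_all add: vcomp_R_vid)
  show ?thesis
  proof (rule CelR_eqI[OF m(1) T base bd])
    fix \<theta> assume \<theta>: "\<theta> \<in> Cel X" "fCel P \<theta> = bC (mcomp R T (vid R (vdom R (cleft R T))) (map (cid R) (ctop R T)))"
    then have p: "bC T = fCel P \<theta>" using base by simp
    note s = CelR_s[OF T \<theta>(1) p]
    let ?x = "vdom X (cleft X \<theta>)"
    have x: "?x \<in> Ob X" "bO (vdom R (cleft R T)) = fOb P ?x"
      using \<theta>(1) b0 by (simp_all add: p P.A.boundary_rules P.fun_rules)
    have hp: "map bH (ctop R T) = map (fHor P) (ctop X \<theta>)" using TD(3) \<theta>(1) by (simp add: p P.fun_rules)
    have Hx: "set (ctop X \<theta>) \<subseteq> Hor X" by (rule P.A.ctop_Hor[OF \<theta>(1)])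
    have cs: "map bC (map (cid R) (ctop R T)) = map (fCel P) (map (cid X) (ctop X \<theta>))"
      unfolding cids TD(3)[symmetric] hp using Hx by (auto simp: P.fun_rules)
    have "sC (mcomp R T (vid R (vdom R (cleft R T))) (map (cid R) (ctop R T)))
        (mcomp X \<theta> (vid X ?x) (map (cid X) (ctop X \<theta>)))
      = mcomp Z (sC T \<theta>) (sV (vid R (vdom R (cleft R T))) (vid X ?x)) (map2 sC (map (cid R) (ctop R T)) (map (cid X) (ctop X \<theta>)))"
      by (rule m(7)[OF P.A.composable_cids[OF \<theta>(1)] p _ cs])
        (use x in \<open>simp add: vid_R(2)[OF a] P.fun_rules\<close>)
    also have "sV (vid R (vdom R (cleft R T))) (vid X ?x) = vid Z (vdom Z (cleft Z (sC T \<theta>)))"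
      using vid_R(5)[OF a x] s VerR_s[of "cleft R T" "cleft X \<theta>"] TD \<theta>(1) p
      by (simp add: P.fun_rules P.A.boundary_rules)
    also have "map2 sC (map (cid R) (ctop R T)) (map (cid X) (ctop X \<theta>)) = map (cid Z) (map2 sH (ctop R T) (ctop X \<theta>))"
    proof -
      have "length Hs = length \<Phi>s \<Longrightarrow> map bH Hs = map (fHor P) \<Phi>s \<Longrightarrow> set Hs \<subseteq> Hor R \<Longrightarrow> set \<Phi>s \<subseteq> Hor X \<Longrightarrow>
         map2 sC (map (cid R) Hs) (map (cid X) \<Phi>s) = map (cid Z) (map2 sH Hs \<Phi>s)" for Hs \<Phi>s
        by (induction Hs \<Phi>s rule: list_induct2) (auto simp: cid_R)
      from this[OF s(7) hp Hs Hx] show ?thesis .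
    qed
    also have "mcomp Z (sC T \<theta>) (vid Z (vdom Z (cleft Z (sC T \<theta>)))) (map (cid Z) (map2 sH (ctop R T) (ctop X \<theta>))) = sC T \<theta>"
      using Q.A.mcomp_cid_right[OF s(1)] s(3) by simp
    also have "mcomp X \<theta> (vid X ?x) (map (cid X) (ctop X \<theta>)) = \<theta>" by (rule P.A.mcomp_cid_right[OF \<theta>(1)])
    finally show "sC (mcomp R T (vid R (vdom R (cleft R T))) (map (cid R) (ctop R T))) \<theta> = sC T \<theta>" .
  qed
qed

lemma mcomp_R_cid_left:
  assumes T: "T \<in> Cel R"
  shows "mcomp R (cid R (ctgt R T)) (cleft R T) [T] = T"
proof -
  interpret R: vdc_operations R by (rule vdc_operations_R)
  note TD = CelR_D[OF T]
  note i = cid_R[OF TD(4)]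
  have c: "composable R (cid R (ctgt R T)) (cleft R T) [T]" by (rule R.composable_single) (use T i in simp_all)
  note m = mcomp_R[OF c]
  have base: "bC (mcomp R (cid R (ctgt R T)) (cleft R T) [T]) = bC T"
    using m(2) i TD P.B.mcomp_cid_left[OF TD(1)] by simp
  have bd: "ctop R (mcomp R (cid R (ctgt R T)) (cleft R T) [T]) = ctop R T"
    "ctgt R (mcomp R (cid R (ctgt R T)) (cleft R T) [T]) = ctgt R T"
    "cleft R (mcomp R (cid R (ctgt R T)) (cleft R T) [T]) = cleft R T"
    "cright R (mcomp R (cid R (ctgt R T)) (cleft R T) [T]) = cright R T"
    using m i vcomp_R_vid(2)[OF TD(6)] vcomp_R_vid(2)[OF TD(8)] TD by simp_all
  show ?thesis
  proof (rule CelR_eqI[OF m(1) T base bd])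
    fix \<theta> assume \<theta>: "\<theta> \<in> Cel X" "fCel P \<theta> = bC (mcomp R (cid R (ctgt R T)) (cleft R T) [T])"
    then have p: "bC T = fCel P \<theta>" using base by simp
    note s = CelR_s[OF T \<theta>(1) p]
    have t: "ctgt X \<theta> \<in> Hor X" using \<theta>(1) by (simp add: P.A.boundary_rules)
    have cx: "composable X (cid X (ctgt X \<theta>)) (cleft X \<theta>) [\<theta>]"
      by (rule P.A.composable_single) (use \<theta>(1) in \<open>simp_all add: P.A.boundary_rules\<close>)
    have "sC (mcomp R (cid R (ctgt R T)) (cleft R T) [T]) (mcomp X (cid X (ctgt X \<theta>)) (cleft X \<theta>) [\<theta>])
        = mcomp Z (sC (cid R (ctgt R T)) (cid X (ctgt X \<theta>))) (sV (cleft R T) (cleft X \<theta>)) (map2 sC [T] [\<theta>])"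
      by (rule m(7)[OF cx]) (use i TD p t \<theta>(1) in \<open>simp_all add: P.fun_rules\<close>)
    also have "\<dots> = mcomp Z (cid Z (ctgt Z (sC T \<theta>))) (cleft Z (sC T \<theta>)) [sC T \<theta>]"
      using s i(7)[OF t] TD p \<theta>(1) by (simp add: P.fun_rules)
    also have "\<dots> = sC T \<theta>" by (rule Q.A.mcomp_cid_left[OF s(1)])
    finally show "sC (mcomp R (cid R (ctgt R T)) (cleft R T) [T]) \<theta> = sC T \<theta>"
      using P.A.mcomp_cid_left[OF \<theta>(1)] by simp
  qed
qed

lemma map_block_comps_base:
  assumes "cpath R v Ts" "cpath R u (concat Css)" "vcod R u = vdom R v" "map (map (ctgt R)) Css = map (ctop R) Ts"
  shows "map bC (block_comps R u Ts Css) = block_comps Y (bV u) (map bC Ts) (map (map bC) Css)"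
  using assms
proof (induction Ts arbitrary: u v Css)
  case (Cons T Ts)
  interpret R: vdc_operations R by (rule vdc_operations_R)
  obtain C Css' where C: "Css = C # Css'" using Cons.prems(4) by (cases Css) auto
  have T: "composable R T u C" using Cons.prems by (auto simp: C composable_def R.cpath_append)
  have "cpath_end Y (bV u) (map bC C) = bV (cpath_end R u C)"
    using boundary_map_cpath[OF boundary_map_base R.composableD(2)[OF T]] by simp
  moreover have "map bC (block_comps R (cpath_end R u C) Ts Css') = block_comps Y (bV (cpath_end R u C)) (map bC Ts) (map (map bC) Css')"
    by (rule Cons.IH[of "cright R T"])
      (use Cons.prems R.composableD(8)[OF T] in \<open>auto simp: C R.cpath_append\<close>)
  ultimately show ?case using mcomp_R(2)[OF T] by (simp add: C)
qed simp

text \<open>A lift \<open>\<theta>\<close> of the image is factored in two steps, first over the outer composite on the left-hand side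
  and then over the inner one. By associativity in \<open>X\<close> the same constituents factor \<open>\<theta>\<close> as required for
  the right-hand side. Hence both sides have as value at \<open>\<theta>\<close> a composite of the same multicells of \<open>Z\<close>,
  bracketed in the two ways that associativity in \<open>Z\<close> identifies.\<close>

lemma mcomp_R_assoc:
  assumes c: "composable R T v Ts" and p: "cpath R u (concat Css)" and uv: "vcod R u = vdom R v"
    and t: "map (map (ctgt R)) Css = map (ctop R) Ts"
  shows "mcomp R (mcomp R T v Ts) u (concat Css) = mcomp R T (vcomp R v u) (block_comps R u Ts Css)"
proof -
  interpret R: vdc_operations R by (rule vdc_operations_R)
  note cD = R.composableD[OF c] and TD = CelR_D[OF R.composableD(1)[OF c]]
  note pV = R.cpath_Ver[OF p]
  note c1 = R.composable_mcomp[OF c p uv t] and c2 = R.composable_block_comps[OF c p uv t]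
  note m0 = mcomp_R[OF c] and m1 = mcomp_R[OF c1] and m2 = mcomp_R[OF c2]
  note bl = R.block_comps[OF cD(2) p uv t]
  note v1 = vcomp_R[OF conjunct1[OF pV] cD(5) uv]
  have bt: "map (map (ctgt Y)) (map (map bC) Css) = map (ctop Y) (map bC Ts)"
  proof -
    have "set (concat Css) \<subseteq> Cel R" by (rule R.cpath_Cel[OF p])
    then have "map (map (ctgt Y)) (map (map bC) Css) = map (map bH) (map (map (ctgt R)) Css)"
      by (auto simp: CelR_D)
    also have "\<dots> = map (ctop Y) (map bC Ts)" unfolding t using cD(7) by (auto simp: CelR_D)
    finally show ?thesis .
  qed
  have bp: "cpath Y (bV u) (concat (map (map bC) Css))"
    using boundary_map_cpath[OF boundary_map_base p] by (simp add: map_concat)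
  have buv: "vcod Y (bV u) = vdom Y (bV v)" using VerR_D[of u] VerR_D[of v] pV cD uv by metis
  have base: "bC (mcomp R (mcomp R T v Ts) u (concat Css)) = bC (mcomp R T (vcomp R v u) (block_comps R u Ts Css))"
    using P.B.mcomp_assoc[OF base_composable[OF c] bp buv bt] m0(2) m1(2) m2(2) v1(2)
      map_block_comps_base[OF cD(2) p uv t] by (simp add: map_concat)
  have endv: "vcod R (cpath_end R u (concat Css)) = vdom R (cpath_end R v Ts)"
  proof -
    have "cright R (mcomp R T v Ts) = vcomp R (cright R T) (cpath_end R v Ts)" by (rule m0(6))
    then show ?thesis using R.composableD(8)[OF c1] vcomp_R(3)[OF cD(6) TD(8) cD(8)] by simp
  qed
  have bd: "ctop R (mcomp R (mcomp R T v Ts) u (concat Css)) = ctop R (mcomp R T (vcomp R v u) (block_comps R u Ts Css))"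
    "ctgt R (mcomp R (mcomp R T v Ts) u (concat Css)) = ctgt R (mcomp R T (vcomp R v u) (block_comps R u Ts Css))"
    "cleft R (mcomp R (mcomp R T v Ts) u (concat Css)) = cleft R (mcomp R T (vcomp R v u) (block_comps R u Ts Css))"
    "cright R (mcomp R (mcomp R T v Ts) u (concat Css)) = cright R (mcomp R T (vcomp R v u) (block_comps R u Ts Css))"
    using m0 m1 m2 bl vcomp_R_assoc[OF _ cD(5) TD(6) uv cD(4)] pV
      vcomp_R_assoc[OF _ cD(6) TD(8) endv cD(8)] by simp_all
  show ?thesis
  proof (rule CelR_eqI[OF m1(1) m2(1) base bd])
    fix \<theta> assume \<theta>: "\<theta> \<in> Cel X" "fCel P \<theta> = bC (mcomp R (mcomp R T v Ts) u (concat Css))"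
    obtain k' w chs where f: "composable X k' w chs" "fCel P k' = bC (mcomp R T v Ts)" "fVer P w = bV u"
      "map (fCel P) chs = map bC (concat Css)" "\<theta> = mcomp X k' w chs"
      using P.mcomp_factor[OF \<theta>(1) base_composable[OF c1]] \<theta>(2) m1(2) by metis
    note fD = P.A.composableD[OF f(1)]
    obtain k v' ths where g: "composable X k v' ths" "fCel P k = bC T" "fVer P v' = bV v"
      "map (fCel P) ths = map bC Ts" "k' = mcomp X k v' ths"
      using P.mcomp_factor[OF fD(1) base_composable[OF c]] f(2) m0(2) by metis
    note gD = P.A.composableD[OF g(1)]
    \<comment> \<open>The lifted path inherits the block structure of the path below it.\<close>
    obtain css where css: "chs = concat css" "map (map (fCel P)) css = map (map bC) Css"
      using map_factor_concat[of "fCel P" chs "map (map bC) Css"] f(4) by (auto simp: map_concat)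
    have len: "map length Css = map length css"
      using arg_cong[OF css(2), of "map length"] by (simp add: o_def)
    have wv: "vcod X w = vdom X v'"
      using fD(4) g gD by (simp add: P.A.boundary_rules)
    have lenT: "length (ctop R T') = length (ctop X t')" if "T' \<in> Cel R" "t' \<in> Cel X" "bC T' = fCel P t'" for T' t'
      using CelR_s(7)[OF that] .
    \<comment> \<open>The blocks fit the tops of the lifted factors, since the concatenations and all lengths agree.\<close>
    have "map (length \<circ> ctop R) Ts = map (length \<circ> ctop X) ths"
    proof -
      have "map bC Ts = map (fCel P) ths \<Longrightarrow> set Ts \<subseteq> Cel R \<Longrightarrow> set ths \<subseteq> Cel X \<Longrightarrow>
          map (length \<circ> ctop R) Ts = map (length \<circ> ctop X) ths"
      proof (induction Ts arbitrary: ths)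
        case (Cons T' Ts)
        then show ?case by (cases ths) (auto simp: lenT)
      qed simp
      then show ?thesis using g(4) cD(7) gD(7) by simp
    qed
    moreover have "map length (map (ctop R) Ts) = map length Css" unfolding t[symmetric] by (simp add: o_def)
    ultimately have "map length (map (map (ctgt X)) css) = map length (map (ctop X) ths)"
      using len by (simp add: o_def)
    moreover have "concat (map (map (ctgt X)) css) = concat (map (ctop X) ths)"
      using fD(3) g by (simp add: css(1) map_concat P.A.boundary_rules)
    ultimately have tx: "map (map (ctgt X)) css = map (ctop X) ths" using concat_eq_blocks by blast
    have px: "cpath X w (concat css)" using fD(2) css by simp
    note assocX = P.A.mcomp_assoc[OF g(1) px wv tx]
    note cX2 = P.A.composable_block_comps[OF g(1) px wv tx]
    have \<theta>2: "\<theta> = mcomp X k (vcomp X v' w) (block_comps X w ths css)"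
      using assocX f(5) g(5) css(1) by simp
    have wV: "w \<in> Ver X" "v' \<in> Ver X" using fD gD by auto
    have cs: "map bC (concat Css) = map (fCel P) (concat css)" using f(4) css(1) by simp
    have g4: "map bC Ts = map (fCel P) ths" using g(4) by simp
    have bX: "map bC (block_comps R u Ts Css) = map (fCel P) (block_comps X w ths css)"
    proof -
      have "map (fCel P) (block_comps X w ths css) = block_comps Y (fVer P w) (map (fCel P) ths) (map (map (fCel P)) css)"
        using gD(2) px wv tx
      proof (induction ths arbitrary: w v' css)
        case (Cons t ths)
        obtain c' css' where c': "css = c' # css'" using Cons.prems(4) by (cases css) auto
        have t': "composable X t w c'" using Cons.prems by (auto simp: c' composable_def P.A.cpath_append)
        have "map (fCel P) (block_comps X (cpath_end X w c') ths css')
          = block_comps Y (fVer P (cpath_end X w c')) (map (fCel P) ths) (map (map (fCel P)) css')"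
          by (rule Cons.IH[of "cright X t"])
            (use Cons.prems P.A.composableD(8)[OF t'] in \<open>auto simp: c' P.A.cpath_append\<close>)
        then show ?case
          using P.fCel_comp[OF t'] P.cpath_fCel[OF P.A.composableD(2)[OF t']] by (simp add: c')
      qed simp
      then show ?thesis using map_block_comps_base[OF cD(2) p uv t] by (simp add: f(3) g(4) css(2))
    qed
    have "sC (mcomp R (mcomp R T v Ts) u (concat Css)) \<theta>
      = mcomp Z (sC (mcomp R T v Ts) k') (sV u w) (map2 sC (concat Css) (concat css))"
      using m1(7)[OF f(1) f(2)[symmetric] f(3)[symmetric] f(4)[symmetric]] by (simp add: f(5) css(1))
    also have "\<dots> = mcomp Z (mcomp Z (sC T k) (sV v v') (map2 sC Ts ths)) (sV u w) (concat (map2 (map2 sC) Css css))"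
      using m0(7)[OF g(1) g(2)[symmetric] g(3)[symmetric] g4] map2_concat[OF len, of sC] by (simp add: g(5))
    also have "\<dots> = mcomp Z (sC T k) (vcomp Z (sV v v') (sV u w)) (block_comps Z (sV u w) (map2 sC Ts ths) (map2 (map2 sC) Css css))"
    proof (rule Q.A.mcomp_assoc)
      show "composable Z (sC T k) (sV v v') (map2 sC Ts ths)"
        by (rule eval_composable[OF c g(1) g(2)[symmetric] g(3)[symmetric] g4])
      show "cpath Z (sV u w) (concat (map2 (map2 sC) Css css))"
        using eval_cpath[OF p px f(3)[symmetric] cs] by (simp add: map2_concat[OF len])
      show "vcod Z (sV u w) = vdom Z (sV v v')"
        using VerR_s[OF conjunct1[OF pV] wV(1) f(3)[symmetric]] VerR_s[OF cD(5) wV(2) g(3)[symmetric]] uv wv by simp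
      show "map (map (ctgt Z)) (map2 (map2 sC) Css css) = map (ctop Z) (map2 sC Ts ths)"
      proof -
        have "map (map (ctgt Z)) (map2 (map2 sC) Css css) = map2 (map2 sH) (map (map (ctgt R)) Css) (map (map (ctgt X)) css)"
        proof -
          have "set (concat Css) \<subseteq> Cel R" "set (concat css) \<subseteq> Cel X" 
            using R.cpath_Cel[OF p] P.A.cpath_Cel[OF px] by auto
          then show ?thesis using css(2)
          proof (induction Css arbitrary: css)
            case (Cons C Css)
            then obtain c' css' where c': "css = c' # css'" by (cases css) auto
            have "map (ctgt Z) (map2 sC C c') = map2 sH (map (ctgt R) C) (map (ctgt X) c')"
            proof -
              have "map (fCel P) c' = map bC C \<Longrightarrow> set C \<subseteq> Cel R \<Longrightarrow> set c' \<subseteq> Cel X \<Longrightarrow>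
                map (ctgt Z) (map2 sC C c') = map2 sH (map (ctgt R) C) (map (ctgt X) c')" for C c'
              proof (induction C arbitrary: c')
                case (Cons a C)
                then show ?case by (cases c') (auto simp: CelR_s)
              qed simp
              then show ?thesis using Cons.prems by (simp add: c')
            qed
            then show ?case using Cons by (simp add: c')
          qed simp
        qed
        also have "\<dots> = map2 (map2 sH) (map (ctop R) Ts) (map (ctop X) ths)" unfolding t tx ..
        also have "\<dots> = map (ctop Z) (map2 sC Ts ths)"
        proof -
          have "map bC Ts = map (fCel P) ths \<Longrightarrow> set Ts \<subseteq> Cel R \<Longrightarrow> set ths \<subseteq> Cel X \<Longrightarrow>
            map2 (map2 sH) (map (ctop R) Ts) (map (ctop X) ths) = map (ctop Z) (map2 sC Ts ths)"
          proof (induction Ts arbitrary: ths)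
            case (Cons a Ts)
            then show ?case by (cases ths) (auto simp: CelR_s)
          qed simp
          then show ?thesis using g4 cD(7) gD(7) by simp
        qed
        finally show ?thesis .
      qed
    qed
    also have "\<dots> = mcomp Z (sC T k) (sV (vcomp R v u) (vcomp X v' w)) (map2 sC (block_comps R u Ts Css) (block_comps X w ths css))"
      using eval_block_comps[OF cD(2) p uv t gD(2) px wv tx f(3)[symmetric] g4 css(2)[symmetric]]
        v1(5)[OF wV(1) wV(2) wv f(3)[symmetric] g(3)[symmetric]] by simp
    also have "\<dots> = sC (mcomp R T (vcomp R v u) (block_comps R u Ts Css)) \<theta>"
      unfolding \<theta>2
      by (rule m2(7)[symmetric, OF cX2 g(2)[symmetric] _ bX])
        (use v1(2) f(3) g(3) wV wv in \<open>simp add: P.fun_rules\<close>)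
    finally show "sC (mcomp R (mcomp R T v Ts) u (concat Css)) \<theta> = sC (mcomp R T (vcomp R v u) (block_comps R u Ts Css)) \<theta>" .
  qed
qed

lemma virtual_double_category_R: "virtual_double_category R"
  by (rule vdc_operations.virtual_double_categoryI[OF vdc_operations_R])
    (rule vcomp_R_vid vcomp_R_assoc mcomp_R_cid_right mcomp_R_cid_left mcomp_R_assoc; assumption)+

lemma large_R: "large_vdc E R"
  unfolding large_vdc_def R_sel
  using virtual_double_category_R in_universe_ObR in_universe_VerR in_universe_HorR in_universe_CelR by blast

end


text \<open>The top of a multicell of a pullback is a list of coded pairs; maps on such a
  list have to be related to binary maps on the two lists of components.\<close>

lemma (in grothendieck_universe) map_map2_pair:
  fixes xs ys :: "'u list"
  shows "map (\<lambda>p. f (pair_fst p) (pair_snd p)) (map2 pair_code xs ys) = map2 f xs ys"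
  by (induction xs ys rule: list_induct2') simp_all

lemma map2_fst_snd: "map2 f (map pair_fst ts) (map pair_snd ts) = map (\<lambda>p. f (pair_fst p) (pair_snd p)) ts"
  by (induction ts) simp_all

lemma map_pairs_eq:
  assumes "map f xs = map f' ys"
    "\<And>x y. x \<in> set xs \<Longrightarrow> y \<in> set ys \<Longrightarrow> f x = f' y \<Longrightarrow> g (pair_code x y) = s (c x) y"
  shows "map g (map2 pair_code xs ys) = map2 s (map c xs) ys"
  using assms
proof (induction xs arbitrary: ys)
  case (Cons x xs)
  then show ?case by (cases ys) simp_all
qed simp

context vdc_cospan
begin

lemma cpath_pairI:
  assumes "cpath A u \<theta>s" "cpath X w ths" "fVer F u = fVer P w" "map (fCel F) \<theta>s = map (fCel P) ths"
  shows "cpath PB (pair_code u w) (map2 pair_code \<theta>s ths)"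
  using assms
proof (induction \<theta>s arbitrary: u w ths)
  case Nil
  then show ?case by (auto simp: PB_mem)
next
  case (Cons \<theta> \<theta>s)
  then obtain t ths' where t: "ths = t # ths'" by (cases ths) auto
  have m: "\<theta> \<in> Cel A" "t \<in> Cel X" "fCel F \<theta> = fCel P t" using Cons.prems by (auto simp: t)
  have "fVer F (cright A \<theta>) = fVer P (cright X t)"
    using F.right_fCel[OF m(1)] P.right_fCel[OF m(2)] m(3) by simp
  then have "cpath PB (pair_code (cright A \<theta>) (cright X t)) (map2 pair_code \<theta>s ths')"
    by (intro Cons.IH) (use Cons.prems in \<open>auto simp: t\<close>)
  then show ?case using Cons.prems m by (simp add: t PB_mem PB_sel(13,14))
qed

lemma composable_pairI:
  assumes "composable A \<kappa> u \<theta>s" "composable X k w ths" "fCel F \<kappa> = fCel P k" "fVer F u = fVer P w"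
    "map (fCel F) \<theta>s = map (fCel P) ths"
  shows "composable PB (pair_code \<kappa> k) (pair_code u w) (map2 pair_code \<theta>s ths)"
proof -
  note c = F.A.composableD[OF assms(1)] and d = P.A.composableD[OF assms(2)]
  have "map (ctgt PB) (map2 pair_code \<theta>s ths) = map2 (\<lambda>\<Gamma> \<Phi>. pair_code \<Gamma> \<Phi>) (map (ctgt A) \<theta>s) (map (ctgt X) ths)"
    by (induction \<theta>s ths rule: list_induct2') (simp_all add: PB_sel)
  then show ?thesis
    using c d assms(3) cpath_pairI[OF c(2) d(2) assms(4,5)] by (simp add: composable_def PB_mem PB_sel(5,6,11,13))
qed

end


section \<open>Evaluation\<close>

context dependent_product
begin

definition base :: "'u vdf" where
  "base = mk_vdf R Y bO bV bH bC"

lemma vfun_base: "vfun base R Y"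
  unfolding base_def
  by (rule vfun_mk_vdf[OF virtual_double_category_R P.vdc_cod boundary_map_base])
    (simp_all add: vid_R vcomp_R cid_R mcomp_R)

lemma base_simps:
  "fdom base = R" "fcod base = Y"
  "a \<in> Ob R \<Longrightarrow> fOb base a = bO a" "u \<in> Ver R \<Longrightarrow> fVer base u = bV u"
  "H \<in> Hor R \<Longrightarrow> fHor base H = bH H" "T \<in> Cel R \<Longrightarrow> fCel base T = bC T"
  by (simp_all add: base_def mk_vdf_simps)

end

sublocale dependent_product \<subseteq> C: vdc_cospan E base P R X Y
  by (intro vdc_cospan.intro grothendieck_universe_axioms vfun_base P.vfun_axioms)

context dependent_product
begin

text \<open>An element of the pullback of the dependent product along \<open>P\<close> is a cell together with a lift of its
  image, at which the cell can be evaluated.\<close>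

definition ev :: "'u vdf" where
  "ev = mk_vdf (vdc_pullback base P) Z (\<lambda>p. sO (pair_fst p) (pair_snd p)) (\<lambda>p. sV (pair_fst p) (pair_snd p))
     (\<lambda>p. sH (pair_fst p) (pair_snd p)) (\<lambda>p. sC (pair_fst p) (pair_snd p))"

lemma ev_simps:
  "fdom ev = C.PB" "fcod ev = Z"
  "p \<in> Ob C.PB \<Longrightarrow> fOb ev p = sO (pair_fst p) (pair_snd p)"
  "p \<in> Ver C.PB \<Longrightarrow> fVer ev p = sV (pair_fst p) (pair_snd p)"
  "p \<in> Hor C.PB \<Longrightarrow> fHor ev p = sH (pair_fst p) (pair_snd p)"
  "p \<in> Cel C.PB \<Longrightarrow> fCel ev p = sC (pair_fst p) (pair_snd p)"
  by (simp_all add: ev_def mk_vdf_simps)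

lemma PB_base:
  "p \<in> Ob C.PB \<Longrightarrow> pair_fst p \<in> Ob R \<and> pair_snd p \<in> Ob X \<and> bO (pair_fst p) = fOb P (pair_snd p)"
  "p \<in> Ver C.PB \<Longrightarrow> pair_fst p \<in> Ver R \<and> pair_snd p \<in> Ver X \<and> bV (pair_fst p) = fVer P (pair_snd p)"
  "p \<in> Hor C.PB \<Longrightarrow> pair_fst p \<in> Hor R \<and> pair_snd p \<in> Hor X \<and> bH (pair_fst p) = fHor P (pair_snd p)"
  "p \<in> Cel C.PB \<Longrightarrow> pair_fst p \<in> Cel R \<and> pair_snd p \<in> Cel X \<and> bC (pair_fst p) = fCel P (pair_snd p)"
  using C.PB_ObD[of p] C.PB_VerD[of p] C.PB_HorD[of p] C.PB_CelD[of p] by (simp_all add: base_simps)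

lemma vfun_ev: "vfun ev C.PB Z"
  unfolding ev_def
proof (rule vfun_mk_vdf[OF C.virtual_double_category_PB Q.vdc_dom])
  show "boundary_map C.PB Z (\<lambda>p. sO (pair_fst p) (pair_snd p)) (\<lambda>p. sV (pair_fst p) (pair_snd p))
     (\<lambda>p. sH (pair_fst p) (pair_snd p)) (\<lambda>p. sC (pair_fst p) (pair_snd p))"
    unfolding boundary_map_def
  proof (intro conjI ballI)
    fix p assume "p \<in> Ob C.PB"
    then show "sO (pair_fst p) (pair_snd p) \<in> Ob Z" using PB_base(1) ObR_D(2) by metis
  next
    fix p assume "p \<in> Ver C.PB"
    then show "sV (pair_fst p) (pair_snd p) \<in> Ver Z"
      "vdom Z (sV (pair_fst p) (pair_snd p)) = sO (pair_fst (vdom C.PB p)) (pair_snd (vdom C.PB p))"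
      "vcod Z (sV (pair_fst p) (pair_snd p)) = sO (pair_fst (vcod C.PB p)) (pair_snd (vcod C.PB p))"
      using PB_base(2)[of p] VerR_s[of "pair_fst p" "pair_snd p"] by (simp_all add: C.PB_sel(5,6))
  next
    fix p assume "p \<in> Hor C.PB"
    then show "sH (pair_fst p) (pair_snd p) \<in> Hor Z"
      "hsrc Z (sH (pair_fst p) (pair_snd p)) = sO (pair_fst (hsrc C.PB p)) (pair_snd (hsrc C.PB p))"
      "htgt Z (sH (pair_fst p) (pair_snd p)) = sO (pair_fst (htgt C.PB p)) (pair_snd (htgt C.PB p))"
      using PB_base(3)[of p] HorR_s[of "pair_fst p" "pair_snd p"] by (simp_all add: C.PB_sel(9,10))
  next
    fix p assume "p \<in> Cel C.PB"
    then show "sC (pair_fst p) (pair_snd p) \<in> Cel Z"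
      "ctop Z (sC (pair_fst p) (pair_snd p)) = map (\<lambda>p. sH (pair_fst p) (pair_snd p)) (ctop C.PB p)"
      "ctgt Z (sC (pair_fst p) (pair_snd p)) = sH (pair_fst (ctgt C.PB p)) (pair_snd (ctgt C.PB p))"
      "cleft Z (sC (pair_fst p) (pair_snd p)) = sV (pair_fst (cleft C.PB p)) (pair_snd (cleft C.PB p))"
      "cright Z (sC (pair_fst p) (pair_snd p)) = sV (pair_fst (cright C.PB p)) (pair_snd (cright C.PB p))"
      using PB_base(4)[of p] CelR_s[of "pair_fst p" "pair_snd p"]
      by (simp_all add: C.PB_sel(11-14) map_map2_pair del: map_map)
  qed
next
  fix p assume "p \<in> Ob C.PB"
  then show "sV (pair_fst (vid C.PB p)) (pair_snd (vid C.PB p)) = vid Z (sO (pair_fst p) (pair_snd p))"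
    using PB_base(1)[of p] vid_R(5)[of "pair_fst p" "pair_snd p"] by (simp add: C.PB_sel(7))
next
  fix u v assume "u \<in> Ver C.PB" "v \<in> Ver C.PB" "vcod C.PB u = vdom C.PB v"
  then show "sV (pair_fst (vcomp C.PB v u)) (pair_snd (vcomp C.PB v u))
      = vcomp Z (sV (pair_fst v) (pair_snd v)) (sV (pair_fst u) (pair_snd u))"
    using PB_base(2)[of u] PB_base(2)[of v] by (simp add: C.PB_sel(5,6,8) vcomp_R(5))
next
  fix p assume "p \<in> Hor C.PB"
  then show "sC (pair_fst (cid C.PB p)) (pair_snd (cid C.PB p)) = cid Z (sH (pair_fst p) (pair_snd p))"
    using PB_base(3)[of p] cid_R(7)[of "pair_fst p" "pair_snd p"] by (simp add: C.PB_sel(15))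
next
  fix \<kappa> u ts assume c: "composable C.PB \<kappa> u ts"
  interpret PB: virtual_double_category C.PB by (rule C.virtual_double_category_PB)
  note cD = PB.composableD[OF c] and cs = C.PB_composableD[OF c]
  have "map bC (map pair_fst ts) = map (fCel P) (map pair_snd ts)"
    using cD(7) PB_base(4) by auto
  then show "sC (pair_fst (mcomp C.PB \<kappa> u ts)) (pair_snd (mcomp C.PB \<kappa> u ts))
      = mcomp Z (sC (pair_fst \<kappa>) (pair_snd \<kappa>)) (sV (pair_fst u) (pair_snd u))
          (map (\<lambda>p. sC (pair_fst p) (pair_snd p)) ts)"
    using mcomp_R(7)[OF cs(1,2)] PB_base(4)[OF cD(1)] PB_base(2)[OF cD(5)]
    by (simp add: C.PB_sel(16) map2_fst_snd)
qed

lemma ev_over: "comp_vdf Q ev = pullback_snd base P"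
proof (rule vfun_eqI[OF vfun_comp[OF vfun_ev Q.vfun_axioms] C.vfun_pullback_snd])
  note s = comp_vdf_simps[where F=ev, unfolded ev_simps(1)] ev_simps C.pullback_simps
  show "fOb (comp_vdf Q ev) p = fOb (pullback_snd base P) p" if "p \<in> Ob C.PB" for p
    using that PB_base(1)[OF that] ObR_D(2)[of "pair_fst p" "pair_snd p"] by (simp add: s)
  show "fVer (comp_vdf Q ev) p = fVer (pullback_snd base P) p" if "p \<in> Ver C.PB" for p
    using that PB_base(2)[OF that] VerR_s[of "pair_fst p" "pair_snd p"] by (simp add: s)
  show "fHor (comp_vdf Q ev) p = fHor (pullback_snd base P) p" if "p \<in> Hor C.PB" for p
    using that PB_base(3)[OF that] HorR_s[of "pair_fst p" "pair_snd p"] by (simp add: s)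
  show "fCel (comp_vdf Q ev) p = fCel (pullback_snd base P) p" if "p \<in> Cel C.PB" for p
    using that PB_base(4)[OF that] CelR_s[of "pair_fst p" "pair_snd p"] by (simp add: s)
qed

end


section \<open>Currying\<close>

text \<open>A test object \<open>e : A \<rightarrow> Y\<close> for the universal property of the dependent product.\<close>

locale currying = dependent_product E P Q X Y Z + e: vfun e A Y
  for E :: "'u \<Rightarrow> 'u \<Rightarrow> bool" and P Q :: "'u vdf" and X Y Z :: "'u vdc" and e :: "'u vdf" and A :: "'u vdc"

sublocale currying \<subseteq> D: vdc_cospan E e P A X Y
  by (intro vdc_cospan.intro grothendieck_universe_axioms e.vfun_axioms P.vfun_axioms)

context currying
begin

text \<open>This is the relation \<open>base_change1\<close> of the 2-category of virtual double categories, for 1-cells into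
  the dependent product.\<close>

definition bchange :: "'u vdf \<Rightarrow> 'u vdf \<Rightarrow> bool" where
  "bchange h h' \<longleftrightarrow> vfun h' D.PB C.PB \<and> comp_vdf (pullback_fst base P) h' = comp_vdf h (pullback_fst e P) \<and>
     comp_vdf (pullback_snd base P) h' = pullback_snd e P"

lemma bchange:
  assumes h: "vfun h A R" and b: "bchange h h'"
  shows "p \<in> Ob D.PB \<Longrightarrow> fOb h' p = pair_code (fOb h (pair_fst p)) (pair_snd p)"
    "p \<in> Ver D.PB \<Longrightarrow> fVer h' p = pair_code (fVer h (pair_fst p)) (pair_snd p)"
    "p \<in> Hor D.PB \<Longrightarrow> fHor h' p = pair_code (fHor h (pair_fst p)) (pair_snd p)"
    "p \<in> Cel D.PB \<Longrightarrow> fCel h' p = pair_code (fCel h (pair_fst p)) (pair_snd p)"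
proof -
  interpret h: vfun h A R by fact
  have b': "vfun h' D.PB C.PB" "comp_vdf (pullback_fst base P) h' = comp_vdf h (pullback_fst e P)"
     "comp_vdf (pullback_snd base P) h' = pullback_snd e P" using b by (simp_all add: bchange_def)
  interpret h': vfun h' D.PB C.PB by (rule b')
  note s = comp_vdf_simps[where F=h', unfolded h'.fdom_eq] comp_vdf_simps[where F="pullback_fst e P", unfolded D.pullback_simps(1)]
    D.pullback_simps C.pullback_simps h'.fun_rules
  show "fOb h' p = pair_code (fOb h (pair_fst p)) (pair_snd p)" if "p \<in> Ob D.PB"
  proof -
    have "pair_fst (fOb h' p) = fOb h (pair_fst p)" "pair_snd (fOb h' p) = pair_snd p"
      using arg_cong[OF b'(2), of "\<lambda>F. fOb F p"] arg_cong[OF b'(3), of "\<lambda>F. fOb F p"] that by (simp_all add: s)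
    then show ?thesis using C.PB_ObD(4)[OF h'.fOb_in[OF that]] by metis
  qed
  show "fVer h' p = pair_code (fVer h (pair_fst p)) (pair_snd p)" if "p \<in> Ver D.PB"
  proof -
    have "pair_fst (fVer h' p) = fVer h (pair_fst p)" "pair_snd (fVer h' p) = pair_snd p"
      using arg_cong[OF b'(2), of "\<lambda>F. fVer F p"] arg_cong[OF b'(3), of "\<lambda>F. fVer F p"] that by (simp_all add: s)
    then show ?thesis using C.PB_VerD(4)[OF h'.fVer_in[OF that]] by metis
  qed
  show "fHor h' p = pair_code (fHor h (pair_fst p)) (pair_snd p)" if "p \<in> Hor D.PB"
  proof -
    have "pair_fst (fHor h' p) = fHor h (pair_fst p)" "pair_snd (fHor h' p) = pair_snd p"
      using arg_cong[OF b'(2), of "\<lambda>F. fHor F p"] arg_cong[OF b'(3), of "\<lambda>F. fHor F p"] that by (simp_all add: s)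
    then show ?thesis using C.PB_HorD(4)[OF h'.fHor_in[OF that]] by metis
  qed
  show "fCel h' p = pair_code (fCel h (pair_fst p)) (pair_snd p)" if "p \<in> Cel D.PB"
  proof -
    have "pair_fst (fCel h' p) = fCel h (pair_fst p)" "pair_snd (fCel h' p) = pair_snd p"
      using arg_cong[OF b'(2), of "\<lambda>F. fCel F p"] arg_cong[OF b'(3), of "\<lambda>F. fCel F p"] that by (simp_all add: s)
    then show ?thesis using C.PB_CelD(4)[OF h'.fCel_in[OF that]] by metis
  qed
qed

lemma ev_bchange:
  assumes h: "vfun h A R" and b: "bchange h h'"
  shows "p \<in> Ob D.PB \<Longrightarrow> fOb (comp_vdf ev h') p = sO (fOb h (pair_fst p)) (pair_snd p)"
    "p \<in> Ver D.PB \<Longrightarrow> fVer (comp_vdf ev h') p = sV (fVer h (pair_fst p)) (pair_snd p)"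
    "p \<in> Hor D.PB \<Longrightarrow> fHor (comp_vdf ev h') p = sH (fHor h (pair_fst p)) (pair_snd p)"
    "p \<in> Cel D.PB \<Longrightarrow> fCel (comp_vdf ev h') p = sC (fCel h (pair_fst p)) (pair_snd p)"
    "vfun (comp_vdf ev h') D.PB Z"
proof -
  have b': "vfun h' D.PB C.PB" using b by (simp add: bchange_def)
  interpret h': vfun h' D.PB C.PB by (rule b')
  note s = comp_vdf_simps[where F=h', unfolded h'.fdom_eq] ev_simps h'.fun_rules
  show "p \<in> Ob D.PB \<Longrightarrow> fOb (comp_vdf ev h') p = sO (fOb h (pair_fst p)) (pair_snd p)"
    "p \<in> Ver D.PB \<Longrightarrow> fVer (comp_vdf ev h') p = sV (fVer h (pair_fst p)) (pair_snd p)"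
    "p \<in> Hor D.PB \<Longrightarrow> fHor (comp_vdf ev h') p = sH (fHor h (pair_fst p)) (pair_snd p)"
    "p \<in> Cel D.PB \<Longrightarrow> fCel (comp_vdf ev h') p = sC (fCel h (pair_fst p)) (pair_snd p)"
    by (simp_all add: s) (simp_all add: bchange[OF h b])
  show "vfun (comp_vdf ev h') D.PB Z" by (rule vfun_comp[OF b' vfun_ev])
qed

lemma over_simps:
  assumes "vfun h A R" "comp_vdf base h = e"
  shows "a \<in> Ob A \<Longrightarrow> bO (fOb h a) = fOb e a" "u \<in> Ver A \<Longrightarrow> bV (fVer h u) = fVer e u"
    "\<Gamma> \<in> Hor A \<Longrightarrow> bH (fHor h \<Gamma>) = fHor e \<Gamma>" "\<theta> \<in> Cel A \<Longrightarrow> bC (fCel h \<theta>) = fCel e \<theta>"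
proof -
  interpret h: vfun h A R by fact
  show "a \<in> Ob A \<Longrightarrow> bO (fOb h a) = fOb e a" "u \<in> Ver A \<Longrightarrow> bV (fVer h u) = fVer e u"
    "\<Gamma> \<in> Hor A \<Longrightarrow> bH (fHor h \<Gamma>) = fHor e \<Gamma>" "\<theta> \<in> Cel A \<Longrightarrow> bC (fCel h \<theta>) = fCel e \<theta>"
    unfolding assms(2)[symmetric] by (simp_all add: comp_vdf_simps h.fdom_eq base_simps h.fun_rules)
qed

text \<open>A cell of the dependent product is determined by its image in \<open>Y\<close>, which \<open>e\<close> prescribes, and by its
  values, which the composite with \<open>ev\<close> records.\<close>

lemma curry_unique:
  assumes h: "vfun h A R" "comp_vdf base h = e" "bchange h h'"
    and k: "vfun k A R" "comp_vdf base k = e" "bchange k k'"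
    and eq: "comp_vdf ev h' = comp_vdf ev k'"
  shows "h = k"
proof -
  interpret h: vfun h A R by (rule h)
  interpret k: vfun k A R by (rule k)
  note o = over_simps[OF h(1,2)] over_simps[OF k(1,2)]
  note ec = ev_bchange[OF h(1,3)] ev_bchange[OF k(1,3)]
  have hO: "fOb h a = fOb k a" if a: "a \<in> Ob A" for a
  proof (rule ObR_eqI)
    fix x assume "x \<in> Ob X" "fOb P x = bO (fOb h a)"
    then have "pair_code a x \<in> Ob D.PB" using a by (simp add: D.PB_mem o)
    then show "sO (fOb h a) x = sO (fOb k a) x"
      using ec(1)[of "pair_code a x"] ec(6)[of "pair_code a x"] eq by simp
  qed (use a in \<open>simp_all add: o h.fun_rules k.fun_rules\<close>)
  have hV: "fVer h u = fVer k u" if u: "u \<in> Ver A" for u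
  proof (rule VerR_eqI)
    fix x assume "x \<in> Ver X" "fVer P x = bV (fVer h u)"
    then have "pair_code u x \<in> Ver D.PB" using u by (simp add: D.PB_mem o)
    then show "sV (fVer h u) x = sV (fVer k u) x"
      using ec(2)[of "pair_code u x"] ec(7)[of "pair_code u x"] eq by simp
  qed (use u in \<open>simp_all add: o h.fun_rules k.fun_rules hO e.A.boundary_rules\<close>)
  have hH: "fHor h u = fHor k u" if u: "u \<in> Hor A" for u
  proof (rule HorR_eqI)
    fix x assume "x \<in> Hor X" "fHor P x = bH (fHor h u)"
    then have "pair_code u x \<in> Hor D.PB" using u by (simp add: D.PB_mem o)
    then show "sH (fHor h u) x = sH (fHor k u) x"
      using ec(3)[of "pair_code u x"] ec(8)[of "pair_code u x"] eq by simp
  qed (use u in \<open>simp_all add: o h.fun_rules k.fun_rules hO e.A.boundary_rules\<close>)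
  have hC: "fCel h t = fCel k t" if t: "t \<in> Cel A" for t
  proof (rule CelR_eqI)
    have "map (fHor h) (ctop A t) = map (fHor k) (ctop A t)" using hH e.A.ctop_Hor[OF t] by auto
    then show "ctop R (fCel h t) = ctop R (fCel k t)" using t by (simp add: h.fun_rules k.fun_rules)
    fix x assume "x \<in> Cel X" "fCel P x = bC (fCel h t)"
    then have "pair_code t x \<in> Cel D.PB" using t by (simp add: D.PB_mem o)
    then show "sC (fCel h t) x = sC (fCel k t) x"
      using ec(4)[of "pair_code t x"] ec(9)[of "pair_code t x"] eq by simp
  qed (use t in \<open>simp_all add: o h.fun_rules k.fun_rules hH hV e.A.boundary_rules\<close>)
  show ?thesis by (rule vfun_eqI[OF h(1) k(1)]) (simp_all add: hO hV hH hC)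
qed

end

text \<open>A functor \<open>g\<close> over \<open>X\<close> out of the pullback of \<open>e\<close>. Its transpose sends a cell of \<open>A\<close> to the family of the
  values of \<open>g\<close> at all pairs with this cell as first component.\<close>

locale curried = currying E P Q X Y Z e A + g: vfun g "vdc_pullback e P" Z
  for E :: "'u \<Rightarrow> 'u \<Rightarrow> bool" and P Q :: "'u vdf" and X Y Z :: "'u vdc" and e :: "'u vdf" and A :: "'u vdc"
    and g :: "'u vdf" +
  assumes g_over: "comp_vdf Q g = pullback_snd e P"
begin

lemma Q_g:
  "p \<in> Ob D.PB \<Longrightarrow> fOb Q (fOb g p) = pair_snd p" "p \<in> Ver D.PB \<Longrightarrow> fVer Q (fVer g p) = pair_snd p"
  "p \<in> Hor D.PB \<Longrightarrow> fHor Q (fHor g p) = pair_snd p" "p \<in> Cel D.PB \<Longrightarrow> fCel Q (fCel g p) = pair_snd p"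
  using arg_cong[OF g_over, of "\<lambda>F. fOb F p"] arg_cong[OF g_over, of "\<lambda>F. fVer F p"]
    arg_cong[OF g_over, of "\<lambda>F. fHor F p"] arg_cong[OF g_over, of "\<lambda>F. fCel F p"]
  by (simp_all add: comp_vdf_simps g.fdom_eq D.pullback_simps)

definition cO :: "'u \<Rightarrow> 'u" where
  "cO a = mkO (fOb e a) (\<lambda>x. fOb g (pair_code a x))"
definition cV :: "'u \<Rightarrow> 'u" where
  "cV u = mkV (fVer e u) (\<lambda>w. fVer g (pair_code u w)) (cO (vdom A u)) (cO (vcod A u))"
definition cH :: "'u \<Rightarrow> 'u" where
  "cH \<Gamma> = mkH (fHor e \<Gamma>) (\<lambda>\<Phi>. fHor g (pair_code \<Gamma> \<Phi>)) (cO (hsrc A \<Gamma>)) (cO (htgt A \<Gamma>))"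
definition cC :: "'u \<Rightarrow> 'u" where
  "cC \<theta> = mkC (fCel e \<theta>) (\<lambda>t. fCel g (pair_code \<theta> t)) (map cH (ctop A \<theta>)) (cH (ctgt A \<theta>))
     (cV (cleft A \<theta>)) (cV (cright A \<theta>))"

lemma cO:
  assumes a: "a \<in> Ob A"
  shows "cO a \<in> Ob R" "bO (cO a) = fOb e a" "x \<in> Ob X \<Longrightarrow> fOb e a = fOb P x \<Longrightarrow> sO (cO a) x = fOb g (pair_code a x)"
proof -
  have i: "isO (fOb e a) (\<lambda>x. fOb g (pair_code a x))"
    unfolding isO_def
  proof (intro conjI ballI impI)
    show "fOb e a \<in> Ob Y" using a by (simp add: e.fun_rules)
    fix x assume "x \<in> Ob X" "fOb P x = fOb e a"
    then have "pair_code a x \<in> Ob D.PB" using a by (simp add: D.PB_mem)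
    then show "fOb g (pair_code a x) \<in> Ob Z" "fOb Q (fOb g (pair_code a x)) = x" by (simp_all add: g.fun_rules Q_g)
  qed
  show "cO a \<in> Ob R" "bO (cO a) = fOb e a" "x \<in> Ob X \<Longrightarrow> fOb e a = fOb P x \<Longrightarrow> sO (cO a) x = fOb g (pair_code a x)"
    using mkO[OF i] by (simp_all add: cO_def)
qed

lemma cV:
  assumes u: "u \<in> Ver A"
  shows "cV u \<in> Ver R" "bV (cV u) = fVer e u" "vdom R (cV u) = cO (vdom A u)" "vcod R (cV u) = cO (vcod A u)"
    "w \<in> Ver X \<Longrightarrow> fVer e u = fVer P w \<Longrightarrow> sV (cV u) w = fVer g (pair_code u w)"
proof -
  have o: "vdom A u \<in> Ob A" "vcod A u \<in> Ob A" using u by (simp_all add: e.A.boundary_rules)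
  have i: "isV (fVer e u) (\<lambda>w. fVer g (pair_code u w)) (cO (vdom A u)) (cO (vcod A u))"
    unfolding isV_def
  proof (intro conjI ballI impI)
    show "fVer e u \<in> Ver Y" using u by (simp add: e.fun_rules)
    show "cO (vdom A u) \<in> ObR" "cO (vcod A u) \<in> ObR" using cO(1)[OF o(1)] cO(1)[OF o(2)] by (simp_all add: R_sel)
    show "bO (cO (vdom A u)) = vdom Y (fVer e u)" "bO (cO (vcod A u)) = vcod Y (fVer e u)"
      using cO(2)[OF o(1)] cO(2)[OF o(2)] u by (simp_all add: e.fun_rules)
    fix w assume w: "w \<in> Ver X" "fVer P w = fVer e u"
    then have p: "pair_code u w \<in> Ver D.PB" using u by (simp add: D.PB_mem)
    then show "fVer g (pair_code u w) \<in> Ver Z" "fVer Q (fVer g (pair_code u w)) = w" by (simp_all add: g.fun_rules Q_g)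
    have d: "fOb e (vdom A u) = fOb P (vdom X w)" "fOb e (vcod A u) = fOb P (vcod X w)"
      using e.dom_fVer[OF u] e.cod_fVer[OF u] P.dom_fVer[OF w(1)] P.cod_fVer[OF w(1)] w(2) by simp_all
    show "vdom Z (fVer g (pair_code u w)) = sO (cO (vdom A u)) (vdom X w)"
      "vcod Z (fVer g (pair_code u w)) = sO (cO (vcod A u)) (vcod X w)"
      using p w(1) d cO(3)[OF o(1)] cO(3)[OF o(2)]
      by (simp_all add: g.fun_rules D.PB_sel(5,6) P.A.boundary_rules)
  qed
  show "cV u \<in> Ver R" "bV (cV u) = fVer e u" "vdom R (cV u) = cO (vdom A u)" "vcod R (cV u) = cO (vcod A u)"
    "w \<in> Ver X \<Longrightarrow> fVer e u = fVer P w \<Longrightarrow> sV (cV u) w = fVer g (pair_code u w)"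
    using mkV[OF i] by (simp_all add: cV_def)
qed

lemma cH:
  assumes u: "u \<in> Hor A"
  shows "cH u \<in> Hor R" "bH (cH u) = fHor e u" "hsrc R (cH u) = cO (hsrc A u)" "htgt R (cH u) = cO (htgt A u)"
    "w \<in> Hor X \<Longrightarrow> fHor e u = fHor P w \<Longrightarrow> sH (cH u) w = fHor g (pair_code u w)"
proof -
  have o: "hsrc A u \<in> Ob A" "htgt A u \<in> Ob A" using u by (simp_all add: e.A.boundary_rules)
  have i: "isH (fHor e u) (\<lambda>w. fHor g (pair_code u w)) (cO (hsrc A u)) (cO (htgt A u))"
    unfolding isH_def
  proof (intro conjI ballI impI)
    show "fHor e u \<in> Hor Y" using u by (simp add: e.fun_rules)
    show "cO (hsrc A u) \<in> ObR" "cO (htgt A u) \<in> ObR" using cO(1)[OF o(1)] cO(1)[OF o(2)] by (simp_all add: R_sel)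
    show "bO (cO (hsrc A u)) = hsrc Y (fHor e u)" "bO (cO (htgt A u)) = htgt Y (fHor e u)"
      using cO(2)[OF o(1)] cO(2)[OF o(2)] u by (simp_all add: e.fun_rules)
    fix w assume w: "w \<in> Hor X" "fHor P w = fHor e u"
    then have p: "pair_code u w \<in> Hor D.PB" using u by (simp add: D.PB_mem)
    then show "fHor g (pair_code u w) \<in> Hor Z" "fHor Q (fHor g (pair_code u w)) = w" by (simp_all add: g.fun_rules Q_g)
    have d: "fOb e (hsrc A u) = fOb P (hsrc X w)" "fOb e (htgt A u) = fOb P (htgt X w)"
      using e.src_fHor[OF u] e.tgt_fHor[OF u] P.src_fHor[OF w(1)] P.tgt_fHor[OF w(1)] w(2) by simp_all
    show "hsrc Z (fHor g (pair_code u w)) = sO (cO (hsrc A u)) (hsrc X w)"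
      "htgt Z (fHor g (pair_code u w)) = sO (cO (htgt A u)) (htgt X w)"
      using p w(1) d cO(3)[OF o(1)] cO(3)[OF o(2)]
      by (simp_all add: g.fun_rules D.PB_sel(9,10) P.A.boundary_rules)
  qed
  show "cH u \<in> Hor R" "bH (cH u) = fHor e u" "hsrc R (cH u) = cO (hsrc A u)" "htgt R (cH u) = cO (htgt A u)"
    "w \<in> Hor X \<Longrightarrow> fHor e u = fHor P w \<Longrightarrow> sH (cH u) w = fHor g (pair_code u w)"
    using mkH[OF i] by (simp_all add: cH_def)
qed

lemma hpath_cH: "hpath A a \<Gamma>s b \<Longrightarrow> hpath R (cO a) (map cH \<Gamma>s) (cO b)"
  by (induction \<Gamma>s arbitrary: a) (auto simp: cO cH)

lemma cC:
  assumes \<theta>: "\<theta> \<in> Cel A"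
  shows "cC \<theta> \<in> Cel R" "bC (cC \<theta>) = fCel e \<theta>" "ctop R (cC \<theta>) = map cH (ctop A \<theta>)" "ctgt R (cC \<theta>) = cH (ctgt A \<theta>)"
    "cleft R (cC \<theta>) = cV (cleft A \<theta>)" "cright R (cC \<theta>) = cV (cright A \<theta>)"
    "t \<in> Cel X \<Longrightarrow> fCel e \<theta> = fCel P t \<Longrightarrow> sC (cC \<theta>) t = fCel g (pair_code \<theta> t)"
proof -
  have b: "ctgt A \<theta> \<in> Hor A" "cleft A \<theta> \<in> Ver A" "cright A \<theta> \<in> Ver A" using \<theta> by (simp_all add: e.A.boundary_rules)
  note H = cH[OF b(1)] and L = cV[OF b(2)] and RR = cV[OF b(3)]
  note Hs = e.A.ctop_Hor[OF \<theta>]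
  have i: "isC (fCel e \<theta>) (\<lambda>t. fCel g (pair_code \<theta> t)) (map cH (ctop A \<theta>)) (cH (ctgt A \<theta>)) (cV (cleft A \<theta>)) (cV (cright A \<theta>))"
    unfolding isC_iff
  proof (intro conjI ballI impI)
    show "fCel e \<theta> \<in> Cel Y" using \<theta> by (simp add: e.fun_rules)
    show "hpath R (vdom R (cV (cleft A \<theta>))) (map cH (ctop A \<theta>)) (vdom R (cV (cright A \<theta>)))"
      using hpath_cH[OF e.A.ctop_path[OF \<theta>]] L RR by simp
    show "map bH (map cH (ctop A \<theta>)) = ctop Y (fCel e \<theta>)" using Hs \<theta> by (auto simp: cH e.fun_rules)
    show "cH (ctgt A \<theta>) \<in> Hor R" "cV (cleft A \<theta>) \<in> Ver R" "cV (cright A \<theta>) \<in> Ver R" using H L RR by simp_all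
    show "bH (cH (ctgt A \<theta>)) = ctgt Y (fCel e \<theta>)" "bV (cV (cleft A \<theta>)) = cleft Y (fCel e \<theta>)"
      "bV (cV (cright A \<theta>)) = cright Y (fCel e \<theta>)" using H L RR \<theta> by (simp_all add: e.fun_rules)
    show "vcod R (cV (cleft A \<theta>)) = hsrc R (cH (ctgt A \<theta>))" "vcod R (cV (cright A \<theta>)) = htgt R (cH (ctgt A \<theta>))"
      using H L RR \<theta> by (simp_all add: e.A.boundary_rules)
    fix t assume t: "t \<in> Cel X" "fCel P t = fCel e \<theta>"
    then have p: "pair_code \<theta> t \<in> Cel D.PB" using \<theta> by (simp add: D.PB_mem)
    then show "fCel g (pair_code \<theta> t) \<in> Cel Z" "fCel Q (fCel g (pair_code \<theta> t)) = t" by (simp_all add: g.fun_rules Q_g)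
    have tops: "map (fHor e) (ctop A \<theta>) = map (fHor P) (ctop X t)"
      using e.top_fCel[OF \<theta>] P.top_fCel[OF t(1)] t(2) by simp
    show "ctop Z (fCel g (pair_code \<theta> t)) = map2 sH (map cH (ctop A \<theta>)) (ctop X t)"
      unfolding g.top_fCel[OF p] D.PB_sel(11) pair_simps
      by (rule map_pairs_eq[OF tops]) (simp add: cH subsetD[OF Hs] subsetD[OF P.A.ctop_Hor[OF t(1)]])
    have d: "fHor e (ctgt A \<theta>) = fHor P (ctgt X t)" "fVer e (cleft A \<theta>) = fVer P (cleft X t)"
      "fVer e (cright A \<theta>) = fVer P (cright X t)"
      using e.tgt_fCel[OF \<theta>] P.tgt_fCel[OF t(1)] e.left_fCel[OF \<theta>] P.left_fCel[OF t(1)]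
        e.right_fCel[OF \<theta>] P.right_fCel[OF t(1)] t(2) by simp_all
    show "ctgt Z (fCel g (pair_code \<theta> t)) = sH (cH (ctgt A \<theta>)) (ctgt X t)"
      "cleft Z (fCel g (pair_code \<theta> t)) = sV (cV (cleft A \<theta>)) (cleft X t)"
      "cright Z (fCel g (pair_code \<theta> t)) = sV (cV (cright A \<theta>)) (cright X t)"
      using p t(1) H(5)[OF _ d(1)] L(5)[OF _ d(2)] RR(5)[OF _ d(3)]
      by (simp_all add: g.fun_rules D.PB_sel(12-14) P.A.boundary_rules)
  qed
  show "cC \<theta> \<in> Cel R" "bC (cC \<theta>) = fCel e \<theta>" "ctop R (cC \<theta>) = map cH (ctop A \<theta>)" "ctgt R (cC \<theta>) = cH (ctgt A \<theta>)"
    "cleft R (cC \<theta>) = cV (cleft A \<theta>)" "cright R (cC \<theta>) = cV (cright A \<theta>)"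
    "t \<in> Cel X \<Longrightarrow> fCel e \<theta> = fCel P t \<Longrightarrow> sC (cC \<theta>) t = fCel g (pair_code \<theta> t)"
    using mkC[OF i] by (simp_all add: cC_def)
qed

lemma boundary_map_curry: "boundary_map A R cO cV cH cC"
  by (simp add: boundary_map_def cO cV cH cC)

lemma cV_vid:
  assumes a: "a \<in> Ob A"
  shows "cV (vid A a) = vid R (cO a)"
proof -
  note o = cO[OF a] and v = vid_R[OF cO(1)[OF a]] and u = cV[OF e.A.vid_in[OF a]]
  show ?thesis
  proof (rule VerR_eqI[OF u(1) v(1)])
    show "bV (cV (vid A a)) = bV (vid R (cO a))" using a by (simp add: u v o e.fun_rules)
    show "vdom R (cV (vid A a)) = vdom R (vid R (cO a))" "vcod R (cV (vid A a)) = vcod R (vid R (cO a))"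
      using a by (simp_all add: u v e.A.boundary_rules)
    fix w assume w: "w \<in> Ver X" "fVer P w = bV (cV (vid A a))"
    then have pw: "fVer P w = vid Y (fOb e a)" using a by (simp add: u e.fun_rules)
    have ea: "fOb e a \<in> Ob Y" using a by (simp add: e.fun_rules)
    let ?x = "vdom X w"
    have ww: "w = vid X ?x" by (rule P.vid_reflect[OF w(1) ea pw])
    have x: "?x \<in> Ob X" "fOb e a = fOb P ?x"
      using w(1) P.dom_fVer[OF w(1)] ea by (simp_all add: pw P.A.boundary_rules P.B.boundary_rules)
    have p: "pair_code a ?x \<in> Ob D.PB" using a x by (simp add: D.PB_mem)
    have "sV (cV (vid A a)) (vid X ?x) = fVer g (pair_code (vid A a) (vid X ?x))"
      using u(5)[of "vid X ?x"] ww w by (simp add: u)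
    also have "\<dots> = fVer g (vid D.PB (pair_code a ?x))" by (simp add: D.PB_sel(7))
    also have "\<dots> = vid Z (fOb g (pair_code a ?x))" by (rule g.fVer_id[OF p])
    also have "\<dots> = sV (vid R (cO a)) (vid X ?x)" using v(5)[OF x(1)] x o by simp
    finally show "sV (cV (vid A a)) w = sV (vid R (cO a)) w" using ww by simp
  qed
qed

lemma cV_vcomp:
  assumes u: "u \<in> Ver A" and v: "v \<in> Ver A" and uv: "vcod A u = vdom A v"
  shows "cV (vcomp A v u) = vcomp R (cV v) (cV u)"
proof -
  note U = cV[OF u] and V = cV[OF v] and W = cV[OF e.A.vcomp_in[OF u v uv]]
  have "vcod R (cV u) = vdom R (cV v)" using U V uv by simp
  note c = vcomp_R[OF U(1) V(1) this]
  show ?thesis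
  proof (rule VerR_eqI[OF W(1) c(1)])
    show "bV (cV (vcomp A v u)) = bV (vcomp R (cV v) (cV u))" using u v uv by (simp add: c U V W e.fun_rules)
    show "vdom R (cV (vcomp A v u)) = vdom R (vcomp R (cV v) (cV u))" "vcod R (cV (vcomp A v u)) = vcod R (vcomp R (cV v) (cV u))"
      using u v uv by (simp_all add: c U V W e.A.boundary_rules)
    fix w assume w: "w \<in> Ver X" "fVer P w = bV (cV (vcomp A v u))"
    obtain w2 w1 where f: "w1 \<in> Ver X" "w2 \<in> Ver X" "vcod X w1 = vdom X w2" "fVer P w1 = fVer e u" "fVer P w2 = fVer e v"
      "w = vcomp X w2 w1"
      using P.vcomp_factor[of w "fVer e u" "fVer e v"] w u v uv by (auto simp: W e.fun_rules)
    have p: "pair_code u w1 \<in> Ver D.PB" "pair_code v w2 \<in> Ver D.PB" using u v f by (simp_all add: D.PB_mem)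
    have "sV (cV (vcomp A v u)) w = fVer g (pair_code (vcomp A v u) (vcomp X w2 w1))"
      using W(5)[of w] w by (simp add: W f(6))
    also have "\<dots> = fVer g (vcomp D.PB (pair_code v w2) (pair_code u w1))" by (simp add: D.PB_sel(8))
    also have "\<dots> = vcomp Z (fVer g (pair_code v w2)) (fVer g (pair_code u w1))"
      by (rule g.fVer_comp[OF p]) (simp add: D.PB_sel(5,6) uv f(3))
    also have "\<dots> = sV (vcomp R (cV v) (cV u)) w"
      using c(5)[OF f(1-3)] f(4,5)[symmetric] U(5)[OF f(1)] V(5)[OF f(2)] by (simp add: U V f(6))
    finally show "sV (cV (vcomp A v u)) w = sV (vcomp R (cV v) (cV u)) w" .
  qed
qed

lemma cC_cid:
  assumes \<Gamma>: "\<Gamma> \<in> Hor A"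
  shows "cC (cid A \<Gamma>) = cid R (cH \<Gamma>)"
proof -
  note H = cH[OF \<Gamma>] and c = cid_R[OF cH(1)[OF \<Gamma>]] and u = cC[OF e.A.cid_in[OF \<Gamma>]]
  have o: "hsrc A \<Gamma> \<in> Ob A" "htgt A \<Gamma> \<in> Ob A" using \<Gamma> by (simp_all add: e.A.boundary_rules)
  show ?thesis
  proof (rule CelR_eqI[OF u(1) c(1)])
    show "bC (cC (cid A \<Gamma>)) = bC (cid R (cH \<Gamma>))" using \<Gamma> by (simp add: u c H e.fun_rules)
    show "ctop R (cC (cid A \<Gamma>)) = ctop R (cid R (cH \<Gamma>))" "ctgt R (cC (cid A \<Gamma>)) = ctgt R (cid R (cH \<Gamma>))"
      "cleft R (cC (cid A \<Gamma>)) = cleft R (cid R (cH \<Gamma>))" "cright R (cC (cid A \<Gamma>)) = cright R (cid R (cH \<Gamma>))"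
      using \<Gamma> o by (simp_all add: u c H e.A.boundary_rules cV_vid)
    fix t assume t: "t \<in> Cel X" "fCel P t = bC (cC (cid A \<Gamma>))"
    then have pt: "fCel P t = cid Y (fHor e \<Gamma>)" using \<Gamma> by (simp add: u e.fun_rules)
    have ea: "fHor e \<Gamma> \<in> Hor Y" using \<Gamma> by (simp add: e.fun_rules)
    let ?x = "ctgt X t"
    have tt: "t = cid X ?x" by (rule P.cid_reflect[OF t(1) ea pt])
    have x: "?x \<in> Hor X" "fHor e \<Gamma> = fHor P ?x"
      using t(1) P.tgt_fCel[OF t(1)] ea by (simp_all add: pt P.A.boundary_rules P.B.boundary_rules)
    have p: "pair_code \<Gamma> ?x \<in> Hor D.PB" using \<Gamma> x by (simp add: D.PB_mem)
    have "sC (cC (cid A \<Gamma>)) (cid X ?x) = fCel g (pair_code (cid A \<Gamma>) (cid X ?x))"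
      using u(7)[of "cid X ?x"] tt t by (simp add: u)
    also have "\<dots> = fCel g (cid D.PB (pair_code \<Gamma> ?x))" by (simp add: D.PB_sel(15))
    also have "\<dots> = cid Z (fHor g (pair_code \<Gamma> ?x))" by (rule g.fCel_id[OF p])
    also have "\<dots> = sC (cid R (cH \<Gamma>)) (cid X ?x)" using c(7)[OF x(1)] x H by simp
    finally show "sC (cC (cid A \<Gamma>)) t = sC (cid R (cH \<Gamma>)) t" using tt by simp
  qed
qed

text \<open>A lift of the image of a composite factors, and its factors pair with those of the composite in \<open>A\<close>
  to composable cells of the pullback. So the value at this lift is the image under \<open>g\<close> of a composite,
  which is the composite of the values.\<close>

lemma cC_mcomp:
  assumes c: "composable A \<kappa> u \<theta>s"
  shows "cC (mcomp A \<kappa> u \<theta>s) = mcomp R (cC \<kappa>) (cV u) (map cC \<theta>s)"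
proof -
  note cD = e.A.composableD[OF c]
  note K = cC[OF cD(1)] and U = cV[OF cD(5)] and M = cC[OF e.A.mcomp_in[OF c]]
  have cR: "composable R (cC \<kappa>) (cV u) (map cC \<theta>s)"
    by (rule boundary_map_composable[OF e.A.vdc_graph_axioms boundary_map_curry c])
  note m = mcomp_R[OF cR]
  have bs: "map bC (map cC \<theta>s) = map (fCel e) \<theta>s" using cD(7) by (auto simp: cC)
  have base: "bC (cC (mcomp A \<kappa> u \<theta>s)) = bC (mcomp R (cC \<kappa>) (cV u) (map cC \<theta>s))"
    unfolding m(2) bs using M(2) K(2) U(2) e.fCel_comp[OF c] by simp
  have end_eq: "cpath_end R (cV u) (map cC \<theta>s) = cV (cpath_end A u \<theta>s)"
    using boundary_map_cpath[OF boundary_map_curry cD(2)] by simp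
  have tops: "map (ctop R) (map cC \<theta>s) = map (map cH) (map (ctop A) \<theta>s)" using cD(7) by (auto simp: cC)
  show ?thesis
  proof (rule CelR_eqI[OF M(1) m(1) base])
    show "ctop R (cC (mcomp A \<kappa> u \<theta>s)) = ctop R (mcomp R (cC \<kappa>) (cV u) (map cC \<theta>s))"
      unfolding m(3) tops M(3) e.A.top_mcomp[OF c] by (simp add: map_concat)
    show "ctgt R (cC (mcomp A \<kappa> u \<theta>s)) = ctgt R (mcomp R (cC \<kappa>) (cV u) (map cC \<theta>s))"
      using c by (simp add: m M K e.A.tgt_mcomp)
    show "cleft R (cC (mcomp A \<kappa> u \<theta>s)) = cleft R (mcomp R (cC \<kappa>) (cV u) (map cC \<theta>s))"
      using c cD by (simp add: m M K e.A.left_mcomp cV_vcomp e.A.boundary_rules)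
    show "cright R (cC (mcomp A \<kappa> u \<theta>s)) = cright R (mcomp R (cC \<kappa>) (cV u) (map cC \<theta>s))"
      unfolding m(6) end_eq using c cD by (simp add: M K e.A.right_mcomp cV_vcomp e.A.boundary_rules)
    fix t assume t: "t \<in> Cel X" "fCel P t = bC (cC (mcomp A \<kappa> u \<theta>s))"
    then have pt: "fCel P t = mcomp Y (fCel e \<kappa>) (fVer e u) (map (fCel e) \<theta>s)" using e.fCel_comp[OF c] by (simp add: M)
    obtain k w ths where f: "composable X k w ths" "fCel P k = fCel e \<kappa>" "fVer P w = fVer e u" "map (fCel P) ths = map (fCel e) \<theta>s"
      "t = mcomp X k w ths"
      using P.mcomp_factor[OF t(1) e.composable_fCel[OF c] pt] by blast
    note xD = P.A.composableD[OF f(1)]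
    have len: "length \<theta>s = length ths" using arg_cong[OF f(4), of length] by simp
    note pc = D.composable_pairI[OF c f(1) f(2)[symmetric] f(3)[symmetric] f(4)[symmetric]]
    have "sC (cC (mcomp A \<kappa> u \<theta>s)) t = fCel g (pair_code (mcomp A \<kappa> u \<theta>s) (mcomp X k w ths))"
      using M(7)[OF t(1)] t(2) by (simp add: M f(5))
    also have "\<dots> = fCel g (mcomp D.PB (pair_code \<kappa> k) (pair_code u w) (map2 pair_code \<theta>s ths))"
      unfolding D.PB_sel(16) map_pair_map2[OF len] by simp
    also have "\<dots> = mcomp Z (fCel g (pair_code \<kappa> k)) (fVer g (pair_code u w)) (map (fCel g) (map2 pair_code \<theta>s ths))"
      by (rule g.fCel_comp[OF pc])
    also have "map (fCel g) (map2 pair_code \<theta>s ths) = map2 sC (map cC \<theta>s) ths"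
      by (rule map_pairs_eq[OF f(4)[symmetric]]) (simp add: cC subsetD[OF cD(7)] subsetD[OF xD(7)])
    also have "fCel g (pair_code \<kappa> k) = sC (cC \<kappa>) k" using K(7)[OF xD(1) f(2)[symmetric]] by simp
    also have "fVer g (pair_code u w) = sV (cV u) w" using U(5)[OF xD(5) f(3)[symmetric]] by simp
    also have "mcomp Z (sC (cC \<kappa>) k) (sV (cV u) w) (map2 sC (map cC \<theta>s) ths) = sC (mcomp R (cC \<kappa>) (cV u) (map cC \<theta>s)) t"
      unfolding f(5) by (rule m(7)[OF f(1), symmetric]) (simp_all only: K U bs f)
    finally show "sC (cC (mcomp A \<kappa> u \<theta>s)) t = sC (mcomp R (cC \<kappa>) (cV u) (map cC \<theta>s)) t" .
  qed
qed

lemma curry_exists: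
  "\<exists>h. vfun h A R \<and> comp_vdf base h = e \<and> (\<forall>h'. bchange h h' \<longrightarrow> comp_vdf ev h' = g)"
proof -
  define h where "h = mk_vdf A R cO cV cH cC"
  have h: "vfun h A R"
    unfolding h_def
    by (rule vfun_mk_vdf[OF e.vdc_dom virtual_double_category_R boundary_map_curry])
      (rule cV_vid cV_vcomp cC_cid cC_mcomp; assumption)+
  have "comp_vdf base h = e"
    by (rule vfun_eqI[OF vfun_comp[OF h vfun_base] e.vfun_axioms]) (simp_all add: h_def comp_vdf_simps mk_vdf_simps base_simps cO cV cH cC)
  moreover have "comp_vdf ev h' = g" if b: "bchange h h'" for h'
    by (rule vfun_eqI[OF ev_bchange(5)[OF h b] g.vfun_axioms])
      (simp_all add: ev_bchange[OF h b] D.PB_ObD D.PB_VerD D.PB_HorD D.PB_CelD h_def mk_vdf_simps cO cV cH cC)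
  ultimately show ?thesis using h by blast
qed

end


section \<open>Currying transformations\<close>

lemma map2_map_right: "map2 f xs (map c ys) = map2 (\<lambda>x y. f x (c y)) xs ys"
  by (induction xs ys rule: list_induct2') simp_all

context currying
begin

text \<open>This is the relation \<open>base_change2\<close> of the 2-category of virtual double categories.\<close>

definition bchange2 :: "'u vtr \<Rightarrow> 'u vdf \<Rightarrow> 'u vdf \<Rightarrow> 'u vtr \<Rightarrow> bool" where
  "bchange2 \<alpha> h' k' \<alpha>' \<longleftrightarrow> vtrans \<alpha>' h' k' D.PB C.PB \<and>
     whisker_left (pullback_fst base P) \<alpha>' = whisker_right \<alpha> (pullback_fst e P) \<and>
     whisker_left (pullback_snd base P) \<alpha>' = id_vtr (pullback_snd e P)"

text \<open>The components of \<open>\<alpha>'\<close> are paired with identities of \<open>X\<close>, so only the values of \<open>\<alpha>\<close> at identities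
  are seen. These are all its values if \<open>\<alpha>\<close> lies over an identity, as in \<open>curry2_unique\<close>.\<close>

lemma ev_bchange2:
  assumes \<alpha>: "vtrans \<alpha> h k A R" and b: "bchange2 \<alpha> h' k' \<alpha>'"
  shows "p \<in> Ob D.PB \<Longrightarrow> tOb (whisker_left ev \<alpha>') p = sV (tOb \<alpha> (pair_fst p)) (vid X (pair_snd p))"
    "p \<in> Hor D.PB \<Longrightarrow> tHor (whisker_left ev \<alpha>') p = sC (tHor \<alpha> (pair_fst p)) (cid X (pair_snd p))"
    "vtrans (whisker_left ev \<alpha>') (comp_vdf ev h') (comp_vdf ev k') D.PB Z"
proof -
  have b': "vtrans \<alpha>' h' k' D.PB C.PB" "whisker_left (pullback_fst base P) \<alpha>' = whisker_right \<alpha> (pullback_fst e P)"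
     "whisker_left (pullback_snd base P) \<alpha>' = id_vtr (pullback_snd e P)" using b by (simp_all add: bchange2_def)
  interpret a: vtrans \<alpha>' h' k' D.PB C.PB by (rule b')
  note s = whisker_left_simps[OF b'(1)] whisker_right_simps[OF D.vfun_pullback_fst \<alpha>]
    id_vtr_simps[OF D.vfun_pullback_snd] C.pullback_simps D.pullback_simps a.trans_rules ev_simps
  show "tOb (whisker_left ev \<alpha>') p = sV (tOb \<alpha> (pair_fst p)) (vid X (pair_snd p))" if "p \<in> Ob D.PB"
    using arg_cong[OF b'(2), of "\<lambda>F. tOb F p"] arg_cong[OF b'(3), of "\<lambda>F. tOb F p"] that by (simp add: s)
  show "tHor (whisker_left ev \<alpha>') p = sC (tHor \<alpha> (pair_fst p)) (cid X (pair_snd p))" if "p \<in> Hor D.PB"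
    using arg_cong[OF b'(2), of "\<lambda>F. tHor F p"] arg_cong[OF b'(3), of "\<lambda>F. tHor F p"] that by (simp add: s)
  show "vtrans (whisker_left ev \<alpha>') (comp_vdf ev h') (comp_vdf ev k') D.PB Z"
    by (rule vtrans_whisker_left[OF b'(1) vfun_ev])
qed

lemma curry2_unique:
  assumes \<alpha>: "vtrans \<alpha> h k A R" "whisker_left base \<alpha> = id_vtr e" "bchange2 \<alpha> h' k' \<alpha>'"
    and \<beta>: "vtrans \<beta> h k A R" "whisker_left base \<beta> = id_vtr e" "bchange2 \<beta> h' k' \<beta>'"
    and eq: "whisker_left ev \<alpha>' = whisker_left ev \<beta>'"
  shows "\<alpha> = \<beta>"
proof -
  interpret a: vtrans \<alpha> h k A R by (rule \<alpha>)
  interpret b: vtrans \<beta> h k A R by (rule \<beta>)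
  have bO': "bV (tOb \<alpha> a) = vid Y (fOb e a)" "bV (tOb \<beta> a) = vid Y (fOb e a)" if a: "a \<in> Ob A" for a
    using arg_cong[OF \<alpha>(2), of "\<lambda>F. tOb F a"] arg_cong[OF \<beta>(2), of "\<lambda>F. tOb F a"] a
    by (simp_all add: whisker_left_simps[OF \<alpha>(1)] whisker_left_simps[OF \<beta>(1)] id_vtr_simps[OF e.vfun_axioms]
        base_simps a.trans_rules b.trans_rules)
  have bH': "bC (tHor \<alpha> a) = cid Y (fHor e a)" "bC (tHor \<beta> a) = cid Y (fHor e a)" if a: "a \<in> Hor A" for a
    using arg_cong[OF \<alpha>(2), of "\<lambda>F. tHor F a"] arg_cong[OF \<beta>(2), of "\<lambda>F. tHor F a"] a
    by (simp_all add: whisker_left_simps[OF \<alpha>(1)] whisker_left_simps[OF \<beta>(1)] id_vtr_simps[OF e.vfun_axioms]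
        base_simps a.trans_rules b.trans_rules)
  note ea = ev_bchange2[OF \<alpha>(1,3)] and eb = ev_bchange2[OF \<beta>(1,3)]
  have O: "tOb \<alpha> a = tOb \<beta> a" if a: "a \<in> Ob A" for a
  proof (rule VerR_eqI)
    fix w assume w: "w \<in> Ver X" "fVer P w = bV (tOb \<alpha> a)"
    have ey: "fOb e a \<in> Ob Y" using a by (simp add: e.fun_rules)
    have pw: "fVer P w = vid Y (fOb e a)" using w bO'[OF a] by simp
    let ?x = "vdom X w"
    have ww: "w = vid X ?x" by (rule P.vid_reflect[OF w(1) ey pw])
    have "pair_code a ?x \<in> Ob D.PB"
      using a w(1) P.dom_fVer[OF w(1)] ey by (simp add: D.PB_mem pw P.A.boundary_rules P.B.boundary_rules)
    then have "sV (tOb \<alpha> a) (vid X ?x) = sV (tOb \<beta> a) (vid X ?x)"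
      using ea(1)[of "pair_code a ?x"] eb(1)[of "pair_code a ?x"] eq by simp
    then show "sV (tOb \<alpha> a) w = sV (tOb \<beta> a) w" using ww by simp
  qed (use a in \<open>simp_all add: a.trans_rules b.trans_rules bO'\<close>)
  have H: "tHor \<alpha> \<Gamma> = tHor \<beta> \<Gamma>" if \<Gamma>: "\<Gamma> \<in> Hor A" for \<Gamma>
  proof (rule CelR_eqI)
    fix t assume t: "t \<in> Cel X" "fCel P t = bC (tHor \<alpha> \<Gamma>)"
    have ey: "fHor e \<Gamma> \<in> Hor Y" using \<Gamma> by (simp add: e.fun_rules)
    have pt: "fCel P t = cid Y (fHor e \<Gamma>)" using t bH'[OF \<Gamma>] by simp
    let ?x = "ctgt X t"
    have tt: "t = cid X ?x" by (rule P.cid_reflect[OF t(1) ey pt])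
    have "pair_code \<Gamma> ?x \<in> Hor D.PB"
      using \<Gamma> t(1) P.tgt_fCel[OF t(1)] ey by (simp add: D.PB_mem pt P.A.boundary_rules P.B.boundary_rules)
    then have "sC (tHor \<alpha> \<Gamma>) (cid X ?x) = sC (tHor \<beta> \<Gamma>) (cid X ?x)"
      using ea(2)[of "pair_code \<Gamma> ?x"] eb(2)[of "pair_code \<Gamma> ?x"] eq by simp
    then show "sC (tHor \<alpha> \<Gamma>) t = sC (tHor \<beta> \<Gamma>) t" using tt by simp
  qed (use \<Gamma> in \<open>simp_all add: a.trans_rules b.trans_rules bH' O e.A.boundary_rules\<close>)
  show ?thesis by (rule vtrans_eqI[OF \<alpha>(1) \<beta>(1)]) (simp_all add: O H)
qed

end

text \<open>A vertical transformation \<open>\<gamma>\<close> over \<open>X\<close> between the functors that correspond to \<open>h\<close> and \<open>k\<close>. The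
  components of its transpose lie over identities of \<open>Y\<close>, whose lifts are the identities of the objects
  or horizontal morphisms \<open>x\<close> in the fibre; the value there is the component of \<open>\<gamma>\<close> at the pair with \<open>x\<close>.\<close>

locale curried2 = currying E P Q X Y Z e A
  for E :: "'u \<Rightarrow> 'u \<Rightarrow> bool" and P Q :: "'u vdf" and X Y Z :: "'u vdc" and e :: "'u vdf" and A :: "'u vdc" +
  fixes h k h' k' :: "'u vdf" and \<gamma> :: "'u vtr"
  assumes h_fun: "vfun h A R" and h_over: "comp_vdf base h = e" and h': "bchange h h'"
    and k_fun: "vfun k A R" and k_over: "comp_vdf base k = e" and k': "bchange k k'"
    and \<gamma>_trans: "vtrans \<gamma> (comp_vdf ev h') (comp_vdf ev k') D.PB Z"
    and \<gamma>_over: "whisker_left Q \<gamma> = id_vtr (pullback_snd e P)"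

sublocale curried2 \<subseteq> h: vfun h A R by (rule h_fun)
sublocale curried2 \<subseteq> k: vfun k A R by (rule k_fun)
sublocale curried2 \<subseteq> \<gamma>: vtrans \<gamma> "comp_vdf ev h'" "comp_vdf ev k'" "vdc_pullback e P" Z by (rule \<gamma>_trans)

context curried2
begin

lemmas h_base = over_simps[OF h_fun h_over]
lemmas k_base = over_simps[OF k_fun k_over]
lemmas ev_h' = ev_bchange[OF h_fun h']
lemmas ev_k' = ev_bchange[OF k_fun k']

lemma Q_\<gamma>:
  "p \<in> Ob D.PB \<Longrightarrow> fVer Q (tOb \<gamma> p) = vid X (pair_snd p)"
  "p \<in> Hor D.PB \<Longrightarrow> fCel Q (tHor \<gamma> p) = cid X (pair_snd p)"
  using arg_cong[OF \<gamma>_over, of "\<lambda>F. tOb F p"] arg_cong[OF \<gamma>_over, of "\<lambda>F. tHor F p"]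
  by (simp_all add: whisker_left_simps[OF \<gamma>_trans] id_vtr_simps[OF D.vfun_pullback_snd] D.pullback_simps)

definition tO :: "'u \<Rightarrow> 'u" where
  "tO a = mkV (vid Y (fOb e a)) (\<lambda>w. tOb \<gamma> (pair_code a (vdom X w))) (fOb h a) (fOb k a)"
definition tH :: "'u \<Rightarrow> 'u" where
  "tH \<Gamma> = mkC (cid Y (fHor e \<Gamma>)) (\<lambda>t. tHor \<gamma> (pair_code \<Gamma> (ctgt X t))) [fHor h \<Gamma>] (fHor k \<Gamma>)
     (tO (hsrc A \<Gamma>)) (tO (htgt A \<Gamma>))"

lemma tO:
  assumes a: "a \<in> Ob A"
  shows "tO a \<in> Ver R" "bV (tO a) = vid Y (fOb e a)" "vdom R (tO a) = fOb h a" "vcod R (tO a) = fOb k a"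
    "x \<in> Ob X \<Longrightarrow> fOb e a = fOb P x \<Longrightarrow> sV (tO a) (vid X x) = tOb \<gamma> (pair_code a x)"
proof -
  have ey: "fOb e a \<in> Ob Y" using a by (simp add: e.fun_rules)
  have i: "isV (vid Y (fOb e a)) (\<lambda>w. tOb \<gamma> (pair_code a (vdom X w))) (fOb h a) (fOb k a)"
    unfolding isV_def
  proof (intro conjI ballI impI)
    show "vid Y (fOb e a) \<in> Ver Y" "bO (fOb h a) = vdom Y (vid Y (fOb e a))" "bO (fOb k a) = vcod Y (vid Y (fOb e a))"
      using a ey by (simp_all add: P.B.boundary_rules h_base k_base)
    show "fOb h a \<in> ObR" "fOb k a \<in> ObR" using h.fOb_in[OF a] k.fOb_in[OF a] by (simp_all add: R_sel)
    fix w assume w: "w \<in> Ver X" "fVer P w = vid Y (fOb e a)"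
    let ?x = "vdom X w"
    have ww: "w = vid X ?x" by (rule P.vid_reflect[OF w(1) ey w(2)])
    have x: "?x \<in> Ob X" using w by (simp add: P.A.boundary_rules)
    have c: "vcod X w = ?x" using P.A.cod_vid[OF x] ww by metis
    have p: "pair_code a ?x \<in> Ob D.PB"
      using a x P.dom_fVer[OF w(1)] ey by (simp add: D.PB_mem w(2) P.B.boundary_rules)
    show "tOb \<gamma> (pair_code a ?x) \<in> Ver Z" "fVer Q (tOb \<gamma> (pair_code a ?x)) = w"
      "vdom Z (tOb \<gamma> (pair_code a ?x)) = sO (fOb h a) ?x" "vcod Z (tOb \<gamma> (pair_code a ?x)) = sO (fOb k a) (vcod X w)"
      using p \<gamma>.trans_rules(1,3,4)[OF p] Q_\<gamma>[of "pair_code a ?x"] ev_h'(1)[OF p] ev_k'(1)[OF p] ww c by simp_all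
  qed
  show "tO a \<in> Ver R" "bV (tO a) = vid Y (fOb e a)" "vdom R (tO a) = fOb h a" "vcod R (tO a) = fOb k a"
    using mkV[OF i] by (simp_all add: tO_def)
  assume "x \<in> Ob X" "fOb e a = fOb P x"
  then show "sV (tO a) (vid X x) = tOb \<gamma> (pair_code a x)"
    using mkV(5)[OF i, of "vid X x"] by (simp add: tO_def P.A.boundary_rules P.fun_rules)
qed

lemma tH:
  assumes \<Gamma>: "\<Gamma> \<in> Hor A"
  shows "tH \<Gamma> \<in> Cel R" "bC (tH \<Gamma>) = cid Y (fHor e \<Gamma>)" "ctop R (tH \<Gamma>) = [fHor h \<Gamma>]" "ctgt R (tH \<Gamma>) = fHor k \<Gamma>"
    "cleft R (tH \<Gamma>) = tO (hsrc A \<Gamma>)" "cright R (tH \<Gamma>) = tO (htgt A \<Gamma>)"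
    "\<Phi> \<in> Hor X \<Longrightarrow> fHor e \<Gamma> = fHor P \<Phi> \<Longrightarrow> sC (tH \<Gamma>) (cid X \<Phi>) = tHor \<gamma> (pair_code \<Gamma> \<Phi>)"
proof -
  have ey: "fHor e \<Gamma> \<in> Hor Y" using \<Gamma> by (simp add: e.fun_rules)
  have o: "hsrc A \<Gamma> \<in> Ob A" "htgt A \<Gamma> \<in> Ob A" using \<Gamma> by (simp_all add: e.A.boundary_rules)
  note l = tO[OF o(1)] and r = tO[OF o(2)]
  have i: "isC (cid Y (fHor e \<Gamma>)) (\<lambda>t. tHor \<gamma> (pair_code \<Gamma> (ctgt X t))) [fHor h \<Gamma>] (fHor k \<Gamma>)
     (tO (hsrc A \<Gamma>)) (tO (htgt A \<Gamma>))"
    unfolding isC_iff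
  proof (intro conjI ballI impI)
    show "cid Y (fHor e \<Gamma>) \<in> Cel Y" "map bH [fHor h \<Gamma>] = ctop Y (cid Y (fHor e \<Gamma>))"
      "bH (fHor k \<Gamma>) = ctgt Y (cid Y (fHor e \<Gamma>))"
      using \<Gamma> ey by (simp_all add: P.B.boundary_rules h_base k_base)
    show "hpath R (vdom R (tO (hsrc A \<Gamma>))) [fHor h \<Gamma>] (vdom R (tO (htgt A \<Gamma>)))"
      using \<Gamma> o l r by (simp add: h.fun_rules)
    show "fHor k \<Gamma> \<in> Hor R" "vcod R (tO (hsrc A \<Gamma>)) = hsrc R (fHor k \<Gamma>)" "vcod R (tO (htgt A \<Gamma>)) = htgt R (fHor k \<Gamma>)"
      using \<Gamma> l r by (simp_all add: k.fun_rules)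
    show "tO (hsrc A \<Gamma>) \<in> Ver R" "tO (htgt A \<Gamma>) \<in> Ver R" using l r by simp_all
    show "bV (tO (hsrc A \<Gamma>)) = cleft Y (cid Y (fHor e \<Gamma>))" "bV (tO (htgt A \<Gamma>)) = cright Y (cid Y (fHor e \<Gamma>))"
      using l r \<Gamma> ey by (simp_all add: P.B.boundary_rules e.fun_rules)
    fix t assume t: "t \<in> Cel X" "fCel P t = cid Y (fHor e \<Gamma>)"
    let ?x = "ctgt X t"
    have tt: "t = cid X ?x" by (rule P.cid_reflect[OF t(1) ey t(2)])
    have x: "?x \<in> Hor X" using t by (simp add: P.A.boundary_rules)
    have tl: "ctop X t = [?x]" "cleft X t = vid X (hsrc X ?x)" "cright X t = vid X (htgt X ?x)"
      using tt x P.A.top_cid P.A.left_cid P.A.right_cid by metis+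
    have ex: "fHor e \<Gamma> = fHor P ?x" using P.tgt_fCel[OF t(1)] ey by (simp add: t(2) P.B.boundary_rules)
    have p: "pair_code \<Gamma> ?x \<in> Hor D.PB" using \<Gamma> x ex by (simp add: D.PB_mem)
    have eo: "fOb e (hsrc A \<Gamma>) = fOb P (hsrc X ?x)" "fOb e (htgt A \<Gamma>) = fOb P (htgt X ?x)"
      using e.src_fHor[OF \<Gamma>] e.tgt_fHor[OF \<Gamma>] P.src_fHor[OF x] P.tgt_fHor[OF x] ex by simp_all
    have xo: "hsrc X ?x \<in> Ob X" "htgt X ?x \<in> Ob X" using x by (simp_all add: P.A.boundary_rules)
    note g = \<gamma>.trans_rules(2,5-8)[OF p]
    show "tHor \<gamma> (pair_code \<Gamma> ?x) \<in> Cel Z" by (rule g)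
    show "fCel Q (tHor \<gamma> (pair_code \<Gamma> ?x)) = t" using Q_\<gamma>(2)[OF p] tt by simp
    show "ctop Z (tHor \<gamma> (pair_code \<Gamma> ?x)) = map2 sH [fHor h \<Gamma>] (ctop X t)"
      using g ev_h'(3)[OF p] by (simp add: tl)
    show "ctgt Z (tHor \<gamma> (pair_code \<Gamma> ?x)) = sH (fHor k \<Gamma>) ?x" using g ev_k'(3)[OF p] by simp
    show "cleft Z (tHor \<gamma> (pair_code \<Gamma> ?x)) = sV (tO (hsrc A \<Gamma>)) (cleft X t)"
      "cright Z (tHor \<gamma> (pair_code \<Gamma> ?x)) = sV (tO (htgt A \<Gamma>)) (cright X t)"
      using g l(5)[OF xo(1) eo(1)] r(5)[OF xo(2) eo(2)] by (simp_all add: tl D.PB_sel(9,10))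
  qed
  show "tH \<Gamma> \<in> Cel R" "bC (tH \<Gamma>) = cid Y (fHor e \<Gamma>)" "ctop R (tH \<Gamma>) = [fHor h \<Gamma>]" "ctgt R (tH \<Gamma>) = fHor k \<Gamma>"
    "cleft R (tH \<Gamma>) = tO (hsrc A \<Gamma>)" "cright R (tH \<Gamma>) = tO (htgt A \<Gamma>)"
    using mkC[OF i] by (simp_all add: tH_def)
  assume "\<Phi> \<in> Hor X" "fHor e \<Gamma> = fHor P \<Phi>"
  then show "sC (tH \<Gamma>) (cid X \<Phi>) = tHor \<gamma> (pair_code \<Gamma> \<Phi>)"
    using mkC(7)[OF i, of "cid X \<Phi>"] by (simp add: tH_def P.A.boundary_rules P.fun_rules)
qed

text \<open>A lift \<open>w\<close> factors as an identity after \<open>w\<close> and as \<open>w\<close> after an identity. At these factorizations the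
  equation becomes the naturality of \<open>\<gamma>\<close> at the pair of \<open>u\<close> and \<open>w\<close>.\<close>

lemma tO_natural:
  assumes u: "u \<in> Ver A"
  shows "vcomp R (tO (vcod A u)) (fVer h u) = vcomp R (fVer k u) (tO (vdom A u))"
proof -
  have o: "vdom A u \<in> Ob A" "vcod A u \<in> Ob A" using u by (simp_all add: e.A.boundary_rules)
  note d = tO[OF o(1)] and c = tO[OF o(2)]
  have hu: "fVer h u \<in> Ver R" "bV (fVer h u) = fVer e u" "vdom R (fVer h u) = fOb h (vdom A u)" "vcod R (fVer h u) = fOb h (vcod A u)"
    using u by (simp_all add: h.fun_rules h_base)
  have ku: "fVer k u \<in> Ver R" "bV (fVer k u) = fVer e u" "vdom R (fVer k u) = fOb k (vdom A u)" "vcod R (fVer k u) = fOb k (vcod A u)"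
    using u by (simp_all add: k.fun_rules k_base)
  have 1: "vcod R (fVer h u) = vdom R (tO (vcod A u))" "vcod R (tO (vdom A u)) = vdom R (fVer k u)"
    using hu ku c d by simp_all
  note v1 = vcomp_R[OF hu(1) c(1) 1(1)] and v2 = vcomp_R[OF d(1) ku(1) 1(2)]
  have b1: "bV (vcomp R (tO (vcod A u)) (fVer h u)) = fVer e u"
    using u by (simp add: v1 c hu e.fun_rules P.B.vcomp_vid_left')
  have b2: "bV (vcomp R (fVer k u) (tO (vdom A u))) = fVer e u"
    using u by (simp add: v2 d ku e.fun_rules P.B.vcomp_vid_right')
  show ?thesis
  proof (rule VerR_eqI[OF v1(1) v2(1)])
    fix w assume w: "w \<in> Ver X" "fVer P w = bV (vcomp R (tO (vcod A u)) (fVer h u))"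
    then have pw: "fVer P w = fVer e u" by (simp add: b1)
    have p: "pair_code u w \<in> Ver D.PB" using u w(1) pw by (simp add: D.PB_mem)
    have x: "vdom X w \<in> Ob X" "vcod X w \<in> Ob X" using w by (simp_all add: P.A.boundary_rules)
    have ex: "fOb e (vdom A u) = fOb P (vdom X w)" "fOb e (vcod A u) = fOb P (vcod X w)"
      using e.dom_fVer[OF u] e.cod_fVer[OF u] P.dom_fVer[OF w(1)] P.cod_fVer[OF w(1)] pw by simp_all
    have "sV (vcomp R (tO (vcod A u)) (fVer h u)) (vcomp X (vid X (vcod X w)) w)
        = vcomp Z (sV (tO (vcod A u)) (vid X (vcod X w))) (sV (fVer h u) w)"
      by (rule v1(5)) (use w(1) x pw ex in \<open>simp_all add: c hu P.A.boundary_rules P.fun_rules\<close>)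
    also have "\<dots> = vcomp Z (tOb \<gamma> (vcod D.PB (pair_code u w))) (fVer (comp_vdf ev h') (pair_code u w))"
      using c(5)[OF x(2) ex(2)] ev_h'(2)[OF p] by (simp add: D.PB_sel(6))
    also have "\<dots> = vcomp Z (fVer (comp_vdf ev k') (pair_code u w)) (tOb \<gamma> (vdom D.PB (pair_code u w)))"
      by (rule \<gamma>.tOb_nat[OF p])
    also have "\<dots> = vcomp Z (sV (fVer k u) w) (sV (tO (vdom A u)) (vid X (vdom X w)))"
      using d(5)[OF x(1) ex(1)] ev_k'(2)[OF p] by (simp add: D.PB_sel(5))
    also have "\<dots> = sV (vcomp R (fVer k u) (tO (vdom A u))) (vcomp X w (vid X (vdom X w)))"
      by (rule v2(5)[symmetric]) (use w(1) x pw ex in \<open>simp_all add: d ku P.A.boundary_rules P.fun_rules\<close>)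
    finally show "sV (vcomp R (tO (vcod A u)) (fVer h u)) w = sV (vcomp R (fVer k u) (tO (vdom A u))) w"
      using w(1) by (simp add: P.A.vcomp_vid_left P.A.vcomp_vid_right)
  qed (simp_all add: b1 b2, simp_all add: v1 v2 c d hu ku)
qed

text \<open>As for vertical morphisms, a lift \<open>t\<close> is factored through identities below and through identities
  above, and the equation becomes the naturality of \<open>\<gamma>\<close> at the pair of \<open>\<theta>\<close> and \<open>t\<close>.\<close>

lemma tH_natural:
  assumes \<theta>: "\<theta> \<in> Cel A"
  shows "ucomp R (tH (ctgt A \<theta>)) (fCel h \<theta>) = mcomp R (fCel k \<theta>) (tO (vdom A (cleft A \<theta>))) (map tH (ctop A \<theta>))"
proof -
  let ?G = "ctgt A \<theta>" and ?a = "vdom A (cleft A \<theta>)" and ?b = "vdom A (cright A \<theta>)"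
  have G: "?G \<in> Hor A" and a: "?a \<in> Ob A" using \<theta> by (simp_all add: e.A.boundary_rules)
  note Hs = e.A.ctop_Hor[OF \<theta>]
  note T = tH[OF G] and tA = tO[OF a]
  have h\<theta>: "fCel h \<theta> \<in> Cel R" "bC (fCel h \<theta>) = fCel e \<theta>" and k\<theta>: "fCel k \<theta> \<in> Cel R" "bC (fCel k \<theta>) = fCel e \<theta>"
    using \<theta> by (simp_all add: h.fun_rules k.fun_rules h_base k_base)
  have c1: "composable R (tH ?G) (cleft R (fCel h \<theta>)) [fCel h \<theta>]"
    by (rule C.F.A.composable_single) (use T h\<theta> \<theta> in \<open>simp_all add: h.fun_rules\<close>)
  have path: "cpath R (tO ?a) (map tH (ctop A \<theta>)) \<and> cpath_end R (tO ?a) (map tH (ctop A \<theta>)) = tO ?b"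
    by (rule cpath_components[OF e.A.ctop_path[OF \<theta>]]) (simp_all add: tO tH)
  have c2: "composable R (fCel k \<theta>) (tO ?a) (map tH (ctop A \<theta>))"
  proof -
    have "map (ctgt R) (map tH (ctop A \<theta>)) = ctop R (fCel k \<theta>)" using Hs \<theta> by (auto simp: tH k.fun_rules)
    then show ?thesis using path k\<theta> tA \<theta> by (simp add: composable_def k.fun_rules e.A.boundary_rules)
  qed
  note m1 = mcomp_R[OF c1] and m2 = mcomp_R[OF c2]
  have "ctop R (tH ?G) = [ctgt R (fCel h \<theta>)]" using T \<theta> by (simp add: h.fun_rules)
  note uc = C.F.A.ucomp_rules[OF T(1) h\<theta>(1) this]
  have bs: "map bC (map tH (ctop A \<theta>)) = map (cid Y) (ctop Y (fCel e \<theta>))" using Hs \<theta> by (auto simp: tH e.fun_rules)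
  have e\<theta>: "fCel e \<theta> \<in> Cel Y" using \<theta> by (simp add: e.fun_rules)
  have ea: "fOb e ?a = vdom Y (cleft Y (fCel e \<theta>))" using \<theta> by (simp add: e.fun_rules e.A.boundary_rules)
  have b1: "bC (ucomp R (tH ?G) (fCel h \<theta>)) = fCel e \<theta>"
    unfolding ucomp_def m1(2) T(2) CelR_D(7)[OF h\<theta>(1)] list.map h\<theta>(2)
    using P.B.mcomp_cid_left[OF e\<theta>] e.tgt_fCel[OF \<theta>] by simp
  have b2: "bC (mcomp R (fCel k \<theta>) (tO ?a) (map tH (ctop A \<theta>))) = fCel e \<theta>"
    unfolding m2(2) bs tA(2) k\<theta>(2) ea by (rule P.B.mcomp_cid_right[OF e\<theta>])
  have tops: "concat (map (ctop R) (map tH (ctop A \<theta>))) = map (fHor h) (ctop A \<theta>)"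
  proof -
    have "concat (map (ctop R) (map tH \<Gamma>s)) = map (fHor h) \<Gamma>s" if "set \<Gamma>s \<subseteq> Hor A" for \<Gamma>s
      using that by (induction \<Gamma>s) (simp_all add: tH)
    then show ?thesis using Hs by blast
  qed
  show ?thesis
  proof (rule CelR_eqI)
    show "ucomp R (tH ?G) (fCel h \<theta>) \<in> Cel R" by (rule uc)
    show "mcomp R (fCel k \<theta>) (tO ?a) (map tH (ctop A \<theta>)) \<in> Cel R" by (rule m2)
    show "bC (ucomp R (tH ?G) (fCel h \<theta>)) = bC (mcomp R (fCel k \<theta>) (tO ?a) (map tH (ctop A \<theta>)))" by (simp add: b1 b2)
    show "ctop R (ucomp R (tH ?G) (fCel h \<theta>)) = ctop R (mcomp R (fCel k \<theta>) (tO ?a) (map tH (ctop A \<theta>)))"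
      unfolding m2(3) tops using \<theta> by (simp add: uc h.fun_rules)
    show "ctgt R (ucomp R (tH ?G) (fCel h \<theta>)) = ctgt R (mcomp R (fCel k \<theta>) (tO ?a) (map tH (ctop A \<theta>)))"
      using \<theta> by (simp add: uc m2 T k.fun_rules)
    show "cleft R (ucomp R (tH ?G) (fCel h \<theta>)) = cleft R (mcomp R (fCel k \<theta>) (tO ?a) (map tH (ctop A \<theta>)))"
      using \<theta> tO_natural[of "cleft A \<theta>"] by (simp add: uc m2 T h.fun_rules k.fun_rules e.A.boundary_rules)
    show "cright R (ucomp R (tH ?G) (fCel h \<theta>)) = cright R (mcomp R (fCel k \<theta>) (tO ?a) (map tH (ctop A \<theta>)))"
      unfolding m2(6) conjunct2[OF path]
      using \<theta> tO_natural[of "cright A \<theta>"] by (simp add: uc T h.fun_rules k.fun_rules e.A.boundary_rules)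
    fix t assume t: "t \<in> Cel X" "fCel P t = bC (ucomp R (tH ?G) (fCel h \<theta>))"
    then have pt: "fCel e \<theta> = fCel P t" by (simp add: b1)
    have p: "pair_code \<theta> t \<in> Cel D.PB" using \<theta> t(1) pt by (simp add: D.PB_mem)
    let ?x = "vdom X (cleft X t)"
    have x: "?x \<in> Ob X" "ctgt X t \<in> Hor X" using t(1) by (simp_all add: P.A.boundary_rules)
    have ex: "fOb e ?a = fOb P ?x" "fHor e ?G = fHor P (ctgt X t)"
      using t(1) e.tgt_fCel[OF \<theta>] P.tgt_fCel[OF t(1)] pt by (simp_all add: ea pt P.fun_rules P.A.boundary_rules)
    have et: "map (fHor e) (ctop A \<theta>) = map (fHor P) (ctop X t)" using e.top_fCel[OF \<theta>] P.top_fCel[OF t(1)] pt by simp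
    have Ht: "set (ctop X t) \<subseteq> Hor X" by (rule P.A.ctop_Hor[OF t(1)])
    have cx: "composable X (cid X (ctgt X t)) (cleft X t) [t]"
      by (rule P.A.composable_single) (use t(1) in \<open>simp_all add: P.A.boundary_rules\<close>)
    have "sC (ucomp R (tH ?G) (fCel h \<theta>)) (mcomp X (cid X (ctgt X t)) (cleft X t) [t])
        = mcomp Z (sC (tH ?G) (cid X (ctgt X t))) (sV (cleft R (fCel h \<theta>)) (cleft X t)) (map2 sC [fCel h \<theta>] [t])"
      unfolding ucomp_def
    proof (rule m1(7)[OF cx])
      show "bC (tH ?G) = fCel P (cid X (ctgt X t))" using T(2) ex(2) x(2) by (simp add: P.fun_rules)
      show "bV (cleft R (fCel h \<theta>)) = fVer P (cleft X t)"
        using CelR_D(7)[OF h\<theta>(1)] P.left_fCel[OF t(1)] pt h\<theta>(2) by simp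
      show "map bC [fCel h \<theta>] = map (fCel P) [t]" using pt h\<theta>(2) by simp
    qed
    also have "\<dots> = ucomp Z (tHor \<gamma> (ctgt D.PB (pair_code \<theta> t))) (fCel (comp_vdf ev h') (pair_code \<theta> t))"
      using T(7)[OF x(2) ex(2)] ev_h'(4)[OF p] CelR_s(5)[OF h\<theta>(1) t(1)] pt h\<theta>(2)
      by (simp add: ucomp_def D.PB_sel(12))
    also have "\<dots> = mcomp Z (fCel (comp_vdf ev k') (pair_code \<theta> t)) (tOb \<gamma> (vdom D.PB (cleft D.PB (pair_code \<theta> t))))
        (map (tHor \<gamma>) (ctop D.PB (pair_code \<theta> t)))"
      by (rule \<gamma>.tHor_nat[OF p])
    also have "map (tHor \<gamma>) (ctop D.PB (pair_code \<theta> t)) = map2 (\<lambda>T \<Phi>. sC T (cid X \<Phi>)) (map tH (ctop A \<theta>)) (ctop X t)"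
      unfolding D.PB_sel(11) pair_simps
      by (rule map_pairs_eq[OF et]) (simp add: tH subsetD[OF Hs] subsetD[OF Ht])
    also have "mcomp Z (fCel (comp_vdf ev k') (pair_code \<theta> t)) (tOb \<gamma> (vdom D.PB (cleft D.PB (pair_code \<theta> t))))
        (map2 (\<lambda>T \<Phi>. sC T (cid X \<Phi>)) (map tH (ctop A \<theta>)) (ctop X t))
      = mcomp Z (sC (fCel k \<theta>) t) (sV (tO ?a) (vid X ?x)) (map2 sC (map tH (ctop A \<theta>)) (map (cid X) (ctop X t)))"
      using ev_k'(4)[OF p] tA(5)[OF x(1) ex(1)] by (simp add: D.PB_sel(5,13) map2_map_right del: map_map)
    also have "\<dots> = sC (mcomp R (fCel k \<theta>) (tO ?a) (map tH (ctop A \<theta>))) (mcomp X t (vid X ?x) (map (cid X) (ctop X t)))"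
    proof (rule m2(7)[OF P.A.composable_cids[OF t(1)], symmetric])
      show "bC (fCel k \<theta>) = fCel P t" using k\<theta>(2) pt by simp
      show "bV (tO ?a) = fVer P (vid X ?x)" using tA(2) ex(1) x(1) by (simp add: P.fun_rules)
      show "map bC (map tH (ctop A \<theta>)) = map (fCel P) (map (cid X) (ctop X t))"
        unfolding bs pt P.top_fCel[OF t(1)] using Ht by (auto simp: P.fun_rules)
    qed
    also have "mcomp X t (vid X ?x) (map (cid X) (ctop X t)) = t" by (rule P.A.mcomp_cid_right[OF t(1)])
    also have "mcomp X (cid X (ctgt X t)) (cleft X t) [t] = t" by (rule P.A.mcomp_cid_left[OF t(1)])
    finally show "sC (ucomp R (tH ?G) (fCel h \<theta>)) t = sC (mcomp R (fCel k \<theta>) (tO ?a) (map tH (ctop A \<theta>))) t" .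
  qed
qed

lemma curry2_exists:
  "\<exists>\<alpha>. vtrans \<alpha> h k A R \<and> whisker_left base \<alpha> = id_vtr e \<and> (\<forall>\<alpha>'. bchange2 \<alpha> h' k' \<alpha>' \<longrightarrow> whisker_left ev \<alpha>' = \<gamma>)"
proof -
  define \<alpha> where "\<alpha> = mk_vtr h k tO tH"
  note s = mk_vtr_simps[where F=h and G=k and tO=tO and tH=tH, unfolded h.fdom_eq, folded \<alpha>_def]
  have \<alpha>: "vtrans \<alpha> h k A R"
    unfolding \<alpha>_def
    by (rule vtrans_mk_vtr[OF h_fun k_fun]) (simp_all add: tO tH tO_natural tH_natural)
  have i: "vtrans (id_vtr e) (comp_vdf base h) (comp_vdf base k) A Y"
    unfolding h_over k_over by (rule vtrans_id[OF e.vfun_axioms])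
  have "whisker_left base \<alpha> = id_vtr e"
    by (rule vtrans_eqI[OF vtrans_whisker_left[OF \<alpha> vfun_base] i])
      (simp_all add: whisker_left_simps[OF \<alpha>] id_vtr_simps[OF e.vfun_axioms] s base_simps tO tH)
  moreover have "whisker_left ev \<alpha>' = \<gamma>" if b: "bchange2 \<alpha> h' k' \<alpha>'" for \<alpha>'
  proof (rule vtrans_eqI[OF ev_bchange2(3)[OF \<alpha> b] \<gamma>_trans])
    note eb = ev_bchange2[OF \<alpha> b]
    show "tOb (whisker_left ev \<alpha>') p = tOb \<gamma> p" if p: "p \<in> Ob D.PB" for p
      using eb(1)[OF p] D.PB_ObD[OF p] by (simp add: s tO)
    show "tHor (whisker_left ev \<alpha>') p = tHor \<gamma> p" if p: "p \<in> Hor D.PB" for p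
      using eb(2)[OF p] D.PB_HorD[OF p] by (simp add: s tH)
  qed
  ultimately show ?thesis using \<alpha> by blast
qed

end


section \<open>Powerfulness\<close>

locale conduche_powerful = grothendieck_universe E + P: discrete_conduche P X Y
  for E :: "'u \<Rightarrow> 'u \<Rightarrow> bool" and P :: "'u vdf" and X Y :: "'u vdc" +
  assumes large_X: "large_vdc E X" and large_Y: "large_vdc E Y"

sublocale conduche_powerful \<subseteq> K: chosen_pullbacks "VDBL E" P "\<lambda>e. pullback_fst e P" "\<lambda>e. pullback_snd e P"
proof (intro chosen_pullbacks.intro two_category_VDBL chosen_pullbacks_axioms.intro)
  show "P \<in> Mor (VDBL E)" by (rule MorI_VDBL[OF P.vfun_axioms large_X large_Y])
  fix e assume "e \<in> Mor (VDBL E)" "tgt (VDBL E) e = tgt (VDBL E) P"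
  then have e: "vfun e (fdom e) Y" "large_vdc E (fdom e)" by (auto simp: VDBL_simps P.fcod_eq)
  interpret vdc_cospan E e P "fdom e" X Y
    by (intro vdc_cospan.intro grothendieck_universe_axioms e P.vfun_axioms)
  show "two_pullback (VDBL E) e P (pullback_fst e P) (pullback_snd e P)"
    by (rule two_pullback_VDBL[OF e(2) large_X large_Y])
qed

context conduche_powerful
begin

definition pi_obj :: "'u vdf \<Rightarrow> 'u vdf" where
  "pi_obj q = dependent_product.base E P q X Y (fdom q)"

definition pi_ev :: "'u vdf \<Rightarrow> 'u vdf" where
  "pi_ev q = dependent_product.ev E P q X Y (fdom q)"

lemma slice_VDBL_Mor:
  "(e, h, r) \<in> Mor (slice (VDBL E) W) \<longleftrightarrow> e \<in> Mor (VDBL E) \<and> r \<in> Mor (VDBL E) \<and> fcod e = W \<and> fcod r = W \<and>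
    h \<in> Mor (VDBL E) \<and> fdom h = fdom e \<and> fcod h = fdom r \<and> comp_vdf r h = e"
  by (simp add: slice_def VDBL_simps(4-12))

lemma slice_VDBL_Two:
  "(e, \<alpha>, r) \<in> Two (slice (VDBL E) W) \<longleftrightarrow> e \<in> Mor (VDBL E) \<and> r \<in> Mor (VDBL E) \<and> fcod e = W \<and> fcod r = W \<and>
    \<alpha> \<in> Two (VDBL E) \<and> fdom (tdom \<alpha>) = fdom e \<and> fcod (tdom \<alpha>) = fdom r \<and> hcomp_vtr (id_vtr r) \<alpha> = id_vtr e"
  by (simp add: slice_def VDBL_simps(4-12))

lemma slice_VDBL_Obj: "q \<in> Obj (slice (VDBL E) W) \<longleftrightarrow> q \<in> Mor (VDBL E) \<and> fcod q = W"
  by (simp add: slice_def VDBL_simps(4-12))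

lemma dependent_product:
  assumes "q \<in> Obj (slice (VDBL E) X)"
  shows "dependent_product E P q X Y (fdom q)"
  using assms by (intro dependent_product.intro grothendieck_universe_axioms P.discrete_conduche_axioms
      dependent_product_axioms.intro large_X large_Y) (auto simp: slice_VDBL_Obj VDBL_simps(2))

lemma currying:
  assumes "q \<in> Obj (slice (VDBL E) X)" "e \<in> Obj (slice (VDBL E) Y)"
  shows "currying E P q X Y (fdom q) e (fdom e)"
  using assms(2) by (intro currying.intro dependent_product assms(1)) (auto simp: slice_VDBL_Obj VDBL_simps(2))

text \<open>The universal property in terms of functors and transformations, restated in the slices. The base change
  of a filler exists by the universal property of the pullback, so it need not be constructed.\<close>

lemma dependent_products: "dependent_products (VDBL E) P (\<lambda>e. pullback_fst e P) (\<lambda>e. pullback_snd e P) pi_obj pi_ev"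
proof (intro dependent_products.intro K.chosen_pullbacks_axioms dependent_products_axioms.intro;
    unfold VDBL_simps(4-12) P.fdom_eq P.fcod_eq)
  fix q assume q: "q \<in> Obj (slice (VDBL E) X)"
  interpret dependent_product E P q X Y "fdom q" by (rule dependent_product[OF q])
  show "pi_obj q \<in> Obj (slice (VDBL E) Y) \<and>
    (pullback_snd (pi_obj q) P, pi_ev q, q) \<in> Mor (slice (VDBL E) X)"
    unfolding pi_obj_def pi_ev_def slice_VDBL_Obj slice_VDBL_Mor
    using MorI_VDBL[OF vfun_base large_R large_Y] MorI_VDBL[OF vfun_ev C.large_PB[OF large_R large_X] large_Z]
      MorI_VDBL[OF C.vfun_pullback_snd C.large_PB[OF large_R large_X] large_X] q
    by (simp add: slice_VDBL_Obj base_simps C.pullback_simps ev_simps ev_over)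
next
  fix q e g assume q: "q \<in> Obj (slice (VDBL E) X)" and e: "e \<in> Obj (slice (VDBL E) Y)"
    and g: "(pullback_snd e P, g, q) \<in> Mor (slice (VDBL E) X)"
  interpret c: currying E P q X Y "fdom q" e "fdom e" by (rule currying[OF q e])
  have "curried E P q X Y (fdom q) e (fdom e) g"
    using g by (intro curried.intro c.currying_axioms curried_axioms.intro)
      (auto simp: slice_VDBL_Mor VDBL_simps(2) c.D.pullback_simps)
  then obtain h where h: "vfun h (fdom e) c.R" "comp_vdf c.base h = e" "\<And>h'. c.bchange h h' \<Longrightarrow> comp_vdf c.ev h' = g"
    using curried.curry_exists by blast
  have lA: "large_vdc E (fdom e)" using e by (simp add: slice_VDBL_Obj VDBL_simps(2))
  have hM: "(e, h, pi_obj q) \<in> Mor (slice (VDBL E) Y)"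
    using e MorI_VDBL[OF c.vfun_base c.large_R large_Y] MorI_VDBL[OF h(1) lA c.large_R] h(2) vfun_eqs[OF h(1)]
    by (simp add: slice_VDBL_Mor slice_VDBL_Obj pi_obj_def c.base_simps)
  then obtain h' where h': "K.base_change1 e h (pi_obj q) h'"
    using K.base_change1_exists[of e h "pi_obj q"] by (auto simp: VDBL_simps(4-12) P.fcod_eq)
  then have "c.bchange h h'"
    by (auto simp: K.base_change1_def c.bchange_def pi_obj_def VDBL_simps(2,4-12) c.D.pullback_simps c.C.pullback_simps)
  then show "\<exists>h h'. (e, h, pi_obj q) \<in> Mor (slice (VDBL E) Y) \<and> K.base_change1 e h (pi_obj q) h' \<and> comp_vdf (pi_ev q) h' = g"
    using hM h' h(3) pi_ev_def by metis
next
  fix q e h k h' k' assume q: "q \<in> Obj (slice (VDBL E) X)" and h: "(e, h, pi_obj q) \<in> Mor (slice (VDBL E) Y)"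
    and k: "(e, k, pi_obj q) \<in> Mor (slice (VDBL E) Y)" and h': "K.base_change1 e h (pi_obj q) h'"
    and k': "K.base_change1 e k (pi_obj q) k'" and eq: "comp_vdf (pi_ev q) h' = comp_vdf (pi_ev q) k'"
  have e: "e \<in> Obj (slice (VDBL E) Y)" using h by (simp add: slice_VDBL_Obj slice_VDBL_Mor)
  interpret c: currying E P q X Y "fdom q" e "fdom e" by (rule currying[OF q e])
  have "c.bchange h h'" "c.bchange k k'"
    using h' k' by (auto simp: K.base_change1_def c.bchange_def pi_obj_def VDBL_simps(2,4-12) c.D.pullback_simps c.C.pullback_simps)
  moreover have "vfun h (fdom e) c.R" "comp_vdf c.base h = e" "vfun k (fdom e) c.R" "comp_vdf c.base k = e"
    using h k by (auto simp: slice_VDBL_Mor VDBL_simps(2) pi_obj_def c.base_simps)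
  ultimately show "h = k" using c.curry_unique eq unfolding pi_ev_def by blast
next
  fix q e h k h' k' \<gamma> assume q: "q \<in> Obj (slice (VDBL E) X)" and h: "(e, h, pi_obj q) \<in> Mor (slice (VDBL E) Y)"
    and k: "(e, k, pi_obj q) \<in> Mor (slice (VDBL E) Y)" and h': "K.base_change1 e h (pi_obj q) h'"
    and k': "K.base_change1 e k (pi_obj q) k'" and \<gamma>: "(pullback_snd e P, \<gamma>, q) \<in> Two (slice (VDBL E) X)"
    and st: "tdom \<gamma> = comp_vdf (pi_ev q) h'" "tcod \<gamma> = comp_vdf (pi_ev q) k'"
  have e: "e \<in> Obj (slice (VDBL E) Y)" using h by (simp add: slice_VDBL_Obj slice_VDBL_Mor)
  interpret c: currying E P q X Y "fdom q" e "fdom e" by (rule currying[OF q e])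
  have b: "c.bchange h h'" "c.bchange k k'"
    using h' k' by (auto simp: K.base_change1_def c.bchange_def pi_obj_def VDBL_simps(2,4-12) c.D.pullback_simps c.C.pullback_simps)
  have hk: "vfun h (fdom e) c.R" "comp_vdf c.base h = e" "vfun k (fdom e) c.R" "comp_vdf c.base k = e"
    using h k by (auto simp: slice_VDBL_Mor VDBL_simps(2) pi_obj_def c.base_simps)
  have t: "vtrans \<gamma> (comp_vdf c.ev h') (comp_vdf c.ev k') c.D.PB (fdom q)"
    using \<gamma> st by (simp add: slice_VDBL_Two VDBL_simps(3) pi_ev_def c.D.pullback_simps vtrans_def)
  have over: "whisker_left q \<gamma> = id_vtr (pullback_snd e P)"
    using \<gamma> hcomp_id_left[OF t c.Q.vfun_axioms] by (simp add: slice_VDBL_Two)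
  have "curried2 E P q X Y (fdom q) e (fdom e) h k h' k' \<gamma>"
    by (intro curried2.intro c.currying_axioms curried2_axioms.intro hk b t over)
  then obtain \<alpha> where \<alpha>: "vtrans \<alpha> h k (fdom e) c.R" "whisker_left c.base \<alpha> = id_vtr e"
    "\<And>\<alpha>'. c.bchange2 \<alpha> h' k' \<alpha>' \<Longrightarrow> whisker_left c.ev \<alpha>' = \<gamma>"
    using curried2.curry2_exists by blast
  have lA: "large_vdc E (fdom e)" using e by (simp add: slice_VDBL_Obj VDBL_simps(2))
  have \<alpha>T: "(e, \<alpha>, pi_obj q) \<in> Two (slice (VDBL E) Y)"
    using h TwoI_VDBL[OF \<alpha>(1) lA c.large_R] \<alpha>(2) vtrans_eqs[OF \<alpha>(1)] hcomp_id_left[OF \<alpha>(1) c.vfun_base]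
    by (simp add: slice_VDBL_Two slice_VDBL_Mor pi_obj_def c.base_simps)
  then obtain \<alpha>' where \<alpha>': "K.base_change2 e \<alpha> (pi_obj q) \<alpha>'"
    using K.base_change2_exists[of e \<alpha> "pi_obj q"] by (auto simp: VDBL_simps(4-12) P.fcod_eq)
  have st': "tdom \<alpha> = h" "tcod \<alpha> = k" using vtrans_eqs[OF \<alpha>(1)] by simp_all
  have ends: "tdom \<alpha>' = h'" "tcod \<alpha>' = k'"
    using \<alpha>' K.base_change1_unique[of "pi_obj q" e] h h' k' st'
    by (auto simp: K.base_change2_def VDBL_simps(4-12) slice_VDBL_Mor P.fcod_eq)
  have v': "vtrans \<alpha>' h' k' c.D.PB c.C.PB"
    using \<alpha>' ends b vfun_eqs[of h' c.D.PB c.C.PB] by (auto simp: K.base_change2_def VDBL_simps(3) c.bchange_def)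
  have "c.bchange2 \<alpha> h' k' \<alpha>'"
    using \<alpha>' v' hcomp_id_left[OF v' c.C.vfun_pullback_fst] hcomp_id_left[OF v' c.C.vfun_pullback_snd]
      hcomp_id_right[OF c.D.vfun_pullback_fst \<alpha>(1)]
    by (simp add: K.base_change2_def c.bchange2_def VDBL_simps(4-12) pi_obj_def)
  then have "hcomp_vtr (id_vtr (pi_ev q)) \<alpha>' = \<gamma>"
    using \<alpha>(3) hcomp_id_left[OF v' c.vfun_ev] by (simp add: pi_ev_def)
  then show "\<exists>\<alpha> \<alpha>'. (e, \<alpha>, pi_obj q) \<in> Two (slice (VDBL E) Y) \<and> tdom \<alpha> = h \<and> tcod \<alpha> = k \<and>
      K.base_change2 e \<alpha> (pi_obj q) \<alpha>' \<and> hcomp_vtr (id_vtr (pi_ev q)) \<alpha>' = \<gamma>"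
    using \<alpha>T \<alpha>' st' by blast
next
  fix q e \<alpha> \<beta> \<alpha>' \<beta>' assume q: "q \<in> Obj (slice (VDBL E) X)" and \<alpha>: "(e, \<alpha>, pi_obj q) \<in> Two (slice (VDBL E) Y)"
    and \<beta>: "(e, \<beta>, pi_obj q) \<in> Two (slice (VDBL E) Y)" and st: "tdom \<alpha> = tdom \<beta>" "tcod \<alpha> = tcod \<beta>"
    and \<alpha>': "K.base_change2 e \<alpha> (pi_obj q) \<alpha>'" and \<beta>': "K.base_change2 e \<beta> (pi_obj q) \<beta>'"
    and eq: "hcomp_vtr (id_vtr (pi_ev q)) \<alpha>' = hcomp_vtr (id_vtr (pi_ev q)) \<beta>'"
  have e: "e \<in> Obj (slice (VDBL E) Y)" using \<alpha> by (simp add: slice_VDBL_Obj slice_VDBL_Two)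
  interpret c: currying E P q X Y "fdom q" e "fdom e" by (rule currying[OF q e])
  let ?h = "tdom \<alpha>" and ?k = "tcod \<alpha>" and ?h' = "tdom \<alpha>'" and ?k' = "tcod \<alpha>'"
  have r: "pi_obj q \<in> Mor (VDBL E)" "tgt (VDBL E) (pi_obj q) = tgt (VDBL E) P"
    using \<alpha> by (simp_all add: slice_VDBL_Two VDBL_simps(4-12) P.fcod_eq)
  have ends: "tdom \<beta>' = ?h'" "tcod \<beta>' = ?k'"
    using \<alpha>' \<beta>' st K.base_change1_unique[OF r] by (auto simp: K.base_change2_def VDBL_simps(4-12))
  have a: "vtrans \<alpha> ?h ?k (fdom e) c.R" and b: "vtrans \<beta> ?h ?k (fdom e) c.R"
    using \<alpha> \<beta> st by (simp_all add: slice_VDBL_Two VDBL_simps(3) pi_obj_def c.base_simps vtrans_def)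
  have a': "vtrans \<alpha>' ?h' ?k' c.D.PB c.C.PB" and b': "vtrans \<beta>' ?h' ?k' c.D.PB c.C.PB"
    using \<alpha>' \<beta>' ends by (simp_all add: K.base_change2_def K.base_change1_def VDBL_simps(3-12) pi_obj_def
        c.D.pullback_simps c.C.pullback_simps vtrans_def)
  have "whisker_left c.base \<alpha> = id_vtr e" "whisker_left c.base \<beta> = id_vtr e"
    using \<alpha> \<beta> hcomp_id_left[OF a c.vfun_base] hcomp_id_left[OF b c.vfun_base] by (simp_all add: slice_VDBL_Two pi_obj_def)
  moreover have "c.bchange2 \<alpha> ?h' ?k' \<alpha>'"
    using \<alpha>' a' hcomp_id_left[OF a' c.C.vfun_pullback_fst] hcomp_id_left[OF a' c.C.vfun_pullback_snd]
      hcomp_id_right[OF c.D.vfun_pullback_fst a]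
    by (simp add: K.base_change2_def c.bchange2_def VDBL_simps(4-12) pi_obj_def)
  moreover have "c.bchange2 \<beta> ?h' ?k' \<beta>'"
    using \<beta>' b' hcomp_id_left[OF b' c.C.vfun_pullback_fst] hcomp_id_left[OF b' c.C.vfun_pullback_snd]
      hcomp_id_right[OF c.D.vfun_pullback_fst b]
    by (simp add: K.base_change2_def c.bchange2_def VDBL_simps(4-12) pi_obj_def)
  moreover have "whisker_left c.ev \<alpha>' = whisker_left c.ev \<beta>'"
    using eq hcomp_id_left[OF a' c.vfun_ev] hcomp_id_left[OF b' c.vfun_ev] by (simp add: pi_ev_def)
  ultimately show "\<alpha> = \<beta>" using c.curry2_unique[OF a _ _ b] by blast
qed

lemma powerful: "powerful (VDBL E) P"
  by (rule dependent_products.powerful[OF dependent_products])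

end

theorem proposition5p5:
  fixes E :: "'u \<Rightarrow> 'u \<Rightarrow> bool" and X Y :: "'u vdc" and P :: "'u vdf"
  assumes "grothendieck_universe E"
    and "X \<in> Obj (VDBL E)" and "Y \<in> Obj (VDBL E)"
    and "P \<in> Mor (VDBL E)" and "src (VDBL E) P = X" and "tgt (VDBL E) P = Y"
    and "discrete_opfibration P"
  shows "powerful (VDBL E) P"
proof -
  have "vfun P X Y" using assms(4-6) by (auto simp: VDBL_simps)
  then have "opfibration P X Y" using assms(7) by (simp add: opfibration_def opfibration_axioms_def)
  then have "discrete_conduche P X Y" by (rule opfibration.discrete_conduche)
  then have "conduche_powerful E P X Y"
    using assms(1-3) by (simp add: conduche_powerful_def conduche_powerful_axioms_def VDBL_simps(1))
  then show ?thesis by (rule conduche_powerful.powerful)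
qed


end
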